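(* Let $\xi=(\xi(t))_{t\geq0}$ be a Lévy process in $\mathbb R^d$ with characteristics $(\mathbf q,a,\Lambda)$, and let $p\in(0,1)$ be an admissible memory parameter for $(\mathbf q,a,\Lambda)$. For $n\geq1$, let $S^{(n)}=(\xi(k/n))_{k\geq0}$ be the discrete time skeleton of $\xi$ with mesh $1/n$, and let $\hat S^{(n)}=(\hat S^{(n)}(k))_{k\geq0}$ be the step reinforced random walk with memory parameter $p$ built from the steps of $S^{(n)}$. Then as $n\to\infty$, in the sense of finite dimensional distributions, $$\big(\hat S^{(n)}(\lfloor tn\rfloor)\big)_{0\leq t\leq1}\Longrightarrow(\hat\xi(t))_{0\leq t\leq1},$$ where $\hat\xi$ is a noise reinforced Lévy process with characteristics $(\mathbf q,a,\Lambda,p)$.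
   Context: Lévy process with characteristics $(\mathbf q,a,\Lambda)$: $\mathbf q$ positive semi-definite quadratic form on $\mathbb R^d$, $a\in\mathbb R^d$, $\Lambda$ Lévy measure; $\mathbb E[e^{i\theta\cdot\xi(t)}]=e^{-t\Psi(\theta)}$ with $\Psi(\theta)=\frac12\mathbf q(\theta)-i a\cdot\theta+\int(1-e^{i\theta\cdot x}+i\theta\cdot x\mathbf 1_{\{|x|<1\}})\Lambda(\mathrm dx)$. The Blumenthal-Getoor index of $(\mathbf q,a,\Lambda)$ is $\beta=\beta(\Lambda):=\inf\{b>0:\int_{|x|\le1}|x|^b\Lambda(\mathrm dx)<\infty\}$ if $\mathbf q=0$ and $\beta=2$ if $\mathbf q\ne0$; $p\in(0,1)$ is admissible if $p\beta<1$. Step reinforced random walk with memory parameter $p$ built from i.i.d. steps $X_1,X_2,\dots$: let $(\varepsilon_i)_{i\ge2}$ be i.i.d. Bernoulli($p$) independent of the steps; set $\hat X_1=X_1$ and for $i\ge2$, $\hat X_i=X_i$ if $\varepsilon_i=0$, while if $\varepsilon_i=1$, $\hat X_i$ is a uniform random sample (independent of everything else) from $\hat X_1,\dots,\hat X_{i-1}$; then $\hat S(n)=\hat X_1+\dots+\hat X_n$, $\hat S(0)=0$. A Yule-Simon process with parameter $\rho>0$ is a time-inhomogeneous pure birth process $Y$ on $[0,1]$ with $Y(0)=0$ and birth rates $\lambda_0(t)=1/(1-t)$, $\lambda_k(t)=k/(\rho t)$ ($k\ge1$); $\mathbb Q$ is its law. A noise reinforced Brownian motion $\hat B$ with memory parameter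 $p<1/2$ in $\mathbb R^d$ has $d$ independent coordinates, each a centered Gaussian process with covariance $t^ps^{1-p}/(1-2p)$ for $0\le s\le t$. Noise reinforced Lévy process with characteristics $(\mathbf q,a,\Lambda,p)$, $p$ admissible: let $\mathcal N=\sum_j\delta_{(x_j,Y_j)}$ be a Poisson point measure with intensity $\nu\otimes\mathbb Q$ with $\nu=(1-p)\Lambda$ and $\mathbb Q$ for parameter $\rho=1/p$; if $\mathbf q\ne0$, let $M$ be a $d\times d$ matrix with $|Mx|^2=\mathbf q(x)$ and $\hat B$ an independent $d$-dimensional noise reinforced Brownian motion with memory parameter $p$. Set $\hat\xi(t)=M\hat B(t)+ta+\Sigma_{1,\infty}(t)+\Sigma^{(c)}_{0,1}(t)$, $t\in[0,1]$ (with $M\hat B\equiv0$ if $\mathbf q=0$), where $\Sigma_{1,\infty}(t)=\sum_j\mathbf 1_{\{|x_j|\ge1\}}Y_j(t)x_j$ and $\Sigma^{(c)}_{0,1}(t)$ is the a.s. limit as $a\to0+$ of $\sum_j\mathbf 1_{\{a\le|x_j|<1\}}Y_j(t)x_j-t\frac{\rho}{\rho-1}\int_{\{a\le|x|<1\}}x\,\nu(\mathrm dx)$.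
   Formalization: The matrix M with |Mx|²=q(x) is required to be symmetric (e.g. the square root of q); for non-symmetric M the Gaussian part MB̂ can have the wrong covariance (e.g. q(x)=x₂², M=[[0,1],[0,0]]) and the claim fails. *)

theory Defs
  imports "HOL-Probability.Probability"
begin

definition psd_quadratic_form :: "(real^'d \<Rightarrow> real) \<Rightarrow> bool" where
  "psd_quadratic_form q \<longleftrightarrow>
     (\<exists>A :: real^'d^'d. \<forall>x. q x = x \<bullet> (A *v x)) \<and> (\<forall>x. 0 \<le> q x)"

definition levy_measure :: "(real^'d) measure \<Rightarrow> bool" where
  "levy_measure \<Lambda> \<longleftrightarrow> sets \<Lambda> = sets borel \<and> emeasure \<Lambda> {0} = 0 \<and>
     (\<integral>\<^sup>+ x. ennreal (min 1 ((norm x)\<^sup>2)) \<partial>\<Lambda>) < \<infinity>"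

definition levy_exponent ::
  "(real^'d \<Rightarrow> real) \<Rightarrow> real^'d \<Rightarrow> (real^'d) measure \<Rightarrow> real^'d \<Rightarrow> complex" where
  "levy_exponent q a \<Lambda> \<theta> =
     complex_of_real (q \<theta> / 2) - \<i> * complex_of_real (a \<bullet> \<theta>)
     + (\<integral> x. (1 - cis (\<theta> \<bullet> x) + \<i> * complex_of_real (\<theta> \<bullet> x) * indicator (ball 0 1) x) \<partial>\<Lambda>)"

definition bg_index :: "(real^'d \<Rightarrow> real) \<Rightarrow> (real^'d) measure \<Rightarrow> real" where
  "bg_index q \<Lambda> =
     (if (\<forall>x. q x = 0)
      then Inf {b::real. 0 < b \<and> (\<integral>\<^sup>+ x\<in>cball 0 1. ennreal (norm x powr b) \<partial>\<Lambda>) < \<infinity>}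
      else 2)"

definition admissible :: "(real^'d \<Rightarrow> real) \<Rightarrow> (real^'d) measure \<Rightarrow> real \<Rightarrow> bool" where
  "admissible q \<Lambda> p \<longleftrightarrow> 0 < p \<and> p < 1 \<and> p * bg_index q \<Lambda> < 1"

definition indep_rv :: "'w measure \<Rightarrow> 'a measure \<Rightarrow> ('w \<Rightarrow> 'a) \<Rightarrow> 'b measure \<Rightarrow> ('w \<Rightarrow> 'b) \<Rightarrow> bool" where
  "indep_rv M Ma X Mb Y \<longleftrightarrow> X \<in> M \<rightarrow>\<^sub>M Ma \<and> Y \<in> M \<rightarrow>\<^sub>M Mb \<and>
     (\<forall>A\<in>sets Ma. \<forall>B\<in>sets Mb.
        measure M (X -` A \<inter> Y -` B \<inter> space M) = measure M (X -` A \<inter> space M) * measure M (Y -` B \<inter> space M))"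

definition levy_process ::
  "'w measure \<Rightarrow> (real^'d \<Rightarrow> real) \<Rightarrow> real^'d \<Rightarrow> (real^'d) measure \<Rightarrow> (real \<Rightarrow> 'w \<Rightarrow> real^'d) \<Rightarrow> bool" where
  "levy_process M q a \<Lambda> \<xi> \<longleftrightarrow>
     (\<forall>t. \<xi> t \<in> borel_measurable M) \<and>
     (\<forall>\<omega>\<in>space M. \<xi> 0 \<omega> = 0 \<and>
        (\<forall>t\<ge>0. continuous (at_right t) (\<lambda>s. \<xi> s \<omega>)) \<and>
        (\<forall>t>0. \<exists>l. ((\<lambda>s. \<xi> s \<omega>) \<longlongrightarrow> l) (at_left t))) \<and>
     (\<forall>m (t::nat \<Rightarrow> real). (\<forall>j<m. 0 \<le> t j \<and> t j \<le> t (Suc j)) \<longrightarrow>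
        prob_space.indep_vars M (\<lambda>_. borel) (\<lambda>j \<omega>. \<xi> (t (Suc j)) \<omega> - \<xi> (t j) \<omega>) {..<m}) \<and>
     (\<forall>s t. 0 \<le> s \<and> s \<le> t \<longrightarrow>
        distr M borel (\<lambda>\<omega>. \<xi> t \<omega> - \<xi> s \<omega>) = distr M borel (\<xi> (t - s))) \<and>
     (\<forall>t \<theta>. 0 \<le> t \<longrightarrow>
        (\<integral>\<omega>. cis (\<theta> \<bullet> \<xi> t \<omega>) \<partial>M) = exp (- (complex_of_real t * levy_exponent q a \<Lambda> \<theta>)))"

function srrw_step :: "(nat \<Rightarrow> 'a) \<Rightarrow> (nat \<Rightarrow> bool) \<Rightarrow> (nat \<Rightarrow> nat) \<Rightarrow> nat \<Rightarrow> 'a" where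
  "srrw_step X \<epsilon> U i =
     (if 2 \<le> i \<and> \<epsilon> i \<and> 1 \<le> U i \<and> U i < i then srrw_step X \<epsilon> U (U i) else X i)"
  by pat_completeness auto
termination by (relation "Wellfounded.measure (\<lambda>(X, \<epsilon>, U, i). i)") auto

definition srrw :: "(nat \<Rightarrow> 'a::comm_monoid_add) \<Rightarrow> (nat \<Rightarrow> bool) \<Rightarrow> (nat \<Rightarrow> nat) \<Rightarrow> nat \<Rightarrow> 'a" where
  "srrw X \<epsilon> U k = (\<Sum>i\<in>{1..k}. srrw_step X \<epsilon> U i)"

definition reinforcement_noise ::
  "'w measure \<Rightarrow> real \<Rightarrow> (real \<Rightarrow> 'w \<Rightarrow> real^'d) \<Rightarrow> (nat \<Rightarrow> 'w \<Rightarrow> bool) \<Rightarrow> (nat \<Rightarrow> 'w \<Rightarrow> nat) \<Rightarrow> bool" where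
  "reinforcement_noise M p \<xi> \<epsilon> U \<longleftrightarrow>
     (\<forall>i\<ge>2. \<epsilon> i \<in> M \<rightarrow>\<^sub>M count_space UNIV \<and> measure M {\<omega>\<in>space M. \<epsilon> i \<omega>} = p) \<and>
     (\<forall>i\<ge>2. U i \<in> M \<rightarrow>\<^sub>M count_space UNIV \<and>
        (\<forall>k\<in>{1..<i}. measure M {\<omega>\<in>space M. U i \<omega> = k} = 1 / real (i - 1))) \<and>
     prob_space.indep_vars M (\<lambda>_. count_space UNIV) \<epsilon> {2..} \<and>
     prob_space.indep_vars M (\<lambda>_. count_space UNIV) U {2..} \<and>
     indep_rv M
        (Pi\<^sub>M {2..} (\<lambda>_. count_space UNIV)) (\<lambda>\<omega>. \<lambda>i\<in>{2..}. \<epsilon> i \<omega>)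
        (Pi\<^sub>M {2..} (\<lambda>_. count_space UNIV)) (\<lambda>\<omega>. \<lambda>i\<in>{2..}. U i \<omega>) \<and>
     indep_rv M
        (Pi\<^sub>M {0..} (\<lambda>_. borel)) (\<lambda>\<omega>. \<lambda>s\<in>{0..}. \<xi> s \<omega>)
        (Pi\<^sub>M {2..} (\<lambda>_. count_space UNIV) \<Otimes>\<^sub>M Pi\<^sub>M {2..} (\<lambda>_. count_space UNIV))
        (\<lambda>\<omega>. (\<lambda>i\<in>{2..}. \<epsilon> i \<omega>, \<lambda>i\<in>{2..}. U i \<omega>))"

definition path_space :: "(real \<Rightarrow> nat) measure" where
  "path_space = Pi\<^sub>M UNIV (\<lambda>_. count_space UNIV)"

definition ys_rate :: "real \<Rightarrow> nat \<Rightarrow> real \<Rightarrow> real" where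
  "ys_rate \<rho> k t = (if k = 0 then 1 / (1 - t) else real k / (\<rho> * t))"

text \<open>Transition function P s t k l of a pure birth process on [0,1] with birth rates lam k t,
  given by the Kolmogorov forward equations (from state k >= 1 only at times s > 0).\<close>
definition pure_birth_transition ::
  "(nat \<Rightarrow> real \<Rightarrow> real) \<Rightarrow> (real \<Rightarrow> real \<Rightarrow> nat \<Rightarrow> nat \<Rightarrow> real) \<Rightarrow> bool" where
  "pure_birth_transition lam P \<longleftrightarrow>
     (\<forall>s k l. 0 \<le> s \<and> s \<le> 1 \<and> (k = 0 \<or> 0 < s) \<longrightarrow>
        P s s k l = (if k = l then 1 else 0) \<and>
        continuous_on {s..1} (\<lambda>t. P s t k l) \<and>
        (\<forall>t. s < t \<and> t < 1 \<longrightarrow>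
           ((\<lambda>t. P s t k l) has_real_derivative
              ((if l = 0 then 0 else lam (l - 1) t * P s t k (l - 1)) - lam l t * P s t k l)) (at t)))"

definition yule_simon_law :: "real \<Rightarrow> (real \<Rightarrow> nat) measure \<Rightarrow> bool" where
  "yule_simon_law \<rho> Q \<longleftrightarrow> prob_space Q \<and> sets Q = sets path_space \<and>
     (\<exists>P. pure_birth_transition (ys_rate \<rho>) P \<and>
        (\<forall>m (t::nat \<Rightarrow> real) (k::nat \<Rightarrow> nat).
           t 0 = 0 \<and> k 0 = 0 \<and> (\<forall>j<m. t j \<le> t (Suc j)) \<and> t m \<le> 1 \<longrightarrow>
           measure Q {f\<in>space Q. \<forall>j\<in>{1..m}. f (t j) = k j} =
             (\<Prod>j<m. P (t j) (t (Suc j)) (k j) (k (Suc j)))))"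

definition poisson_prob :: "real \<Rightarrow> nat \<Rightarrow> real" where
  "poisson_prob r k = r ^ k / fact k * exp (- r)"

text \<open>The random point measure sum_{j in J} delta_(at j) is a Poisson point measure with
  intensity mu: counts in disjoint sets of finite intensity are independent Poisson variables.\<close>
definition poisson_point_measure ::
  "'w measure \<Rightarrow> 'e measure \<Rightarrow> ('w \<Rightarrow> nat set) \<Rightarrow> (nat \<Rightarrow> 'w \<Rightarrow> 'e) \<Rightarrow> bool" where
  "poisson_point_measure N \<mu> J atom \<longleftrightarrow>
     (\<lambda>\<omega> j. (j \<in> J \<omega>, atom j \<omega>)) \<in> N \<rightarrow>\<^sub>M Pi\<^sub>M UNIV (\<lambda>_. count_space UNIV \<Otimes>\<^sub>M \<mu>) \<and>
     (\<forall>m (A :: nat \<Rightarrow> 'e set).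
        (\<forall>i<m. A i \<in> sets \<mu> \<and> emeasure \<mu> (A i) < \<infinity>) \<and> disjoint_family_on A {..<m} \<longrightarrow>
        prob_space.indep_vars N (\<lambda>_. count_space UNIV)
           (\<lambda>i \<omega>. card {j\<in>J \<omega>. atom j \<omega> \<in> A i}) {..<m} \<and>
        (\<forall>i<m. \<forall>k. measure N {\<omega>\<in>space N. finite {j\<in>J \<omega>. atom j \<omega> \<in> A i} \<and>
                                         card {j\<in>J \<omega>. atom j \<omega> \<in> A i} = k}
                   = poisson_prob (measure \<mu> (A i)) k))"

definition nrbm_cov :: "real \<Rightarrow> real \<Rightarrow> real \<Rightarrow> real" where
  "nrbm_cov p s t = (max s t) powr p * (min s t) powr (1 - p) / (1 - 2 * p)"

text \<open>d independent coordinates, each a centered Gaussian process on [0,1] with covariance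
  t^p s^(1-p)/(1-2p) (Gaussian law of finite families given by their characteristic function).\<close>
definition nrbm :: "'w measure \<Rightarrow> real \<Rightarrow> (real \<Rightarrow> 'w \<Rightarrow> real^'d) \<Rightarrow> bool" where
  "nrbm N p B \<longleftrightarrow>
     (\<forall>t. B t \<in> borel_measurable N) \<and>
     prob_space.indep_vars N (\<lambda>_. Pi\<^sub>M {0..1} (\<lambda>_. borel)) (\<lambda>i \<omega>. \<lambda>t\<in>{0..1}. B t \<omega> $ i) UNIV \<and>
     (\<forall>i m (t::nat \<Rightarrow> real) (c::nat \<Rightarrow> real). (\<forall>k<m. 0 \<le> t k \<and> t k \<le> 1) \<longrightarrow>
        (\<integral>\<omega>. cis (\<Sum>k<m. c k * B (t k) \<omega> $ i) \<partial>N) =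
          complex_of_real (exp (- (\<Sum>k<m. \<Sum>l<m. c k * c l * nrbm_cov p (t k) (t l)) / 2)))"

definition big_jump_sum ::
  "('w \<Rightarrow> nat set) \<Rightarrow> (nat \<Rightarrow> 'w \<Rightarrow> real^'d) \<Rightarrow> (nat \<Rightarrow> 'w \<Rightarrow> real \<Rightarrow> nat) \<Rightarrow> real \<Rightarrow> 'w \<Rightarrow> real^'d" where
  "big_jump_sum J xs Ys t \<omega> = (\<Sum>j\<in>{j\<in>J \<omega>. 1 \<le> norm (xs j \<omega>)}. real (Ys j \<omega> t) *\<^sub>R xs j \<omega>)"

definition small_jump_sum ::
  "(real^'d) measure \<Rightarrow> real \<Rightarrow> ('w \<Rightarrow> nat set) \<Rightarrow> (nat \<Rightarrow> 'w \<Rightarrow> real^'d) \<Rightarrow> (nat \<Rightarrow> 'w \<Rightarrow> real \<Rightarrow> nat)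
     \<Rightarrow> real \<Rightarrow> real \<Rightarrow> 'w \<Rightarrow> real^'d" where
  "small_jump_sum \<nu> \<rho> J xs Ys e t \<omega> =
     (\<Sum>j\<in>{j\<in>J \<omega>. e \<le> norm (xs j \<omega>) \<and> norm (xs j \<omega>) < 1}. real (Ys j \<omega> t) *\<^sub>R xs j \<omega>)
     - (t * \<rho> / (\<rho> - 1)) *\<^sub>R (\<integral> x. indicator {x. e \<le> norm x \<and> norm x < 1} x *\<^sub>R x \<partial>\<nu>)"

definition nrlp_value ::
  "(real^'d \<Rightarrow> real) \<Rightarrow> real^'d^'d \<Rightarrow> real^'d \<Rightarrow> ('w \<Rightarrow> nat set) \<Rightarrow> (nat \<Rightarrow> 'w \<Rightarrow> real^'d)
     \<Rightarrow> (nat \<Rightarrow> 'w \<Rightarrow> real \<Rightarrow> nat) \<Rightarrow> (real \<Rightarrow> 'w \<Rightarrow> real^'d) \<Rightarrow> (real \<Rightarrow> 'w \<Rightarrow> real^'d)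
     \<Rightarrow> real \<Rightarrow> 'w \<Rightarrow> real^'d" where
  "nrlp_value q Mat a J xs Ys B Sc t \<omega> =
     (if (\<forall>x. q x = 0) then 0 else Mat *v B t \<omega>) + t *\<^sub>R a + big_jump_sum J xs Ys t \<omega> + Sc t \<omega>"

end

theory Submission
  imports Defs "HOL-Real_Asymp.Real_Asymp"
begin

text \<open>
  All steps of the reinforced walk that go back to the same innovation form a tree, and conditionally
  on the genealogy the walk is \<open>\<Sum>r. N\<^sub>r(k) X\<^sub>r\<close> with independent steps \<open>X\<^sub>r\<close> and tree sizes
  \<open>N\<^sub>r(k)\<close>. Hence its characteristic function is the mean of
  \<open>exp (- (1/n) \<Sum>r. \<Psi> (\<Sum>j. N\<^sub>r(t\<^sub>j n) \<theta>\<^sub>j))\<close>, and everything reduces to a law of large numbers: the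
  empirical average over \<open>r\<close> of a functional of the tree sizes at times \<open>t\<^sub>j n\<close> converges in mean to
  \<open>1 - p\<close> times its expectation under the Yule-Simon law. For functionals supported on finitely many
  values this follows from a family of finitely supported eigenfunctions of the growth dynamics, which
  turn both the discrete recursion and the Kolmogorov equations into scalar linear equations.
  Functionals of growth \<open>b < 1/p\<close> are reached by truncation, using an exact martingale for a rising
  factorial of the tree sizes; admissibility of \<open>p\<close> says precisely that \<open>\<Psi>\<close> has such growth. The limit
  \<open>exp (- (1 - p) E [\<Psi> (\<Sum>j. Y(t\<^sub>j) \<theta>\<^sub>j)])\<close> is the characteristic function of the noise reinforced Levy
  process by the exponential formula for Poisson point measures and the second moments of the
  Yule-Simon process, and the continuity theorem for characteristic functions concludes.
\<close>

text \<open>The Yule-Simon law is specified through forward equations for single transition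
  probabilities, which would call for a uniqueness argument and for differentiating infinite sums
  over states. For \<open>\<gamma> \<noteq> 0\<close> the nonzero solutions of
  \<open>k * (\<phi> (k + 1) - \<phi> k) = \<gamma> * \<phi> k\<close> are unique up to a factor,
  and they have finite support exactly if \<open>\<gamma> = - r\<close> with a positive integer
  \<open>r\<close>; then all these sums are finite. For positive \<open>\<gamma>\<close> they grow
  like \<open>k powr \<gamma>\<close> and serve for the moments. The finitely supported ones form a
  triangular system with diagonal entries 1 or -1, so indicators of single sizes are recovered by a
  finite induction. The size 0 escapes this system: a copied index never founds a tree and looks the
  same as a tree not yet born. Functionals therefore have to vanish on the zero vector, as the
  characteristic exponent does. Moments of the Yule-Simon process are not computed from its
  transition function but carried over from exact recursions for the trees.\<close>

declare srrw_step.simps [simp del]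

section \<open>Genealogy of the reinforced walk\<close>

text \<open>Running the recursion of \<open>srrw_step\<close> on the identity sequence yields the
  index of the ancestor, and termination comes for free. One function \<open>c\<close> replaces the
  pair of Bernoulli and uniform variables, the value 0 meaning an innovation.\<close>

definition origin :: "(nat \<Rightarrow> nat) \<Rightarrow> nat \<Rightarrow> nat" where
  "origin c i = srrw_step (\<lambda>i. i) (\<lambda>i. c i \<noteq> 0) c i"

definition tree_size :: "(nat \<Rightarrow> nat) \<Rightarrow> nat \<Rightarrow> nat \<Rightarrow> nat" where
  "tree_size c k r = card {i \<in> {1..k}. origin c i = r}"

lemma origin_rec: "origin c i = (if 2 \<le> i \<and> 1 \<le> c i \<and> c i < i then origin c (c i) else i)"
  unfolding origin_def by (subst srrw_step.simps) auto

lemma origin_bounds: "1 \<le> i \<Longrightarrow> 1 \<le> origin c i \<and> origin c i \<le> i"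
proof (induction i rule: less_induct)
  case (less i)
  then show ?case
    using origin_rec[of c i] by (auto split: if_splits) (metis le_trans less_imp_le)
qed

lemma origin_cong: "(\<And>j. 2 \<le> j \<Longrightarrow> j \<le> k \<Longrightarrow> c j = d j) \<Longrightarrow> origin c k = origin d k"
proof (induction k rule: less_induct)
  case (less k)
  show ?case
  proof (cases "2 \<le> k")
    case True
    then have "c k = d k"
      using less.prems by simp
    moreover have "origin c (d k) = origin d (d k)" if "d k < k"
      using that less.prems by (intro less.IH) auto
    ultimately show ?thesis
      using origin_rec[of c k] origin_rec[of d k] by simp
  next
    case False
    then show ?thesis
      using origin_rec[of c k] origin_rec[of d k] by simp
  qed
qed

lemma origin_fun_upd: "k < i \<Longrightarrow> origin (c(i := x)) k = origin c k"
  by (rule origin_cong) auto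

lemma origin_new: "origin (c(Suc i := 0)) (Suc i) = Suc i"
  by (subst origin_rec) auto

lemma origin_copy: "1 \<le> u \<Longrightarrow> u \<le> i \<Longrightarrow> origin (c(Suc i := u)) (Suc i) = origin c u"
  by (subst origin_rec) (auto simp: origin_fun_upd)

section \<open>Tree sizes\<close>

lemma tree_size_0 [simp]: "tree_size c 0 r = 0"
  by (simp add: tree_size_def)

lemma tree_size_Suc:
  "tree_size c (Suc k) r = tree_size c k r + (if origin c (Suc k) = r then 1 else 0)"
proof -
  have "{i \<in> {1..Suc k}. origin c i = r} =
      {i \<in> {1..k}. origin c i = r} \<union> (if origin c (Suc k) = r then {Suc k} else {})"
    by (auto simp: le_Suc_eq)
  then show ?thesis
    by (auto simp: tree_size_def)
qed

lemma tree_size_mono: "k \<le> l \<Longrightarrow> tree_size c k r \<le> tree_size c l r"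
  unfolding tree_size_def by (intro card_mono) auto

lemma tree_size_fun_upd: "k < i \<Longrightarrow> tree_size (c(i := x)) k r = tree_size c k r"
  unfolding tree_size_def by (rule arg_cong[where f=card]) (auto simp: origin_fun_upd)

lemma tree_size_cong: "(\<And>j. 2 \<le> j \<Longrightarrow> j \<le> k \<Longrightarrow> c j = d j) \<Longrightarrow> tree_size c k r = tree_size d k r"
  unfolding tree_size_def
  by (rule arg_cong[where f=card]) (auto simp: intro!: origin_cong origin_cong[symmetric])

lemma tree_size_eq_0: "k < r \<Longrightarrow> tree_size c k r = 0"
  unfolding tree_size_def using origin_bounds[of _ c] by fastforce

text \<open>Double counting of the indices up to \<open>k\<close> by their origin. It is used twice:
  with the steps as \<open>f\<close> to rewrite the walk, and with increments as \<open>f\<close>,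
  where averaging over a uniform index becomes size biased averaging over trees.\<close>

lemma sum_origin_eq_sum_tree_size:
  fixes f :: "nat \<Rightarrow> 'a::real_vector"
  assumes "k \<le> n"
  shows "(\<Sum>i=1..k. f (origin c i)) = (\<Sum>r=1..n. real (tree_size c k r) *\<^sub>R f r)"
  using assms
proof (induction k)
  case (Suc k)
  have b: "1 \<le> origin c (Suc k)" "origin c (Suc k) \<le> n"
    using origin_bounds[of "Suc k" c] Suc.prems by auto
  have "(\<Sum>r=1..n. real (tree_size c (Suc k) r) *\<^sub>R f r) =
      (\<Sum>r=1..n. real (tree_size c k r) *\<^sub>R f r) + (\<Sum>r=1..n. if origin c (Suc k) = r then f r else 0)"
    unfolding sum.distrib[symmetric]
    by (intro sum.cong refl) (auto simp: tree_size_Suc scaleR_add_left)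
  also have "(\<Sum>r=1..n. if origin c (Suc k) = r then f r else 0) = f (origin c (Suc k))"
    using b by simp
  finally show ?case
    using Suc by simp
qed simp

lemma sum_tree_size: "k \<le> n \<Longrightarrow> (\<Sum>r=1..n. real (tree_size c k r)) = real k"
  using sum_origin_eq_sum_tree_size[of k n "\<lambda>_. 1::real" c] by simp

text \<open>Out of range values of \<open>U\<close> cause no mismatch: both recursions treat an
  index outside \<open>{1..<i}\<close> as an innovation, so the identity holds for every
  outcome.\<close>

lemma srrw_step_eq_origin:
  "srrw_step X e U i = X (origin (\<lambda>i. if e i then U i else 0) i)"
proof (induction i rule: less_induct)
  case (less i)
  then show ?case
    by (subst srrw_step.simps, subst origin_rec) auto
qed

lemma srrw_eq_tree_size:
  fixes X :: "nat \<Rightarrow> 'a::real_vector"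
  assumes "k \<le> n"
  shows "srrw X e U k = (\<Sum>r=1..n. real (tree_size (\<lambda>i. if e i then U i else 0) k r) *\<^sub>R X r)"
  unfolding srrw_def srrw_step_eq_origin using assms by (rule sum_origin_eq_sum_tree_size)

section \<open>Expectation over the reinforcement noise\<close>

text \<open>A genealogy is coded by the function sending \<open>i\<close> to the index that is sampled at step \<open>i\<close>,
  or to \<open>0\<close> if step \<open>i\<close> is an innovation. As only finitely many choices matter, expectations are
  iterated finite averages.\<close>

definition avg_step :: "real \<Rightarrow> nat \<Rightarrow> ((nat \<Rightarrow> nat) \<Rightarrow> 'b::real_vector) \<Rightarrow> (nat \<Rightarrow> nat) \<Rightarrow> 'b" where
  "avg_step p i G c = (if i = 0 then G (c(Suc i := 0))
     else (1 - p) *\<^sub>R G (c(Suc i := 0)) + (p / real i) *\<^sub>R (\<Sum>u=1..i. G (c(Suc i := u))))"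

text \<open>The latest choice is integrated out first, which is the tower property:
  \<open>avg_step p i\<close> is the conditional expectation given the choices up to index
  \<open>i\<close>. The first step is always an innovation, hence the separate case
  \<open>i = 0\<close> there.\<close>

primrec avg :: "real \<Rightarrow> nat \<Rightarrow> ((nat \<Rightarrow> nat) \<Rightarrow> 'b::real_vector) \<Rightarrow> 'b" where
  "avg p 0 G = G (\<lambda>_. 0)"
| "avg p (Suc i) G = avg p i (avg_step p i G)"

lemma avg_step_add: "avg_step p i (\<lambda>c. F c + G c) c = avg_step p i F c + avg_step p i G c"
  by (simp add: avg_step_def scaleR_add_right sum.distrib)

lemma avg_step_scaleR: "avg_step p i (\<lambda>c. a *\<^sub>R F c) c = a *\<^sub>R avg_step p i F c"
  by (simp add: avg_step_def scaleR_add_right scaleR_right.sum[symmetric] mult.commute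
      flip: scaleR_sum_right)

lemma avg_step_const: "avg_step p i (\<lambda>_. a) c = a"
  by (simp add: avg_step_def scaleR_left_diff_distrib sum_constant_scaleR)

lemma avg_step_mono:
  fixes F G :: "(nat \<Rightarrow> nat) \<Rightarrow> real"
  assumes "0 \<le> p" "p \<le> 1" "\<And>x. x \<le> i \<Longrightarrow> F (c(Suc i := x)) \<le> G (c(Suc i := x))"
  shows "avg_step p i F c \<le> avg_step p i G c"
  using assms unfolding avg_step_def
  by (auto intro!: add_mono mult_left_mono sum_mono divide_right_mono)

lemma avg_step_norm:
  fixes F :: "(nat \<Rightarrow> nat) \<Rightarrow> 'b::real_normed_vector"
  assumes "0 \<le> p" "p \<le> 1"
  shows "norm (avg_step p i F c) \<le> avg_step p i (\<lambda>c. norm (F c)) c"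
proof (cases "i = 0")
  case False
  have "norm (avg_step p i F c) \<le> norm ((1 - p) *\<^sub>R F (c(Suc i := 0)))
      + norm ((p / real i) *\<^sub>R (\<Sum>u=1..i. F (c(Suc i := u))))"
    using False unfolding avg_step_def by (simp only: if_False norm_triangle_ineq)
  also have "\<dots> \<le> (1 - p) * norm (F (c(Suc i := 0)))
      + (p / real i) * (\<Sum>u=1..i. norm (F (c(Suc i := u))))"
    using assms by (auto intro!: add_mono mult_left_mono norm_sum divide_right_mono)
  finally show ?thesis
    using False by (simp add: avg_step_def)
qed (simp add: avg_step_def)

lemma avg_add: "avg p n (\<lambda>c. F c + G c) = avg p n F + avg p n G"
  by (induction n arbitrary: F G) (simp_all add: avg_step_add[abs_def])

lemma avg_scaleR: "avg p n (\<lambda>c. a *\<^sub>R F c) = a *\<^sub>R avg p n F"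
  by (induction n arbitrary: F) (simp_all add: avg_step_scaleR[abs_def])

lemma avg_mult: "avg p n (\<lambda>c. a * F c) = a * avg p n F" for a :: real
  using avg_scaleR[of p n a F] by simp

lemma avg_const: "avg p n (\<lambda>_. a) = a"
  by (induction n) (simp_all add: avg_step_const[abs_def])

lemma avg_diff: "avg p n (\<lambda>c. F c - G c) = avg p n F - avg p n G"
  using avg_add[of p n F "\<lambda>c. (-1) *\<^sub>R G c"] by (simp only: avg_scaleR) simp

lemma avg_sum: "finite I \<Longrightarrow> avg p n (\<lambda>c. \<Sum>i\<in>I. F i c) = (\<Sum>i\<in>I. avg p n (F i))"
  by (induction I rule: finite_induct) (simp_all add: avg_add avg_const)

lemma avg_mono:
  fixes F G :: "(nat \<Rightarrow> nat) \<Rightarrow> real"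
  assumes "0 \<le> p" "p \<le> 1" "\<And>c. F c \<le> G c"
  shows "avg p n F \<le> avg p n G"
  using assms(3)
proof (induction n arbitrary: F G)
  case (Suc n)
  show ?case
    by (simp, rule Suc.IH, rule avg_step_mono) (use assms Suc.prems in auto)
qed simp

lemma avg_nonneg:
  fixes F :: "(nat \<Rightarrow> nat) \<Rightarrow> real"
  assumes "0 \<le> p" "p \<le> 1" "\<And>c. 0 \<le> F c"
  shows "0 \<le> avg p n F"
  using avg_mono[of p "\<lambda>_. 0" F n] assms by (simp add: avg_const)

lemma avg_norm:
  fixes F :: "(nat \<Rightarrow> nat) \<Rightarrow> 'b::real_normed_vector"
  assumes "0 \<le> p" "p \<le> 1"
  shows "norm (avg p n F) \<le> avg p n (\<lambda>c. norm (F c))"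
proof (induction n arbitrary: F)
  case (Suc n)
  have "norm (avg p n (avg_step p n F)) \<le> avg p n (\<lambda>c. norm (avg_step p n F c))"
    by (rule Suc.IH)
  also have "\<dots> \<le> avg p n (avg_step p n (\<lambda>c. norm (F c)))"
    using assms by (intro avg_mono avg_step_norm)
  finally show ?case
    by simp
qed simp

text \<open>The mean square deviation from the mean is nonnegative.\<close>

lemma avg_square_le:
  fixes F :: "(nat \<Rightarrow> nat) \<Rightarrow> real"
  assumes "0 \<le> p" "p \<le> 1"
  shows "(avg p n F)\<^sup>2 \<le> avg p n (\<lambda>c. (F c)\<^sup>2)"
proof -
  define a where "a = avg p n F"
  have "0 \<le> avg p n (\<lambda>c. (F c - a)\<^sup>2)"
    using assms by (intro avg_nonneg) auto
  also have "(\<lambda>c. (F c - a)\<^sup>2) = (\<lambda>c. (F c)\<^sup>2 - (2 * a) * F c + a\<^sup>2)"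
    by (auto simp: power2_eq_square algebra_simps)
  also have "avg p n \<dots> = avg p n (\<lambda>c. (F c)\<^sup>2) - (2 * a) * a + a\<^sup>2"
    by (simp only: avg_add avg_diff avg_mult avg_const a_def)
  finally show ?thesis
    by (simp add: a_def power2_eq_square)
qed

text \<open>Orthogonality of martingale increments gives mean square bounds, whereas the limit
  theorems below are stated for the mean absolute error; this converts one into the other.\<close>

lemma avg_abs_le_sqrt:
  fixes F :: "(nat \<Rightarrow> nat) \<Rightarrow> real"
  assumes "0 \<le> p" "p \<le> 1"
  shows "avg p n (\<lambda>c. \<bar>F c\<bar>) \<le> sqrt (avg p n (\<lambda>c. (F c)\<^sup>2))"
  using avg_square_le[OF assms, of n "\<lambda>c. \<bar>F c\<bar>"] by (intro real_le_rsqrt) simp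

text \<open>Choices after \<open>k\<close> are averaged over without effect, the weights of one step
  summing to 1. So functionals of the trees at different times can all be averaged over one common
  genealogy of length \<open>n\<close>.\<close>

lemma avg_extend:
  assumes "k \<le> n" "\<And>c i x. k < i \<Longrightarrow> G (c(i := x)) = G c"
  shows "avg p n G = avg p k G"
  using assms(1)
proof (induction n)
  case (Suc n)
  show ?case
  proof (cases "k = Suc n")
    case False
    then have "avg_step p n G = G"
      using Suc.prems assms(2)
      by (auto simp: fun_eq_iff avg_step_def scaleR_left_diff_distrib sum_constant_scaleR)
    with Suc False show ?thesis
      by simp
  qed simp
qed simp

text \<open>Conditionally on the genealogy up to step \<open>i\<close>, the tree \<open>r\<close> grows with probability
  \<open>p / i\<close> times its size.\<close>

lemma avg_step_tree_sum:
  fixes \<phi> :: "nat \<Rightarrow> real" and \<alpha> :: "(nat \<Rightarrow> nat) \<Rightarrow> nat \<Rightarrow> real"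
  assumes i: "1 \<le> i" and \<phi>0: "\<phi> 0 = 0"
    and eig: "\<And>k. real k * (\<phi> (Suc k) - \<phi> k) = \<gamma> * \<phi> k"
    and \<alpha>: "\<And>c x r. \<alpha> (c(Suc i := x)) r = \<alpha> c r"
  shows "avg_step p i (\<lambda>c. \<Sum>r=1..Suc i. \<alpha> c r * \<phi> (tree_size c (Suc i) r)) c =
     (1 + p * \<gamma> / real i) * (\<Sum>r=1..i. \<alpha> c r * \<phi> (tree_size c i r))
       + (1 - p) * \<alpha> c (Suc i) * \<phi> 1"
proof -
  define W where "W = (\<Sum>r=1..i. \<alpha> c r * \<phi> (tree_size c i r))"
  define n where "n r = tree_size c i r" for r
  have n0: "n (Suc i) = 0"
    by (simp add: n_def tree_size_eq_0)
  have size: "tree_size (c(Suc i := x)) (Suc i) r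
      = n r + (if origin (c(Suc i := x)) (Suc i) = r then 1 else 0)" for x r
    by (simp add: tree_size_Suc tree_size_fun_upd n_def)
  \<comment> \<open>An innovation founds the tree \<open>Suc i\<close>, of former size 0, and leaves
    the others unchanged.\<close>
  have new: "(\<Sum>r=1..Suc i. \<alpha> (c(Suc i := 0)) r * \<phi> (tree_size (c(Suc i := 0)) (Suc i) r))
      = W + \<alpha> c (Suc i) * \<phi> 1"
  proof -
    have "(\<Sum>r=1..i. \<alpha> c r * \<phi> (n r + (if Suc i = r then 1 else 0))) = W"
      unfolding W_def by (intro sum.cong) (auto simp: n_def)
    then show ?thesis
      by (simp add: size origin_new n0 \<alpha>)
  qed
  \<comment> \<open>Copying \<open>u\<close> enlarges the tree of \<open>u\<close> alone.\<close>
  have copy: "(\<Sum>r=1..Suc i. \<alpha> (c(Suc i := u)) r * \<phi> (tree_size (c(Suc i := u)) (Suc i) r))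
      = W + \<alpha> c (origin c u) * (\<phi> (Suc (n (origin c u))) - \<phi> (n (origin c u)))"
    if u: "u \<in> {1..i}" for u
  proof -
    have b: "1 \<le> origin c u" "origin c u \<le> i"
      using origin_bounds[of u c] u by auto
    have "(\<Sum>r=1..Suc i. \<alpha> (c(Suc i := u)) r * \<phi> (tree_size (c(Suc i := u)) (Suc i) r))
        = (\<Sum>r=1..Suc i. \<alpha> c r * \<phi> (n r)
            + (if origin c u = r then \<alpha> c r * (\<phi> (Suc (n r)) - \<phi> (n r)) else 0))"
      using u by (intro sum.cong refl) (auto simp: size origin_copy \<alpha> algebra_simps)
    also have "\<dots> = (\<Sum>r=1..Suc i. \<alpha> c r * \<phi> (n r))
        + \<alpha> c (origin c u) * (\<phi> (Suc (n (origin c u))) - \<phi> (n (origin c u)))"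
      using b by (simp only: sum.distrib) (simp add: sum.delta)
    also have "(\<Sum>r=1..Suc i. \<alpha> c r * \<phi> (n r)) = W"
      using n0 by (simp add: \<phi>0 W_def n_def)
    finally show ?thesis .
  qed
  \<comment> \<open>A uniform index falls into tree \<open>r\<close> with weight
    \<open>tree_size c i r\<close>, which supplies the factor \<open>k\<close> in the eigenvalue
    equation.\<close>
  have "(\<Sum>u=1..i. \<alpha> c (origin c u) * (\<phi> (Suc (n (origin c u))) - \<phi> (n (origin c u))))
      = (\<Sum>r=1..i. real (tree_size c i r) *\<^sub>R (\<alpha> c r * (\<phi> (Suc (n r)) - \<phi> (n r))))"
    by (rule sum_origin_eq_sum_tree_size[where f="\<lambda>r. \<alpha> c r * (\<phi> (Suc (n r)) - \<phi> (n r))"]) simp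
  also have "\<dots> = (\<Sum>r=1..i. \<alpha> c r * (\<gamma> * \<phi> (n r)))"
    by (intro sum.cong refl) (simp add: n_def[symmetric] eig[symmetric] mult.left_commute)
  also have "\<dots> = \<gamma> * W"
    by (simp add: W_def n_def sum_distrib_left mult.left_commute)
  finally have s: "(\<Sum>u=1..i. \<alpha> c (origin c u) * (\<phi> (Suc (n (origin c u))) - \<phi> (n (origin c u)))) = \<gamma> * W" .
  have "avg_step p i (\<lambda>c. \<Sum>r=1..Suc i. \<alpha> c r * \<phi> (tree_size c (Suc i) r)) c =
      (1 - p) * (W + \<alpha> c (Suc i) * \<phi> 1) + (p / real i) * (\<Sum>u=1..i. W + \<alpha> c (origin c u)
        * (\<phi> (Suc (n (origin c u))) - \<phi> (n (origin c u))))"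
    unfolding avg_step_def new using i copy by (simp del: sum.cl_ivl_Suc)
  also have "\<dots> = (1 - p) * (W + \<alpha> c (Suc i) * \<phi> 1) + (p / real i) * (real i * W + \<gamma> * W)"
    by (simp only: sum.distrib s) simp
  also have "\<dots> = (1 + p * \<gamma> / real i) * W + (1 - p) * \<alpha> c (Suc i) * \<phi> 1"
    using i by (simp add: field_simps)
  finally show ?thesis
    by (simp add: W_def)
qed

text \<open>One step raises a single tree by one, a new tree included because its former size is 0
  and \<open>\<phi> 0 = 0\<close>. This supplies the bounded increments for
  \<open>avg_recursion_L2\<close>.\<close>

lemma tree_sum_increment_bound:
  fixes \<phi> :: "nat \<Rightarrow> real" and \<alpha> :: "(nat \<Rightarrow> nat) \<Rightarrow> nat \<Rightarrow> real"
  assumes \<phi>0: "\<phi> 0 = 0"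
    and \<alpha>: "\<And>c x r. \<alpha> (c(Suc i := x)) r = \<alpha> c r"
    and b\<alpha>: "\<And>r. \<bar>\<alpha> c r\<bar> \<le> 1" and b\<phi>: "\<And>k. \<bar>\<phi> (Suc k) - \<phi> k\<bar> \<le> C"
  shows "\<bar>(\<Sum>r=1..Suc i. \<alpha> (c(Suc i := x)) r * \<phi> (tree_size (c(Suc i := x)) (Suc i) r))
     - (\<Sum>r=1..i. \<alpha> c r * \<phi> (tree_size c i r))\<bar> \<le> C"
proof -
  define s where "s = origin (c(Suc i := x)) (Suc i)"
  have s: "1 \<le> s" "s \<le> Suc i"
    unfolding s_def using origin_bounds[of "Suc i"] by auto
  define n where "n r = tree_size c i r" for r
  have n0: "n (Suc i) = 0"
    by (simp add: n_def tree_size_eq_0)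
  have "(\<Sum>r=1..i. \<alpha> c r * \<phi> (tree_size c i r)) = (\<Sum>r=1..Suc i. \<alpha> c r * \<phi> (n r))"
    using n0 by (simp add: \<phi>0 n_def)
  moreover have "(\<Sum>r=1..Suc i. \<alpha> (c(Suc i := x)) r * \<phi> (tree_size (c(Suc i := x)) (Suc i) r))
      = (\<Sum>r=1..Suc i. \<alpha> c r * \<phi> (n r) + (if s = r then \<alpha> c r * (\<phi> (Suc (n r)) - \<phi> (n r)) else 0))"
    by (intro sum.cong refl)
      (auto simp: tree_size_Suc tree_size_fun_upd n_def s_def \<alpha> algebra_simps)
  moreover have "\<dots> = (\<Sum>r=1..Suc i. \<alpha> c r * \<phi> (n r)) + \<alpha> c s * (\<phi> (Suc (n s)) - \<phi> (n s))"
    using s by (simp only: sum.distrib) (simp add: sum.delta)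
  moreover have "\<bar>\<alpha> c s * (\<phi> (Suc (n s)) - \<phi> (n s))\<bar> \<le> 1 * C"
    unfolding abs_mult using b\<alpha> b\<phi> by (intro mult_mono) auto
  ultimately show ?thesis
    by simp
qed

section \<open>Linear recursions\<close>

text \<open>Logarithms are compared with those of \<open>(1 + 1 / i) powr \<gamma>\<close>, whose
  product telescopes to a multiple of \<open>n powr \<gamma>\<close>; the difference is of order
  \<open>1 / i ^ 2\<close>, hence summable. Starting at \<open>i0\<close> keeps the factors positive
  when \<open>\<gamma>\<close> is negative.\<close>

lemma prod_one_plus_asymptotics:
  fixes \<gamma> :: real and i0 :: nat
  assumes i0: "1 \<le> i0" and pos: "\<And>i. i0 \<le> i \<Longrightarrow> 0 < 1 + \<gamma> / real i"
  shows "\<exists>C>0. (\<lambda>n. (\<Prod>i=i0..<n. 1 + \<gamma> / real i) / real n powr \<gamma>) \<longlonglongrightarrow> C"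
proof -
  define f where "f i = ln (1 + \<gamma> / real i) - \<gamma> * ln (1 + 1 / real i)" for i :: nat
  have "f \<in> O(\<lambda>i. 1 / real i ^ 2)"
    unfolding f_def by real_asymp
  moreover have "summable (\<lambda>i. norm (1 / real i ^ 2))"
    using inverse_power_summable[of 2, where 'a=real] by (simp add: field_simps)
  ultimately have "summable f"
    by (rule summable_comparison_test_bigo[rotated])
  then have lim: "(\<lambda>n. (\<Sum>i<n. f i)) \<longlonglongrightarrow> suminf f"
    by (rule summable_LIMSEQ)
  have eq: "(\<Prod>i=i0..<n. 1 + \<gamma> / real i) / real n powr \<gamma>
      = exp ((\<Sum>i<n. f i) - (\<Sum>i<i0. f i)) / real i0 powr \<gamma>" if "i0 \<le> n" for n
    using that
  proof (induction n rule: dec_induct)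
    case (step n)
    have n: "real n > 0"
      using step i0 by simp
    have "exp (f n) = (1 + \<gamma> / real n) / (1 + 1 / real n) powr \<gamma>"
      using pos[of n] step n by (simp add: f_def exp_diff powr_def add_nonneg_eq_0_iff)
    also have "(1 + 1 / real n) powr \<gamma> = real (Suc n) powr \<gamma> / real n powr \<gamma>"
      using n by (subst powr_divide[symmetric]) (auto simp: field_simps)
    finally have e: "exp (f n) = (1 + \<gamma> / real n) * real n powr \<gamma> / real (Suc n) powr \<gamma>"
      by simp
    have "exp ((\<Sum>i<Suc n. f i) - (\<Sum>i<i0. f i)) = exp ((\<Sum>i<n. f i) - (\<Sum>i<i0. f i)) * exp (f n)"
      by (simp add: exp_add[symmetric] algebra_simps)
    also have "\<dots> / real i0 powr \<gamma>
        = (\<Prod>i=i0..<n. 1 + \<gamma> / real i) / real n powr \<gamma> * exp (f n)"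
      using step.IH by simp
    also have "\<dots> = (\<Prod>i=i0..<Suc n. 1 + \<gamma> / real i) / real (Suc n) powr \<gamma>"
      unfolding e using n step.hyps by simp
    finally show ?case ..
  qed simp
  have "(\<lambda>n. exp ((\<Sum>i<n. f i) - (\<Sum>i<i0. f i)) / real i0 powr \<gamma>)
      \<longlonglongrightarrow> exp (suminf f - (\<Sum>i<i0. f i)) / real i0 powr \<gamma>"
    by (intro tendsto_intros lim) (use i0 in simp)
  then have "(\<lambda>n. (\<Prod>i=i0..<n. 1 + \<gamma> / real i) / real n powr \<gamma>)
      \<longlonglongrightarrow> exp (suminf f - (\<Sum>i<i0. f i)) / real i0 powr \<gamma>"
    by (rule Lim_transform_eventually)
      (use eq in \<open>auto intro!: eventually_sequentiallyI[of i0]\<close>)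
  moreover have "exp (suminf f - (\<Sum>i<i0. f i)) / real i0 powr \<gamma> > 0"
    using i0 by simp
  ultimately show ?thesis
    by blast
qed

lemma ex_one_plus_pos: "\<exists>i0\<ge>1. \<forall>i\<ge>i0. 0 < 1 + \<gamma> / real (i::nat)" for \<gamma> :: real
proof (intro exI[of _ "nat \<lceil>\<bar>\<gamma>\<bar>\<rceil> + 1"] conjI allI impI)
  fix i :: nat
  assume "nat \<lceil>\<bar>\<gamma>\<bar>\<rceil> + 1 \<le> i"
  then have "\<bar>\<gamma>\<bar> < real i"
    by linarith
  then show "0 < 1 + \<gamma> / real i"
    by (cases "i = 0") (auto simp: field_simps abs_less_iff)
qed simp

text \<open>The unknown constant of \<open>prod_one_plus_asymptotics\<close> cancels in the quotient
  of the products up to \<open>b n\<close> and up to \<open>a n\<close>, leaving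
  \<open>(b n / a n) powr \<gamma>\<close>.\<close>

lemma prod_one_plus_ratio:
  fixes \<gamma> s t :: real and a b :: "nat \<Rightarrow> nat"
  assumes st: "0 < s" "0 < t" and ab: "\<And>n. a n \<le> b n"
    and a: "(\<lambda>n. real (a n) / real n) \<longlonglongrightarrow> s" and b: "(\<lambda>n. real (b n) / real n) \<longlonglongrightarrow> t"
  shows "(\<lambda>n. \<Prod>i=a n..<b n. 1 + \<gamma> / real i) \<longlonglongrightarrow> (t / s) powr \<gamma>"
proof -
  obtain i0 where i0: "1 \<le> i0" and pos: "\<And>i. i0 \<le> i \<Longrightarrow> 0 < 1 + \<gamma> / real i"
    using ex_one_plus_pos[of \<gamma>] by auto
  define R where "R n = (\<Prod>i=i0..<n. 1 + \<gamma> / real i)" for n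
  obtain C where C: "C > 0" "(\<lambda>n. R n / real n powr \<gamma>) \<longlonglongrightarrow> C"
    using prod_one_plus_asymptotics[OF i0 pos] unfolding R_def by blast
  have at_top: "filterlim d at_top sequentially"
    if d: "(\<lambda>n. real (d n) / real n) \<longlonglongrightarrow> u" "0 < u" for d :: "nat \<Rightarrow> nat" and u :: real
  proof -
    have "filterlim (\<lambda>n. (real (d n) / real n) * real n) at_top sequentially"
      by (rule filterlim_tendsto_pos_mult_at_top[OF d filterlim_real_sequentially])
    moreover have "\<forall>\<^sub>F n in sequentially. (real (d n) / real n) * real n = real (d n)"
      using eventually_gt_at_top[of 0] by eventually_elim simp
    ultimately have "filterlim (\<lambda>n. real (d n)) at_top sequentially"
      using filterlim_cong[OF refl refl] by fast
    then show ?thesis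
      using filterlim_sequentially_iff_filterlim_real by blast
  qed
  note ta = at_top[OF a st(1)] and tb = at_top[OF b st(2)]
  have ev: "\<forall>\<^sub>F n in sequentially. max i0 1 \<le> a n"
    using ta unfolding filterlim_at_top by blast
  have "(\<lambda>n. (R (b n) / real (b n) powr \<gamma>) / (R (a n) / real (a n) powr \<gamma>)
          * ((real (b n) / real n) / (real (a n) / real n)) powr \<gamma>)
      \<longlonglongrightarrow> C / C * (t / s) powr \<gamma>"
    using st C by (intro tendsto_intros filterlim_compose[OF C(2)] ta tb a b) auto
  then have "(\<lambda>n. (R (b n) / real (b n) powr \<gamma>) / (R (a n) / real (a n) powr \<gamma>)
          * ((real (b n) / real n) / (real (a n) / real n)) powr \<gamma>) \<longlonglongrightarrow> (t / s) powr \<gamma>"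
    using C by simp
  then show ?thesis
  proof (rule Lim_transform_eventually)
    show "\<forall>\<^sub>F n in sequentially. (R (b n) / real (b n) powr \<gamma>) / (R (a n) / real (a n) powr \<gamma>)
          * ((real (b n) / real n) / (real (a n) / real n)) powr \<gamma> = (\<Prod>i=a n..<b n. 1 + \<gamma> / real i)"
      using ev eventually_ge_at_top[of 1]
    proof eventually_elim
      case (elim n)
      then have n: "i0 \<le> a n" "real (a n) > 0" "real (b n) > 0" "n \<noteq> 0"
        using ab[of n] by (auto intro: less_le_trans)
      have "R (b n) = R (a n) * (\<Prod>i=a n..<b n. 1 + \<gamma> / real i)"
        unfolding R_def using n ab[of n] by (simp add: prod.atLeastLessThan_concat)
      moreover have "R (a n) > 0"
        unfolding R_def by (intro prod_pos) (use pos in auto)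
      moreover have "((real (b n) / real n) / (real (a n) / real n)) powr \<gamma>
          = real (b n) powr \<gamma> / real (a n) powr \<gamma>"
        using n by (simp add: powr_divide)
      ultimately show ?case
        using n by simp
    qed
  qed
qed

text \<open>\<open>c * i / (1 - \<gamma>)\<close> is a particular solution. What remains solves the
  homogeneous recursion and is of order \<open>n powr \<gamma>\<close>, which is negligible against
  \<open>n\<close> because \<open>\<gamma> < 1\<close>.\<close>

lemma linear_recursion_limit:
  fixes u :: "nat \<Rightarrow> real"
  assumes \<gamma>: "\<gamma> < 1" and u: "\<And>i. 1 \<le> i \<Longrightarrow> u (Suc i) = (1 + \<gamma> / real i) * u i + c"
  shows "(\<lambda>n. u n / real n) \<longlonglongrightarrow> c / (1 - \<gamma>)"
proof -
  obtain i0 where i0: "1 \<le> i0" and pos: "\<And>i. i0 \<le> i \<Longrightarrow> 0 < 1 + \<gamma> / real i"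
    using ex_one_plus_pos[of \<gamma>] by auto
  define R where "R n = (\<Prod>i=i0..<n. 1 + \<gamma> / real i)" for n
  obtain C where C: "C > 0" "(\<lambda>n. R n / real n powr \<gamma>) \<longlonglongrightarrow> C"
    using prod_one_plus_asymptotics[OF i0 pos] unfolding R_def by blast
  define v where "v i = u i - c * real i / (1 - \<gamma>)" for i
  have v: "v n = v i0 * R n" if "i0 \<le> n" for n
    using that
  proof (induction n rule: dec_induct)
    case (step n)
    have "v (Suc n) = (1 + \<gamma> / real n) * v n"
      using step i0 \<gamma> unfolding v_def by (simp add: u field_simps)
    then show ?case
      using step by (simp add: R_def)
  qed (simp add: R_def)
  have "(\<lambda>n. real n powr (\<gamma> - 1)) \<longlonglongrightarrow> 0"
    using \<gamma> by (intro tendsto_neg_powr filterlim_real_sequentially) auto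
  then have "(\<lambda>n. c / (1 - \<gamma>) + v i0 * ((R n / real n powr \<gamma>) * real n powr (\<gamma> - 1)))
      \<longlonglongrightarrow> c / (1 - \<gamma>) + v i0 * (C * 0)"
    by (intro tendsto_intros C)
  then have "(\<lambda>n. c / (1 - \<gamma>) + v i0 * ((R n / real n powr \<gamma>) * real n powr (\<gamma> - 1)))
      \<longlonglongrightarrow> c / (1 - \<gamma>)"
    by simp
  then show ?thesis
  proof (rule Lim_transform_eventually)
    show "\<forall>\<^sub>F n in sequentially.
        c / (1 - \<gamma>) + v i0 * ((R n / real n powr \<gamma>) * real n powr (\<gamma> - 1)) = u n / real n"
      using eventually_ge_at_top[of i0]
    proof eventually_elim
      case (elim n)
      then have n: "real n > 0"
        using i0 by simp
      have "u n = c * real n / (1 - \<gamma>) + v i0 * R n"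
        using v[OF elim] by (simp add: v_def)
      moreover have "(R n / real n powr \<gamma>) * real n powr (\<gamma> - 1) = R n / real n"
        using n by (simp add: powr_diff)
      ultimately show ?case
        using n by (simp add: add_divide_distrib)
    qed
  qed
qed

text \<open>The second moment is the squared mean plus the variance, and the variance is the least
  mean square deviation, so any centre \<open>a\<close> is allowed. In the application
  \<open>a\<close> is built from the values before the step, where the increment bound
  applies.\<close>

lemma avg_step_square_le:
  fixes F :: "(nat \<Rightarrow> nat) \<Rightarrow> real"
  shows "avg_step p i (\<lambda>c. (F c)\<^sup>2) c \<le> (avg_step p i F c)\<^sup>2 + avg_step p i (\<lambda>c. (F c - a)\<^sup>2) c"
proof -
  define m where "m = avg_step p i F c"
  have "avg_step p i (\<lambda>c. (F c - a)\<^sup>2) c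
      = avg_step p i (\<lambda>c. (F c)\<^sup>2 + ((- 2 * a) *\<^sub>R F c + a\<^sup>2)) c"
    by (rule arg_cong[where f="\<lambda>G. avg_step p i G c"]) (auto simp: power2_eq_square algebra_simps)
  also have "\<dots> = avg_step p i (\<lambda>c. (F c)\<^sup>2) c + (- 2 * a * m + a\<^sup>2)"
    by (simp only: avg_step_add avg_step_scaleR avg_step_const m_def) simp
  finally have "(avg_step p i F c)\<^sup>2 + avg_step p i (\<lambda>c. (F c - a)\<^sup>2) c - avg_step p i (\<lambda>c. (F c)\<^sup>2) c
      = (m - a)\<^sup>2"
    by (simp add: m_def power2_eq_square algebra_simps)
  then show ?thesis
    by (smt (verit) zero_le_power2)
qed

text \<open>The martingale increments of the rescaled recursion are orthogonal and bounded.\<close>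

lemma avg_recursion_L2:
  fixes W :: "nat \<Rightarrow> (nat \<Rightarrow> nat) \<Rightarrow> real"
  assumes p: "0 \<le> p" "p \<le> 1" and a: "1 \<le> a" "\<gamma> \<le> real a" "0 \<le> \<gamma>" and ab: "a \<le> b"
    and adapted: "\<And>i c j x. a \<le> i \<Longrightarrow> i < j \<Longrightarrow> W i (c(j := x)) = W i c"
    and step: "\<And>i c. a \<le> i \<Longrightarrow> avg_step p i (W (Suc i)) c = (1 - \<gamma> / real i) * W i c + d"
    and incr: "\<And>i c x. a \<le> i \<Longrightarrow> x \<le> i \<Longrightarrow> \<bar>W (Suc i) (c(Suc i := x)) - W i c\<bar> \<le> C"
  shows "avg p b (\<lambda>c. ((W b c - d * real b / (1 + \<gamma>))
      - (\<Prod>i=a..<b. 1 - \<gamma> / real i) * (W a c - d * real a / (1 + \<gamma>)))\<^sup>2) \<le> C\<^sup>2 * real (b - a)"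
  using ab
proof (induction b rule: dec_induct)
  case base
  then show ?case by (simp add: avg_const)
next
  case (step b)
  define k where "k i = d * real i / (1 + \<gamma>)" for i
  define A where "A i = (\<Prod>i=a..<i. 1 - \<gamma> / real i)" for i
  \<comment> \<open>Subtracting the particular solution \<open>k\<close> and the homogeneous
    solution started from \<open>W a\<close> leaves a process that starts at 0 and has conditional
    mean \<open>(1 - \<gamma> / b) * Z b\<close>.\<close>
  define Z where "Z i c = (W i c - k i) - A i * (W a c - k a)" for i c
  have b: "1 \<le> b"
    using step a by simp
  have one: "avg_step p b (\<lambda>c. (Z (Suc b) c)\<^sup>2) c \<le> (Z b c)\<^sup>2 + C\<^sup>2" for c
  proof -
    have Wa: "W a (c(Suc b := x)) = W a c" for x
      using adapted[of a "Suc b" c x] step by simp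
    have "avg_step p b (Z (Suc b)) c
        = avg_step p b (\<lambda>c'. W (Suc b) c' + (- k (Suc b) - A (Suc b) * (W a c - k a))) c"
      unfolding avg_step_def Z_def Wa by (simp add: algebra_simps)
    also have "\<dots> = (1 - \<gamma> / real b) * W b c + d - k (Suc b) - A (Suc b) * (W a c - k a)"
      using step by (simp only: avg_step_add avg_step_const assms(8))
    also have "(1 - \<gamma> / real b) * W b c + d - k (Suc b) - A (Suc b) * (W a c - k a)
        = (1 - \<gamma> / real b) * Z b c"
    proof -
      have "1 + \<gamma> \<noteq> 0" "real b \<noteq> 0"
        using b a by auto
      then have 1: "d - k (Suc b) = - (1 - \<gamma> / real b) * k b"
        unfolding k_def by (simp add: divide_simps) (simp add: algebra_simps)
      have 2: "A (Suc b) = A b * (1 - \<gamma> / real b)"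
        using step by (simp add: A_def)
      show ?thesis
        unfolding Z_def 2 using 1 by algebra
    qed
    finally have m: "avg_step p b (Z (Suc b)) c = (1 - \<gamma> / real b) * Z b c" .
    \<comment> \<open>Here \<open>0 \<le> \<gamma> \<le> a \<le> b\<close> enters: the conditional
      mean is a contraction, so each step adds at most the square of \<open>C\<close> to the second
      moment.\<close>
    have "\<bar>1 - \<gamma> / real b\<bar> \<le> 1"
      using a step b by (auto simp: abs_le_iff field_simps)
    then have "((1 - \<gamma> / real b) * Z b c)\<^sup>2 \<le> 1\<^sup>2 * (Z b c)\<^sup>2"
      unfolding power_mult_distrib by (intro mult_right_mono) (simp_all add: abs_square_le_1)
    moreover have "avg_step p b (\<lambda>c'. (Z (Suc b) c' - (W b c - k (Suc b) - A (Suc b) * (W a c - k a)))\<^sup>2) c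
        \<le> avg_step p b (\<lambda>_. C\<^sup>2) c"
    proof (rule avg_step_mono[OF p])
      fix x assume x: "x \<le> b"
      have "\<bar>Z (Suc b) (c(Suc b := x)) - (W b c - k (Suc b) - A (Suc b) * (W a c - k a))\<bar> \<le> C"
        using incr[of b x c] step x by (simp add: Z_def Wa)
      then show "(Z (Suc b) (c(Suc b := x)) - (W b c - k (Suc b) - A (Suc b) * (W a c - k a)))\<^sup>2 \<le> C\<^sup>2"
        by (metis abs_ge_zero power2_abs power_mono)
    qed
    ultimately show ?thesis
      using avg_step_square_le[of p b "Z (Suc b)" c "W b c - k (Suc b) - A (Suc b) * (W a c - k a)"]
      unfolding m avg_step_const by simp
  qed
  have "avg p (Suc b) (\<lambda>c. (Z (Suc b) c)\<^sup>2) \<le> avg p b (\<lambda>c. (Z b c)\<^sup>2 + C\<^sup>2)"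
    unfolding avg.simps by (rule avg_mono[OF p one])
  also have "\<dots> \<le> C\<^sup>2 * real (b - a) + C\<^sup>2"
    using step.IH by (simp add: avg_add avg_const Z_def A_def k_def)
  also have "\<dots> = C\<^sup>2 * real (Suc b - a)"
    using step by (simp add: algebra_simps Suc_diff_le)
  finally show ?case
    by (simp add: Z_def A_def k_def)
qed

section \<open>Eigenfunctions of the Yule generator\<close>

text \<open>The function \<open>eig r\<close> solves \<open>k * (\<phi> (k + 1) - \<phi> k) = - r * \<phi> k\<close>. It has finite support, so
  it yields closed equations for both the discrete and the continuous growth dynamics.\<close>

definition eig :: "nat \<Rightarrow> nat \<Rightarrow> real" where
  "eig r k = (if k = 0 then 0 else (-1) ^ (k - 1) * real ((r - 1) choose (k - 1)))"

lemma eig_0 [simp]: "eig r 0 = 0"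
  by (simp add: eig_def)

lemma eig_1 [simp]: "eig r (Suc 0) = 1"
  by (simp add: eig_def)

lemma eig_gt: "1 \<le> r \<Longrightarrow> r < k \<Longrightarrow> eig r k = 0"
  by (auto simp: eig_def intro: binomial_eq_0)

text \<open>The diagonal entry is 1 or -1 and thus its own inverse; \<open>lln_point\<close> uses
  this to solve the triangular system for the indicators of single sizes.\<close>

lemma eig_same: "1 \<le> r \<Longrightarrow> eig r r * eig r r = 1"
  by (simp add: eig_def power_mult_distrib[symmetric] flip: power2_eq_square power_mult)

text \<open>The alternating sign turns the difference into a sum of neighbouring binomial
  coefficients; Pascal's rule and the absorption identity
  \<open>(j + 1) * (n + 1 choose j + 1) = (n + 1) * (n choose j)\<close> do the rest.\<close>

lemma eig_eigen:
  assumes "1 \<le> r"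
  shows "real k * (eig r (Suc k) - eig r k) = - real r * eig r k"
proof (cases k)
  case (Suc j)
  obtain r' where r: "r = Suc r'"
    using assms by (cases r) auto
  have "real (Suc j) * (real (r' choose Suc j) + real (r' choose j)) = real (Suc r') * real (r' choose j)"
    using Suc_times_binomial_eq[of r' j]
    by (simp only: binomial_Suc_Suc flip: of_nat_add of_nat_mult) (simp add: add.commute mult.commute)
  moreover have "real (Suc j) * ((-1) ^ Suc j * real (r' choose Suc j) - (-1) ^ j * real (r' choose j))
      = - ((-1) ^ j) * (real (Suc j) * (real (r' choose Suc j) + real (r' choose j)))"
    by (simp add: algebra_simps)
  ultimately show ?thesis
    unfolding Suc r eig_def by simp (simp add: algebra_simps)
qed simp

lemma eig_bound: "\<bar>eig r k\<bar> \<le> 2 ^ r"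
proof (cases "k = 0")
  case False
  have "(r - 1) choose (k - 1) \<le> 2 ^ (r - 1)"
    by (rule binomial_le_pow2)
  also have "\<dots> \<le> 2 ^ r"
    by (intro power_increasing) auto
  finally have "real ((r - 1) choose (k - 1)) \<le> 2 ^ r"
    by (metis of_nat_le_iff of_nat_numeral of_nat_power)
  then show ?thesis
    using False by (simp add: eig_def abs_mult)
qed simp

lemma eig_increment_bound: "\<bar>eig r (Suc k) - eig r k\<bar> \<le> 2 * 2 ^ r"
  using eig_bound[of r k] eig_bound[of r "Suc k"] by simp

section \<open>Transition function of the Yule-Simon process\<close>

locale yule_simon_transition =
  fixes p :: real and P :: "real \<Rightarrow> real \<Rightarrow> nat \<Rightarrow> nat \<Rightarrow> real"
  assumes p: "0 < p" "p < 1" and P: "pure_birth_transition (ys_rate (1 / p)) P"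
begin

lemma P_refl: "0 \<le> s \<Longrightarrow> s \<le> 1 \<Longrightarrow> k = 0 \<or> 0 < s \<Longrightarrow> P s s k l = (if k = l then 1 else 0)"
  using P unfolding pure_birth_transition_def by blast

lemma P_cont: "0 \<le> s \<Longrightarrow> s \<le> 1 \<Longrightarrow> k = 0 \<or> 0 < s \<Longrightarrow> continuous_on {s..1} (\<lambda>t. P s t k l)"
  using P unfolding pure_birth_transition_def by blast

lemma P_deriv:
  "0 \<le> s \<Longrightarrow> k = 0 \<or> 0 < s \<Longrightarrow> s < t \<Longrightarrow> t < 1 \<Longrightarrow>
    ((\<lambda>t. P s t k l) has_real_derivative
      ((if l = 0 then 0 else ys_rate (1 / p) (l - 1) t * P s t k (l - 1))
        - ys_rate (1 / p) l t * P s t k l)) (at t)"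
  using P[unfolded pure_birth_transition_def, rule_format, of s k l] by auto

text \<open>State 0 is only left, never entered, and it is left at rate \<open>1 / (1 - t)\<close>,
  so \<open>P s t k 0 / (1 - t)\<close> is constant in \<open>t\<close>. The birth time of a tree is
  thus uniform on the unit interval.\<close>

lemma P_to_0:
  assumes s: "0 \<le> s" "s < 1" and k: "k = 0 \<or> 0 < s" and t: "s \<le> t" "t \<le> 1"
  shows "P s t k 0 = (if k = 0 then (1 - t) / (1 - s) else 0)"
proof -
  define K where "K = (if k = 0 then 1 / (1 - s) else 0)"
  have cont: "continuous_on {s..1} (\<lambda>t. P s t k 0)"
    using P_cont s k by simp
  have eq: "P s u k 0 - K * (1 - u) = 0" if u: "s \<le> u" "u < 1" for u
  proof (cases "s = u")
    case True
    then show ?thesis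
      using P_refl[of s k 0] s k by (simp add: K_def)
  next
    case False
    then have su: "s < u"
      using u by simp
    have "P s u k 0 / (1 - u) = P s s k 0 / (1 - s)"
    proof (rule DERIV_isconst_end[OF su])
      show "continuous_on {s..u} (\<lambda>u. P s u k 0 / (1 - u))"
        using u by (intro continuous_intros continuous_on_subset[OF cont]) auto
      fix x assume x: "s < x" "x < u"
      have "((\<lambda>u. P s u k 0 / (1 - u)) has_real_derivative
          ((- ys_rate (1 / p) 0 x * P s x k 0) * (1 - x) - P s x k 0 * (0 - 1)) / ((1 - x) * (1 - x))) (at x)"
        using P_deriv[of s k x 0] s k x u
        by (intro DERIV_divide DERIV_diff DERIV_const DERIV_ident) auto
      moreover have z: "((- ys_rate (1 / p) 0 x * P s x k 0) * (1 - x) - P s x k 0 * (0 - 1)) = 0"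
        using x u by (simp add: ys_rate_def)
      ultimately show "((\<lambda>u. P s u k 0 / (1 - u)) has_real_derivative 0) (at x)"
        unfolding z by simp
    qed
    then show ?thesis
      using P_refl[of s k 0] s k u by (auto simp: K_def field_simps split: if_splits)
  qed
  \<comment> \<open>The rate explodes at time 1; the identity holds on \<open>{s..<1}\<close> and
    extends by continuity.\<close>
  have cl: "closure {s..<1} = {s..1}"
    using s by simp
  have "P s t k 0 - K * (1 - t) = 0"
  proof (rule continuous_constant_on_closure[of "{s..<1}" "\<lambda>t. P s t k 0 - K * (1 - t)" 0])
    show "continuous_on (closure {s..<1}) (\<lambda>t. P s t k 0 - K * (1 - t))"
      unfolding cl by (intro continuous_intros cont)
  qed (use eq t cl in auto)
  then show ?thesis
    by (simp add: K_def)
qed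

text \<open>The expectation of \<open>eig r\<close> of the state at time \<open>t\<close>, started
  from \<open>k\<close> at time \<open>s\<close>. The sum is complete because \<open>eig r\<close>
  vanishes at 0 and above \<open>r\<close>.\<close>

definition P_eig :: "nat \<Rightarrow> real \<Rightarrow> real \<Rightarrow> nat \<Rightarrow> real" where
  "P_eig r s t k = (\<Sum>l=1..r. P s t k l * eig r l)"

text \<open>Summation by parts moves the generator from \<open>P\<close> to \<open>eig r\<close>,
  where it acts on the positive states as multiplication by \<open>- p * r / t\<close>. The
  inhomogeneous term is the flow out of state 0, weighted with \<open>eig r 1 = 1\<close>.\<close>

lemma P_eig_deriv:
  assumes r: "1 \<le> r" and s: "0 \<le> s" and k: "k = 0 \<or> 0 < s" and t: "s < t" "t < 1"
  shows "((\<lambda>t. P_eig r s t k) has_real_derivative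
    (P s t k 0 / (1 - t) - p * real r / t * P_eig r s t k)) (at t)"
proof -
  define g where "g l = ys_rate (1 / p) l t * P s t k l" for l
  have "((\<lambda>t. P_eig r s t k) has_real_derivative (\<Sum>l=1..r. (g (l - 1) - g l) * eig r l)) (at t)"
    unfolding P_eig_def
  proof (rule DERIV_sum)
    fix l assume "l \<in> {1..r}"
    then have "((\<lambda>t. P s t k l) has_real_derivative (g (l - 1) - g l)) (at t)"
      using P_deriv[OF s k t, of l] by (simp add: g_def)
    then show "((\<lambda>t. P s t k l * eig r l) has_real_derivative (g (l - 1) - g l) * eig r l) (at t)"
      by (rule DERIV_cmult_right)
  qed
  moreover have "(\<Sum>l=1..r. (g (l - 1) - g l) * eig r l)
      = P s t k 0 / (1 - t) - p * real r / t * P_eig r s t k"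
  proof -
    have 1: "(\<Sum>l=1..r. g (l - 1) * eig r l) = (\<Sum>l=0..<r. g l * eig r (Suc l))"
      by (rule sum.reindex_bij_witness[of _ Suc "\<lambda>l. l - 1"]) auto
    \<comment> \<open>The index \<open>r\<close> may be added since
      \<open>eig r (Suc r) = 0\<close>; here the finite support closes the equation.\<close>
    also have "\<dots> = (\<Sum>l=0..r. g l * eig r (Suc l))"
      using eig_gt[OF r, of "Suc r"] by (simp add: sum.atLeastLessThan_Suc atLeastLessThanSuc_atLeastAtMost[symmetric])
    also have "\<dots> = g 0 + (\<Sum>l=1..r. g l * eig r (Suc l))"
      by (simp add: sum.atLeast_Suc_atMost)
    finally have "(\<Sum>l=1..r. (g (l - 1) - g l) * eig r l) = g 0 + (\<Sum>l=1..r. g l * (eig r (Suc l) - eig r l))"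
      by (simp add: left_diff_distrib right_diff_distrib sum_subtractf)
    also have "(\<Sum>l=1..r. g l * (eig r (Suc l) - eig r l)) = (\<Sum>l=1..r. - (p * real r / t) * (P s t k l * eig r l))"
    proof (intro sum.cong refl)
      fix l assume "l \<in> {1..r}"
      then have "g l * (eig r (Suc l) - eig r l) = p / t * P s t k l * (real l * (eig r (Suc l) - eig r l))"
        by (simp add: g_def ys_rate_def)
      also have "\<dots> = - (p * real r / t) * (P s t k l * eig r l)"
        unfolding eig_eigen[OF r] by simp
      finally show "g l * (eig r (Suc l) - eig r l) = - (p * real r / t) * (P s t k l * eig r l)" .
    qed
    also have "\<dots> = - (p * real r / t) * P_eig r s t k"
      unfolding P_eig_def sum_distrib_left ..
    finally show ?thesis
      by (simp add: g_def ys_rate_def)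
  qed
  ultimately show ?thesis
    by simp
qed

lemma P_eig_cont:
  "0 \<le> s \<Longrightarrow> s \<le> 1 \<Longrightarrow> k = 0 \<or> 0 < s \<Longrightarrow> continuous_on {s..1} (\<lambda>t. P_eig r s t k)"
  unfolding P_eig_def by (intro continuous_intros P_cont)

lemma P_eig_refl:
  assumes r: "1 \<le> r" and s: "0 \<le> s" "s \<le> 1" and k: "k = 0 \<or> 0 < s"
  shows "P_eig r s s k = eig r k"
proof -
  have "P_eig r s s k = (\<Sum>l=1..r. if k = l then eig r l else 0)"
    unfolding P_eig_def using s k by (intro sum.cong) (auto simp: P_refl)
  also have "\<dots> = eig r k"
    using eig_gt[OF r, of k] by (cases "k = 0") auto
  finally show ?thesis .
qed

text \<open>By \<open>P_to_0\<close> the source term is constant in \<open>t\<close>, namely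
  \<open>1 / (1 - s)\<close> or 0, so \<open>K * t\<close> is a particular solution and
  \<open>t powr \<gamma>\<close> an integrating factor. For \<open>s = 0\<close> the power of
  \<open>s / t\<close> is 0, so the start of the process is covered.\<close>

lemma P_eig_eq:
  assumes r: "1 \<le> r" and s: "0 \<le> s" "s < 1" and k: "k = 0 \<or> 0 < s" and t: "s < t" "t \<le> 1"
  shows "P_eig r s t k = (if k = 0 then (t - s * (s / t) powr (p * r)) / ((1 - s) * (1 + p * r))
    else (s / t) powr (p * r) * eig r k)"
proof -
  define \<gamma> where "\<gamma> = p * real r"
  have \<gamma>: "\<gamma> > 0"
    using p r by (simp add: \<gamma>_def)
  define K where "K = (if k = 0 then 1 / ((1 - s) * (1 + \<gamma>)) else 0)"
  have "t powr \<gamma> * (P_eig r s t k - K * t) = s powr \<gamma> * (P_eig r s s k - K * s)"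
  proof (rule DERIV_isconst_end[OF t(1)])
    have "continuous_on {s..t} (\<lambda>t. P_eig r s t k)"
      using s k t by (intro continuous_on_subset[OF P_eig_cont]) auto
    \<comment> \<open>At \<open>s = 0\<close>, where the equation is singular, continuity of
      \<open>t powr \<gamma>\<close> rests on \<open>\<gamma> > 0\<close>.\<close>
    then show "continuous_on {s..t} (\<lambda>t. t powr \<gamma> * (P_eig r s t k - K * t))"
      using s \<gamma> by (intro continuous_intros continuous_on_powr') auto
    fix x assume x: "s < x" "x < t"
    have x0: "x > 0" "x < 1"
      using x s t by auto
    have D: "P s x k 0 / (1 - x) = (1 + \<gamma>) * K"
      using P_to_0[of s k x] s k t x \<gamma> by (auto simp: K_def)
    have "((\<lambda>t. t powr \<gamma> * (P_eig r s t k - K * t)) has_real_derivative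
        (\<gamma> * x powr (\<gamma> - 1)) * (P_eig r s x k - K * x)
        + ((P s x k 0 / (1 - x) - p * real r / x * P_eig r s x k) - K * 1) * x powr \<gamma>) (at x)"
      using x0 P_eig_deriv[OF r s(1) k x(1) x0(2)]
      by (intro DERIV_mult DERIV_diff has_real_derivative_powr DERIV_cmult DERIV_ident) auto
    moreover have "(\<gamma> * x powr (\<gamma> - 1)) * (P_eig r s x k - K * x)
        + ((P s x k 0 / (1 - x) - p * real r / x * P_eig r s x k) - K * 1) * x powr \<gamma> = 0"
      unfolding D using x0 by (simp add: powr_diff field_simps \<gamma>_def)
    ultimately show "((\<lambda>t. t powr \<gamma> * (P_eig r s t k - K * t)) has_real_derivative 0) (at x)"
      by simp
  qed
  moreover have "t powr \<gamma> > 0"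
    using s t by simp
  ultimately have "P_eig r s t k - K * t = s powr \<gamma> / t powr \<gamma> * (eig r k - K * s)"
    using P_eig_refl[OF r, of s k] s k by (simp add: field_simps)
  also have "s powr \<gamma> / t powr \<gamma> = (s / t) powr \<gamma>"
    using s t by (simp add: powr_divide)
  finally have "P_eig r s t k = K * t + (s / t) powr \<gamma> * (eig r k - K * s)"
    by simp
  then show ?thesis
    unfolding \<gamma>_def[symmetric] K_def by (cases "k = 0") (simp_all add: diff_divide_distrib)
qed

end

section \<open>Law of large numbers for tree sizes\<close>

lemma avg_abs_tendsto_triangle:
  fixes F G :: "nat \<Rightarrow> (nat \<Rightarrow> nat) \<Rightarrow> real"
  assumes p: "0 \<le> p" "p \<le> 1"
    and FG: "(\<lambda>n. avg p n (\<lambda>c. \<bar>F n c - G n c\<bar>)) \<longlonglongrightarrow> 0"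
    and G: "(\<lambda>n. avg p n (\<lambda>c. \<bar>G n c - L\<bar>)) \<longlonglongrightarrow> 0"
  shows "(\<lambda>n. avg p n (\<lambda>c. \<bar>F n c - L\<bar>)) \<longlonglongrightarrow> 0"
proof (rule tendsto_sandwich[OF _ _ tendsto_const])
  show "(\<lambda>n. avg p n (\<lambda>c. \<bar>F n c - G n c\<bar>) + avg p n (\<lambda>c. \<bar>G n c - L\<bar>)) \<longlonglongrightarrow> 0"
    using tendsto_add[OF FG G] by simp
  show "\<forall>\<^sub>F n in sequentially. avg p n (\<lambda>c. \<bar>F n c - L\<bar>)
      \<le> avg p n (\<lambda>c. \<bar>F n c - G n c\<bar>) + avg p n (\<lambda>c. \<bar>G n c - L\<bar>)"
    unfolding avg_add[symmetric] by (intro always_eventually allI avg_mono p) linarith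
  show "\<forall>\<^sub>F n in sequentially. 0 \<le> avg p n (\<lambda>c. \<bar>F n c - L\<bar>)"
    by (intro always_eventually allI avg_nonneg p) simp
qed

lemma avg_abs_tendsto_0I:
  fixes F :: "nat \<Rightarrow> (nat \<Rightarrow> nat) \<Rightarrow> real"
  assumes p: "0 \<le> p" "p \<le> 1" and le: "\<forall>\<^sub>F n in sequentially. avg p n (\<lambda>c. \<bar>F n c\<bar>) \<le> b n"
    and b: "b \<longlonglongrightarrow> 0"
  shows "(\<lambda>n. avg p n (\<lambda>c. \<bar>F n c\<bar>)) \<longlonglongrightarrow> 0"
  by (rule tendsto_sandwich[OF _ le tendsto_const b])
    (intro always_eventually allI avg_nonneg p, simp)

text \<open>Time 0, at which all trees are empty, is always included so that path probabilities
  start from a fixed state. Strict monotonicity keeps \<open>1 - \<tau> j\<close> positive for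
  \<open>j < m\<close> and the denominators of \<open>\<tau> j / \<tau> (Suc j)\<close> away from 0;
  \<open>enumerate_times\<close> reduces any finite family of times to this form.\<close>

locale yule_simon_times = yule_simon_transition +
  fixes \<tau> :: "nat \<Rightarrow> real" and m :: nat
  assumes \<tau>0: "\<tau> 0 = 0" and \<tau>_less: "\<And>j. j < m \<Longrightarrow> \<tau> j < \<tau> (Suc j)" and \<tau>_le_1: "\<tau> m \<le> 1"
begin

lemma p_le: "0 \<le> p" "p \<le> 1"
  using p by auto

lemma \<tau>_mono: "i \<le> j \<Longrightarrow> j \<le> m \<Longrightarrow> \<tau> i \<le> \<tau> j"
proof (induction j rule: dec_induct)
  case (step j)
  then show ?case
    using \<tau>_less[of j] by simp
qed simp

lemma \<tau>_strict_mono: "i < j \<Longrightarrow> j \<le> m \<Longrightarrow> \<tau> i < \<tau> j"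
  using \<tau>_mono[of "Suc i" j] \<tau>_less[of i] by simp

lemma \<tau>_nonneg: "j \<le> m \<Longrightarrow> 0 \<le> \<tau> j"
  using \<tau>_mono[of 0 j] \<tau>0 by simp

lemma \<tau>_pos: "0 < j \<Longrightarrow> j \<le> m \<Longrightarrow> 0 < \<tau> j"
  using \<tau>_strict_mono[of 0 j] \<tau>0 by simp

lemma \<tau>_le: "j \<le> m \<Longrightarrow> \<tau> j \<le> 1"
  using \<tau>_mono[of j m] \<tau>_le_1 by simp

section \<open>Lattice times of the skeleton\<close>

definition idx :: "nat \<Rightarrow> nat \<Rightarrow> nat" where
  "idx n j = nat \<lfloor>\<tau> j * real n\<rfloor>"

lemma idx_0 [simp]: "idx n 0 = 0"
  by (simp add: idx_def \<tau>0)

lemma idx_mono: "i \<le> j \<Longrightarrow> j \<le> m \<Longrightarrow> idx n i \<le> idx n j"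
  unfolding idx_def by (intro nat_mono floor_mono mult_right_mono \<tau>_mono) auto

lemma idx_le: "j \<le> m \<Longrightarrow> idx n j \<le> n"
proof -
  assume "j \<le> m"
  then have "\<tau> j * real n \<le> 1 * real n"
    by (intro mult_right_mono \<tau>_le) auto
  then show ?thesis
    unfolding idx_def by linarith
qed

lemma idx_tendsto: "j \<le> m \<Longrightarrow> (\<lambda>n. real (idx n j) / real n) \<longlonglongrightarrow> \<tau> j"
proof -
  assume j: "j \<le> m"
  have *: "real (idx n j) = real_of_int \<lfloor>\<tau> j * real n\<rfloor>" for n
    unfolding idx_def using \<tau>_nonneg[OF j] by simp
  have "(\<lambda>n. real_of_int \<lfloor>\<tau> j * real n\<rfloor> / real n) \<longlonglongrightarrow> \<tau> j"
  proof (rule tendsto_sandwich)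
    show "\<forall>\<^sub>F n in sequentially. \<tau> j - 1 / real n \<le> real_of_int \<lfloor>\<tau> j * real n\<rfloor> / real n"
      using eventually_gt_at_top[of 0]
    proof eventually_elim
      case (elim n)
      have "\<tau> j * real n - 1 \<le> real_of_int \<lfloor>\<tau> j * real n\<rfloor>"
        by linarith
      then have "(\<tau> j * real n - 1) / real n \<le> real_of_int \<lfloor>\<tau> j * real n\<rfloor> / real n"
        by (rule divide_right_mono) simp
      then show ?case
        using elim by (simp add: diff_divide_distrib)
    qed
    show "\<forall>\<^sub>F n in sequentially. real_of_int \<lfloor>\<tau> j * real n\<rfloor> / real n \<le> \<tau> j"
      using eventually_gt_at_top[of 0]
      by eventually_elim (auto simp: field_simps)
    show "(\<lambda>n. \<tau> j - 1 / real n) \<longlonglongrightarrow> \<tau> j"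
      using tendsto_diff[OF tendsto_const lim_1_over_n] by simp
  qed auto
  then show ?thesis
    unfolding * .
qed

lemma idx_at_top:
  assumes "0 < j" "j \<le> m"
  shows "\<forall>\<^sub>F n in sequentially. k \<le> idx n j"
proof -
  have "(\<lambda>n. real (idx n j) / real n - real k / real n) \<longlonglongrightarrow> \<tau> j - 0"
    by (intro tendsto_diff idx_tendsto assms lim_const_over_n)
  then have "\<forall>\<^sub>F n in sequentially. 0 < real (idx n j) / real n - real k / real n"
    by (rule order_tendstoD(1)) (use \<tau>_pos[OF assms] in simp)
  then show ?thesis
    by eventually_elim (auto simp: divide_less_cancel)
qed

section \<open>Trees that follow a prescribed path of sizes\<close>

definition match :: "nat \<Rightarrow> nat \<Rightarrow> (nat \<Rightarrow> nat) \<Rightarrow> (nat \<Rightarrow> nat) \<Rightarrow> nat \<Rightarrow> real" where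
  "match l n \<kappa> c r = of_bool (\<forall>j\<in>{1..l}. tree_size c (idx n j) r = \<kappa> j)"

definition path_prob :: "nat \<Rightarrow> (nat \<Rightarrow> nat) \<Rightarrow> real" where
  "path_prob l \<kappa> = (\<Prod>j<l. P (\<tau> j) (\<tau> (Suc j)) (\<kappa> j) (\<kappa> (Suc j)))"

text \<open>The factors \<open>(1 - \<tau> (Suc j)) / (1 - \<tau> j)\<close> telescope; the value is
  the chance that a uniform birth time exceeds \<open>\<tau> l\<close>.\<close>

lemma path_prob_0:
  assumes "l \<le> m" "\<And>j. j \<le> l \<Longrightarrow> \<kappa> j = 0"
  shows "path_prob l \<kappa> = 1 - \<tau> l"
  using assms
proof (induction l)
  case 0
  then show ?case by (simp add: path_prob_def \<tau>0)
next
  case (Suc l)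
  have lt: "\<tau> l < \<tau> (Suc l)" "\<tau> (Suc l) \<le> 1" "0 \<le> \<tau> l"
    using Suc.prems \<tau>_less \<tau>_le \<tau>_nonneg by auto
  have "P (\<tau> l) (\<tau> (Suc l)) 0 0 = (1 - \<tau> (Suc l)) / (1 - \<tau> l)"
    using P_to_0[of "\<tau> l" 0 "\<tau> (Suc l)"] lt by simp
  moreover have "path_prob l \<kappa> = 1 - \<tau> l"
    using Suc by simp
  ultimately show ?case
    using lt Suc.prems by (simp add: path_prob_def)
qed

text \<open>State 0 cannot be re-entered, so some factor of the product vanishes.\<close>

lemma path_prob_eq_0:
  assumes "l \<le> m" "\<kappa> l = 0" "i \<in> {1..l}" "\<kappa> i \<noteq> 0"
  shows "path_prob l \<kappa> = 0"
  using assms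
proof (induction l)
  case (Suc l)
  show ?case
  proof (cases "\<kappa> l = 0")
    case True
    have "i \<noteq> Suc l"
      using Suc.prems by auto
    then have "path_prob l \<kappa> = 0"
      using Suc True by auto
    then show ?thesis
      by (simp add: path_prob_def)
  next
    case False
    then have "l \<noteq> 0"
      using Suc.prems by (cases "l = 0") auto
    then have "P (\<tau> l) (\<tau> (Suc l)) (\<kappa> l) 0 = 0"
      using P_to_0[of "\<tau> l" "\<kappa> l" "\<tau> (Suc l)"] \<tau>_pos[of l] \<tau>_less[of l] \<tau>_le[of "Suc l"] False Suc.prems
      by auto
    then show ?thesis
      using Suc.prems by (simp add: path_prob_def)
  qed
qed simp

text \<open>With weights frozen after \<open>idx n l\<close>, the sum of \<open>eig R\<close> over
  the trees obeys an exact linear recursion on the next time interval, the discrete counterpart of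
  \<open>P_eig_deriv\<close>. A source appears only if the prescribed path is still zero at
  \<open>\<tau> l\<close>, because trees born later have an empty past. In that case
  \<open>eig R 0 = 0\<close> makes the starting value vanish, which is why the assumed law for
  \<open>l\<close> is restricted to nonzero paths.\<close>

lemma lln_eigen:
  assumes l: "l < m" and R: "1 \<le> R" and \<kappa>0: "\<kappa> 0 = 0"
    and IH: "\<exists>j\<in>{1..l}. \<kappa> j \<noteq> 0 \<Longrightarrow>
      (\<lambda>n. avg p n (\<lambda>c. \<bar>(\<Sum>r=1..n. match l n \<kappa> c r) / real n - (1 - p) * path_prob l \<kappa>\<bar>)) \<longlonglongrightarrow> 0"
  shows "(\<lambda>n. avg p n (\<lambda>c. \<bar>(\<Sum>r=1..n. match l n \<kappa> c r * eig R (tree_size c (idx n (Suc l)) r)) / real n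
      - (1 - p) * path_prob l \<kappa> * P_eig R (\<tau> l) (\<tau> (Suc l)) (\<kappa> l)\<bar>)) \<longlonglongrightarrow> 0"
proof -
  define s t \<gamma> where "s = \<tau> l" and "t = \<tau> (Suc l)" and "\<gamma> = p * real R"
  have st: "0 \<le> s" "s < t" "t \<le> 1" "s < 1"
    using \<tau>_nonneg[of l] \<tau>_less[OF l] \<tau>_le[of "Suc l"] l by (auto simp: s_def t_def)
  have \<gamma>: "0 < \<gamma>"
    using p R by (simp add: \<gamma>_def)
  define Y where "Y = (1 - p) * path_prob l \<kappa>"
  define z where "z \<longleftrightarrow> (\<forall>j\<in>{1..l}. \<kappa> j = 0)"
  define d where "d = (1 - p) * of_bool z"
  \<comment> \<open>From \<open>i0\<close> on the factors \<open>1 - \<gamma> / i\<close> lie in the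
    unit interval. For \<open>l = 0\<close>, where \<open>idx n l = 0\<close>, the recursion is
    started at \<open>i0\<close> instead; the first \<open>i0\<close> steps contribute only
    O(1/n).\<close>
  define i0 where "i0 = nat \<lceil>\<gamma>\<rceil> + 1"
  define a where "a n = max (idx n l) i0" for n
  define b where "b n = idx n (Suc l)" for n
  define W where "W n i c = (\<Sum>r=1..i. match l n \<kappa> c r * eig R (tree_size c i r))" for n i c
  define A where "A n = (\<Prod>i=a n..<b n. 1 - \<gamma> / real i)" for n
  define C :: real where "C = 2 * 2 ^ R"
  have i0: "1 \<le> i0" "\<gamma> \<le> real i0"
    unfolding i0_def by linarith+
  have a: "1 \<le> a n" "\<gamma> \<le> real (a n)" "idx n l \<le> a n" for n
    using i0 by (auto simp: a_def le_max_iff_disj)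
  have b_le: "b n \<le> n" for n
    unfolding b_def using l by (intro idx_le) simp
  have ab: "\<forall>\<^sub>F n in sequentially. a n \<le> b n"
    using idx_at_top[of "Suc l" i0] l
    by (auto elim!: eventually_mono simp: a_def b_def intro!: idx_mono)
  have match_upd: "match l n \<kappa> (c(j := x)) r = match l n \<kappa> c r" if "idx n l < j" for n c j x r
  proof -
    have "tree_size (c(j := x)) (idx n j') r = tree_size c (idx n j') r" if "j' \<in> {1..l}" for j'
      using idx_mono[of j' l n] that l \<open>idx n l < j\<close> by (intro tree_size_fun_upd) auto
    then show ?thesis
      by (simp add: match_def)
  qed
  have match_new: "match l n \<kappa> c (Suc i) = of_bool z" if "idx n l \<le> i" for n c i
  proof -
    have "tree_size c (idx n j') (Suc i) = 0" if "j' \<in> {1..l}" for j'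
      using idx_mono[of j' l n] that l \<open>idx n l \<le> i\<close> by (intro tree_size_eq_0) auto
    then show ?thesis
      by (auto simp: match_def z_def)
  qed
  have A_le: "\<bar>A n\<bar> \<le> 1" for n
    unfolding A_def abs_prod
  proof (intro prod_le_1 conjI)
    fix i assume "i \<in> {a n..<b n}"
    then have "\<gamma> \<le> real i" "0 < real i"
      using a(1,2)[of n] by auto
    then show "\<bar>1 - \<gamma> / real i\<bar> \<le> 1"
      using \<gamma> by (auto simp: abs_le_iff field_simps)
  qed simp
  \<comment> \<open>The prediction of \<open>W n (b n) c / n\<close> from the state at
    \<open>a n\<close>; the deviation from it is the martingale part, which the mean square bound
    controls.\<close>
  define D where "D n c = A n * (W n (a n) c / real n) + d * (real (b n) / real n - A n * (real (a n) / real n)) / (1 + \<gamma>)" for n c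
  have L2: "(\<lambda>n. avg p n (\<lambda>c. \<bar>W n (b n) c / real n - D n c\<bar>)) \<longlonglongrightarrow> 0"
  proof (rule avg_abs_tendsto_0I[OF p_le])
    show "(\<lambda>n. C * sqrt (1 / real n)) \<longlonglongrightarrow> 0"
      using tendsto_mult[OF tendsto_const tendsto_real_sqrt[OF lim_1_over_n]] by fastforce
    show "\<forall>\<^sub>F n in sequentially. avg p n (\<lambda>c. \<bar>W n (b n) c / real n - D n c\<bar>) \<le> C * sqrt (1 / real n)"
      using ab eventually_gt_at_top[of 0]
    proof eventually_elim
      case (elim n)
      define Z where "Z c = (W n (b n) c - d * real (b n) / (1 + \<gamma>))
          - A n * (W n (a n) c - d * real (a n) / (1 + \<gamma>))" for c
      have adapted: "W n i (c(j := x)) = W n i c" if "a n \<le> i" "i < j" for i c j x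
        unfolding W_def using that a(3)[of n]
        by (intro sum.cong refl) (simp add: match_upd tree_size_fun_upd)
      have "avg p (b n) (\<lambda>c. (Z c)\<^sup>2) \<le> C\<^sup>2 * real (b n - a n)"
        unfolding Z_def A_def
      proof (rule avg_recursion_L2[OF p_le a(1,2) less_imp_le[OF \<gamma>] elim(1)])
        fix i c
        assume i: "a n \<le> i"
        have "avg_step p i (\<lambda>c. \<Sum>r=1..Suc i. match l n \<kappa> c r * eig R (tree_size c (Suc i) r)) c =
            (1 + p * (- real R) / real i) * (\<Sum>r=1..i. match l n \<kappa> c r * eig R (tree_size c i r))
            + (1 - p) * match l n \<kappa> c (Suc i) * eig R 1"
          using i a[of n] by (intro avg_step_tree_sum eig_eigen[OF R] match_upd) auto
        then show "avg_step p i (W n (Suc i)) c = (1 - \<gamma> / real i) * W n i c + d"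
          unfolding W_def[abs_def] using i a(3)[of n]
          by (simp add: match_new \<gamma>_def d_def del: sum.cl_ivl_Suc)
      next
        fix i c x
        assume "a n \<le> i" "x \<le> i"
        then show "\<bar>W n (Suc i) (c(Suc i := x)) - W n i c\<bar> \<le> C"
          unfolding W_def C_def using a[of n]
          by (intro tree_sum_increment_bound eig_increment_bound match_upd) (auto simp: match_def)
      qed (rule adapted)
      moreover have "avg p n (\<lambda>c. (Z c)\<^sup>2) = avg p (b n) (\<lambda>c. (Z c)\<^sup>2)"
        unfolding Z_def using elim(1) by (intro avg_extend b_le) (simp add: adapted)
      moreover have "C\<^sup>2 * real (b n - a n) \<le> C\<^sup>2 * real n"
        using b_le[of n] by (intro mult_left_mono) auto
      ultimately have "avg p n (\<lambda>c. (Z c)\<^sup>2) \<le> C\<^sup>2 * real n"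
        by simp
      then have "avg p n (\<lambda>c. \<bar>Z c\<bar>) \<le> sqrt (C\<^sup>2 * real n)"
        using avg_abs_le_sqrt[OF p_le, of n Z] by (meson order_trans real_sqrt_le_mono)
      also have "\<dots> = C * sqrt (real n)"
        by (simp add: real_sqrt_mult C_def)
      finally have "avg p n (\<lambda>c. \<bar>Z c\<bar>) \<le> C * sqrt (real n)" .
      moreover have "\<bar>W n (b n) c / real n - D n c\<bar> = (1 / real n) * \<bar>Z c\<bar>" for c
      proof -
        have "W n (b n) c / real n - D n c = (1 / real n) * Z c"
          unfolding Z_def D_def by (simp add: diff_divide_distrib algebra_simps)
        then show ?thesis
          by (simp add: abs_mult)
      qed
      ultimately have "avg p n (\<lambda>c. \<bar>W n (b n) c / real n - D n c\<bar>) \<le> (1 / real n) * (C * sqrt (real n))"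
        by (simp only: avg_mult) (simp add: divide_right_mono)
      also have "\<dots> = C * sqrt (1 / real n)"
        using elim by (simp add: real_sqrt_divide field_simps)
      finally show ?case .
    qed
  qed
  have start: "(\<lambda>n. avg p n (\<lambda>c. \<bar>W n (a n) c / real n - eig R (\<kappa> l) * Y\<bar>)) \<longlonglongrightarrow> 0"
  proof (cases "l = 0")
    case True
    have "\<bar>W n (a n) c\<bar> \<le> real i0 * 2 ^ R" for n c
    proof -
      have "a n = i0"
        using True by (simp add: a_def)
      then have "\<bar>W n (a n) c\<bar> \<le> (\<Sum>r=1..i0. \<bar>match l n \<kappa> c r * eig R (tree_size c i0 r)\<bar>)"
        unfolding W_def by (simp only: sum_abs)
      also have "\<dots> \<le> (\<Sum>r=1..i0. 1 * 2 ^ R)"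
        unfolding abs_mult using eig_bound by (intro sum_mono mult_mono) (auto simp: match_def)
      finally show ?thesis
        by simp
    qed
    then have "avg p n (\<lambda>c. \<bar>W n (a n) c / real n - eig R (\<kappa> l) * Y\<bar>) \<le> (real i0 * 2 ^ R) / real n" for n
      using True \<kappa>0 avg_mono[OF p_le, of "\<lambda>c. \<bar>W n (a n) c / real n - eig R (\<kappa> l) * Y\<bar>" "\<lambda>_. (real i0 * 2 ^ R) / real n" n]
      by (simp add: avg_const abs_divide divide_right_mono)
    then show ?thesis
      by (intro avg_abs_tendsto_0I[OF p_le _ lim_const_over_n] always_eventually allI)
  next
    case False
    have ev: "\<forall>\<^sub>F n in sequentially. a n = idx n l"
      using idx_at_top[of l i0] l False by (auto elim!: eventually_mono simp: a_def)
    have W_a: "W n (idx n l) c = eig R (\<kappa> l) * (\<Sum>r=1..n. match l n \<kappa> c r)" if nz: "\<not> z" for n c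
    proof -
      \<comment> \<open>Indices beyond \<open>idx n l\<close> have an empty past and cannot match a
        nonzero path.\<close>
      have "(\<Sum>r=1..n. match l n \<kappa> c r) = (\<Sum>r=1..idx n l. match l n \<kappa> c r)"
      proof (rule sum.mono_neutral_right)
        show "\<forall>r\<in>{1..n} - {1..idx n l}. match l n \<kappa> c r = 0"
        proof
          fix r assume "r \<in> {1..n} - {1..idx n l}"
          then have "match l n \<kappa> c (Suc (r - 1)) = of_bool z"
            by (intro match_new) auto
          then show "match l n \<kappa> c r = 0"
            using nz \<open>r \<in> {1..n} - {1..idx n l}\<close> by simp
        qed
      qed (use idx_le[of l n] l in auto)
      moreover have "match l n \<kappa> c r * eig R (tree_size c (idx n l) r) = eig R (\<kappa> l) * match l n \<kappa> c r" for r
        using False by (auto simp: match_def intro!: bexI[of _ l])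
      ultimately show ?thesis
        unfolding W_def by (simp only: sum_distrib_left)
    qed
    have W_z: "W n (idx n l) c = 0" if z for n c
      unfolding W_def using that False by (intro sum.neutral) (auto simp: match_def z_def intro!: bexI[of _ l] gr0I)
    have e: "(\<lambda>n. avg p n (\<lambda>c. \<bar>W n (idx n l) c / real n - eig R (\<kappa> l) * Y\<bar>)) \<longlonglongrightarrow> 0"
    proof (cases z)
      case True
      then have "eig R (\<kappa> l) = 0"
        using False by (auto simp: z_def)
      then show ?thesis
        using W_z[OF True] by (simp add: avg_const)
    next
      case nz: False
      then have "\<exists>j\<in>{1..l}. \<kappa> j \<noteq> 0"
        by (auto simp: z_def)
      from IH[OF this] have "(\<lambda>n. \<bar>eig R (\<kappa> l)\<bar> * avg p n (\<lambda>c. \<bar>(\<Sum>r=1..n. match l n \<kappa> c r) / real n - Y\<bar>)) \<longlonglongrightarrow> 0"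
        using tendsto_mult_right_zero unfolding Y_def by blast
      moreover have "\<bar>eig R (\<kappa> l)\<bar> * \<bar>(\<Sum>r=1..n. match l n \<kappa> c r) / real n - Y\<bar>
          = \<bar>W n (idx n l) c / real n - eig R (\<kappa> l) * Y\<bar>" for n c
        unfolding W_a[OF nz] abs_mult[symmetric] by (simp add: right_diff_distrib)
      ultimately show ?thesis
        by (simp add: avg_mult[symmetric])
    qed
    show ?thesis
      by (rule Lim_transform_eventually[OF e]) (use ev in eventually_elim, simp)
  qed
  have A_lim: "A \<longlonglongrightarrow> (s / t) powr \<gamma>" if "l \<noteq> 0"
  proof -
    have s: "0 < s" "0 < t"
      using \<tau>_pos[of l] l that st by (auto simp: s_def)
    have ev: "\<forall>\<^sub>F n in sequentially. a n = idx n l"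
      using idx_at_top[of l i0] l that by (auto elim!: eventually_mono simp: a_def)
    have "(\<lambda>n. \<Prod>i=idx n l..<idx n (Suc l). 1 + (- \<gamma>) / real i) \<longlonglongrightarrow> (t / s) powr (- \<gamma>)"
      using l s by (intro prod_one_plus_ratio idx_mono) (auto simp: s_def t_def intro!: idx_tendsto)
    moreover have "(t / s) powr (- \<gamma>) = (s / t) powr \<gamma>"
      using s by (simp add: powr_minus powr_divide divide_simps)
    ultimately have "(\<lambda>n. \<Prod>i=idx n l..<idx n (Suc l). 1 + (- \<gamma>) / real i) \<longlonglongrightarrow> (s / t) powr \<gamma>"
      by simp
    then show ?thesis
      by (rule Lim_transform_eventually) (use ev in eventually_elim, simp add: A_def b_def)
  qed
  \<comment> \<open>The limit of \<open>D\<close> in the shape delivered by the discrete recursion;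
    \<open>L_eq\<close> identifies it with the solution of the forward equation.\<close>
  define L where "L = (s / t) powr \<gamma> * (eig R (\<kappa> l) * Y) + d * (t - s * (s / t) powr \<gamma>) / (1 + \<gamma>)"
  define e2 where "e2 n = (A n - (s / t) powr \<gamma>) * (eig R (\<kappa> l) * Y)" for n
  define e3 where "e3 n = d * (real (b n) / real n - A n * (real (a n) / real n)) / (1 + \<gamma>)
      - d * (t - s * (s / t) powr \<gamma>) / (1 + \<gamma>)" for n
  have e2: "e2 \<longlonglongrightarrow> 0"
  proof (cases "l = 0")
    case False
    have "e2 \<longlonglongrightarrow> ((s / t) powr \<gamma> - (s / t) powr \<gamma>) * (eig R (\<kappa> l) * Y)"
      unfolding e2_def by (intro tendsto_mult tendsto_diff A_lim[OF False] tendsto_const)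
    then show ?thesis
      by simp
  qed (simp add: e2_def[abs_def] \<kappa>0)
  have Aa: "(\<lambda>n. A n * (real (a n) / real n)) \<longlonglongrightarrow> s * (s / t) powr \<gamma>"
  proof (cases "l = 0")
    case True
    have "(\<lambda>n. A n * (real (a n) / real n)) \<longlonglongrightarrow> 0"
    proof (rule Lim_null_comparison)
      show "\<forall>\<^sub>F n in sequentially. norm (A n * (real (a n) / real n)) \<le> real i0 / real n"
      proof (intro always_eventually allI)
        fix n
        have "\<bar>A n\<bar> * (real i0 / real n) \<le> 1 * (real i0 / real n)"
          using A_le by (intro mult_right_mono) auto
        then show "norm (A n * (real (a n) / real n)) \<le> real i0 / real n"
          using True by (simp add: a_def abs_mult)
      qed
    qed (rule lim_const_over_n)
    then show ?thesis
      using True by (simp add: s_def \<tau>0)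
  next
    case False
    have ev: "\<forall>\<^sub>F n in sequentially. a n = idx n l"
      using idx_at_top[of l i0] l False by (auto elim!: eventually_mono simp: a_def)
    have "(\<lambda>n. A n * (real (idx n l) / real n)) \<longlonglongrightarrow> (s / t) powr \<gamma> * s"
      unfolding s_def[symmetric] using l by (intro tendsto_mult A_lim False) (auto simp: s_def intro!: idx_tendsto)
    then show ?thesis
      by (subst mult.commute, elim Lim_transform_eventually) (use ev in eventually_elim, simp)
  qed
  have "e3 \<longlonglongrightarrow> d * (t - s * (s / t) powr \<gamma>) / (1 + \<gamma>) - d * (t - s * (s / t) powr \<gamma>) / (1 + \<gamma>)"
    unfolding e3_def b_def t_def[symmetric] using \<gamma> l
    by (intro tendsto_intros Aa idx_tendsto[of "Suc l", folded t_def]) auto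
  then have e3: "e3 \<longlonglongrightarrow> 0"
    by simp
  have D_lim: "(\<lambda>n. avg p n (\<lambda>c. \<bar>D n c - L\<bar>)) \<longlonglongrightarrow> 0"
  proof (rule avg_abs_tendsto_0I[OF p_le])
    show "(\<lambda>n. avg p n (\<lambda>c. \<bar>W n (a n) c / real n - eig R (\<kappa> l) * Y\<bar>) + (\<bar>e2 n\<bar> + \<bar>e3 n\<bar>)) \<longlonglongrightarrow> 0"
      using tendsto_add[OF start tendsto_add[OF tendsto_rabs_zero[OF e2] tendsto_rabs_zero[OF e3]]] by simp
    have le: "\<bar>D n c - L\<bar> \<le> \<bar>W n (a n) c / real n - eig R (\<kappa> l) * Y\<bar> + (\<bar>e2 n\<bar> + \<bar>e3 n\<bar>)" for n c
    proof -
      have "D n c - L = A n * (W n (a n) c / real n - eig R (\<kappa> l) * Y) + (e2 n + e3 n)"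
        unfolding D_def L_def e2_def e3_def by (simp add: algebra_simps)
      then have "\<bar>D n c - L\<bar> \<le> \<bar>A n * (W n (a n) c / real n - eig R (\<kappa> l) * Y)\<bar> + (\<bar>e2 n\<bar> + \<bar>e3 n\<bar>)"
        by (smt (verit))
      also have "\<bar>A n * (W n (a n) c / real n - eig R (\<kappa> l) * Y)\<bar>
          \<le> 1 * \<bar>W n (a n) c / real n - eig R (\<kappa> l) * Y\<bar>"
        unfolding abs_mult using A_le by (intro mult_right_mono) auto
      finally show ?thesis
        by simp
    qed
    show "\<forall>\<^sub>F n in sequentially. avg p n (\<lambda>c. \<bar>D n c - L\<bar>)
        \<le> avg p n (\<lambda>c. \<bar>W n (a n) c / real n - eig R (\<kappa> l) * Y\<bar>) + (\<bar>e2 n\<bar> + \<bar>e3 n\<bar>)"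
    proof (intro always_eventually allI)
      fix n
      show "avg p n (\<lambda>c. \<bar>D n c - L\<bar>)
          \<le> avg p n (\<lambda>c. \<bar>W n (a n) c / real n - eig R (\<kappa> l) * Y\<bar>) + (\<bar>e2 n\<bar> + \<bar>e3 n\<bar>)"
        using avg_mono[OF p_le le[of n], of n] unfolding avg_add avg_const .
    qed
  qed
  \<comment> \<open>On a zero path only the source term survives, and
    \<open>path_prob l \<kappa> = 1 - s\<close> cancels the denominator in \<open>P_eig_eq\<close>;
    on a nonzero path \<open>d = 0\<close>.\<close>
  have L_eq: "L = (1 - p) * path_prob l \<kappa> * P_eig R s t (\<kappa> l)"
  proof (cases z)
    case True
    then have \<kappa>l: "\<kappa> j = 0" if "j \<le> l" for j
      using that \<kappa>0 by (cases "j = 0") (auto simp: z_def)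
    have "path_prob l \<kappa> = 1 - s"
      using path_prob_0[of l \<kappa>] l \<kappa>l by (simp add: s_def)
    moreover have "P_eig R s t 0 = (t - s * (s / t) powr \<gamma>) / ((1 - s) * (1 + \<gamma>))"
      using P_eig_eq[OF R, of s 0 t] st by (simp add: \<gamma>_def)
    ultimately show ?thesis
      using True \<kappa>l[of l] st by (simp add: L_def d_def)
  next
    case False
    then obtain i where i: "i \<in> {1..l}" "\<kappa> i \<noteq> 0"
      by (auto simp: z_def)
    show ?thesis
    proof (cases "\<kappa> l = 0")
      case True
      then show ?thesis
        using path_prob_eq_0[OF _ True i] l False by (simp add: L_def d_def)
    next
      case nz: False
      then have "0 < s"
        using \<tau>_pos[of l] l i by (auto simp: s_def)
      then show ?thesis
        using False nz P_eig_eq[OF R, of s "\<kappa> l" t] st by (simp add: L_def d_def Y_def \<gamma>_def)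
    qed
  qed
  have W_b: "W n (b n) c = (\<Sum>r=1..n. match l n \<kappa> c r * eig R (tree_size c (b n) r))" for n c
    unfolding W_def using b_le[of n]
    by (intro sum.mono_neutral_left) (auto simp: tree_size_eq_0)
  show ?thesis
    using avg_abs_tendsto_triangle[OF p_le L2 D_lim] unfolding L_eq W_b unfolding b_def s_def t_def .
qed

lemma match_Suc: "match (Suc l) n \<kappa> c r = match l n \<kappa> c r * of_bool (tree_size c (idx n (Suc l)) r = \<kappa> (Suc l))"
  by (auto simp: match_def atLeastAtMostSuc_conv)

text \<open>Induction over the times. The functions \<open>eig 1\<close> to \<open>eig v\<close>
  arise from the indicators of the sizes 1 to \<open>v\<close> by a triangular matrix, so the errors
  \<open>E v\<close> are recovered from the errors \<open>G v\<close> by an inner induction over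
  \<open>v\<close>. The zero path is excluded: a copied index founds no tree and would be counted as
  matching it.\<close>

lemma lln_point:
  assumes "l \<le> m" "\<kappa> 0 = 0" "\<exists>j\<in>{1..l}. \<kappa> j \<noteq> 0"
  shows "(\<lambda>n. avg p n (\<lambda>c. \<bar>(\<Sum>r=1..n. match l n \<kappa> c r) / real n - (1 - p) * path_prob l \<kappa>\<bar>)) \<longlonglongrightarrow> 0"
  using assms
proof (induction l arbitrary: \<kappa>)
  case (Suc l)
  show ?case
  proof (cases "\<kappa> (Suc l) = 0")
    \<comment> \<open>A nonzero path ending in 0 is impossible on both sides: tree sizes are
      monotone in time, and \<open>path_prob\<close> vanishes.\<close>
    case True
    obtain i where i: "i \<in> {1..Suc l}" "\<kappa> i \<noteq> 0"
      using Suc.prems by auto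
    have "match (Suc l) n \<kappa> c r = 0" for n c r
    proof -
      have "tree_size c (idx n i) r \<le> tree_size c (idx n (Suc l)) r"
        using i Suc.prems by (intro tree_size_mono idx_mono) auto
      then have "\<not> (tree_size c (idx n i) r = \<kappa> i \<and> tree_size c (idx n (Suc l)) r = \<kappa> (Suc l))"
        using True i by simp
      then show ?thesis
        using i unfolding match_def by force
    qed
    moreover have "path_prob (Suc l) \<kappa> = 0"
      using path_prob_eq_0[OF _ True i] Suc.prems by simp
    ultimately show ?thesis
      by (simp add: avg_const)
  next
    case False
    define s t Y where "s = \<tau> l" and "t = \<tau> (Suc l)" and "Y = (1 - p) * path_prob l \<kappa>"
    define E where "E v n c = (\<Sum>r=1..n. match l n \<kappa> c r * of_bool (tree_size c (idx n (Suc l)) r = v)) / real n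
        - Y * P s t (\<kappa> l) v" for v n c
    define G where "G v n c = (\<Sum>r=1..n. match l n \<kappa> c r * eig v (tree_size c (idx n (Suc l)) r)) / real n
        - Y * P_eig v s t (\<kappa> l)" for v n c
    have G_lim: "(\<lambda>n. avg p n (\<lambda>c. \<bar>G v n c\<bar>)) \<longlonglongrightarrow> 0" if "1 \<le> v" for v
      using lln_eigen[of l v \<kappa>] that Suc by (simp add: G_def Y_def s_def t_def)
    have eig_expand: "eig v k = (\<Sum>w=1..v. eig v w * of_bool (k = w))" if "1 \<le> v" for v k
    proof -
      have "(\<Sum>w=1..v. eig v w * of_bool (k = w)) = (\<Sum>w=1..v. if w = k then eig v w else 0)"
        by (intro sum.cong) auto
      then show ?thesis
        using eig_gt[OF that, of k] by (cases "k = 0") auto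
    qed
    have GE: "G v n c = (\<Sum>w=1..v. eig v w * E w n c)" if "1 \<le> v" for v n c
    proof -
      define B where "B w = (\<Sum>r=1..n. match l n \<kappa> c r * of_bool (tree_size c (idx n (Suc l)) r = w))" for w
      have "(\<Sum>r=1..n. match l n \<kappa> c r * eig v (tree_size c (idx n (Suc l)) r))
          = (\<Sum>r=1..n. \<Sum>w=1..v. eig v w * (match l n \<kappa> c r * of_bool (tree_size c (idx n (Suc l)) r = w)))"
        by (intro sum.cong refl, subst eig_expand[OF that]) (simp only: sum_distrib_left mult.left_commute)
      also have "\<dots> = (\<Sum>w=1..v. \<Sum>r=1..n. eig v w * (match l n \<kappa> c r * of_bool (tree_size c (idx n (Suc l)) r = w)))"
        by (rule sum.swap)
      also have "\<dots> = (\<Sum>w=1..v. eig v w * B w)"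
        by (simp only: B_def sum_distrib_left)
      finally have "G v n c = (\<Sum>w=1..v. eig v w * B w) / real n - Y * (\<Sum>w=1..v. P s t (\<kappa> l) w * eig v w)"
        by (simp only: G_def P_eig_def)
      also have "\<dots> = (\<Sum>w=1..v. eig v w * (B w / real n - Y * P s t (\<kappa> l) w))"
        unfolding sum_divide_distrib sum_distrib_left sum_subtractf[symmetric]
        by (intro sum.cong refl) (simp add: algebra_simps)
      finally show ?thesis
        by (simp only: E_def B_def)
    qed
    have "(\<lambda>n. avg p n (\<lambda>c. \<bar>E v n c\<bar>)) \<longlonglongrightarrow> 0" if "1 \<le> v" for v
      using that
    proof (induction v rule: less_induct)
      case (less v)
      show ?case
      proof (rule avg_abs_tendsto_0I[OF p_le])
        show "(\<lambda>n. \<bar>eig v v\<bar> * (avg p n (\<lambda>c. \<bar>G v n c\<bar>) + (\<Sum>w=1..<v. \<bar>eig v w\<bar> * avg p n (\<lambda>c. \<bar>E w n c\<bar>)))) \<longlonglongrightarrow> 0"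
          by (intro tendsto_mult_right_zero tendsto_add_zero tendsto_null_sum G_lim less) auto
        have le: "\<bar>E v n c\<bar> \<le> \<bar>eig v v\<bar> * (\<bar>G v n c\<bar> + (\<Sum>w=1..<v. \<bar>eig v w\<bar> * \<bar>E w n c\<bar>))" for n c
        proof -
          have "{1..v} = insert v {1..<v}"
            using less.prems by auto
          then have "G v n c = eig v v * E v n c + (\<Sum>w=1..<v. eig v w * E w n c)"
            by (simp add: GE[OF less.prems])
          \<comment> \<open>Multiplication by \<open>eig v v\<close> inverts the diagonal entry,
            whose square is 1.\<close>
          then have "eig v v * (G v n c - (\<Sum>w=1..<v. eig v w * E w n c)) = (eig v v * eig v v) * E v n c"
            by (simp add: algebra_simps)
          then have "E v n c = eig v v * (G v n c - (\<Sum>w=1..<v. eig v w * E w n c))"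
            using eig_same[OF less.prems] by simp
          then have "\<bar>E v n c\<bar> = \<bar>eig v v\<bar> * \<bar>G v n c - (\<Sum>w=1..<v. eig v w * E w n c)\<bar>"
            by (subst abs_mult[symmetric]) (rule arg_cong[where f=abs])
          moreover have "\<bar>G v n c - (\<Sum>w=1..<v. eig v w * E w n c)\<bar> \<le> \<bar>G v n c\<bar> + (\<Sum>w=1..<v. \<bar>eig v w\<bar> * \<bar>E w n c\<bar>)"
            using sum_abs[of "\<lambda>w. eig v w * E w n c" "{1..<v}"] unfolding abs_mult by linarith
          ultimately show ?thesis
            using mult_left_mono[OF _ abs_ge_zero] by simp
        qed
        show "\<forall>\<^sub>F n in sequentially. avg p n (\<lambda>c. \<bar>E v n c\<bar>)
            \<le> \<bar>eig v v\<bar> * (avg p n (\<lambda>c. \<bar>G v n c\<bar>) + (\<Sum>w=1..<v. \<bar>eig v w\<bar> * avg p n (\<lambda>c. \<bar>E w n c\<bar>)))"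
        proof (intro always_eventually allI)
          fix n
          show "avg p n (\<lambda>c. \<bar>E v n c\<bar>)
            \<le> \<bar>eig v v\<bar> * (avg p n (\<lambda>c. \<bar>G v n c\<bar>) + (\<Sum>w=1..<v. \<bar>eig v w\<bar> * avg p n (\<lambda>c. \<bar>E w n c\<bar>)))"
            using avg_mono[OF p_le le[of n], of n] by (simp only: avg_mult avg_add avg_sum finite_atLeastLessThan)
        qed
      qed
    qed
    from this[of "\<kappa> (Suc l)"] False show ?thesis
      unfolding E_def match_Suc by (simp add: Y_def s_def t_def path_prob_def mult.assoc)
  qed
qed simp

end

section \<open>Moments of tree sizes\<close>

text \<open>For \<open>k \<ge> 1\<close> and \<open>b \<ge> 0\<close> this is Gamma(k + b) /
  (Gamma(k) Gamma(1 + b)), the eigenfunction for the eigenvalue \<open>b\<close>; at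
  \<open>b = - r\<close> with a positive integer \<open>r\<close> the same product is
  \<open>eig r\<close>.\<close>

definition rising :: "real \<Rightarrow> nat \<Rightarrow> real" where
  "rising b k = (if k = 0 then 0 else \<Prod>i=1..<k. 1 + b / real i)"

lemma rising_0 [simp]: "rising b 0 = 0"
  by (simp add: rising_def)

lemma rising_eigen: "real k * (rising b (Suc k) - rising b k) = b * rising b k"
  by (cases "k = 0") (simp_all add: rising_def prod.atLeastLessThan_Suc algebra_simps)

text \<open>The quotient has a positive limit by \<open>prod_one_plus_asymptotics\<close>, which
  bounds it below for large \<open>k\<close>; a minimum covers the finitely many small
  \<open>k\<close>.\<close>

lemma rising_lower:
  assumes "0 \<le> b"
  shows "\<exists>c>0. \<forall>k. c * real k powr b \<le> rising b k"
proof -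
  have pos: "0 < 1 + b / real i" if "1 \<le> i" for i :: nat
    using assms by (simp add: add_pos_nonneg)
  obtain C where C: "C > 0" "(\<lambda>n. (\<Prod>i=1..<n. 1 + b / real i) / real n powr b) \<longlonglongrightarrow> C"
    using prod_one_plus_asymptotics[of 1 b] pos by auto
  define q where "q n = (\<Prod>i=1..<n. 1 + b / real i) / real n powr b" for n
  have "\<forall>\<^sub>F n in sequentially. C / 2 < q n"
    unfolding q_def using C by (intro order_tendstoD(1)[OF C(2)]) auto
  then obtain n0 where n0: "\<And>n. n \<ge> n0 \<Longrightarrow> C / 2 < q n"
    by (auto simp: eventually_sequentially)
  define c where "c = Min (insert (C / 2) (q ` {1..n0}))"
  have qpos: "0 < q n" if "1 \<le> n" for n
    unfolding q_def using that pos by (intro divide_pos_pos prod_pos) auto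
  have "c > 0"
    unfolding c_def using C qpos by (subst Min_gr_iff) auto
  moreover have "c * real k powr b \<le> rising b k" for k
  proof (cases "k = 0")
    case False
    have "c \<le> q k"
    proof (cases "k \<le> n0")
      case True
      then show ?thesis
        unfolding c_def using False by (intro Min_le) auto
    next
      case False
      then have "C / 2 < q k"
        by (intro n0) simp
      moreover have "c \<le> C / 2"
        unfolding c_def by (intro Min_le) auto
      ultimately show ?thesis
        by simp
    qed
    then show ?thesis
      using False by (simp add: q_def rising_def field_simps)
  qed simp
  ultimately show ?thesis
    by blast
qed

lemma avg_tree_sum_rec:
  assumes "1 \<le> i" "\<phi> 0 = 0" "\<And>k. real k * (\<phi> (Suc k) - \<phi> k) = \<gamma> * \<phi> k"
  shows "avg p (Suc i) (\<lambda>c. \<Sum>r=1..Suc i. \<phi> (tree_size c (Suc i) r))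
    = (1 + p * \<gamma> / real i) * avg p i (\<lambda>c. \<Sum>r=1..i. \<phi> (tree_size c i r)) + (1 - p) * \<phi> 1"
proof -
  have "avg_step p i (\<lambda>c. \<Sum>r=1..Suc i. \<phi> (tree_size c (Suc i) r))
      = (\<lambda>c. (1 + p * \<gamma> / real i) * (\<Sum>r=1..i. \<phi> (tree_size c i r)) + (1 - p) * \<phi> 1)"
    using avg_step_tree_sum[OF assms, where \<alpha>="\<lambda>_ _. 1" and p=p] by (auto simp: fun_eq_iff)
  then show ?thesis
    by (simp only: avg.simps avg_add avg_mult avg_const)
qed

lemma avg_tree_sum_limit:
  assumes "p * \<gamma> < 1" "\<phi> 0 = 0" "\<And>k. real k * (\<phi> (Suc k) - \<phi> k) = \<gamma> * \<phi> k"
  shows "(\<lambda>n. avg p n (\<lambda>c. \<Sum>r=1..n. \<phi> (tree_size c n r)) / real n) \<longlonglongrightarrow> (1 - p) * \<phi> 1 / (1 - p * \<gamma>)"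
  by (rule linear_recursion_limit[OF assms(1)]) (rule avg_tree_sum_rec[OF _ assms(2,3)])

text \<open>A power is in general not an eigenfunction, so it is dominated by a multiple of
  \<open>rising b\<close>, whose mean solves a linear recursion with rate \<open>p * b\<close>. A
  rate below 1 means linear growth of the mean.\<close>

lemma avg_tree_moment_bound:
  assumes p: "0 \<le> p" "p \<le> 1" and b: "0 \<le> b" "p * b < 1"
  shows "\<exists>K. \<forall>n. avg p n (\<lambda>c. \<Sum>r=1..n. real (tree_size c n r) powr b) \<le> K * real n"
proof -
  obtain c where c: "c > 0" "\<And>k. c * real k powr b \<le> rising b k"
    using rising_lower[OF b(1)] by blast
  have "Bseq (\<lambda>n. avg p n (\<lambda>c. \<Sum>r=1..n. rising b (tree_size c n r)) / real n)"
    by (rule convergent_imp_Bseq[OF convergentI[OF avg_tree_sum_limit[OF b(2) rising_0 rising_eigen]]])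
  then obtain K where K: "\<And>n. norm (avg p n (\<lambda>c. \<Sum>r=1..n. rising b (tree_size c n r)) / real n) \<le> K"
    unfolding Bseq_def by blast
  have "avg p n (\<lambda>c. \<Sum>r=1..n. real (tree_size c n r) powr b) \<le> (K / c) * real n" for n
  proof (cases "n = 0")
    case False
    have "c * avg p n (\<lambda>c. \<Sum>r=1..n. real (tree_size c n r) powr b)
        \<le> avg p n (\<lambda>c. \<Sum>r=1..n. rising b (tree_size c n r))"
      unfolding avg_mult[symmetric] sum_distrib_left by (intro avg_mono p sum_mono c)
    also have "\<dots> \<le> K * real n"
      using K[of n] False by (simp add: field_simps abs_le_iff)
    finally show ?thesis
      using c by (simp add: field_simps)
  qed simp
  then show ?thesis
    by blast
qed

section \<open>Law of large numbers for functionals of polynomial growth\<close>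

locale yule_simon_process = yule_simon_times +
  fixes Q :: "(real \<Rightarrow> nat) measure"
  assumes prob_Q: "prob_space Q" and sets_Q: "sets Q = sets path_space"
    and law_Q: "\<And>l (t::nat \<Rightarrow> real) (k::nat \<Rightarrow> nat).
           t 0 = 0 \<Longrightarrow> k 0 = 0 \<Longrightarrow> (\<forall>j<l. t j \<le> t (Suc j)) \<Longrightarrow> t l \<le> 1 \<Longrightarrow>
           measure Q {f\<in>space Q. \<forall>j\<in>{1..l}. f (t j) = k j} =
             (\<Prod>j<l. P (t j) (t (Suc j)) (k j) (k (Suc j)))"
begin

section \<open>The Yule-Simon law at finitely many times\<close>

sublocale Q: prob_space Q
  by (rule prob_Q)

lemma space_Q: "space Q = UNIV"
  using sets_eq_imp_space_eq[OF sets_Q] by (simp add: path_space_def space_PiM)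

lemma measurable_eval_Q [measurable]: "(\<lambda>y. y t) \<in> Q \<rightarrow>\<^sub>M count_space UNIV"
  unfolding measurable_cong_sets[OF sets_Q refl] path_space_def
  by (rule measurable_component_singleton) simp

text \<open>\<open>law_Q\<close> prescribes values at the indices from 1 on, so the initial value is
  read off by listing time 0 twice.\<close>

lemma AE_Q_0: "AE y in Q. y 0 = 0"
proof -
  have "measure Q {f\<in>space Q. \<forall>j\<in>{1..1::nat}. f ((\<lambda>_. 0) j) = (\<lambda>_. 0) j} = P 0 0 0 0"
    using law_Q[of "\<lambda>_. 0" "\<lambda>_. 0" 1] by simp
  then have "Q.prob {f\<in>space Q. f 0 = 0} = 1"
    using P_refl[of 0 0 0] by simp
  then show ?thesis
    by (subst (asm) Q.prob_Collect_eq_1) measurable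
qed

text \<open>Vectors of sizes are encoded as functions vanishing off \<open>{1..m}\<close>. They form
  a countable set, so every functional of them is measurable.\<close>

definition vecs :: "(nat \<Rightarrow> nat) set" where
  "vecs = {v. \<forall>j. j \<notin> {1..m} \<longrightarrow> v j = 0}"

definition size_vec :: "nat \<Rightarrow> (nat \<Rightarrow> nat) \<Rightarrow> nat \<Rightarrow> nat \<Rightarrow> nat" where
  "size_vec n c r = (\<lambda>j. if j \<in> {1..m} then tree_size c (idx n j) r else 0)"

definition path_vec :: "(real \<Rightarrow> nat) \<Rightarrow> nat \<Rightarrow> nat" where
  "path_vec y = (\<lambda>j. if j \<in> {1..m} then y (\<tau> j) else 0)"

definition total :: "(nat \<Rightarrow> nat) \<Rightarrow> real" where
  "total v = (\<Sum>j=1..m. real (v j))"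

lemma size_vec_in: "size_vec n c r \<in> vecs" and path_vec_in: "path_vec y \<in> vecs"
  by (auto simp: vecs_def size_vec_def path_vec_def)

lemma countable_vecs: "countable vecs"
proof -
  have "vecs \<subseteq> (\<lambda>f j. if j \<in> {1..m} then f j else 0) ` (Pi\<^sub>E {1..m} (\<lambda>_. UNIV))"
  proof
    fix v assume v: "v \<in> vecs"
    show "v \<in> (\<lambda>f j. if j \<in> {1..m} then f j else 0) ` (Pi\<^sub>E {1..m} (\<lambda>_. UNIV))"
      by (rule image_eqI[of _ _ "restrict v {1..m}"]) (use v in \<open>auto simp: vecs_def fun_eq_iff\<close>)
  qed
  then show ?thesis
    by (rule countable_subset) (intro countable_image countable_PiE, auto)
qed

lemma path_vec_eq_iff: "\<kappa> \<in> vecs \<Longrightarrow> path_vec y = \<kappa> \<longleftrightarrow> (\<forall>j\<in>{1..m}. y (\<tau> j) = \<kappa> j)"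
  by (auto simp: path_vec_def vecs_def fun_eq_iff)

lemma size_vec_eq_iff: "\<kappa> \<in> vecs \<Longrightarrow> of_bool (size_vec n c r = \<kappa>) = match m n \<kappa> c r"
  by (auto simp: size_vec_def vecs_def fun_eq_iff match_def)

lemma measurable_path_vec: "path_vec \<in> Q \<rightarrow>\<^sub>M count_space vecs"
proof (subst measurable_count_space_eq_countable[OF countable_vecs], intro conjI ballI)
  fix \<kappa> assume \<kappa>: "\<kappa> \<in> vecs"
  have "path_vec -` {\<kappa>} \<inter> space Q = {y\<in>space Q. \<forall>j\<in>{1..m}. y (\<tau> j) = \<kappa> j}"
    using path_vec_eq_iff[OF \<kappa>] by auto
  also have "\<dots> \<in> sets Q"
    by measurable
  finally show "path_vec -` {\<kappa>} \<inter> space Q \<in> sets Q" .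
qed (simp add: path_vec_in)

lemma measurable_path_vec_compose [measurable]: "(\<lambda>y. F (path_vec y)) \<in> Q \<rightarrow>\<^sub>M borel"
  by (rule measurable_compose[OF measurable_path_vec]) simp

lemma prob_path_vec:
  assumes "\<kappa> \<in> vecs"
  shows "Q.prob {y\<in>space Q. path_vec y = \<kappa>} = path_prob m \<kappa>"
proof -
  have "\<kappa> 0 = 0"
    using assms by (simp add: vecs_def)
  moreover have "\<forall>j<m. \<tau> j \<le> \<tau> (Suc j)"
    using \<tau>_less by (simp add: less_imp_le)
  ultimately show ?thesis
    using law_Q[of \<tau> \<kappa> m] \<tau>0 \<tau>_le_1 unfolding path_vec_eq_iff[OF assms] by (simp add: path_prob_def)
qed

definition box :: "nat \<Rightarrow> (nat \<Rightarrow> nat) set" where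
  "box L = {v. \<forall>j. (j \<in> {1..m} \<longrightarrow> v j \<in> {..L}) \<and> (j \<notin> {1..m} \<longrightarrow> v j = 0)}"

lemma finite_box: "finite (box L)"
  unfolding box_def by (rule finite_set_of_finite_funs) auto

lemma box_subset: "box L \<subseteq> vecs"
  by (auto simp: box_def vecs_def)

lemma total_nonneg: "0 \<le> total v"
  by (simp add: total_def sum_nonneg)

lemma total_0 [simp]: "total (\<lambda>_. 0) = 0"
  by (simp add: total_def)

lemma le_total: "j \<in> {1..m} \<Longrightarrow> real (v j) \<le> total v"
  unfolding total_def by (rule member_le_sum) auto

lemma notin_box: "v \<in> vecs \<Longrightarrow> v \<notin> box L \<Longrightarrow> real L < total v"
proof -
  assume "v \<in> vecs" "v \<notin> box L"
  then obtain j where "j \<in> {1..m}" "L < v j"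
    by (auto simp: box_def vecs_def not_le)
  then show ?thesis
    using le_total[of j v] by simp
qed

lemma total_size_vec: "total (size_vec n c r) \<le> real m * real (tree_size c n r)"
proof -
  have "total (size_vec n c r) \<le> (\<Sum>j=1..m. real (tree_size c n r))"
    unfolding total_def
    by (intro sum_mono) (auto simp: size_vec_def intro!: tree_size_mono idx_le)
  then show ?thesis
    by simp
qed

text \<open>On the box \<open>F\<close> is a finite combination of indicators of single vectors, and
  its value 0 at the zero vector removes the one vector that \<open>lln_point\<close> does not
  reach.\<close>

lemma lln_box:
  fixes F G :: "(nat \<Rightarrow> nat) \<Rightarrow> complex" and L :: nat
  assumes F0: "F (\<lambda>_. 0) = 0"
  defines "G \<equiv> \<lambda>v. F v * of_bool (v \<in> box L)"
  shows "(\<lambda>n. avg p n (\<lambda>c. norm ((\<Sum>r=1..n. G (size_vec n c r)) / real n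
      - (1 - p) * (\<integral>y. G (path_vec y) \<partial>Q)))) \<longlonglongrightarrow> 0"
proof -
  define B where "B = box L - {\<lambda>_. 0}"
  have B: "finite B" "B \<subseteq> vecs"
    using finite_box box_subset by (auto simp: B_def)
  have G: "G v = (\<Sum>\<kappa>\<in>B. F \<kappa> * of_bool (v = \<kappa>))" for v
  proof -
    have "(\<Sum>\<kappa>\<in>B. F \<kappa> * of_bool (v = \<kappa>)) = (\<Sum>\<kappa>\<in>B. if v = \<kappa> then F \<kappa> else 0)"
      by (intro sum.cong) auto
    also have "\<dots> = (if v \<in> B then F v else 0)"
      using B by simp
    also have "\<dots> = G v"
      using F0 by (auto simp: G_def B_def)
    finally show ?thesis ..
  qed
  have int: "(\<integral>y. G (path_vec y) \<partial>Q) = (\<Sum>\<kappa>\<in>B. F \<kappa> * path_prob m \<kappa>)"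
  proof -
    have "(\<integral>y. G (path_vec y) \<partial>Q) = (\<Sum>\<kappa>\<in>B. \<integral>y. F \<kappa> * of_bool (path_vec y = \<kappa>) \<partial>Q)"
      unfolding G
      by (rule Bochner_Integration.integral_sum, rule Q.integrable_const_bound[where B="norm (F _)"]) 
        (auto intro!: AE_I2)
    also have "\<dots> = (\<Sum>\<kappa>\<in>B. F \<kappa> * path_prob m \<kappa>)"
    proof (intro sum.cong refl)
      fix \<kappa> assume "\<kappa> \<in> B"
      then have \<kappa>: "\<kappa> \<in> vecs"
        using B by auto
      have "(\<integral>y. F \<kappa> * of_bool (path_vec y = \<kappa>) \<partial>Q)
          = (\<integral>y. F \<kappa> * complex_of_real (indicator {y\<in>space Q. path_vec y = \<kappa>} y) \<partial>Q)"
        by (intro Bochner_Integration.integral_cong) (auto simp: space_Q)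
      also have "\<dots> = F \<kappa> * complex_of_real (Q.prob {y\<in>space Q. path_vec y = \<kappa>})"
        by (subst integral_mult_right_zero, subst integral_complex_of_real) (simp add: space_Q)
      finally show "(\<integral>y. F \<kappa> * of_bool (path_vec y = \<kappa>) \<partial>Q) = F \<kappa> * path_prob m \<kappa>"
        using prob_path_vec[OF \<kappa>] by simp
    qed
    finally show ?thesis .
  qed
  define E where "E \<kappa> n c = (\<Sum>r=1..n. match m n \<kappa> c r) / real n - (1 - p) * path_prob m \<kappa>" for \<kappa> n c
  have E: "(\<lambda>n. avg p n (\<lambda>c. \<bar>E \<kappa> n c\<bar>)) \<longlonglongrightarrow> 0" if "\<kappa> \<in> B" for \<kappa>
  proof -
    have "\<kappa> \<in> vecs" "\<kappa> \<noteq> (\<lambda>_. 0)"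
      using that B by (auto simp: B_def)
    moreover from this obtain x where "\<kappa> x \<noteq> 0"
      by (auto simp: fun_eq_iff)
    ultimately have "\<exists>j\<in>{1..m}. \<kappa> j \<noteq> 0" "\<kappa> 0 = 0"
      unfolding vecs_def by (blast, simp)
    then show ?thesis
      unfolding E_def by (intro lln_point) auto
  qed
  have eq: "(\<Sum>r=1..n. G (size_vec n c r)) / real n - (1 - p) * (\<integral>y. G (path_vec y) \<partial>Q)
      = (\<Sum>\<kappa>\<in>B. F \<kappa> * complex_of_real (E \<kappa> n c))" for n c
  proof -
    have "(\<Sum>r=1..n. G (size_vec n c r)) = (\<Sum>r=1..n. \<Sum>\<kappa>\<in>B. F \<kappa> * complex_of_real (match m n \<kappa> c r))"
      unfolding G using B by (intro sum.cong refl) (auto simp: size_vec_eq_iff[symmetric])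
    also have "\<dots> = (\<Sum>\<kappa>\<in>B. F \<kappa> * complex_of_real (\<Sum>r=1..n. match m n \<kappa> c r))"
      by (subst sum.swap) (simp add: sum_distrib_left)
    finally have "(\<Sum>r=1..n. G (size_vec n c r)) / real n - (1 - p) * (\<integral>y. G (path_vec y) \<partial>Q)
        = (\<Sum>\<kappa>\<in>B. F \<kappa> * complex_of_real (\<Sum>r=1..n. match m n \<kappa> c r)) / real n
          - (1 - p) * (\<Sum>\<kappa>\<in>B. F \<kappa> * path_prob m \<kappa>)"
      by (simp only: int)
    also have "\<dots> = (\<Sum>\<kappa>\<in>B. F \<kappa> * complex_of_real (\<Sum>r=1..n. match m n \<kappa> c r) / real n
          - (1 - p) * (F \<kappa> * path_prob m \<kappa>))"
      by (simp only: sum_divide_distrib sum_distrib_left sum_subtractf)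
    also have "\<dots> = (\<Sum>\<kappa>\<in>B. F \<kappa> * complex_of_real (E \<kappa> n c))"
      unfolding E_def of_real_diff of_real_divide of_real_mult
      by (intro sum.cong refl) (simp add: algebra_simps)
    finally show ?thesis .
  qed
  show ?thesis
  proof (rule tendsto_sandwich[OF _ _ tendsto_const])
    show "(\<lambda>n. \<Sum>\<kappa>\<in>B. norm (F \<kappa>) * avg p n (\<lambda>c. \<bar>E \<kappa> n c\<bar>)) \<longlonglongrightarrow> 0"
      by (intro tendsto_null_sum tendsto_mult_right_zero E)
    show "\<forall>\<^sub>F n in sequentially. avg p n (\<lambda>c. norm ((\<Sum>r=1..n. G (size_vec n c r)) / real n
      - (1 - p) * (\<integral>y. G (path_vec y) \<partial>Q))) \<le> (\<Sum>\<kappa>\<in>B. norm (F \<kappa>) * avg p n (\<lambda>c. \<bar>E \<kappa> n c\<bar>))"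
    proof (intro always_eventually allI)
      fix n
      have "avg p n (\<lambda>c. norm (\<Sum>\<kappa>\<in>B. F \<kappa> * complex_of_real (E \<kappa> n c)))
          \<le> avg p n (\<lambda>c. \<Sum>\<kappa>\<in>B. norm (F \<kappa>) * \<bar>E \<kappa> n c\<bar>)"
        by (intro avg_mono p_le order_trans[OF norm_sum] sum_mono) (simp add: norm_mult)
      then show "avg p n (\<lambda>c. norm ((\<Sum>r=1..n. G (size_vec n c r)) / real n
          - (1 - p) * (\<integral>y. G (path_vec y) \<partial>Q))) \<le> (\<Sum>\<kappa>\<in>B. norm (F \<kappa>) * avg p n (\<lambda>c. \<bar>E \<kappa> n c\<bar>))"
        unfolding eq by (simp only: avg_sum[OF B(1)] avg_mult)
    qed
    show "\<forall>\<^sub>F n in sequentially. 0 \<le> avg p n (\<lambda>c. norm ((\<Sum>r=1..n. G (size_vec n c r)) / real n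
      - (1 - p) * (\<integral>y. G (path_vec y) \<partial>Q)))"
      by (intro always_eventually allI avg_nonneg p_le) simp
  qed
qed

text \<open>Sizes at earlier times are at most the final size, so the bound of
  \<open>avg_tree_moment_bound\<close> carries over with the factor \<open>m powr b\<close>.\<close>

lemma avg_total_moment_bound:
  assumes b: "0 \<le> b" "p * b < 1"
  shows "\<exists>K\<ge>0. \<forall>n. avg p n (\<lambda>c. (\<Sum>r=1..n. total (size_vec n c r) powr b) / real n) \<le> K"
proof -
  obtain K where K: "\<And>n. avg p n (\<lambda>c. \<Sum>r=1..n. real (tree_size c n r) powr b) \<le> K * real n"
    using avg_tree_moment_bound[OF p_le b] by blast
  have "0 \<le> K"
    using K[of 1] avg_nonneg[OF p_le, of "\<lambda>c. \<Sum>r=1..1. real (tree_size c 1 r) powr b" 1]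
    by (smt (verit) mult_cancel_left1 of_nat_1 powr_ge_zero sum_nonneg)
  moreover have "avg p n (\<lambda>c. (\<Sum>r=1..n. total (size_vec n c r) powr b) / real n) \<le> real m powr b * K" for n
  proof (cases "n = 0")
    case True
    then show ?thesis
      using \<open>0 \<le> K\<close> by (simp add: avg_const)
  next
    case False
    have "avg p n (\<lambda>c. (\<Sum>r=1..n. total (size_vec n c r) powr b) / real n)
        \<le> avg p n (\<lambda>c. (real m powr b / real n) * (\<Sum>r=1..n. real (tree_size c n r) powr b))"
    proof (intro avg_mono p_le)
      fix c
      have "total (size_vec n c r) powr b \<le> real m powr b * real (tree_size c n r) powr b" for r
        using powr_mono2[OF b(1) total_nonneg total_size_vec, of n c r] by (simp add: powr_mult)
      then show "(\<Sum>r=1..n. total (size_vec n c r) powr b) / real n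
          \<le> (real m powr b / real n) * (\<Sum>r=1..n. real (tree_size c n r) powr b)"
        unfolding times_divide_eq_left sum_distrib_left sum_divide_distrib
        by (intro sum_mono divide_right_mono) auto
    qed
    also have "\<dots> \<le> (real m powr b / real n) * (K * real n)"
      unfolding avg_mult by (intro mult_left_mono K) simp
    finally show ?thesis
      using False by simp
  qed
  ultimately show ?thesis
    by (intro exI[of _ "real m powr b * K"]) simp
qed

text \<open>The moment is inherited from the trees: through \<open>lln_box\<close> every truncated
  mean is bounded by the uniform bound \<open>K\<close> of the discrete means, up to the factor
  \<open>1 - p\<close>, and monotone convergence removes the truncation.\<close>

lemma total_moment_Q:
  assumes b: "0 < b" "p * b < 1"
  shows "integrable Q (\<lambda>y. total (path_vec y) powr b)"
proof -
  obtain K where K: "0 \<le> K" "\<And>n. avg p n (\<lambda>c. (\<Sum>r=1..n. total (size_vec n c r) powr b) / real n) \<le> K"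
    using avg_total_moment_bound[of b] b by auto
  define G where "G L v = total v powr b * of_bool (v \<in> box L)" for L v
  have G_nonneg: "0 \<le> G L v" for L v
    by (simp add: G_def)
  have int: "integrable Q (\<lambda>y. G L (path_vec y))" for L
  proof (rule Q.integrable_const_bound[where B="(real m * real L) powr b"])
    show "AE y in Q. norm (G L (path_vec y)) \<le> (real m * real L) powr b"
    proof (intro AE_I2)
      fix y
      show "norm (G L (path_vec y)) \<le> (real m * real L) powr b"
      proof (cases "path_vec y \<in> box L")
        case True
        then have "total (path_vec y) \<le> (\<Sum>j=1..m. real L)"
          unfolding total_def by (intro sum_mono) (auto simp: box_def)
        then show ?thesis
          using True b by (simp add: G_def powr_mono2 total_nonneg)
      qed (simp add: G_def)
    qed
  qed measurable
  have bound: "(1 - p) * (\<integral>y. G L (path_vec y) \<partial>Q) \<le> K" for L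
  proof -
    define F where "F v = complex_of_real (total v powr b)" for v
    have G: "F v * of_bool (v \<in> box L) = complex_of_real (G L v)" for v
      by (simp add: F_def G_def)
    have "F (\<lambda>_. 0) = 0"
      using b by (simp add: F_def)
    from lln_box[of F, OF this, of L] have lim: "(\<lambda>n. avg p n (\<lambda>c. norm ((\<Sum>r=1..n. complex_of_real (G L (size_vec n c r))) / real n
        - (1 - p) * (\<integral>y. complex_of_real (G L (path_vec y)) \<partial>Q)))) \<longlonglongrightarrow> 0"
      unfolding G .
    have eq: "norm ((\<Sum>r=1..n. complex_of_real (G L (size_vec n c r))) / real n
        - (1 - p) * (\<integral>y. complex_of_real (G L (path_vec y)) \<partial>Q))
        = \<bar>(\<Sum>r=1..n. G L (size_vec n c r)) / real n - (1 - p) * (\<integral>y. G L (path_vec y) \<partial>Q)\<bar>" for n c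
      unfolding integral_complex_of_real
      by (simp only: of_real_sum[symmetric] of_real_divide[symmetric] of_real_mult[symmetric]
          of_real_diff[symmetric] norm_of_real)
    have "(1 - p) * (\<integral>y. G L (path_vec y) \<partial>Q) \<le> K + avg p n (\<lambda>c. \<bar>(\<Sum>r=1..n. G L (size_vec n c r)) / real n
        - (1 - p) * (\<integral>y. G L (path_vec y) \<partial>Q)\<bar>)" for n
    proof -
      have "(1 - p) * (\<integral>y. G L (path_vec y) \<partial>Q) = avg p n (\<lambda>c. (1 - p) * (\<integral>y. G L (path_vec y) \<partial>Q))"
        by (simp add: avg_const)
      also have "\<dots> \<le> avg p n (\<lambda>c. (\<Sum>r=1..n. total (size_vec n c r) powr b) / real n
          + \<bar>(\<Sum>r=1..n. G L (size_vec n c r)) / real n - (1 - p) * (\<integral>y. G L (path_vec y) \<partial>Q)\<bar>)"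
      proof (intro avg_mono p_le)
        fix c
        have "(\<Sum>r=1..n. G L (size_vec n c r)) / real n \<le> (\<Sum>r=1..n. total (size_vec n c r) powr b) / real n"
          by (intro divide_right_mono sum_mono) (auto simp: G_def)
        then show "(1 - p) * (\<integral>y. G L (path_vec y) \<partial>Q) \<le> (\<Sum>r=1..n. total (size_vec n c r) powr b) / real n
          + \<bar>(\<Sum>r=1..n. G L (size_vec n c r)) / real n - (1 - p) * (\<integral>y. G L (path_vec y) \<partial>Q)\<bar>"
          by linarith
      qed
      also have "\<dots> \<le> K + avg p n (\<lambda>c. \<bar>(\<Sum>r=1..n. G L (size_vec n c r)) / real n
        - (1 - p) * (\<integral>y. G L (path_vec y) \<partial>Q)\<bar>)"
        unfolding avg_add using K by simp
      finally show ?thesis .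
    qed
    moreover have "(\<lambda>n. K + avg p n (\<lambda>c. \<bar>(\<Sum>r=1..n. G L (size_vec n c r)) / real n
        - (1 - p) * (\<integral>y. G L (path_vec y) \<partial>Q)\<bar>)) \<longlonglongrightarrow> K"
      using tendsto_add[OF tendsto_const lim[unfolded eq]] by simp
    ultimately show ?thesis
      by (intro LIMSEQ_le_const) auto
  qed
  have mono: "G L v \<le> G (Suc L) v" for L v
    by (auto simp: G_def box_def)
  have inc: "incseq (\<lambda>L. \<integral>y. G L (path_vec y) \<partial>Q)"
    by (intro incseq_SucI integral_mono int mono)
  have bdd: "(\<integral>y. G L (path_vec y) \<partial>Q) \<le> K / (1 - p)" for L
    using bound[of L] p by (simp add: field_simps)
  obtain l where l: "(\<lambda>L. \<integral>y. G L (path_vec y) \<partial>Q) \<longlonglongrightarrow> l"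
    using incseq_convergent[OF inc] bdd by metis
  have "has_bochner_integral Q (\<lambda>y. total (path_vec y) powr b) l"
  proof (rule has_bochner_integral_monotone_convergence[OF int _ _ l])
    show "AE y in Q. mono (\<lambda>L. G L (path_vec y))"
      by (intro AE_I2 incseq_SucI mono)
    show "AE y in Q. (\<lambda>L. G L (path_vec y)) \<longlonglongrightarrow> total (path_vec y) powr b"
    proof (intro AE_I2)
      fix y
      have "path_vec y \<in> box L" if "nat \<lceil>total (path_vec y)\<rceil> \<le> L" for L
        using notin_box[OF path_vec_in, of y L] that by linarith
      then show "(\<lambda>L. G L (path_vec y)) \<longlonglongrightarrow> total (path_vec y) powr b"
        by (intro tendsto_eventually eventually_sequentiallyI[of "nat \<lceil>total (path_vec y)\<rceil>"])
          (simp add: G_def)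
    qed
  qed measurable
  then show ?thesis
    by (auto simp: integrable.simps)
qed

text \<open>Truncation to a box. The tails are small both in the mean over genealogies and under
  \<open>Q\<close>, because moments of a slightly higher order are bounded: this is uniform
  integrability.\<close>

theorem lln:
  fixes F :: "(nat \<Rightarrow> nat) \<Rightarrow> complex"
  assumes b: "0 < b" "p * b < 1"
    and F: "\<And>v. v \<in> vecs \<Longrightarrow> norm (F v) \<le> C * total v powr b"
  shows "(\<lambda>n. avg p n (\<lambda>c. norm ((\<Sum>r=1..n. F (size_vec n c r)) / real n
      - (1 - p) * (\<integral>y. F (path_vec y) \<partial>Q)))) \<longlonglongrightarrow> 0"
    and "integrable Q (\<lambda>y. F (path_vec y))"
proof -
  \<comment> \<open>The midpoint between \<open>b\<close> and \<open>1 / p\<close>: moments of this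
    order are still bounded, and off the box
    \<open>total v powr b \<le> L powr (b - b') * total v powr b'\<close> with a factor that tends
    to 0.\<close>
  define b' where "b' = (b + 1 / p) / 2"
  have b': "b < b'" "0 < b'" "p * b' < 1"
    using b p add_pos_pos[of 1 "b * p"] by (auto simp: b'_def field_simps)
  obtain K where K: "0 \<le> K" "\<And>n. avg p n (\<lambda>c. (\<Sum>r=1..n. total (size_vec n c r) powr b') / real n) \<le> K"
    using avg_total_moment_bound[of b'] b' by auto
  define K' where "K' = (\<integral>y. total (path_vec y) powr b' \<partial>Q)"
  define C' where "C' = max C 0"
  have C': "0 \<le> C'" "\<And>v. v \<in> vecs \<Longrightarrow> norm (F v) \<le> C' * total v powr b"
    using order_trans[OF F mult_right_mono[of C C']] by (auto simp: C'_def)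
  have F0: "F (\<lambda>_. 0) = 0"
    using F[of "\<lambda>_. 0"] b by (simp add: vecs_def)
  show int_F: "integrable Q (\<lambda>y. F (path_vec y))"
    by (rule Bochner_Integration.integrable_bound[OF integrable_mult_right[OF total_moment_Q[OF b], of C']])
      (use C' path_vec_in in \<open>auto simp: abs_mult\<close>)
  define G where "G L v = F v * of_bool (v \<in> box L)" for L v
  have tail: "norm (F v - G L v) \<le> C' * real L powr (b - b') * total v powr b'" if v: "v \<in> vecs" and L: "1 \<le> L" for v L
  proof (cases "v \<in> box L")
    case False
    then have lt: "real L < total v"
      using notin_box v by simp
    have "total v powr b = total v powr (b - b') * total v powr b'"
      by (simp add: powr_add[symmetric])
    also have "\<dots> \<le> real L powr (b - b') * total v powr b'"
      using lt L b' by (intro mult_right_mono powr_mono2') auto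
    finally have "C' * total v powr b \<le> C' * (real L powr (b - b') * total v powr b')"
      using C' by (intro mult_left_mono)
    then show ?thesis
      using C'(2)[OF v] False by (simp add: G_def mult.assoc)
  qed (use C' in \<open>simp add: G_def\<close>)
  define \<delta> where "\<delta> L = C' * real L powr (b - b') * (K + K')" for L
  have upper: "avg p n (\<lambda>c. norm ((\<Sum>r=1..n. F (size_vec n c r)) / real n - (1 - p) * (\<integral>y. F (path_vec y) \<partial>Q)))
      \<le> \<delta> L + avg p n (\<lambda>c. norm ((\<Sum>r=1..n. G L (size_vec n c r)) / real n - (1 - p) * (\<integral>y. G L (path_vec y) \<partial>Q)))"
    if L: "1 \<le> L" for L n
  proof -
    define D where "D = C' * real L powr (b - b')"
    have D: "0 \<le> D"
      using C' by (simp add: D_def)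
    have int_G: "integrable Q (\<lambda>y. G L (path_vec y))"
      by (rule Bochner_Integration.integrable_bound[OF int_F]) (auto simp: G_def)
    have "norm ((\<integral>y. F (path_vec y) \<partial>Q) - (\<integral>y. G L (path_vec y) \<partial>Q)) \<le> D * K'"
    proof -
      have "norm ((\<integral>y. F (path_vec y) \<partial>Q) - (\<integral>y. G L (path_vec y) \<partial>Q))
          = norm (\<integral>y. F (path_vec y) - G L (path_vec y) \<partial>Q)"
        using int_F int_G by simp
      also have "\<dots> \<le> (\<integral>y. D * total (path_vec y) powr b' \<partial>Q)"
        by (rule order_trans[OF integral_norm_bound integral_mono])
          (use int_F int_G total_moment_Q[OF b'(2,3)] tail[OF path_vec_in L] in \<open>auto simp: D_def\<close>)
      finally show ?thesis
        by (simp add: K'_def)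
    qed
    then have Qb: "norm ((1 - p) * ((\<integral>y. F (path_vec y) \<partial>Q) - (\<integral>y. G L (path_vec y) \<partial>Q))) \<le> D * K'"
      using p mult_left_le_one_le[of "norm ((\<integral>y. F (path_vec y) \<partial>Q) - (\<integral>y. G L (path_vec y) \<partial>Q))" "1 - p"]
      by (simp only: norm_mult norm_of_real) simp
    have "norm ((\<Sum>r=1..n. F (size_vec n c r)) / real n - (1 - p) * (\<integral>y. F (path_vec y) \<partial>Q))
        \<le> D * ((\<Sum>r=1..n. total (size_vec n c r) powr b') / real n) + (D * K'
          + norm ((\<Sum>r=1..n. G L (size_vec n c r)) / real n - (1 - p) * (\<integral>y. G L (path_vec y) \<partial>Q)))" for c
    proof -
      define a1 where "a1 = (\<Sum>r=1..n. F (size_vec n c r)) / real n"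
      define a2 where "a2 = (\<Sum>r=1..n. G L (size_vec n c r)) / real n"
      have "a1 - a2 = (\<Sum>r=1..n. F (size_vec n c r) - G L (size_vec n c r)) / real n"
        by (simp add: a1_def a2_def sum_subtractf diff_divide_distrib)
      then have "norm (a1 - a2) = norm (\<Sum>r=1..n. F (size_vec n c r) - G L (size_vec n c r)) / real n"
        by (simp add: norm_divide)
      also have "\<dots> \<le> (\<Sum>r=1..n. D * total (size_vec n c r) powr b') / real n"
        by (intro divide_right_mono order_trans[OF norm_sum] sum_mono)
          (use tail[OF size_vec_in L] in \<open>auto simp: D_def\<close>)
      finally have "norm (a1 - a2) \<le> D * ((\<Sum>r=1..n. total (size_vec n c r) powr b') / real n)"
        by (simp add: sum_distrib_left)
      moreover have "norm (a1 - (1 - p) * (\<integral>y. F (path_vec y) \<partial>Q)) \<le> norm (a1 - a2)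
          + norm ((1 - p) * ((\<integral>y. F (path_vec y) \<partial>Q) - (\<integral>y. G L (path_vec y) \<partial>Q)))
          + norm (a2 - (1 - p) * (\<integral>y. G L (path_vec y) \<partial>Q))"
        by (simp add: right_diff_distrib) norm
      ultimately show ?thesis
        using Qb by (simp add: a1_def a2_def)
    qed
    from avg_mono[OF p_le this, where n=n] have "avg p n (\<lambda>c. norm ((\<Sum>r=1..n. F (size_vec n c r)) / real n - (1 - p) * (\<integral>y. F (path_vec y) \<partial>Q)))
        \<le> D * avg p n (\<lambda>c. (\<Sum>r=1..n. total (size_vec n c r) powr b') / real n) + (D * K'
          + avg p n (\<lambda>c. norm ((\<Sum>r=1..n. G L (size_vec n c r)) / real n - (1 - p) * (\<integral>y. G L (path_vec y) \<partial>Q))))"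
      unfolding avg_add avg_mult avg_const .
    also have "D * avg p n (\<lambda>c. (\<Sum>r=1..n. total (size_vec n c r) powr b') / real n) \<le> D * K"
      using D K by (intro mult_left_mono)
    finally show ?thesis
      by (simp add: \<delta>_def D_def algebra_simps)
  qed
  have \<delta>_lim: "\<delta> \<longlonglongrightarrow> 0"
  proof -
    have "(\<lambda>L. real L powr (b - b')) \<longlonglongrightarrow> 0"
      using b' by (intro tendsto_neg_powr filterlim_real_sequentially) auto
    then show ?thesis
      unfolding \<delta>_def by (intro tendsto_mult_left_zero tendsto_mult_right_zero)
  qed
  show "(\<lambda>n. avg p n (\<lambda>c. norm ((\<Sum>r=1..n. F (size_vec n c r)) / real n
      - (1 - p) * (\<integral>y. F (path_vec y) \<partial>Q)))) \<longlonglongrightarrow> 0"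
  proof (rule LIMSEQ_I)
    fix e :: real assume e: "0 < e"
    have "\<forall>\<^sub>F L in sequentially. \<delta> L < e / 2 \<and> 1 \<le> L"
      using order_tendstoD(2)[OF \<delta>_lim, of "e / 2"] e eventually_ge_at_top[of 1] by (auto intro: eventually_conj)
    then obtain L where L: "\<delta> L < e / 2" "1 \<le> L"
      by (auto dest: eventually_happens)
    have "\<forall>\<^sub>F n in sequentially. avg p n (\<lambda>c. norm ((\<Sum>r=1..n. G L (size_vec n c r)) / real n
        - (1 - p) * (\<integral>y. G L (path_vec y) \<partial>Q))) < e / 2"
      using order_tendstoD(2)[OF lln_box[of F, OF F0, of L], of "e / 2"] e unfolding G_def by simp
    then obtain n0 where n0: "\<And>n. n \<ge> n0 \<Longrightarrow> avg p n (\<lambda>c. norm ((\<Sum>r=1..n. G L (size_vec n c r)) / real n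
        - (1 - p) * (\<integral>y. G L (path_vec y) \<partial>Q))) < e / 2"
      by (auto simp: eventually_sequentially)
    have "norm (avg p n (\<lambda>c. norm ((\<Sum>r=1..n. F (size_vec n c r)) / real n
        - (1 - p) * (\<integral>y. F (path_vec y) \<partial>Q))) - 0) < e" if "n \<ge> n0" for n
      using upper[OF L(2), of n] n0[OF that] L(1)
        avg_nonneg[OF p_le, of "\<lambda>c. norm ((\<Sum>r=1..n. F (size_vec n c r)) / real n - (1 - p) * (\<integral>y. F (path_vec y) \<partial>Q))" n]
      by simp
    then show "\<exists>n0. \<forall>n\<ge>n0. norm (avg p n (\<lambda>c. norm ((\<Sum>r=1..n. F (size_vec n c r)) / real n
        - (1 - p) * (\<integral>y. F (path_vec y) \<partial>Q))) - 0) < e"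
      by blast
  qed
qed

lemma avg_norm_tendsto:
  fixes X :: "nat \<Rightarrow> (nat \<Rightarrow> nat) \<Rightarrow> complex"
  assumes "(\<lambda>n. avg p n (\<lambda>c. norm (X n c - L))) \<longlonglongrightarrow> 0"
  shows "(\<lambda>n. avg p n (X n)) \<longlonglongrightarrow> L"
proof (rule LIM_zero_cancel, rule Lim_null_comparison[OF _ assms], intro always_eventually allI)
  fix n
  show "norm (avg p n (X n) - L) \<le> avg p n (\<lambda>c. norm (X n c - L))"
    using avg_norm[OF p_le, of n "\<lambda>c. X n c - L"] by (simp only: avg_diff avg_const)
qed

lemma lln_mean_real:
  fixes F :: "(nat \<Rightarrow> nat) \<Rightarrow> real"
  assumes b: "0 < b" "p * b < 1"
    and F: "\<And>v. v \<in> vecs \<Longrightarrow> \<bar>F v\<bar> \<le> C * total v powr b"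
  shows "(\<lambda>n. avg p n (\<lambda>c. (\<Sum>r=1..n. F (size_vec n c r))) / real n) \<longlonglongrightarrow> (1 - p) * (\<integral>y. F (path_vec y) \<partial>Q)"
    and "integrable Q (\<lambda>y. F (path_vec y))"
proof -
  have F': "norm (complex_of_real (F v)) \<le> C * total v powr b" if "v \<in> vecs" for v
    using F[OF that] by simp
  note * = lln[OF b F']
  show "integrable Q (\<lambda>y. F (path_vec y))"
    using integrable_Re[OF *(2)] by simp
  have "(\<lambda>n. avg p n (\<lambda>c. norm ((\<Sum>r=1..n. complex_of_real (F (size_vec n c r))) / real n
      - (1 - p) * (\<integral>y. complex_of_real (F (path_vec y)) \<partial>Q)))) \<longlonglongrightarrow> 0"
    by (rule *(1))
  moreover have "norm ((\<Sum>r=1..n. complex_of_real (F (size_vec n c r))) / real n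
      - (1 - p) * (\<integral>y. complex_of_real (F (path_vec y)) \<partial>Q))
      = \<bar>(\<Sum>r=1..n. F (size_vec n c r)) / real n - (1 - p) * (\<integral>y. F (path_vec y) \<partial>Q)\<bar>" for n c
    unfolding integral_complex_of_real
    by (simp only: of_real_sum[symmetric] of_real_divide[symmetric] of_real_mult[symmetric]
        of_real_diff[symmetric] norm_of_real)
  ultimately have lim: "(\<lambda>n. avg p n (\<lambda>c. \<bar>(\<Sum>r=1..n. F (size_vec n c r)) / real n - (1 - p) * (\<integral>y. F (path_vec y) \<partial>Q)\<bar>)) \<longlonglongrightarrow> 0"
    by simp
  show "(\<lambda>n. avg p n (\<lambda>c. (\<Sum>r=1..n. F (size_vec n c r))) / real n) \<longlonglongrightarrow> (1 - p) * (\<integral>y. F (path_vec y) \<partial>Q)"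
  proof (rule LIM_zero_cancel, rule Lim_null_comparison[OF _ lim], intro always_eventually allI)
    fix n
    have *: "avg p n (\<lambda>c. (1 / real n) * (\<Sum>r=1..n. F (size_vec n c r)) - (1 - p) * (\<integral>y. F (path_vec y) \<partial>Q))
        = avg p n (\<lambda>c. (\<Sum>r=1..n. F (size_vec n c r))) / real n - (1 - p) * (\<integral>y. F (path_vec y) \<partial>Q)"
      unfolding avg_diff avg_const avg_mult by simp
    show "norm (avg p n (\<lambda>c. (\<Sum>r=1..n. F (size_vec n c r))) / real n - (1 - p) * (\<integral>y. F (path_vec y) \<partial>Q))
        \<le> avg p n (\<lambda>c. \<bar>(\<Sum>r=1..n. F (size_vec n c r)) / real n - (1 - p) * (\<integral>y. F (path_vec y) \<partial>Q)\<bar>)"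
      using avg_norm[OF p_le, of n "\<lambda>c. (1 / real n) * (\<Sum>r=1..n. F (size_vec n c r)) - (1 - p) * (\<integral>y. F (path_vec y) \<partial>Q)"]
      unfolding * by (simp only: real_norm_def times_divide_eq_left mult_1_left)
  qed
qed

section \<open>First and second moments of the Yule-Simon process\<close>

lemma mean_Q:
  assumes j: "j \<in> {1..m}"
  shows "(1 - p) * (\<integral>y. real (path_vec y j) \<partial>Q) = \<tau> j"
    and "integrable Q (\<lambda>y. real (path_vec y j))"
proof -
  have F: "\<bar>real (v j)\<bar> \<le> 1 * total v powr 1" for v
    using le_total[OF j, of v] total_nonneg[of v] by simp
  have p1: "(0::real) < 1" "p * 1 < 1"
    using p by auto
  show "integrable Q (\<lambda>y. real (path_vec y j))"
    by (rule lln_mean_real(2)[OF p1 F])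
  have "(\<lambda>n. avg p n (\<lambda>c. (\<Sum>r=1..n. real (size_vec n c r j))) / real n) \<longlonglongrightarrow> (1 - p) * (\<integral>y. real (path_vec y j) \<partial>Q)"
    by (rule lln_mean_real(1)[OF p1 F])
  \<comment> \<open>Tree sizes after \<open>k\<close> steps add up to \<open>k\<close> whatever the
    genealogy, so the law of large numbers becomes an identity for the mean.\<close>
  moreover have "(\<Sum>r=1..n. real (size_vec n c r j)) = real (idx n j)" for n c
    using j idx_le[of j n] by (simp add: size_vec_def sum_tree_size[simplified])
  moreover have "(\<lambda>n. real (idx n j) / real n) \<longlonglongrightarrow> \<tau> j"
    using j by (intro idx_tendsto) auto
  ultimately show "(1 - p) * (\<integral>y. real (path_vec y j) \<partial>Q) = \<tau> j"
    by (simp add: avg_const LIMSEQ_unique)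
qed

text \<open>The identity function has eigenvalue 1, and the sizes at time \<open>a\<close> act as
  frozen weights. Trees founded after \<open>a\<close> have weight 0, so no source term
  arises.\<close>

lemma avg_product_rec:
  assumes "1 \<le> a" "a \<le> b"
  shows "avg p b (\<lambda>c. \<Sum>r=1..b. real (tree_size c a r) * real (tree_size c b r))
    = (\<Prod>i=a..<b. 1 + p / real i) * avg p a (\<lambda>c. \<Sum>r=1..a. (real (tree_size c a r))\<^sup>2)"
  using assms(2)
proof (induction b rule: dec_induct)
  case (step b)
  have b: "1 \<le> b"
    using step assms by simp
  have "avg_step p b (\<lambda>c. \<Sum>r=1..Suc b. real (tree_size c a r) * real (tree_size c (Suc b) r)) c
      = (1 + p * 1 / real b) * (\<Sum>r=1..b. real (tree_size c a r) * real (tree_size c b r))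
        + (1 - p) * real (tree_size c a (Suc b)) * real 1" for c
    by (rule avg_step_tree_sum[OF b, where \<phi>=real])
      (use step in \<open>auto simp: tree_size_fun_upd algebra_simps\<close>)
  moreover have "tree_size c a (Suc b) = 0" for c
    using step by (simp add: tree_size_eq_0)
  ultimately have "avg_step p b (\<lambda>c. \<Sum>r=1..Suc b. real (tree_size c a r) * real (tree_size c (Suc b) r))
      = (\<lambda>c. (1 + p / real b) * (\<Sum>r=1..b. real (tree_size c a r) * real (tree_size c b r)))"
    by (simp add: fun_eq_iff del: sum.cl_ivl_Suc)
  then show ?case
    unfolding avg.simps using step by (simp add: avg_mult)
qed (simp add: power2_eq_square)

text \<open>The function \<open>k * (k + 1)\<close> has eigenvalue 2, and its linear part is removed
  by the exact identity \<open>sum_tree_size\<close>. The bound on \<open>p\<close> makes the rate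
  \<open>2 * p\<close> less than 1.\<close>

lemma avg_square_limit:
  assumes "p < 1 / 2"
  shows "(\<lambda>n. avg p n (\<lambda>c. \<Sum>r=1..n. (real (tree_size c n r))\<^sup>2) / real n) \<longlonglongrightarrow> 1 / (1 - 2 * p)"
proof -
  have "(\<lambda>n. avg p n (\<lambda>c. \<Sum>r=1..n. real (tree_size c n r) * (real (tree_size c n r) + 1)) / real n)
      \<longlonglongrightarrow> (1 - p) * (real 1 * (real 1 + 1)) / (1 - p * 2)"
    by (rule avg_tree_sum_limit[where \<phi>="\<lambda>k. real k * (real k + 1)"])
      (use assms in \<open>auto simp: algebra_simps\<close>)
  then have "(\<lambda>n. avg p n (\<lambda>c. \<Sum>r=1..n. real (tree_size c n r) * (real (tree_size c n r) + 1)) / real n - 1)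
      \<longlonglongrightarrow> (1 - p) * (real 1 * (real 1 + 1)) / (1 - p * 2) - 1"
    by (intro tendsto_diff tendsto_const)
  moreover have "(1 - p) * (real 1 * (real 1 + 1)) / (1 - p * 2) - 1 = 1 / (1 - 2 * p)"
    using assms by (simp add: field_simps)
  moreover have "avg p n (\<lambda>c. \<Sum>r=1..n. real (tree_size c n r) * (real (tree_size c n r) + 1))
      = avg p n (\<lambda>c. \<Sum>r=1..n. (real (tree_size c n r))\<^sup>2) + real n" for n
    using sum_tree_size[of n n] by (simp add: distrib_left sum.distrib avg_add avg_const power2_eq_square)
  ultimately have "(\<lambda>n. (avg p n (\<lambda>c. \<Sum>r=1..n. (real (tree_size c n r))\<^sup>2) + real n) / real n - 1) \<longlonglongrightarrow> 1 / (1 - 2 * p)"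
    by simp
  then show ?thesis
    by (rule Lim_transform_eventually)
      (use eventually_gt_at_top[of 0] in \<open>eventually_elim, simp add: add_divide_distrib\<close>)
qed

text \<open>The mean squares at \<open>\<tau> i\<close> converge to
  \<open>\<tau> i / (1 - 2 * p)\<close>, and the recursion up to \<open>\<tau> j\<close> multiplies
  them by \<open>(\<tau> j / \<tau> i) powr p\<close>. The product is the covariance of the noise
  reinforced Brownian motion, which is why this process appears in the limit.\<close>

lemma product_moment_Q:
  assumes p2: "p < 1 / 2" and ij: "i \<in> {1..m}" "j \<in> {1..m}"
  shows "(1 - p) * (\<integral>y. real (path_vec y i) * real (path_vec y j) \<partial>Q) = nrbm_cov p (\<tau> i) (\<tau> j)"
    and "integrable Q (\<lambda>y. real (path_vec y i) * real (path_vec y j))"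
proof -
  have F: "\<bar>real (v i) * real (v j)\<bar> \<le> 1 * total v powr 2" if "i \<in> {1..m}" "j \<in> {1..m}" for v i j
  proof -
    have "real (v i) * real (v j) \<le> total v * total v"
      using le_total[OF that(1)] le_total[OF that(2)] total_nonneg by (intro mult_mono) auto
    then show ?thesis
      using total_nonneg[of v] by (cases "total v = 0") (auto simp: power2_eq_square powr_numeral)
  qed
  have b: "(0::real) < 2" "p * 2 < 1"
    using p2 by auto
  show "integrable Q (\<lambda>y. real (path_vec y i) * real (path_vec y j))"
    by (rule lln_mean_real(2)[OF b F[OF ij]])
  have main: "(1 - p) * (\<integral>y. real (path_vec y i) * real (path_vec y j) \<partial>Q) = nrbm_cov p (\<tau> i) (\<tau> j)"
    if ij: "i \<in> {1..m}" "j \<in> {1..m}" "i \<le> j" for i j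
  proof -
    have \<tau>: "0 < \<tau> i" "\<tau> i \<le> \<tau> j"
      using \<tau>_pos[of i] \<tau>_mono[of i j] ij by auto
    define B where "B n = avg p n (\<lambda>c. \<Sum>r=1..n. (real (tree_size c n r))\<^sup>2)" for n
    have lim1: "(\<lambda>n. avg p n (\<lambda>c. (\<Sum>r=1..n. real (size_vec n c r i) * real (size_vec n c r j))) / real n)
        \<longlonglongrightarrow> (1 - p) * (\<integral>y. real (path_vec y i) * real (path_vec y j) \<partial>Q)"
      by (rule lln_mean_real(1)[OF b F[OF ij(1,2)]])
    have at_top: "filterlim (\<lambda>n. idx n i) at_top sequentially"
      unfolding filterlim_at_top using idx_at_top[of i] ij by auto
    have "(\<lambda>n. (\<Prod>k=idx n i..<idx n j. 1 + p / real k) * ((B (idx n i) / real (idx n i)) * (real (idx n i) / real n)))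
        \<longlonglongrightarrow> (\<tau> j / \<tau> i) powr p * (1 / (1 - 2 * p) * \<tau> i)"
      using ij \<tau> unfolding B_def
      by (intro tendsto_mult prod_one_plus_ratio idx_mono idx_tendsto filterlim_compose[OF avg_square_limit[OF p2] at_top]) auto
    moreover have "(\<tau> j / \<tau> i) powr p * (1 / (1 - 2 * p) * \<tau> i) = nrbm_cov p (\<tau> i) (\<tau> j)"
      using \<tau> by (simp add: nrbm_cov_def powr_divide powr_diff max_def min_def)
    moreover have "\<forall>\<^sub>F n in sequentially. (\<Prod>k=idx n i..<idx n j. 1 + p / real k) * ((B (idx n i) / real (idx n i)) * (real (idx n i) / real n))
        = avg p n (\<lambda>c. (\<Sum>r=1..n. real (size_vec n c r i) * real (size_vec n c r j))) / real n"
    proof -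
      have "\<forall>\<^sub>F n in sequentially. 1 \<le> idx n i"
        using idx_at_top[of i 1] ij by auto
      then show ?thesis
      proof eventually_elim
        case (elim n)
        define a b where "a = idx n i" and "b = idx n j"
        have ab: "1 \<le> a" "a \<le> b" "b \<le> n"
          using elim ij idx_mono[of i j n] idx_le[of j n] by (auto simp: a_def b_def)
        have "(\<Sum>r=1..n. real (size_vec n c r i) * real (size_vec n c r j))
            = (\<Sum>r=1..b. real (tree_size c a r) * real (tree_size c b r))" for c
        proof -
          have "(\<Sum>r=1..b. real (tree_size c a r) * real (tree_size c b r))
              = (\<Sum>r=1..n. real (tree_size c a r) * real (tree_size c b r))"
            by (rule sum.mono_neutral_left) (use ab in \<open>auto simp: tree_size_eq_0\<close>)
          then show ?thesis
            using ij by (simp add: size_vec_def a_def b_def)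
        qed
        moreover have "avg p n (\<lambda>c. \<Sum>r=1..b. real (tree_size c a r) * real (tree_size c b r))
            = avg p b (\<lambda>c. \<Sum>r=1..b. real (tree_size c a r) * real (tree_size c b r))"
          by (rule avg_extend) (use ab in \<open>auto simp: tree_size_fun_upd\<close>)
        ultimately show ?case
          using avg_product_rec[OF ab(1,2)] ab
          by (simp add: a_def[symmetric] b_def[symmetric] B_def)
      qed
    qed
    ultimately have "(\<lambda>n. avg p n (\<lambda>c. (\<Sum>r=1..n. real (size_vec n c r i) * real (size_vec n c r j))) / real n)
        \<longlonglongrightarrow> nrbm_cov p (\<tau> i) (\<tau> j)"
      using Lim_transform_eventually by fastforce
    with lim1 show ?thesis
      by (rule LIMSEQ_unique)
  qed
  show "(1 - p) * (\<integral>y. real (path_vec y i) * real (path_vec y j) \<partial>Q) = nrbm_cov p (\<tau> i) (\<tau> j)"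
  proof (cases "i \<le> j")
    case False
    then show ?thesis
      using main[of j i] ij by (simp add: mult.commute nrbm_cov_def max.commute min.commute)
  qed (use main ij in auto)
qed

end

section \<open>Characteristic function of the reinforced walk\<close>

lemma Int_stable_vimage: "Int_stable {Z -` A \<inter> S |A. A \<in> sets N}"
proof (rule Int_stableI)
  fix a b assume "a \<in> {Z -` A \<inter> S |A. A \<in> sets N}" "b \<in> {Z -` A \<inter> S |A. A \<in> sets N}"
  then obtain A B where "a = Z -` A \<inter> S" "b = Z -` B \<inter> S" "A \<in> sets N" "B \<in> sets N"
    by auto
  then show "a \<inter> b \<in> {Z -` A \<inter> S |A. A \<in> sets N}"
    by (intro CollectI exI[of _ "A \<inter> B"]) auto
qed

text \<open>Factorisation is assumed on preimages only; these are closed under intersection, which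
  extends it to the generated sigma algebras.\<close>

lemma (in prob_space) indep_rv_imp_indep_var:
  assumes "indep_rv M Ma X Mb Y"
  shows "indep_var Ma X Mb Y"
proof -
  have X [measurable]: "X \<in> M \<rightarrow>\<^sub>M Ma" and Y [measurable]: "Y \<in> M \<rightarrow>\<^sub>M Mb"
    using assms by (auto simp: indep_rv_def)
  have "indep_set (sigma_sets (space M) {X -` A \<inter> space M |A. A \<in> sets Ma})
      (sigma_sets (space M) {Y -` A \<inter> space M |A. A \<in> sets Mb})"
  proof (rule indep_set_sigma_sets[OF indep_setI Int_stable_vimage Int_stable_vimage])
    fix a b assume "a \<in> {X -` A \<inter> space M |A. A \<in> sets Ma}" "b \<in> {Y -` A \<inter> space M |A. A \<in> sets Mb}"
    then obtain A B where AB: "a = X -` A \<inter> space M" "b = Y -` B \<inter> space M" "A \<in> sets Ma" "B \<in> sets Mb"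
      by auto
    then have "a \<inter> b = X -` A \<inter> Y -` B \<inter> space M"
      by auto
    then show "prob (a \<inter> b) = prob a * prob b"
      using assms AB by (auto simp: indep_rv_def)
  qed (auto intro: measurable_sets)
  then show ?thesis
    by (simp add: indep_var_eq)
qed

lemma (in prob_space) indep_rv_integral_mult:
  fixes f :: "'b \<Rightarrow> complex" and g :: "'c \<Rightarrow> complex"
  assumes ind: "indep_rv M Ma X Mb Y" and f: "f \<in> borel_measurable Ma" and g: "g \<in> borel_measurable Mb"
    and bf: "\<And>x. norm (f x) \<le> 1" and bg: "\<And>x. norm (g x) \<le> 1"
  shows "(\<integral>\<omega>. f (X \<omega>) * g (Y \<omega>) \<partial>M) = (\<integral>\<omega>. f (X \<omega>) \<partial>M) * (\<integral>\<omega>. g (Y \<omega>) \<partial>M)"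
proof -
  have XY [measurable]: "X \<in> M \<rightarrow>\<^sub>M Ma" "Y \<in> M \<rightarrow>\<^sub>M Mb"
    using ind by (auto simp: indep_rv_def)
  note [measurable] = f g
  have "indep_rv M borel (\<lambda>\<omega>. f (X \<omega>)) borel (\<lambda>\<omega>. g (Y \<omega>))"
    unfolding indep_rv_def
  proof (intro conjI ballI)
    fix A B :: "complex set"
    assume AB: "A \<in> sets borel" "B \<in> sets borel"
    have "X \<omega> \<in> space Ma" "Y \<omega> \<in> space Mb" if "\<omega> \<in> space M" for \<omega>
      using measurable_space[OF XY(1) that] measurable_space[OF XY(2) that] .
    then have eq: "(\<lambda>\<omega>. f (X \<omega>)) -` A \<inter> space M = X -` (f -` A \<inter> space Ma) \<inter> space M"
        "(\<lambda>\<omega>. g (Y \<omega>)) -` B \<inter> space M = Y -` (g -` B \<inter> space Mb) \<inter> space M"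
        "(\<lambda>\<omega>. f (X \<omega>)) -` A \<inter> (\<lambda>\<omega>. g (Y \<omega>)) -` B \<inter> space M
          = X -` (f -` A \<inter> space Ma) \<inter> Y -` (g -` B \<inter> space Mb) \<inter> space M"
      by auto
    have "f -` A \<inter> space Ma \<in> sets Ma" "g -` B \<inter> space Mb \<in> sets Mb"
      using AB f g by (auto intro: measurable_sets)
    then show "prob ((\<lambda>\<omega>. f (X \<omega>)) -` A \<inter> (\<lambda>\<omega>. g (Y \<omega>)) -` B \<inter> space M)
        = prob ((\<lambda>\<omega>. f (X \<omega>)) -` A \<inter> space M) * prob ((\<lambda>\<omega>. g (Y \<omega>)) -` B \<inter> space M)"
      using ind unfolding eq indep_rv_def by blast
  qed measurable
  then have "indep_var borel (\<lambda>\<omega>. f (X \<omega>)) borel (\<lambda>\<omega>. g (Y \<omega>))"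
    by (rule indep_rv_imp_indep_var)
  then show ?thesis
    by (rule indep_var_lebesgue_integral)
      (auto intro!: integrable_const_bound[where B=1] bf bg)
qed

section \<open>Averages as finite sums over genealogies\<close>

definition genealogies :: "nat \<Rightarrow> (nat \<Rightarrow> nat) set" where
  "genealogies n = {c. (\<forall>i\<in>{2..n}. c i < i) \<and> (\<forall>i. i \<notin> {2..n} \<longrightarrow> c i = 0)}"

definition genealogy_prob :: "real \<Rightarrow> nat \<Rightarrow> (nat \<Rightarrow> nat) \<Rightarrow> real" where
  "genealogy_prob p n c = (\<Prod>i\<in>{2..n}. if c i = 0 then 1 - p else p / real (i - 1))"

lemma finite_genealogies: "finite (genealogies n)"
proof (rule finite_subset)
  show "genealogies n \<subseteq> {c. \<forall>i. (i \<in> {2..n} \<longrightarrow> c i \<in> {..<n}) \<and> (i \<notin> {2..n} \<longrightarrow> c i = 0)}"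
  proof
    fix c assume c: "c \<in> genealogies n"
    have "c i < n" if "i \<in> {2..n}" for i
      using c that less_le_trans[of "c i" i n] unfolding genealogies_def by simp
    then show "c \<in> {c. \<forall>i. (i \<in> {2..n} \<longrightarrow> c i \<in> {..<n}) \<and> (i \<notin> {2..n} \<longrightarrow> c i = 0)}"
      using c unfolding genealogies_def by simp
  qed
  show "finite {c. \<forall>i. (i \<in> {2..n} \<longrightarrow> c i \<in> {..<n}) \<and> (i \<notin> {2..n} \<longrightarrow> c i = 0)}"
    by (rule finite_set_of_finite_funs) auto
qed

lemma mem_genealogies:
  "c \<in> genealogies n \<longleftrightarrow> (\<forall>i\<in>{2..n}. c i < i) \<and> (\<forall>i. i \<notin> {2..n} \<longrightarrow> c i = 0)"
  by (simp add: genealogies_def)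

lemma genealogies_le_1: "n \<le> 1 \<Longrightarrow> genealogies n = {\<lambda>_. 0}"
  by (auto simp: mem_genealogies fun_eq_iff set_eq_iff)

lemma genealogies_Suc:
  assumes "1 \<le> n"
  shows "bij_betw (\<lambda>(c, x). c(Suc n := x)) (genealogies n \<times> {..n}) (genealogies (Suc n))"
proof (rule bij_betw_byWitness[where f'="\<lambda>c. (c(Suc n := 0), c (Suc n))"])
  show "\<forall>a\<in>genealogies n \<times> {..n}. (\<lambda>c. (c(Suc n := 0), c (Suc n))) (case a of (c, x) \<Rightarrow> c(Suc n := x)) = a"
    by (auto simp: mem_genealogies fun_eq_iff)
  show "\<forall>a'\<in>genealogies (Suc n). (case (a'(Suc n := 0), a' (Suc n)) of (c, x) \<Rightarrow> c(Suc n := x)) = a'"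
    by auto
  show "(\<lambda>(c, x). c(Suc n := x)) ` (genealogies n \<times> {..n}) \<subseteq> genealogies (Suc n)"
    using assms by (auto simp: mem_genealogies split: if_splits)
  show "(\<lambda>c. (c(Suc n := 0), c (Suc n))) ` genealogies (Suc n) \<subseteq> genealogies n \<times> {..n}"
  proof clarify
    fix c assume c: "c \<in> genealogies (Suc n)"
    have "c (Suc n) < Suc n"
      using c assms bspec[of "{2..Suc n}" "\<lambda>i. c i < i" "Suc n"] unfolding mem_genealogies by simp
    moreover have "c(Suc n := 0) \<in> genealogies n"
      using c unfolding mem_genealogies by auto
    ultimately show "c(Suc n := 0) \<in> genealogies n \<and> c (Suc n) \<in> {..n}"
      by simp
  qed
qed

text \<open>Unrolls the iterated averages into one weight per genealogy, the form in which they meet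
  the probabilities of events on the sample space.\<close>

lemma avg_eq_sum: "avg p n G = (\<Sum>c\<in>genealogies n. genealogy_prob p n c *\<^sub>R G c)"
proof (induction n arbitrary: G)
  case 0
  then show ?case by (simp add: genealogies_le_1 genealogy_prob_def)
next
  case (Suc n)
  show ?case
  proof (cases "n = 0")
    case True
    have "(\<lambda>_. 0)(Suc 0 := 0) = (\<lambda>_. 0::nat)"
      by auto
    then show ?thesis
      using True by (simp add: genealogies_le_1 genealogy_prob_def avg_step_def)
  next
    case False
    define w where "w x = (if x = 0 then 1 - p else p / real n)" for x :: nat
    have step: "avg_step p n G c = (\<Sum>x\<le>n. w x *\<^sub>R G (c(Suc n := x)))" for c
    proof -
      have "{..n} = insert 0 {1..n}"
        by auto
      then have "(\<Sum>x\<le>n. w x *\<^sub>R G (c(Suc n := x))) = w 0 *\<^sub>R G (c(Suc n := 0)) + (\<Sum>x=1..n. w x *\<^sub>R G (c(Suc n := x)))"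
        by simp
      also have "(\<Sum>x=1..n. w x *\<^sub>R G (c(Suc n := x))) = (\<Sum>x=1..n. (p / real n) *\<^sub>R G (c(Suc n := x)))"
        by (intro sum.cong) (auto simp: w_def)
      moreover have "w 0 = 1 - p"
        by (simp add: w_def)
      ultimately show ?thesis
        using False unfolding avg_step_def by (simp only: if_False scaleR_sum_right)
    qed
    have gp: "genealogy_prob p (Suc n) (c(Suc n := x)) = genealogy_prob p n c * w x" for c x
    proof -
      have "{2..Suc n} = insert (Suc n) {2..n}"
        using False by auto
      moreover have "(\<Prod>i\<in>{2..n}. if (c(Suc n := x)) i = 0 then 1 - p else p / real (i - 1)) = genealogy_prob p n c"
        unfolding genealogy_prob_def by (intro prod.cong) auto
      ultimately show ?thesis
        by (simp add: genealogy_prob_def w_def mult.commute)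
    qed
    have "avg p (Suc n) G = (\<Sum>c\<in>genealogies n. \<Sum>x\<le>n. (genealogy_prob p n c * w x) *\<^sub>R G (c(Suc n := x)))"
      by (simp add: Suc step scaleR_sum_right)
    also have "\<dots> = (\<Sum>(c, x)\<in>genealogies n \<times> {..n}. (genealogy_prob p n c * w x) *\<^sub>R G (c(Suc n := x)))"
      by (rule sum.cartesian_product)
    also have "\<dots> = (\<Sum>(c, x)\<in>genealogies n \<times> {..n}. genealogy_prob p (Suc n) (c(Suc n := x)) *\<^sub>R G (c(Suc n := x)))"
      by (simp add: gp)
    also have "\<dots> = (\<Sum>c\<in>genealogies (Suc n). genealogy_prob p (Suc n) c *\<^sub>R G c)"
      using sum.reindex_bij_betw[OF genealogies_Suc, of n "\<lambda>c. genealogy_prob p (Suc n) c *\<^sub>R G c"] False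
      by (simp add: case_prod_unfold)
    finally show ?thesis .
  qed
qed

lemma (in prob_space) prob_indep_vars_Ball:
  assumes ind: "indep_vars (\<lambda>_. count_space UNIV) X I" and J: "finite J" "J \<subseteq> I"
  shows "prob {\<omega>\<in>space M. \<forall>i\<in>J. X i \<omega> = x i} = (\<Prod>i\<in>J. prob {\<omega>\<in>space M. X i \<omega> = x i})"
proof (cases "J = {}")
  case True
  then show ?thesis by (simp add: prob_space)
next
  case False
  have "prob (\<Inter>i\<in>J. X i -` {x i} \<inter> space M) = (\<Prod>i\<in>J. prob (X i -` {x i} \<inter> space M))"
    using indep_varsD[OF ind False J] by simp
  moreover have "(\<Inter>i\<in>J. X i -` {x i} \<inter> space M) = {\<omega>\<in>space M. \<forall>i\<in>J. X i \<omega> = x i}"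
    using False by auto
  moreover have "X i -` {x i} \<inter> space M = {\<omega>\<in>space M. X i \<omega> = x i}" for i
    by auto
  ultimately show ?thesis
    by simp
qed

lemma measurable_srrw_step:
  fixes X :: "nat \<Rightarrow> 'w \<Rightarrow> 'a::{real_normed_vector, second_countable_topology}"
  assumes X: "\<And>i. X i \<in> borel_measurable M"
    and e: "\<And>i. 2 \<le> i \<Longrightarrow> \<epsilon> i \<in> M \<rightarrow>\<^sub>M count_space UNIV"
    and U: "\<And>i. 2 \<le> i \<Longrightarrow> U i \<in> M \<rightarrow>\<^sub>M count_space UNIV"
  shows "(\<lambda>\<omega>. srrw_step (\<lambda>i. X i \<omega>) (\<lambda>i. \<epsilon> i \<omega>) (\<lambda>i. U i \<omega>) i) \<in> borel_measurable M"
proof (induction i rule: less_induct)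
  case (less i)
  note [measurable] = X
  show ?case
  proof (cases "2 \<le> i")
    case True
    note [measurable] = e[OF True] U[OF True]
    have [measurable]: "(\<lambda>\<omega>. srrw_step (\<lambda>i. X i \<omega>) (\<lambda>i. \<epsilon> i \<omega>) (\<lambda>i. U i \<omega>) u) \<in> borel_measurable M" if "u \<in> {1..<i}" for u
      using less that by simp
    \<comment> \<open>The random index is removed by summing over its finitely many values, as the
      induction hypothesis covers fixed indices.\<close>
    have "(\<lambda>\<omega>. srrw_step (\<lambda>i. X i \<omega>) (\<lambda>i. \<epsilon> i \<omega>) (\<lambda>i. U i \<omega>) i)
        = (\<lambda>\<omega>. if \<epsilon> i \<omega> \<and> 1 \<le> U i \<omega> \<and> U i \<omega> < i
            then \<Sum>u\<in>{1..<i}. of_bool (U i \<omega> = u) *\<^sub>R srrw_step (\<lambda>i. X i \<omega>) (\<lambda>i. \<epsilon> i \<omega>) (\<lambda>i. U i \<omega>) u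
            else X i \<omega>)"
    proof
      fix \<omega>
      have "(\<Sum>u\<in>{1..<i}. of_bool (U i \<omega> = u) *\<^sub>R srrw_step (\<lambda>i. X i \<omega>) (\<lambda>i. \<epsilon> i \<omega>) (\<lambda>i. U i \<omega>) u)
          = (\<Sum>u\<in>{1..<i}. if u = U i \<omega> then srrw_step (\<lambda>i. X i \<omega>) (\<lambda>i. \<epsilon> i \<omega>) (\<lambda>i. U i \<omega>) u else 0)"
        by (intro sum.cong) auto
      then show "srrw_step (\<lambda>i. X i \<omega>) (\<lambda>i. \<epsilon> i \<omega>) (\<lambda>i. U i \<omega>) i
        = (if \<epsilon> i \<omega> \<and> 1 \<le> U i \<omega> \<and> U i \<omega> < i
            then \<Sum>u\<in>{1..<i}. of_bool (U i \<omega> = u) *\<^sub>R srrw_step (\<lambda>i. X i \<omega>) (\<lambda>i. \<epsilon> i \<omega>) (\<lambda>i. U i \<omega>) u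
            else X i \<omega>)"
        using True by (subst srrw_step.simps) auto
    qed
    also have "\<dots> \<in> borel_measurable M"
      by measurable
    finally show ?thesis .
  next
    case False
    then show ?thesis
      by (subst srrw_step.simps) simp
  qed
qed

lemma measurable_srrw:
  fixes X :: "nat \<Rightarrow> 'w \<Rightarrow> 'a::{real_normed_vector, second_countable_topology}"
  assumes "\<And>i. X i \<in> borel_measurable M"
    and "\<And>i. 2 \<le> i \<Longrightarrow> \<epsilon> i \<in> M \<rightarrow>\<^sub>M count_space UNIV"
    and "\<And>i. 2 \<le> i \<Longrightarrow> U i \<in> M \<rightarrow>\<^sub>M count_space UNIV"
  shows "(\<lambda>\<omega>. srrw (\<lambda>i. X i \<omega>) (\<lambda>i. \<epsilon> i \<omega>) (\<lambda>i. U i \<omega>) k) \<in> borel_measurable M"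
  unfolding srrw_def by (intro borel_measurable_sum measurable_srrw_step assms)

section \<open>The genealogy on the probability space of the walk\<close>

context
  fixes M :: "'w measure" and p :: real and \<xi> :: "real \<Rightarrow> 'w \<Rightarrow> real^'d"
    and \<epsilon> :: "nat \<Rightarrow> 'w \<Rightarrow> bool" and U :: "nat \<Rightarrow> 'w \<Rightarrow> nat"
  assumes M: "prob_space M" and noise: "reinforcement_noise M p \<xi> \<epsilon> U"
begin

interpretation prob_space M by (rule M)

lemma measurable_noise:
  "2 \<le> i \<Longrightarrow> \<epsilon> i \<in> M \<rightarrow>\<^sub>M count_space UNIV" "2 \<le> i \<Longrightarrow> U i \<in> M \<rightarrow>\<^sub>M count_space UNIV"
  using noise by (auto simp: reinforcement_noise_def)

text \<open>\<open>U\<close> is prescribed only at copying steps. At innovations its value does not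
  influence the walk, and fixing it would split the sample space into more pieces than there are
  genealogies.\<close>

definition genealogy_event :: "nat \<Rightarrow> (nat \<Rightarrow> nat) \<Rightarrow> 'w \<Rightarrow> bool" where
  "genealogy_event n c \<omega> \<longleftrightarrow> (\<forall>i\<in>{2..n}. \<epsilon> i \<omega> = (c i \<noteq> 0)) \<and> (\<forall>i\<in>{i\<in>{2..n}. c i \<noteq> 0}. U i \<omega> = c i)"

lemma prob_genealogy_event:
  assumes c: "c \<in> genealogies n"
  shows "prob {\<omega>\<in>space M. genealogy_event n c \<omega>} = genealogy_prob p n c"
proof -
  define I1 where "I1 = {i\<in>{2..n}. c i \<noteq> 0}"
  define E where "E = {\<omega>\<in>space M. \<forall>i\<in>{2..n}. \<epsilon> i \<omega> = (c i \<noteq> 0)}"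
  define V where "V = {\<omega>\<in>space M. \<forall>i\<in>I1. U i \<omega> = c i}"
  let ?S = "Pi\<^sub>M {2::nat..} (\<lambda>_. count_space (UNIV::bool set))"
  let ?T = "Pi\<^sub>M {2::nat..} (\<lambda>_. count_space (UNIV::nat set))"
  have ind: "indep_rv M ?S (\<lambda>\<omega>. \<lambda>i\<in>{2..}. \<epsilon> i \<omega>) ?T (\<lambda>\<omega>. \<lambda>i\<in>{2..}. U i \<omega>)"
    using noise by (auto simp: reinforcement_noise_def)
  define A where "A = {e\<in>space ?S. \<forall>i\<in>{2..n}. e i = (c i \<noteq> 0)}"
  define B where "B = {u\<in>space ?T. \<forall>i\<in>I1. u i = c i}"
  have A: "A \<in> sets ?S"
  proof -
    have [measurable]: "(\<lambda>e. e i) \<in> ?S \<rightarrow>\<^sub>M count_space UNIV" if "i \<in> {2..n}" for i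
      using that by (intro measurable_component_singleton) auto
    show ?thesis
      unfolding A_def by measurable
  qed
  have B: "B \<in> sets ?T"
  proof -
    have [measurable]: "(\<lambda>e. e i) \<in> ?T \<rightarrow>\<^sub>M count_space UNIV" if "i \<in> I1" for i
      using that by (intro measurable_component_singleton) (auto simp: I1_def)
    have "finite I1"
      by (simp add: I1_def)
    then show ?thesis
      unfolding B_def by measurable
  qed
  have pre: "(\<lambda>\<omega>. \<lambda>i\<in>{2..}. \<epsilon> i \<omega>) -` A \<inter> space M = E" "(\<lambda>\<omega>. \<lambda>i\<in>{2..}. U i \<omega>) -` B \<inter> space M = V"
    by (auto simp: A_def B_def E_def V_def I1_def space_PiM)
  have "{\<omega>\<in>space M. genealogy_event n c \<omega>}
      = (\<lambda>\<omega>. \<lambda>i\<in>{2..}. \<epsilon> i \<omega>) -` A \<inter> (\<lambda>\<omega>. \<lambda>i\<in>{2..}. U i \<omega>) -` B \<inter> space M"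
  proof -
    have "{\<omega>\<in>space M. genealogy_event n c \<omega>} = E \<inter> V"
      unfolding genealogy_event_def E_def V_def I1_def by blast
    then show ?thesis
      unfolding pre[symmetric] by blast
  qed
  then have "prob {\<omega>\<in>space M. genealogy_event n c \<omega>} = prob E * prob V"
    using ind A B unfolding indep_rv_def pre[symmetric] by simp
  also have "prob E = (\<Prod>i\<in>{2..n}. prob {\<omega>\<in>space M. \<epsilon> i \<omega> = (c i \<noteq> 0)})"
    unfolding E_def by (rule prob_indep_vars_Ball[where I="{2..}"])
      (use noise in \<open>auto simp: reinforcement_noise_def\<close>)
  also have "prob V = (\<Prod>i\<in>I1. prob {\<omega>\<in>space M. U i \<omega> = c i})"
    unfolding V_def by (rule prob_indep_vars_Ball[where I="{2..}"])
      (use noise in \<open>auto simp: reinforcement_noise_def I1_def\<close>)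
  also have "(\<Prod>i\<in>{2..n}. prob {\<omega>\<in>space M. \<epsilon> i \<omega> = (c i \<noteq> 0)}) = (\<Prod>i\<in>{2..n}. if c i = 0 then 1 - p else p)"
  proof (intro prod.cong refl)
    fix i assume i: "i \<in> {2..n}"
    then have e: "prob {\<omega>\<in>space M. \<epsilon> i \<omega>} = p"
      using noise by (auto simp: reinforcement_noise_def)
    have [measurable]: "\<epsilon> i \<in> M \<rightarrow>\<^sub>M count_space UNIV"
      using i by (simp add: measurable_noise)
    have "{\<omega>\<in>space M. \<not> \<epsilon> i \<omega>} = space M - {\<omega>\<in>space M. \<epsilon> i \<omega>}"
      by auto
    then have "prob {\<omega>\<in>space M. \<not> \<epsilon> i \<omega>} = 1 - p"
      using prob_compl[of "{\<omega>\<in>space M. \<epsilon> i \<omega>}"] e by simp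
    then show "prob {\<omega>\<in>space M. \<epsilon> i \<omega> = (c i \<noteq> 0)} = (if c i = 0 then 1 - p else p)"
      using e by simp
  qed
  also have "(\<Prod>i\<in>I1. prob {\<omega>\<in>space M. U i \<omega> = c i}) = (\<Prod>i\<in>I1. 1 / real (i - 1))"
  proof (intro prod.cong refl)
    fix i assume i: "i \<in> I1"
    then have "c i \<in> {1..<i}" "2 \<le> i"
      using c by (auto simp: I1_def mem_genealogies)
    then show "prob {\<omega>\<in>space M. U i \<omega> = c i} = 1 / real (i - 1)"
      using noise by (auto simp: reinforcement_noise_def)
  qed
  also have "\<dots> = (\<Prod>i\<in>{2..n}. if c i \<noteq> 0 then 1 / real (i - 1) else 1)"
    unfolding I1_def by (rule prod.inter_filter) simp
  also have "(\<Prod>i\<in>{2..n}. if c i = 0 then 1 - p else p) * (\<Prod>i\<in>{2..n}. if c i \<noteq> 0 then 1 / real (i - 1) else 1) = genealogy_prob p n c"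
    unfolding genealogy_prob_def prod.distrib[symmetric] by (intro prod.cong) auto
  finally show ?thesis .
qed

text \<open>The \<open>i - 1\<close> values in \<open>{1..<i}\<close> have probability
  \<open>1 / (i - 1)\<close> each, so no mass is left outside.\<close>

lemma AE_U_range: "AE \<omega> in M. \<forall>i\<in>{2..n}. U i \<omega> \<in> {1..<i}"
proof (rule AE_finite_allI)
  fix i assume "i \<in> {2..n}"
  then have i: "2 \<le> i"
    by simp
  have [measurable]: "U i \<in> M \<rightarrow>\<^sub>M count_space UNIV"
    using i by (rule measurable_noise)
  have "prob {\<omega>\<in>space M. U i \<omega> \<in> {1..<i}} = prob (\<Union>k\<in>{1..<i}. {\<omega>\<in>space M. U i \<omega> = k})"
    by (rule arg_cong[where f=prob]) auto
  also have "\<dots> = (\<Sum>k\<in>{1..<i}. prob {\<omega>\<in>space M. U i \<omega> = k})"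
    by (rule finite_measure_finite_Union) (auto simp: disjoint_family_on_def)
  also have "\<dots> = (\<Sum>k\<in>{1..<i}. 1 / real (i - 1))"
    using noise i by (intro sum.cong) (auto simp: reinforcement_noise_def)
  also have "\<dots> = 1"
    using i by simp
  finally have "prob {\<omega>\<in>space M. U i \<omega> \<in> {1..<i}} = 1" .
  then show "AE \<omega> in M. U i \<omega> \<in> {1..<i}"
    by (subst (asm) prob_Collect_eq_1) auto
qed simp

lemma genealogy_event_iff:
  assumes "\<forall>i\<in>{2..n}. U i \<omega> \<in> {1..<i}" "c \<in> genealogies n"
  shows "genealogy_event n c \<omega> \<longleftrightarrow> c = (\<lambda>i. if i \<in> {2..n} \<and> \<epsilon> i \<omega> then U i \<omega> else 0)"
proof
  assume "genealogy_event n c \<omega>"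
  then show "c = (\<lambda>i. if i \<in> {2..n} \<and> \<epsilon> i \<omega> then U i \<omega> else 0)"
    using assms(2) by (auto simp: genealogy_event_def mem_genealogies fun_eq_iff)
next
  assume c: "c = (\<lambda>i. if i \<in> {2..n} \<and> \<epsilon> i \<omega> then U i \<omega> else 0)"
  have "U i \<omega> \<noteq> 0" if "i \<in> {2..n}" for i
    using bspec[OF assms(1) that] by simp
  then show "genealogy_event n c \<omega>"
    unfolding genealogy_event_def c by auto
qed

text \<open>The events of the finitely many genealogies partition the sample space up to a null set.
  On each of them the phase is a fixed linear combination of the steps, which are independent of the
  noise and of each other, and the exponent of a single step is \<open>1 / n\<close> times that of
  the process.\<close>

lemma char_srrw:
  fixes \<theta> :: "nat \<Rightarrow> real^'d" and k :: "nat \<Rightarrow> nat"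
  assumes levy: "levy_process M q a \<Lambda> \<xi>" and n: "1 \<le> n" and I: "finite I" "\<And>j. j \<in> I \<Longrightarrow> k j \<le> n"
  shows "(\<integral>\<omega>. cis (\<Sum>j\<in>I. \<theta> j \<bullet> srrw (\<lambda>i. \<xi> (real i / real n) \<omega> - \<xi> (real (i - 1) / real n) \<omega>)
      (\<lambda>i. \<epsilon> i \<omega>) (\<lambda>i. U i \<omega>) (k j)) \<partial>M)
    = avg p n (\<lambda>c. exp (- (\<Sum>r=1..n. levy_exponent q a \<Lambda> (\<Sum>j\<in>I. real (tree_size c (k j) r) *\<^sub>R \<theta> j)) / complex_of_real (real n)))"
proof -
  define X where "X r \<omega> = \<xi> (real r / real n) \<omega> - \<xi> (real (r - 1) / real n) \<omega>" for r \<omega>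
  define \<zeta> where "\<zeta> c r = (\<Sum>j\<in>I. real (tree_size c (k j) r) *\<^sub>R \<theta> j)" for c r
  define Z where "Z c \<omega> = cis (\<Sum>r=1..n. \<zeta> c r \<bullet> X r \<omega>)" for c \<omega>
  define C where "C \<omega> = (\<lambda>i. if i \<in> {2..n} \<and> \<epsilon> i \<omega> then U i \<omega> else 0)" for \<omega>
  have \<xi>_meas [measurable]: "\<xi> t \<in> borel_measurable M" for t
    using levy by (auto simp: levy_process_def)
  have X_meas [measurable]: "X r \<in> borel_measurable M" for r
    unfolding X_def by measurable
  have Z_meas [measurable]: "Z c \<in> borel_measurable M" for c
    unfolding Z_def cis_conv_exp by measurable
  have eqS: "(\<Sum>j\<in>I. \<theta> j \<bullet> srrw (\<lambda>i. X i \<omega>) (\<lambda>i. \<epsilon> i \<omega>) (\<lambda>i. U i \<omega>) (k j)) = (\<Sum>r=1..n. \<zeta> (C \<omega>) r \<bullet> X r \<omega>)" for \<omega>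
  proof -
    \<comment> \<open>Only the choices up to \<open>k j \<le> n\<close> matter, so the noise may be
      cut off at \<open>n\<close>, which almost surely gives a member of
      \<open>genealogies n\<close>.\<close>
    have "tree_size (\<lambda>i. if \<epsilon> i \<omega> then U i \<omega> else 0) (k j) r = tree_size (C \<omega>) (k j) r" if "j \<in> I" for j r
      using I(2)[OF that] by (intro tree_size_cong) (auto simp: C_def)
    then have "(\<Sum>j\<in>I. \<theta> j \<bullet> srrw (\<lambda>i. X i \<omega>) (\<lambda>i. \<epsilon> i \<omega>) (\<lambda>i. U i \<omega>) (k j))
        = (\<Sum>j\<in>I. \<Sum>r=1..n. real (tree_size (C \<omega>) (k j) r) * (\<theta> j \<bullet> X r \<omega>))"
      using I by (intro sum.cong refl) (simp add: srrw_eq_tree_size[of _ n] inner_sum_right)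
    also have "\<dots> = (\<Sum>r=1..n. \<zeta> (C \<omega>) r \<bullet> X r \<omega>)"
      by (subst sum.swap) (simp add: \<zeta>_def inner_sum_left)
    finally show ?thesis .
  qed
  then have lhs: "(\<integral>\<omega>. cis (\<Sum>j\<in>I. \<theta> j \<bullet> srrw (\<lambda>i. \<xi> (real i / real n) \<omega> - \<xi> (real (i - 1) / real n) \<omega>)
      (\<lambda>i. \<epsilon> i \<omega>) (\<lambda>i. U i \<omega>) (k j)) \<partial>M) = (\<integral>\<omega>. Z (C \<omega>) \<omega> \<partial>M)"
    unfolding Z_def X_def by simp
  have [measurable]: "Measurable.pred M (genealogy_event n c)" for c
  proof -
    have [measurable]: "\<epsilon> i \<in> M \<rightarrow>\<^sub>M count_space UNIV" "U i \<in> M \<rightarrow>\<^sub>M count_space UNIV" if "i \<in> {2..n}" for i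
      using that by (auto intro: measurable_noise)
    show ?thesis
      unfolding genealogy_event_def[abs_def] by (intro pred_intros_logic pred_intros_finite) measurable
  qed
  have ev_meas: "(\<lambda>\<omega>. of_bool (genealogy_event n c \<omega>) :: complex) \<in> borel_measurable M" for c
    unfolding of_bool_def by measurable
  have "AE \<omega> in M. Z (C \<omega>) \<omega> = (\<Sum>c\<in>genealogies n. of_bool (genealogy_event n c \<omega>) * Z c \<omega>)"
    using AE_U_range[of n]
  proof eventually_elim
    case (elim \<omega>)
    have C: "C \<omega> \<in> genealogies n"
      using elim by (auto simp: C_def mem_genealogies)
    have "(\<Sum>c\<in>genealogies n. of_bool (genealogy_event n c \<omega>) * Z c \<omega>) = (\<Sum>c\<in>genealogies n. if c = C \<omega> then Z c \<omega> else 0)"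
      by (intro sum.cong refl) (auto simp: genealogy_event_iff[OF elim] C_def)
    then show ?case
      using C finite_genealogies by simp
  qed
  moreover have "(\<lambda>\<omega>. Z (C \<omega>) \<omega>) \<in> borel_measurable M"
  proof -
    have [measurable]: "(\<lambda>\<omega>. srrw (\<lambda>i. X i \<omega>) (\<lambda>i. \<epsilon> i \<omega>) (\<lambda>i. U i \<omega>) (k j)) \<in> borel_measurable M" for j
      by (intro measurable_srrw X_meas measurable_noise)
    show ?thesis
      unfolding Z_def eqS[symmetric] cis_conv_exp by measurable
  qed
  ultimately have "(\<integral>\<omega>. Z (C \<omega>) \<omega> \<partial>M) = (\<integral>\<omega>. (\<Sum>c\<in>genealogies n. of_bool (genealogy_event n c \<omega>) * Z c \<omega>) \<partial>M)"
    by (intro integral_cong_AE borel_measurable_sum borel_measurable_times Z_meas ev_meas)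
  also have "\<dots> = (\<Sum>c\<in>genealogies n. \<integral>\<omega>. of_bool (genealogy_event n c \<omega>) * Z c \<omega> \<partial>M)"
    by (rule Bochner_Integration.integral_sum, rule integrable_const_bound[where B=1])
      (auto simp: Z_def[symmetric] norm_mult Z_meas ev_meas intro!: borel_measurable_times,
        auto simp: Z_def)
  also have "\<dots> = (\<Sum>c\<in>genealogies n. genealogy_prob p n c *\<^sub>R (\<integral>\<omega>. Z c \<omega> \<partial>M))"
  proof (intro sum.cong refl)
    fix c assume c: "c \<in> genealogies n"
    let ?S = "Pi\<^sub>M {2::nat..} (\<lambda>_. count_space (UNIV::bool set))"
    let ?T = "Pi\<^sub>M {2::nat..} (\<lambda>_. count_space (UNIV::nat set))"
    let ?R = "Pi\<^sub>M {0::real..} (\<lambda>_. borel :: (real^'d) measure)"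
    have ind: "indep_rv M ?R (\<lambda>\<omega>. \<lambda>s\<in>{0..}. \<xi> s \<omega>) (?S \<Otimes>\<^sub>M ?T)
        (\<lambda>\<omega>. (\<lambda>i\<in>{2..}. \<epsilon> i \<omega>, \<lambda>i\<in>{2..}. U i \<omega>))"
      using noise by (simp add: reinforcement_noise_def)
    \<comment> \<open>\<open>f\<close> and \<open>g\<close> express the two factors as measurable
      functions on the product spaces between which independence is assumed.\<close>
    define f where "f w = cis (\<Sum>r=1..n. \<zeta> c r \<bullet> (w (real r / real n) - w (real (r - 1) / real n)))" for w :: "real \<Rightarrow> real^'d"
    define g where "g = (\<lambda>(e, u). of_bool ((\<forall>i\<in>{2..n}. e i = (c i \<noteq> 0)) \<and> (\<forall>i\<in>{i\<in>{2..n}. c i \<noteq> 0}. u i = c i)) :: complex)"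
    have f: "f \<in> borel_measurable ?R"
    proof -
      have [measurable]: "(\<lambda>w. w s) \<in> ?R \<rightarrow>\<^sub>M borel" if "0 \<le> s" for s
        using that by (intro measurable_component_singleton) auto
      show ?thesis
        unfolding f_def cis_conv_exp by measurable
    qed
    have g: "g \<in> borel_measurable (?S \<Otimes>\<^sub>M ?T)"
    proof -
      have [measurable]: "(\<lambda>x. fst x i) \<in> ?S \<Otimes>\<^sub>M ?T \<rightarrow>\<^sub>M count_space UNIV" if "i \<in> {2..n}" for i
        using that by (intro measurable_compose[OF measurable_fst] measurable_component_singleton) auto
      have [measurable]: "(\<lambda>x. snd x i) \<in> ?S \<Otimes>\<^sub>M ?T \<rightarrow>\<^sub>M count_space UNIV" if "i \<in> {i\<in>{2..n}. c i \<noteq> 0}" for i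
        using that by (intro measurable_compose[OF measurable_snd] measurable_component_singleton) auto
      show ?thesis
        unfolding g_def case_prod_unfold by measurable
    qed
    have "(\<integral>\<omega>. f (\<lambda>s\<in>{0..}. \<xi> s \<omega>) * g (\<lambda>i\<in>{2..}. \<epsilon> i \<omega>, \<lambda>i\<in>{2..}. U i \<omega>) \<partial>M)
        = (\<integral>\<omega>. f (\<lambda>s\<in>{0..}. \<xi> s \<omega>) \<partial>M) * (\<integral>\<omega>. g (\<lambda>i\<in>{2..}. \<epsilon> i \<omega>, \<lambda>i\<in>{2..}. U i \<omega>) \<partial>M)"
      by (rule indep_rv_integral_mult[OF ind f g]) (auto simp: f_def g_def)
    moreover have "f (\<lambda>s\<in>{0..}. \<xi> s \<omega>) = Z c \<omega>" for \<omega>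
      by (simp add: f_def Z_def X_def)
    moreover have "g (\<lambda>i\<in>{2..}. \<epsilon> i \<omega>, \<lambda>i\<in>{2..}. U i \<omega>) = of_bool (genealogy_event n c \<omega>)" for \<omega>
      by (auto simp: g_def genealogy_event_def)
    moreover have "(\<integral>\<omega>. of_bool (genealogy_event n c \<omega>) \<partial>M) = complex_of_real (genealogy_prob p n c)"
    proof -
      have "(\<integral>\<omega>. of_bool (genealogy_event n c \<omega>) \<partial>M)
          = (\<integral>\<omega>. complex_of_real (indicator {\<omega>\<in>space M. genealogy_event n c \<omega>} \<omega>) \<partial>M)"
        by (intro Bochner_Integration.integral_cong) auto
      also have "\<dots> = complex_of_real (genealogy_prob p n c)"
        unfolding integral_complex_of_real using prob_genealogy_event[OF c] by simp
      finally show ?thesis .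
    qed
    ultimately show "(\<integral>\<omega>. of_bool (genealogy_event n c \<omega>) * Z c \<omega> \<partial>M) = genealogy_prob p n c *\<^sub>R (\<integral>\<omega>. Z c \<omega> \<partial>M)"
      by (simp add: mult.commute scaleR_conv_of_real)
  qed
  also have "\<dots> = avg p n (\<lambda>c. \<integral>\<omega>. Z c \<omega> \<partial>M)"
    by (rule avg_eq_sum[symmetric])
  also have "(\<lambda>c. \<integral>\<omega>. Z c \<omega> \<partial>M) = (\<lambda>c. exp (- (\<Sum>r=1..n. levy_exponent q a \<Lambda> (\<zeta> c r)) / complex_of_real (real n)))"
  proof
    fix c
    have indX: "indep_vars (\<lambda>_. borel) (\<lambda>j \<omega>. X (Suc j) \<omega>) {..<n}"
    proof -
      have "indep_vars (\<lambda>_. borel) (\<lambda>j \<omega>. \<xi> (real (Suc j) / real n) \<omega> - \<xi> (real j / real n) \<omega>) {..<n}"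
        using levy[unfolded levy_process_def, THEN conjunct2, THEN conjunct2, THEN conjunct1, rule_format, of n "\<lambda>j. real j / real n"]
        by (simp add: divide_right_mono)
      then show ?thesis
        by (simp add: X_def)
    qed
    have "(\<integral>\<omega>. Z c \<omega> \<partial>M) = (\<integral>\<omega>. (\<Prod>j<n. cis (\<zeta> c (Suc j) \<bullet> X (Suc j) \<omega>)) \<partial>M)"
    proof -
      have "(\<Sum>r=1..n. h r) = (\<Sum>j<n. h (Suc j))" for h :: "nat \<Rightarrow> real"
        by (rule sum.reindex_bij_witness[of _ Suc "\<lambda>r. r - 1"]) auto
      then show ?thesis
        unfolding Z_def by (simp add: cis_conv_exp sum_distrib_left exp_sum)
    qed
    also have "\<dots> = (\<Prod>j<n. \<integral>\<omega>. cis (\<zeta> c (Suc j) \<bullet> X (Suc j) \<omega>) \<partial>M)"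
    proof (rule indep_vars_lebesgue_integral)
      show "indep_vars (\<lambda>_. borel) (\<lambda>j \<omega>. cis (\<zeta> c (Suc j) \<bullet> X (Suc j) \<omega>)) {..<n}"
        by (rule indep_vars_compose2[OF indX]) (auto simp: cis_conv_exp)
      show "integrable M (\<lambda>\<omega>. cis (\<zeta> c (Suc j) \<bullet> X (Suc j) \<omega>))" for j
        by (rule integrable_const_bound[where B=1]) (auto simp: cis_conv_exp)
    qed simp
    also have "\<dots> = (\<Prod>j<n. exp (- (complex_of_real (1 / real n) * levy_exponent q a \<Lambda> (\<zeta> c (Suc j)))))"
    proof (intro prod.cong refl)
      fix j
      have eq: "distr M borel (X (Suc j)) = distr M borel (\<xi> (1 / real n))"
      proof -
        have "distr M borel (\<lambda>\<omega>. \<xi> (real (Suc j) / real n) \<omega> - \<xi> (real j / real n) \<omega>)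
            = distr M borel (\<xi> (real (Suc j) / real n - real j / real n))"
          using levy[unfolded levy_process_def, THEN conjunct2, THEN conjunct2, THEN conjunct2, THEN conjunct1, rule_format, of "real j / real n" "real (Suc j) / real n"]
          by (simp add: divide_right_mono)
        then show ?thesis
          by (simp add: X_def[abs_def] diff_divide_distrib[symmetric])
      qed
      have m: "(\<lambda>x. cis (\<zeta> c (Suc j) \<bullet> x)) \<in> borel_measurable borel"
        unfolding cis_conv_exp by measurable
      have "(\<integral>\<omega>. cis (\<zeta> c (Suc j) \<bullet> X (Suc j) \<omega>) \<partial>M) = (\<integral>x. cis (\<zeta> c (Suc j) \<bullet> x) \<partial>distr M borel (X (Suc j)))"
        using m by (subst integral_distr) auto
      also have "\<dots> = (\<integral>\<omega>. cis (\<zeta> c (Suc j) \<bullet> \<xi> (1 / real n) \<omega>) \<partial>M)"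
        unfolding eq using m by (subst integral_distr) auto
      also have "\<dots> = exp (- (complex_of_real (1 / real n) * levy_exponent q a \<Lambda> (\<zeta> c (Suc j))))"
        using levy unfolding levy_process_def by simp
      finally show "(\<integral>\<omega>. cis (\<zeta> c (Suc j) \<bullet> X (Suc j) \<omega>) \<partial>M)
          = exp (- (complex_of_real (1 / real n) * levy_exponent q a \<Lambda> (\<zeta> c (Suc j))))" .
    qed
    also have "\<dots> = exp (\<Sum>j<n. - (complex_of_real (1 / real n) * levy_exponent q a \<Lambda> (\<zeta> c (Suc j))))"
      by (simp add: exp_sum)
    also have "(\<Sum>j<n. - (complex_of_real (1 / real n) * levy_exponent q a \<Lambda> (\<zeta> c (Suc j))))
        = - (\<Sum>r=1..n. levy_exponent q a \<Lambda> (\<zeta> c r)) / complex_of_real (real n)"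
    proof -
      have "(\<Sum>r=1..n. levy_exponent q a \<Lambda> (\<zeta> c r)) = (\<Sum>j<n. levy_exponent q a \<Lambda> (\<zeta> c (Suc j)))"
        by (rule sum.reindex_bij_witness[of _ Suc "\<lambda>r. r - 1"]) auto
      then show ?thesis
        by (simp add: sum_negf sum_divide_distrib)
    qed
    finally show "(\<integral>\<omega>. Z c \<omega> \<partial>M) = exp (- (\<Sum>r=1..n. levy_exponent q a \<Lambda> (\<zeta> c r)) / complex_of_real (real n))" .
  qed
  finally show ?thesis
    unfolding lhs \<zeta>_def .
qed

end

section \<open>Levy continuity theorem in Euclidean spaces\<close>

text \<open>Left unnormalised, so that it is exactly the characteristic function of the standard
  Gaussian law, see \<open>gauss_char\<close>.\<close>

definition gauss :: "'e::euclidean_space \<Rightarrow> real" where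
  "gauss x = exp (- (norm x)\<^sup>2 / 2)"

lemma gauss_pos: "0 < gauss x"
  by (simp add: gauss_def)

lemma borel_measurable_gauss [measurable]: "gauss \<in> borel_measurable borel"
  unfolding gauss_def[abs_def] by measurable

lemma gauss_eq_prod: "gauss (x::'e::euclidean_space) = (\<Prod>b\<in>Basis. exp (- (x \<bullet> b)\<^sup>2 / 2))"
proof -
  have "(norm x)\<^sup>2 = (\<Sum>b\<in>Basis. (x \<bullet> b)\<^sup>2)"
    unfolding power2_norm_eq_inner by (subst euclidean_inner) (simp add: power2_eq_square)
  then show ?thesis
    by (simp add: gauss_def exp_sum[symmetric] sum_negf sum_divide_distrib[symmetric])
qed

definition std_gauss :: "('e::euclidean_space \<Rightarrow> real) measure" where
  "std_gauss = Pi\<^sub>M Basis (\<lambda>_. std_normal_distribution)"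

definition coords :: "('e::euclidean_space \<Rightarrow> real) \<Rightarrow> 'e" where
  "coords u = (\<Sum>b\<in>Basis. u b *\<^sub>R b)"

lemma measurable_coords [measurable]: "coords \<in> borel_measurable (std_gauss :: ('e::euclidean_space \<Rightarrow> real) measure)"
proof -
  have [measurable]: "(\<lambda>u. u b) \<in> borel_measurable (std_gauss :: ('e \<Rightarrow> real) measure)" if "b \<in> Basis" for b
    unfolding std_gauss_def
    using measurable_component_singleton[OF that, of "\<lambda>_. std_normal_distribution"]
    by (simp cong: measurable_cong_sets)
  show ?thesis
    unfolding coords_def by measurable
qed

lemma prob_space_std_gauss: "prob_space (std_gauss :: ('e::euclidean_space \<Rightarrow> real) measure)"
  unfolding std_gauss_def by (intro prob_space_PiM) (simp add: prob_space_normal_density)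

text \<open>Factorises over the coordinates into the one-dimensional formula. It turns integrals of
  Gaussian kernels into integrals of characteristic functions.\<close>

lemma gauss_char:
  "complex_of_real (gauss x) = (\<integral>u. cis (x \<bullet> coords u) \<partial>(std_gauss :: ('e::euclidean_space \<Rightarrow> real) measure))"
proof -
  interpret std: real_distribution std_normal_distribution
    by (rule real_dist_normal_dist)
  interpret P: product_sigma_finite "\<lambda>_::'e. std_normal_distribution"
    by standard
  have "complex_of_real (gauss x) = (\<Prod>b\<in>Basis. complex_of_real (exp (- (x \<bullet> b)\<^sup>2 / 2)))"
    unfolding gauss_eq_prod by simp
  also have "\<dots> = (\<Prod>b\<in>Basis. \<integral>t. iexp ((x \<bullet> b) * t) \<partial>std_normal_distribution)"
    using char_std_normal_distribution by (simp add: char_def fun_eq_iff)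
  also have "\<dots> = (\<integral>u. (\<Prod>b\<in>Basis. iexp ((x \<bullet> b) * u b)) \<partial>std_gauss)"
    unfolding std_gauss_def
    by (rule P.product_integral_prod[symmetric]) (auto intro!: std.integrable_const_bound[where B=1])
  also have "\<dots> = (\<integral>u. cis (x \<bullet> coords u) \<partial>std_gauss)"
    by (intro Bochner_Integration.integral_cong refl)
      (simp add: cis_conv_exp coords_def inner_sum_right exp_sum[symmetric] sum_distrib_left mult.commute)
  finally show ?thesis .
qed

lemma integrable_gauss: "integrable lborel (gauss :: 'e::euclidean_space \<Rightarrow> real)"
proof (rule integrableI_bounded)
  have fin: "(\<integral>\<^sup>+t. ennreal (exp (- t\<^sup>2 / 2)) \<partial>lborel) < \<infinity>"
  proof -
    have "integrable lborel (\<lambda>t. sqrt (2 * pi) * std_normal_density t)"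
      by (intro integrable_mult_right integrable_normal_density) simp
    then have "integrable lborel (\<lambda>t::real. exp (- t\<^sup>2 / 2))"
      by (simp add: std_normal_density_def)
    then show ?thesis
      by (simp add: integrable_iff_bounded)
  qed
  have "(\<integral>\<^sup>+x. ennreal (norm (gauss x)) \<partial>(lborel :: 'e measure))
      = (\<integral>\<^sup>+x. (\<Prod>b\<in>Basis. ennreal (exp (- (x \<bullet> b)\<^sup>2 / 2))) \<partial>(lborel :: 'e measure))"
    by (intro nn_integral_cong) (simp add: gauss_eq_prod prod_ennreal abs_prod)
  also have "\<dots> = (\<Prod>b\<in>(Basis::'e set). (\<integral>\<^sup>+t. ennreal (exp (- t\<^sup>2 / 2)) \<partial>lborel))"
    by (rule nn_integral_lborel_prod) auto
  also have "\<dots> < \<infinity>"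
    using fin by (simp add: ennreal_prod_eq_top less_top[symmetric] power_eq_top_ennreal)
  finally show "(\<integral>\<^sup>+x. ennreal (norm (gauss x)) \<partial>(lborel :: 'e measure)) < \<infinity>" .
qed simp

lemma integral_gauss_pos: "0 < (\<integral>x. gauss x \<partial>(lborel :: 'e::euclidean_space measure))"
proof -
  have "\<not> (AE x in (lborel :: 'e measure). gauss x = 0)"
    using gauss_pos[where 'a='e] by (simp add: less_imp_neq[symmetric] eventually_False ae_filter_eq_bot_iff)
  then have "(\<integral>x. gauss x \<partial>(lborel :: 'e measure)) \<noteq> 0"
    using integral_nonneg_eq_0_iff_AE[OF integrable_gauss] gauss_pos less_imp_le by blast
  moreover have "0 \<le> (\<integral>x. gauss x \<partial>(lborel :: 'e measure))"
    by (intro Bochner_Integration.integral_nonneg) (simp add: gauss_def)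
  ultimately show ?thesis
    by simp
qed

section \<open>Gaussian smoothing of test functions\<close>

definition smooth :: "real \<Rightarrow> ('e::euclidean_space \<Rightarrow> real) \<Rightarrow> 'e \<Rightarrow> real" where
  "smooth \<sigma> f y = (\<integral>w. f (y + \<sigma> *\<^sub>R w) * gauss w \<partial>lborel)"

text \<open>An affine change of variables moves \<open>y\<close> from \<open>f\<close> into the
  kernel, so that after exchanging integrals a measure in \<open>y\<close> meets the kernel
  alone.\<close>

lemma smooth_eq:
  fixes f :: "'e::euclidean_space \<Rightarrow> real"
  assumes \<sigma>: "0 < \<sigma>" and f [measurable]: "f \<in> borel_measurable borel"
  shows "\<sigma> ^ DIM('e) * smooth \<sigma> f y = (\<integral>x. f x * gauss ((1 / \<sigma>) *\<^sub>R (x - y)) \<partial>lborel)"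
proof -
  have "(\<integral>x. f x * gauss ((1 / \<sigma>) *\<^sub>R (x - y)) \<partial>lborel)
      = (\<integral>x. f x * gauss ((1 / \<sigma>) *\<^sub>R (x - y)) \<partial>density (distr lborel borel (\<lambda>x. y + \<sigma> *\<^sub>R x)) (\<lambda>_. ennreal (\<bar>\<sigma>\<bar> ^ DIM('e))))"
    using \<sigma> by (subst lborel_affine[of \<sigma> y]) auto
  also have "\<dots> = (\<integral>x. \<bar>\<sigma>\<bar> ^ DIM('e) * (f (y + \<sigma> *\<^sub>R x) * gauss ((1 / \<sigma>) *\<^sub>R (y + \<sigma> *\<^sub>R x - y))) \<partial>lborel)"
    by (subst integral_density) (auto simp: integral_distr)
  also have "\<dots> = \<sigma> ^ DIM('e) * smooth \<sigma> f y"
    using \<sigma> by (simp add: smooth_def)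
  finally show ?thesis ..
qed

text \<open>Split at \<open>norm w = R\<close>: inside, uniform continuity applies because
  \<open>\<sigma> * R < d\<close>; outside, the Gaussian tail is small. The factor of
  \<open>f y\<close> is the total mass of the unnormalised kernel.\<close>

lemma smooth_close:
  fixes f :: "'e::euclidean_space \<Rightarrow> real"
  assumes f [measurable]: "f \<in> borel_measurable borel" and B: "\<And>x. \<bar>f x\<bar> \<le> B"
    and uc: "uniformly_continuous_on UNIV f" and e: "0 < e"
  shows "\<exists>\<sigma>>0. \<forall>y. \<bar>smooth \<sigma> f y - (\<integral>w. gauss w \<partial>(lborel :: 'e measure)) * f y\<bar> \<le> e"
proof -
  define K where "K = (\<integral>w. gauss w \<partial>(lborel :: 'e measure))"
  have K: "0 < K"
    unfolding K_def by (rule integral_gauss_pos)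
  have B0: "0 \<le> B"
    using B[of 0] by simp
  \<comment> \<open>Chosen so that \<open>e1 * K + 2 * B * e1 = e\<close>.\<close>
  define e1 where "e1 = e / (2 * B + K)"
  have e1: "0 < e1"
    using e K B0 by (simp add: e1_def add_nonneg_pos)
  define tl where "tl R = (\<integral>w. gauss w * indicator {w. real R < norm w} w \<partial>(lborel :: 'e measure))" for R :: nat
  have "tl \<longlonglongrightarrow> (\<integral>w. 0 \<partial>(lborel :: 'e measure))"
    unfolding tl_def
  proof (rule integral_dominated_convergence[where w=gauss])
    show "AE w in (lborel :: 'e measure). (\<lambda>R. gauss w * indicator {w. real R < norm w} w) \<longlonglongrightarrow> 0"
    proof (intro AE_I2)
      fix w :: 'e
      show "(\<lambda>R. gauss w * indicator {w. real R < norm w} w) \<longlonglongrightarrow> 0"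
        by (intro tendsto_eventually eventually_sequentiallyI[of "nat \<lceil>norm w\<rceil>"])
          (auto simp: indicator_def) 
    qed
    show "AE w in (lborel :: 'e measure). norm (gauss w * indicator {w. real R < norm w} w) \<le> gauss w" for R
      by (intro AE_I2) (auto simp: gauss_def indicator_def)
  qed (auto intro: integrable_gauss)
  then have "\<forall>\<^sub>F R in sequentially. tl R < e1"
    using e1 by (intro order_tendstoD(2)) auto
  then obtain R where R: "tl R < e1"
    by (auto dest: eventually_happens)
  obtain d where d: "d > 0" "\<And>x y. dist x y < d \<Longrightarrow> dist (f x) (f y) < e1"
    using uc e1 unfolding uniformly_continuous_on_def by (metis UNIV_I dist_commute)
  define \<sigma> where "\<sigma> = d / (real R + 1)"
  have \<sigma>: "0 < \<sigma>"
    using d by (simp add: \<sigma>_def)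
  have "\<bar>smooth \<sigma> f y - K * f y\<bar> \<le> e" for y
  proof -
    have int1: "integrable lborel (\<lambda>w. f (y + \<sigma> *\<^sub>R w) * gauss w)"
      by (rule Bochner_Integration.integrable_bound[OF integrable_mult_right[OF integrable_gauss, of B]])
        (auto simp: abs_mult gauss_def B intro!: mult_mono abs_ge_self[THEN order_trans[rotated]] order_trans[OF B])
    have "smooth \<sigma> f y - K * f y = (\<integral>w. (f (y + \<sigma> *\<^sub>R w) - f y) * gauss w \<partial>lborel)"
      unfolding smooth_def K_def left_diff_distrib
      using int1 integrable_gauss[where 'e='e] by (simp add: mult.commute)
    then have "\<bar>smooth \<sigma> f y - K * f y\<bar> \<le> (\<integral>w. \<bar>(f (y + \<sigma> *\<^sub>R w) - f y) * gauss w\<bar> \<partial>lborel)"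
      using integral_abs_bound by metis
    also have "\<dots> \<le> (\<integral>w. e1 * gauss w + 2 * B * (gauss w * indicator {w. real R < norm w} w) \<partial>(lborel :: 'e measure))"
    proof (rule integral_mono)
      show "integrable lborel (\<lambda>w. \<bar>(f (y + \<sigma> *\<^sub>R w) - f y) * gauss w\<bar>)"
        unfolding left_diff_distrib
        using int1 integrable_gauss[where 'e='e] by (intro integrable_abs Bochner_Integration.integrable_diff integrable_mult_right) auto
      show "integrable (lborel :: 'e measure) (\<lambda>w. e1 * gauss w + 2 * B * (gauss w * indicator {w. real R < norm w} w))"
        using integrable_gauss[where 'e='e]
        by (intro Bochner_Integration.integrable_add integrable_mult_right integrable_real_mult_indicator) auto
      fix w :: 'e
      have g0: "0 \<le> gauss w"
        by (simp add: gauss_def)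
      show "\<bar>(f (y + \<sigma> *\<^sub>R w) - f y) * gauss w\<bar> \<le> e1 * gauss w + 2 * B * (gauss w * indicator {w. real R < norm w} w)"
      proof (cases "real R < norm w")
        case True
        have "\<bar>f (y + \<sigma> *\<^sub>R w) - f y\<bar> \<le> 2 * B"
          using B[of "y + \<sigma> *\<^sub>R w"] B[of y] by linarith
        then have "\<bar>f (y + \<sigma> *\<^sub>R w) - f y\<bar> * gauss w \<le> 2 * B * gauss w"
          using g0 by (rule mult_right_mono)
        then show ?thesis
          using True g0 e1 by (simp add: abs_mult add_increasing)
      next
        case False
        have "\<sigma> * norm w < d"
        proof -
          have "\<sigma> * norm w \<le> \<sigma> * real R"
            using False \<sigma> by (intro mult_left_mono) auto
          also have "\<dots> < d"
            using d by (simp add: \<sigma>_def field_simps)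
          finally show ?thesis .
        qed
        then have "dist (y + \<sigma> *\<^sub>R w) y < d"
          using \<sigma> by (simp add: dist_norm)
        then have "\<bar>f (y + \<sigma> *\<^sub>R w) - f y\<bar> \<le> e1"
          using d(2) by (force simp: dist_real_def)
        then have "\<bar>f (y + \<sigma> *\<^sub>R w) - f y\<bar> * gauss w \<le> e1 * gauss w"
          using g0 by (rule mult_right_mono)
        then show ?thesis
          using False g0 by (simp add: abs_mult)
      qed
    qed
    also have "\<dots> = e1 * K + 2 * B * tl R"
      unfolding K_def tl_def using integrable_gauss[where 'e='e]
      by (subst Bochner_Integration.integral_add) (auto intro!: integrable_mult_right integrable_real_mult_indicator)
    also have "\<dots> \<le> e1 * K + 2 * B * e1"
      using R B0 by (intro add_left_mono mult_left_mono) auto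
    also have "\<dots> = e1 * (2 * B + K)"
      by (simp add: algebra_simps)
    also have "\<dots> = e"
      using K B0 by (simp add: e1_def add_nonneg_pos)
    finally show ?thesis .
  qed
  then show ?thesis
    using \<sigma> unfolding K_def by blast
qed

section \<open>From characteristic functions to test functions\<close>

context
  fixes \<mu> :: "nat \<Rightarrow> 'e::euclidean_space measure" and \<nu> :: "'e measure"
  assumes prob_\<mu>: "\<And>n. prob_space (\<mu> n)" and prob_\<nu>: "prob_space \<nu>"
    and sets_\<mu>: "\<And>n. sets (\<mu> n) = sets borel" and sets_\<nu>: "sets \<nu> = sets borel"
    and char_lim: "\<And>\<theta>. (\<lambda>n. \<integral>x. cis (\<theta> \<bullet> x) \<partial>\<mu> n) \<longlonglongrightarrow> (\<integral>x. cis (\<theta> \<bullet> x) \<partial>\<nu>)"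
begin

text \<open>A Parseval identity: the kernel is written as a characteristic function and the
  integrals are exchanged, so that \<open>\<kappa>\<close> enters through its characteristic
  function alone.\<close>

lemma integral_gauss_translate:
  assumes "prob_space \<kappa>" and sets: "sets \<kappa> = sets borel"
  shows "complex_of_real (\<integral>y. gauss (s *\<^sub>R (x - y)) \<partial>\<kappa>)
    = (\<integral>u. cis (s *\<^sub>R x \<bullet> coords u) * (\<integral>y. cis ((- s *\<^sub>R coords u) \<bullet> y) \<partial>\<kappa>) \<partial>(std_gauss :: ('e \<Rightarrow> real) measure))"
proof -
  interpret \<kappa>: prob_space \<kappa> by fact
  interpret G: prob_space "std_gauss :: ('e \<Rightarrow> real) measure" by (rule prob_space_std_gauss)
  interpret GK: pair_prob_space "std_gauss :: ('e \<Rightarrow> real) measure" \<kappa> ..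
  note [measurable_cong] = sets
  have "complex_of_real (\<integral>y. gauss (s *\<^sub>R (x - y)) \<partial>\<kappa>) = (\<integral>y. \<integral>u. cis (s *\<^sub>R (x - y) \<bullet> coords u) \<partial>std_gauss \<partial>\<kappa>)"
    unfolding integral_complex_of_real[symmetric] gauss_char ..
  also have "\<dots> = (\<integral>u. \<integral>y. cis (s *\<^sub>R (x - y) \<bullet> coords u) \<partial>\<kappa> \<partial>std_gauss)"
  proof (rule GK.Fubini_integral)
    show "integrable (std_gauss \<Otimes>\<^sub>M \<kappa>) (\<lambda>(u, y). cis (s *\<^sub>R (x - y) \<bullet> coords u))"
      by (rule GK.integrable_const_bound[where B=1]) (auto simp: cis_conv_exp case_prod_unfold)
  qed
  also have "\<dots> = (\<integral>u. cis (s *\<^sub>R x \<bullet> coords u) * (\<integral>y. cis ((- s *\<^sub>R coords u) \<bullet> y) \<partial>\<kappa>) \<partial>std_gauss)"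
    unfolding integral_mult_right_zero[symmetric]
    by (intro Bochner_Integration.integral_cong refl)
      (simp add: cis_mult inner_diff_left inner_diff_right inner_commute right_diff_distrib)
  finally show ?thesis .
qed

lemma gauss_translate_limit:
  "(\<lambda>n. \<integral>y. gauss (s *\<^sub>R (x - y)) \<partial>\<mu> n) \<longlonglongrightarrow> (\<integral>y. gauss (s *\<^sub>R (x - y)) \<partial>\<nu>)"
proof -
  interpret G: prob_space "std_gauss :: ('e \<Rightarrow> real) measure" by (rule prob_space_std_gauss)
  have bound: "norm (\<integral>y. cis (\<theta> \<bullet> y) \<partial>\<kappa>) \<le> 1" if "prob_space \<kappa>" for \<kappa> :: "'e measure" and \<theta>
  proof -
    interpret \<kappa>: prob_space \<kappa> by fact
    have "norm (\<integral>y. cis (\<theta> \<bullet> y) \<partial>\<kappa>) \<le> (\<integral>y. norm (cis (\<theta> \<bullet> y)) \<partial>\<kappa>)"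
      by (rule integral_norm_bound)
    then show ?thesis
      by (simp add: \<kappa>.prob_space)
  qed
  have meas: "(\<lambda>u. \<integral>y. cis ((- s *\<^sub>R coords u) \<bullet> y) \<partial>\<kappa>) \<in> borel_measurable (std_gauss :: ('e \<Rightarrow> real) measure)"
    if "prob_space \<kappa>" "sets \<kappa> = sets borel" for \<kappa> :: "'e measure"
  proof -
    interpret \<kappa>: prob_space \<kappa> by fact
    note [measurable_cong] = that(2)
    show ?thesis
      unfolding cis_conv_exp by measurable
  qed
  note [measurable] = meas[OF prob_\<nu> sets_\<nu>] meas[OF prob_\<mu> sets_\<mu>]
  have "(\<lambda>n. \<integral>u. cis (s *\<^sub>R x \<bullet> coords u) * (\<integral>y. cis ((- s *\<^sub>R coords u) \<bullet> y) \<partial>\<mu> n) \<partial>(std_gauss :: ('e \<Rightarrow> real) measure))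
      \<longlonglongrightarrow> (\<integral>u. cis (s *\<^sub>R x \<bullet> coords u) * (\<integral>y. cis ((- s *\<^sub>R coords u) \<bullet> y) \<partial>\<nu>) \<partial>(std_gauss :: ('e \<Rightarrow> real) measure))"
  proof (rule integral_dominated_convergence[where w="\<lambda>_. 1"])
    show "(\<lambda>u. cis (s *\<^sub>R x \<bullet> coords u) * (\<integral>y. cis ((- s *\<^sub>R coords u) \<bullet> y) \<partial>\<nu>)) \<in> borel_measurable (std_gauss :: ('e \<Rightarrow> real) measure)"
      unfolding cis_conv_exp[of "s *\<^sub>R x \<bullet> _"] by measurable
    show "(\<lambda>u. cis (s *\<^sub>R x \<bullet> coords u) * (\<integral>y. cis ((- s *\<^sub>R coords u) \<bullet> y) \<partial>\<mu> n)) \<in> borel_measurable (std_gauss :: ('e \<Rightarrow> real) measure)" for n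
      unfolding cis_conv_exp[of "s *\<^sub>R x \<bullet> _"] by measurable
    show "AE u in std_gauss. (\<lambda>n. cis (s *\<^sub>R x \<bullet> coords u) * (\<integral>y. cis ((- s *\<^sub>R coords u) \<bullet> y) \<partial>\<mu> n))
        \<longlonglongrightarrow> cis (s *\<^sub>R x \<bullet> coords u) * (\<integral>y. cis ((- s *\<^sub>R coords u) \<bullet> y) \<partial>\<nu>)"
      by (intro AE_I2 tendsto_mult tendsto_const char_lim)
    show "AE u in std_gauss. norm (cis (s *\<^sub>R x \<bullet> coords u) * (\<integral>y. cis ((- s *\<^sub>R coords u) \<bullet> y) \<partial>\<mu> n)) \<le> 1" for n
      using bound[OF prob_\<mu>] by (intro AE_I2) (simp only: norm_mult norm_cis mult_1_left)
  qed simp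
  then have "(\<lambda>n. complex_of_real (\<integral>y. gauss (s *\<^sub>R (x - y)) \<partial>\<mu> n)) \<longlonglongrightarrow> complex_of_real (\<integral>y. gauss (s *\<^sub>R (x - y)) \<partial>\<nu>)"
    by (simp only: integral_gauss_translate[OF prob_\<mu> sets_\<mu>] integral_gauss_translate[OF prob_\<nu> sets_\<nu>])
  then show ?thesis
    by (simp add: tendsto_of_real_iff)
qed

text \<open>After an exchange of integrals the inner Gaussian integrals converge pointwise and are
  bounded by 1, so \<open>\<bar>f x\<bar>\<close> dominates.\<close>

lemma smooth_limit:
  assumes f: "integrable lborel f" and \<sigma>: "0 < \<sigma>"
  shows "(\<lambda>n. \<integral>y. smooth \<sigma> f y \<partial>\<mu> n) \<longlonglongrightarrow> (\<integral>y. smooth \<sigma> f y \<partial>\<nu>)"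
proof -
  have f_meas [measurable]: "f \<in> borel_measurable borel"
    using borel_measurable_integrable[OF f] by simp
  have swap: "\<sigma> ^ DIM('e) * (\<integral>y. smooth \<sigma> f y \<partial>\<kappa>) = (\<integral>x. f x * (\<integral>y. gauss ((1 / \<sigma>) *\<^sub>R (x - y)) \<partial>\<kappa>) \<partial>lborel)"
    if \<kappa>: "prob_space \<kappa>" "sets \<kappa> = sets borel" for \<kappa> :: "'e measure"
  proof -
    interpret \<kappa>: prob_space \<kappa> by fact
    interpret LK: pair_sigma_finite "lborel :: 'e measure" \<kappa> ..
    note [measurable_cong] = \<kappa>(2)
    have "\<sigma> ^ DIM('e) * (\<integral>y. smooth \<sigma> f y \<partial>\<kappa>) = (\<integral>y. \<integral>x. f x * gauss ((1 / \<sigma>) *\<^sub>R (x - y)) \<partial>lborel \<partial>\<kappa>)"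
      unfolding integral_mult_right_zero[symmetric] smooth_eq[OF \<sigma> f_meas] ..
    also have "\<dots> = (\<integral>x. \<integral>y. f x * gauss ((1 / \<sigma>) *\<^sub>R (x - y)) \<partial>\<kappa> \<partial>lborel)"
    proof (rule LK.Fubini_integral)
      have "integrable (lborel \<Otimes>\<^sub>M \<kappa>) (\<lambda>(x, y). f x)"
      proof (rule LK.Fubini_integrable)
        show "integrable lborel (\<lambda>x. \<integral>y. norm (case (x, y) of (x, y) \<Rightarrow> f x) \<partial>\<kappa>)"
          using f by (simp add: \<kappa>.prob_space)
      qed auto
      then show "integrable (lborel \<Otimes>\<^sub>M \<kappa>) (\<lambda>(x, y). f x * gauss ((1 / \<sigma>) *\<^sub>R (x - y)))"
        by (rule Bochner_Integration.integrable_bound)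
          (auto simp: abs_mult gauss_def intro!: AE_I2 mult_left_le)
    qed
    finally show ?thesis
      by simp
  qed
  have b: "\<bar>\<integral>y. gauss ((1 / \<sigma>) *\<^sub>R (x - y)) \<partial>\<kappa>\<bar> \<le> 1" if "prob_space \<kappa>" for \<kappa> :: "'e measure" and x
  proof -
    interpret \<kappa>: prob_space \<kappa> by fact
    have "\<bar>\<integral>y. gauss ((1 / \<sigma>) *\<^sub>R (x - y)) \<partial>\<kappa>\<bar> \<le> (\<integral>y. \<bar>gauss ((1 / \<sigma>) *\<^sub>R (x - y))\<bar> \<partial>\<kappa>)"
      by (rule integral_abs_bound)
    also have "\<dots> \<le> 1"
    proof (cases "integrable \<kappa> (\<lambda>y. \<bar>gauss ((1 / \<sigma>) *\<^sub>R (x - y))\<bar>)")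
      case True
      then have "(\<integral>y. \<bar>gauss ((1 / \<sigma>) *\<^sub>R (x - y))\<bar> \<partial>\<kappa>) \<le> (\<integral>y. 1 \<partial>\<kappa>)"
        by (intro integral_mono) (auto simp: gauss_def)
      then show ?thesis
        by (simp add: \<kappa>.prob_space)
    qed (simp add: not_integrable_integral_eq)
    finally show ?thesis .
  qed
  have meas: "(\<lambda>x. \<integral>y. gauss ((1 / \<sigma>) *\<^sub>R (x - y)) \<partial>\<kappa>) \<in> borel_measurable borel"
    if "prob_space \<kappa>" "sets \<kappa> = sets borel" for \<kappa> :: "'e measure"
  proof -
    interpret \<kappa>: prob_space \<kappa> by fact
    note [measurable_cong] = that(2)
    show ?thesis
      by measurable
  qed
  note [measurable] = meas[OF prob_\<nu> sets_\<nu>] meas[OF prob_\<mu> sets_\<mu>]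
  have "(\<lambda>n. \<integral>x. f x * (\<integral>y. gauss ((1 / \<sigma>) *\<^sub>R (x - y)) \<partial>\<mu> n) \<partial>lborel)
      \<longlonglongrightarrow> (\<integral>x. f x * (\<integral>y. gauss ((1 / \<sigma>) *\<^sub>R (x - y)) \<partial>\<nu>) \<partial>lborel)"
  proof (rule integral_dominated_convergence[where w="\<lambda>x. \<bar>f x\<bar>"])
    show "AE x in lborel. (\<lambda>n. f x * (\<integral>y. gauss ((1 / \<sigma>) *\<^sub>R (x - y)) \<partial>\<mu> n))
        \<longlonglongrightarrow> f x * (\<integral>y. gauss ((1 / \<sigma>) *\<^sub>R (x - y)) \<partial>\<nu>)"
      by (intro AE_I2 tendsto_mult tendsto_const gauss_translate_limit)
    show "AE x in lborel. norm (f x * (\<integral>y. gauss ((1 / \<sigma>) *\<^sub>R (x - y)) \<partial>\<mu> n)) \<le> \<bar>f x\<bar>" for n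
      using b[OF prob_\<mu>] by (intro AE_I2) (auto simp: abs_mult intro!: mult_left_le)
  qed (use f in auto)
  then have "(\<lambda>n. \<sigma> ^ DIM('e) * (\<integral>y. smooth \<sigma> f y \<partial>\<mu> n)) \<longlonglongrightarrow> \<sigma> ^ DIM('e) * (\<integral>y. smooth \<sigma> f y \<partial>\<nu>)"
    by (simp only: swap[OF prob_\<mu> sets_\<mu>] swap[OF prob_\<nu> sets_\<nu>])
  then show ?thesis
    using \<sigma> by (subst (asm) tendsto_mult_left_iff) auto
qed

text \<open>Smoothing approximates \<open>K * f\<close> uniformly, hence simultaneously for all the
  measures involved; the factor \<open>K > 0\<close> is divided out at the end.\<close>

lemma compact_support_limit:
  fixes f :: "'e \<Rightarrow> real"
  assumes cont: "continuous_on UNIV f" and supp: "\<And>x. R < norm x \<Longrightarrow> f x = 0"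
  shows "(\<lambda>n. \<integral>y. f y \<partial>\<mu> n) \<longlonglongrightarrow> (\<integral>y. f y \<partial>\<nu>)"
proof -
  have f_meas [measurable]: "f \<in> borel_measurable borel"
    using cont by (rule borel_measurable_continuous_onI)
  have "bounded (f ` cball 0 R)"
    using cont by (intro compact_imp_bounded compact_continuous_image continuous_on_subset[OF cont]) auto
  then obtain B0 where "\<forall>x\<in>f ` cball 0 R. norm x \<le> B0"
    unfolding bounded_iff by blast
  then have B0: "norm x \<le> R \<Longrightarrow> \<bar>f x\<bar> \<le> B0" for x
    by simp
  define B where "B = max B0 0"
  have B: "\<bar>f x\<bar> \<le> B" for x
    using B0[of x] supp[of x] by (cases "norm x \<le> R") (auto simp: B_def)
  have f_int: "integrable lborel f"
  proof (rule Bochner_Integration.integrable_bound)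
    show "integrable lborel (\<lambda>x::'e. B * indicator (cball 0 R) x)"
      by (intro integrable_mult_right integrable_real_indicator) (use emeasure_lborel_cball_finite[of "0::'e" R] in auto)
    show "AE x in lborel. norm (f x) \<le> norm (B * indicator (cball 0 R) x)"
      using B supp by (intro AE_I2) (auto simp: indicator_def B_def not_le)
  qed simp
  have uc: "uniformly_continuous_on UNIV f"
    unfolding uniformly_continuous_on_def
  proof (intro allI impI)
    fix e :: real assume e: "0 < e"
    have "uniformly_continuous_on (cball 0 (R + 1)) f"
      by (intro compact_uniformly_continuous continuous_on_subset[OF cont]) auto
    then obtain d where d: "d > 0" "\<And>x y. x \<in> cball 0 (R + 1) \<Longrightarrow> y \<in> cball 0 (R + 1) \<Longrightarrow> dist y x < d \<Longrightarrow> dist (f y) (f x) < e"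
      unfolding uniformly_continuous_on_def using e by metis
    show "\<exists>d>0. \<forall>x\<in>UNIV. \<forall>x'\<in>UNIV. dist x' x < d \<longrightarrow> dist (f x') (f x) < e"
    proof (intro exI[of _ "min d 1"] conjI ballI impI)
      fix x y :: 'e assume xy: "dist y x < min d 1"
      have n: "norm y \<le> norm x + dist y x" "norm x \<le> norm y + dist y x"
        by (auto simp: dist_norm) norm+
      show "dist (f y) (f x) < e"
      proof (cases "x \<in> cball 0 (R + 1) \<and> y \<in> cball 0 (R + 1)")
        case True
        then show ?thesis
          using d(2)[of x y] xy by simp
      next
        case False
        \<comment> \<open>One point lies outside the larger ball and the two are closer than 1, so
          both lie where \<open>f\<close> vanishes.\<close>
        then have "R < norm x" "R < norm y"
          using n xy by auto
        then show ?thesis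
          using supp e by simp
      qed
    qed (use d in auto)
  qed
  define K where "K = (\<integral>w. gauss w \<partial>(lborel :: 'e measure))"
  have K: "0 < K"
    unfolding K_def by (rule integral_gauss_pos)
  have "(\<lambda>n. K * (\<integral>y. f y \<partial>\<mu> n)) \<longlonglongrightarrow> K * (\<integral>y. f y \<partial>\<nu>)"
  proof (rule LIMSEQ_I)
    fix e :: real assume e: "0 < e"
    obtain \<sigma> where \<sigma>: "0 < \<sigma>" "\<And>y. \<bar>smooth \<sigma> f y - K * f y\<bar> \<le> e / 4"
      using smooth_close[OF f_meas B uc, of "e / 4"] e unfolding K_def by auto
    have smooth_meas: "smooth \<sigma> f \<in> borel_measurable borel"
      unfolding smooth_def[abs_def] by measurable
    have close: "\<bar>(\<integral>y. smooth \<sigma> f y \<partial>\<kappa>) - K * (\<integral>y. f y \<partial>\<kappa>)\<bar> \<le> e / 4"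
      if \<kappa>: "prob_space \<kappa>" "sets \<kappa> = sets borel" for \<kappa> :: "'e measure"
    proof -
      interpret \<kappa>: prob_space \<kappa> by fact
      have m: "f \<in> borel_measurable \<kappa>" "smooth \<sigma> f \<in> borel_measurable \<kappa>"
        unfolding measurable_cong_sets[OF \<kappa>(2) refl] by (rule f_meas, rule smooth_meas)
      have i1: "integrable \<kappa> f"
        using B m by (intro \<kappa>.integrable_const_bound[where B=B]) auto
      have i2: "integrable \<kappa> (smooth \<sigma> f)"
      proof (intro \<kappa>.integrable_const_bound[where B="K * B + e / 4"] AE_I2)
        fix y
        have "\<bar>K * f y\<bar> \<le> K * B"
          using K B by (simp add: abs_mult)
        then show "norm (smooth \<sigma> f y) \<le> K * B + e / 4"
          using \<sigma>(2)[of y] unfolding real_norm_def by linarith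
      qed (rule m)
      have "\<bar>(\<integral>y. smooth \<sigma> f y \<partial>\<kappa>) - K * (\<integral>y. f y \<partial>\<kappa>)\<bar> = \<bar>\<integral>y. smooth \<sigma> f y - K * f y \<partial>\<kappa>\<bar>"
        using i1 i2 by simp
      also have "\<dots> \<le> (\<integral>y. \<bar>smooth \<sigma> f y - K * f y\<bar> \<partial>\<kappa>)"
        by (rule integral_abs_bound)
      also have "\<dots> \<le> (\<integral>y. e / 4 \<partial>\<kappa>)"
        using i1 i2 \<sigma> by (intro integral_mono integrable_abs Bochner_Integration.integrable_diff integrable_mult_right) auto
      finally show ?thesis
        by (simp add: \<kappa>.prob_space)
    qed
    obtain n0 where n0: "\<And>n. n \<ge> n0 \<Longrightarrow> \<bar>(\<integral>y. smooth \<sigma> f y \<partial>\<mu> n) - (\<integral>y. smooth \<sigma> f y \<partial>\<nu>)\<bar> < e / 4"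
      using LIMSEQ_D[OF smooth_limit[OF f_int \<sigma>(1)], of "e / 4"] e by auto
    have "norm (K * (\<integral>y. f y \<partial>\<mu> n) - K * (\<integral>y. f y \<partial>\<nu>)) < e" if "n \<ge> n0" for n
      using n0[OF that] close[OF prob_\<mu> sets_\<mu>, of n] close[OF prob_\<nu> sets_\<nu>] e unfolding real_norm_def by linarith
    then show "\<exists>n0. \<forall>n\<ge>n0. norm (K * (\<integral>y. f y \<partial>\<mu> n) - K * (\<integral>y. f y \<partial>\<nu>)) < e"
      by blast
  qed
  then show ?thesis
    using K by (subst (asm) tendsto_mult_left_iff) auto
qed

text \<open>Tightness comes for free: the cut-off is itself a compactly supported test function, so
  the mass it misses under \<open>\<mu> n\<close> converges to the mass it misses under
  \<open>\<nu>\<close>, which is small for large \<open>R\<close>.\<close>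

theorem Levy_continuity_euclidean:
  fixes f :: "'e \<Rightarrow> real"
  assumes cont: "continuous_on UNIV f" and bdd: "bounded (range f)"
  shows "(\<lambda>n. \<integral>y. f y \<partial>\<mu> n) \<longlonglongrightarrow> (\<integral>y. f y \<partial>\<nu>)"
proof -
  obtain B0 where B0: "\<And>x. \<bar>f x\<bar> \<le> B0"
    using bdd unfolding bounded_iff by auto
  define B where "B = B0 + 1"
  have B: "\<bar>f x\<bar> \<le> B" "0 < B" for x
    using B0[of x] abs_ge_zero[of "f x"] unfolding B_def by linarith+
  define cut where "cut R x = max 0 (min 1 (real R + 1 - norm x))" for R :: nat and x :: 'e
  have cut: "0 \<le> cut R x" "cut R x \<le> 1" "real R + 1 < norm x \<Longrightarrow> cut R x = 0" for R x
    by (auto simp: cut_def)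
  have cut_cont: "continuous_on UNIV (cut R)" for R
    unfolding cut_def by (intro continuous_intros)
  have cut_meas: "cut R \<in> borel_measurable borel" for R
    using cut_cont by (rule borel_measurable_continuous_onI)
  have f_meas: "f \<in> borel_measurable borel"
    using cont by (rule borel_measurable_continuous_onI)
  have ints: "integrable \<kappa> f" "integrable \<kappa> (cut R)" "integrable \<kappa> (\<lambda>x. f x * cut R x)"
    if \<kappa>: "prob_space \<kappa>" "sets \<kappa> = sets borel" for \<kappa> :: "'e measure" and R
  proof -
    interpret \<kappa>: prob_space \<kappa> by fact
    have m: "f \<in> borel_measurable \<kappa>" "cut R \<in> borel_measurable \<kappa>"
      using f_meas cut_meas measurable_cong_sets[OF \<kappa>(2) refl] by auto
    show "integrable \<kappa> f"
      using B m by (intro \<kappa>.integrable_const_bound[where B=B]) auto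
    show "integrable \<kappa> (cut R)"
      using cut m by (intro \<kappa>.integrable_const_bound[where B=1]) (auto simp: abs_of_nonneg)
    have "\<bar>f x * cut R x\<bar> \<le> B * 1" for x
      unfolding abs_mult using B cut by (intro mult_mono) (auto simp: abs_of_nonneg)
    then show "integrable \<kappa> (\<lambda>x. f x * cut R x)"
      using m by (intro \<kappa>.integrable_const_bound[where B=B]) auto
  qed
  have tail: "\<bar>(\<integral>y. f y \<partial>\<kappa>) - (\<integral>y. f y * cut R y \<partial>\<kappa>)\<bar> \<le> B * (1 - (\<integral>y. cut R y \<partial>\<kappa>))"
    if \<kappa>: "prob_space \<kappa>" "sets \<kappa> = sets borel" for \<kappa> :: "'e measure" and R
  proof -
    interpret \<kappa>: prob_space \<kappa> by fact
    have "\<bar>(\<integral>y. f y \<partial>\<kappa>) - (\<integral>y. f y * cut R y \<partial>\<kappa>)\<bar> = \<bar>\<integral>y. f y - f y * cut R y \<partial>\<kappa>\<bar>"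
      using ints[OF \<kappa>] by simp
    also have "\<dots> \<le> (\<integral>y. \<bar>f y - f y * cut R y\<bar> \<partial>\<kappa>)"
      by (rule integral_abs_bound)
    also have "\<dots> \<le> (\<integral>y. B * (1 - cut R y) \<partial>\<kappa>)"
    proof (intro integral_mono)
      fix y
      have "\<bar>f y - f y * cut R y\<bar> = \<bar>f y\<bar> * (1 - cut R y)"
        using cut[of R y] abs_mult[of "f y" "1 - cut R y"] by (simp add: right_diff_distrib)
      then show "\<bar>f y - f y * cut R y\<bar> \<le> B * (1 - cut R y)"
        using B cut by (simp add: mult_right_mono)
    qed (use ints[OF \<kappa>] in auto)
    also have "\<dots> = B * (1 - (\<integral>y. cut R y \<partial>\<kappa>))"
      using ints[OF \<kappa>] by (simp add: \<kappa>.prob_space)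
    finally show ?thesis .
  qed
  interpret \<nu>: prob_space \<nu> by (rule prob_\<nu>)
  have cut_lim: "(\<lambda>R. \<integral>y. cut R y \<partial>\<nu>) \<longlonglongrightarrow> (\<integral>y. 1 \<partial>\<nu>)"
  proof (rule integral_dominated_convergence[where w="\<lambda>_. 1"])
    show "AE y in \<nu>. (\<lambda>R. cut R y) \<longlonglongrightarrow> 1"
    proof (intro AE_I2 tendsto_eventually)
      fix y
      show "\<forall>\<^sub>F R in sequentially. cut R y = 1"
        by (rule eventually_sequentiallyI[of "nat \<lceil>norm y\<rceil>"]) (auto simp: cut_def)
    qed
    show "cut R \<in> borel_measurable \<nu>" for R
      using cut_meas measurable_cong_sets[OF sets_\<nu> refl] by auto
  qed (use cut in auto)
  show ?thesis
  proof (rule LIMSEQ_I)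
    fix e :: real assume e: "0 < e"
    \<comment> \<open>Two tails of at most \<open>B * d = e / 4\<close> each and an error below
      \<open>e / 4\<close> for the cut-off integrals stay below \<open>e\<close>.\<close>
    define d where "d = e / (4 * B)"
    have d: "0 < d" "B * d = e / 4"
      using e B by (auto simp: d_def)
    have "\<forall>\<^sub>F R in sequentially. 1 - d < (\<integral>y. cut R y \<partial>\<nu>)"
      using d by (intro order_tendstoD(1)[OF cut_lim]) (simp add: \<nu>.prob_space)
    then obtain R where R: "1 - d < (\<integral>y. cut R y \<partial>\<nu>)"
      by (auto dest: eventually_happens)
    have "(\<lambda>n. \<integral>y. cut R y \<partial>\<mu> n) \<longlonglongrightarrow> (\<integral>y. cut R y \<partial>\<nu>)"
      using cut(3) by (intro compact_support_limit[OF cut_cont, of "real R + 1"])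
    then have "\<forall>\<^sub>F n in sequentially. 1 - d < (\<integral>y. cut R y \<partial>\<mu> n)"
      using R by (rule order_tendstoD(1))
    moreover have "(\<lambda>n. \<integral>y. f y * cut R y \<partial>\<mu> n) \<longlonglongrightarrow> (\<integral>y. f y * cut R y \<partial>\<nu>)"
      using cut(3) by (intro compact_support_limit[of _ "real R + 1"] continuous_on_mult cont cut_cont) auto
    then have "\<forall>\<^sub>F n in sequentially. dist (\<integral>y. f y * cut R y \<partial>\<mu> n) (\<integral>y. f y * cut R y \<partial>\<nu>) < e / 4"
      using e by (intro tendstoD) auto
    ultimately have "\<forall>\<^sub>F n in sequentially. norm ((\<integral>y. f y \<partial>\<mu> n) - (\<integral>y. f y \<partial>\<nu>)) < e"
    proof eventually_elim
      case (elim n)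
      have "B * (1 - (\<integral>y. cut R y \<partial>\<mu> n)) \<le> e / 4" "B * (1 - (\<integral>y. cut R y \<partial>\<nu>)) \<le> e / 4"
        unfolding d(2)[symmetric] using elim R B by (auto intro!: mult_left_mono)
      then show ?case
        using tail[OF prob_\<mu> sets_\<mu>, of n R] tail[OF prob_\<nu> sets_\<nu>, of R] elim e
        unfolding dist_real_def real_norm_def by linarith
    qed
    then show "\<exists>n0. \<forall>n\<ge>n0. norm ((\<integral>y. f y \<partial>\<mu> n) - (\<integral>y. f y \<partial>\<nu>)) < e"
      by (simp add: eventually_sequentially)
  qed
qed

end

section \<open>Characteristic functional of a Poisson point measure\<close>

text \<open>The exponential series at \<open>r * cis c\<close>. For \<open>c = 0\<close> it says
  that the Poisson weights sum to 1.\<close>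

lemma poisson_prob_sums:
  fixes r c :: real
  shows "(\<lambda>k. cis (c * real k) * complex_of_real (poisson_prob r k)) sums exp (complex_of_real r * (cis c - 1))"
proof -
  define x where "x = complex_of_real r * cis c"
  have "(\<lambda>k. (x ^ k /\<^sub>R fact k) * complex_of_real (exp (- r))) sums (exp x * complex_of_real (exp (- r)))"
    by (intro sums_mult2 exp_converges)
  moreover have "(x ^ k /\<^sub>R fact k) * complex_of_real (exp (- r)) = cis (c * real k) * complex_of_real (poisson_prob r k)" for k
  proof -
    define z where "z = cis (c * real k)"
    have "cis c ^ k = z"
      unfolding z_def mult.commute[of c] by (rule Complex.DeMoivre)
    then have x: "x ^ k = complex_of_real (r ^ k) * z"
      by (simp only: x_def power_mult_distrib of_real_power)
    show ?thesis
      unfolding x z_def[symmetric] poisson_prob_def by (simp add: scaleR_conv_of_real field_simps)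
  qed
  moreover have "exp x * complex_of_real (exp (- r)) = exp (complex_of_real r * (cis c - 1))"
  proof -
    have "exp x * complex_of_real (exp (- r)) = exp (x + complex_of_real (- r))"
      by (simp only: exp_of_real[symmetric] exp_add)
    then show ?thesis
      by (simp add: x_def algebra_simps)
  qed
  ultimately show ?thesis
    by simp
qed

section \<open>Measurability of sums over atoms\<close>

lemma measurable_atom_finite [measurable]:
  assumes A: "A \<in> sets \<mu>"
  shows "Measurable.pred (Pi\<^sub>M UNIV (\<lambda>_::nat. count_space UNIV \<Otimes>\<^sub>M \<mu>))
    (\<lambda>z. finite {j. fst (z j) \<and> snd (z j) \<in> A})"
proof -
  note [measurable] = A
  have "finite {j. fst (z j) \<and> snd (z j) \<in> A} \<longleftrightarrow> (\<exists>n. \<forall>j. n \<le> j \<longrightarrow> \<not> (fst (z j) \<and> snd (z j) \<in> A))" for z :: "nat \<Rightarrow> bool \<times> 'a"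
    unfolding finite_nat_set_iff_bounded by (intro iff_exI) (auto simp flip: not_le)
  then show ?thesis
    by simp
qed

text \<open>A sum over an infinite index set is 0 by convention, so the approximating partial sums
  carry a finiteness test that makes them 0 on such configurations.\<close>

lemma measurable_atom_sum:
  fixes h :: "'e \<Rightarrow> 'b::{real_normed_vector, second_countable_topology}"
  assumes A: "A \<in> sets \<mu>" and h: "h \<in> borel_measurable \<mu>"
  shows "(\<lambda>z. \<Sum>j\<in>{j. fst (z j) \<and> snd (z j) \<in> A}. h (snd (z j)))
    \<in> borel_measurable (Pi\<^sub>M UNIV (\<lambda>_::nat. count_space UNIV \<Otimes>\<^sub>M \<mu>))"
proof -
  note [measurable] = A h
  define S where "S z = {j. fst (z j) \<and> snd (z j) \<in> A}" for z :: "nat \<Rightarrow> bool \<times> 'e"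
  define F where "F n z = (if finite (S z) then \<Sum>j<n. if fst (z j) \<and> snd (z j) \<in> A then h (snd (z j)) else 0 else 0)" for n z
  show ?thesis
    unfolding S_def[symmetric]
  proof (rule borel_measurable_LIMSEQ_metric)
    show "F n \<in> borel_measurable (Pi\<^sub>M UNIV (\<lambda>_::nat. count_space UNIV \<Otimes>\<^sub>M \<mu>))" for n
      unfolding F_def S_def by measurable
    fix z
    show "(\<lambda>n. F n z) \<longlonglongrightarrow> (\<Sum>j\<in>S z. h (snd (z j)))"
    proof (cases "finite (S z)")
      case True
      then obtain n0 where n0: "\<And>j. j \<in> S z \<Longrightarrow> j < n0"
        unfolding finite_nat_set_iff_bounded by blast
      show ?thesis
      proof (intro tendsto_eventually eventually_sequentiallyI[of n0])
        fix n assume "n0 \<le> n"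
        then have "S z \<subseteq> {..<n}"
          using n0 by force
        have "(\<Sum>j<n. if fst (z j) \<and> snd (z j) \<in> A then h (snd (z j)) else 0) = (\<Sum>j\<in>{j\<in>{..<n}. j \<in> S z}. h (snd (z j)))"
          by (subst sum.inter_filter) (auto simp: S_def)
        also have "{j\<in>{..<n}. j \<in> S z} = S z"
          using \<open>S z \<subseteq> {..<n}\<close> by auto
        finally show "F n z = (\<Sum>j\<in>S z. h (snd (z j)))"
          using True by (simp add: F_def)
      qed
    qed (simp add: F_def)
  qed
qed

context
  fixes N :: "'v measure" and \<mu> :: "'e measure" and J :: "'v \<Rightarrow> nat set" and atom :: "nat \<Rightarrow> 'v \<Rightarrow> 'e"
  assumes N: "prob_space N" and PPM: "poisson_point_measure N \<mu> J atom"
begin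

interpretation prob_space N by (rule N)

lemma measurable_PPM: "(\<lambda>\<omega> j. (j \<in> J \<omega>, atom j \<omega>)) \<in> N \<rightarrow>\<^sub>M Pi\<^sub>M UNIV (\<lambda>_. count_space UNIV \<Otimes>\<^sub>M \<mu>)"
  using PPM by (simp add: poisson_point_measure_def)

lemma measurable_PPM_sum:
  fixes h :: "'e \<Rightarrow> 'b::{real_normed_vector, second_countable_topology}"
  assumes "A \<in> sets \<mu>" "h \<in> borel_measurable \<mu>"
  shows "(\<lambda>\<omega>. \<Sum>j\<in>{j\<in>J \<omega>. atom j \<omega> \<in> A}. h (atom j \<omega>)) \<in> borel_measurable N"
  using measurable_compose[OF measurable_PPM measurable_atom_sum[OF assms]] by simp

lemma measurable_PPM_finite:
  assumes "A \<in> sets \<mu>"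
  shows "Measurable.pred N (\<lambda>\<omega>. finite {j\<in>J \<omega>. atom j \<omega> \<in> A})"
  using measurable_compose[OF measurable_PPM measurable_atom_finite[OF assms]] by simp

lemma PPM_counts:
  fixes m :: nat and A :: "nat \<Rightarrow> 'e set"
  assumes "\<And>i. i < m \<Longrightarrow> A i \<in> sets \<mu> \<and> emeasure \<mu> (A i) < \<infinity>" "disjoint_family_on A {..<m}"
  shows "indep_vars (\<lambda>_. count_space UNIV) (\<lambda>i \<omega>. card {j\<in>J \<omega>. atom j \<omega> \<in> A i}) {..<m}"
    and "\<And>i k. i < m \<Longrightarrow> prob {\<omega>\<in>space N. finite {j\<in>J \<omega>. atom j \<omega> \<in> A i} \<and> card {j\<in>J \<omega>. atom j \<omega> \<in> A i} = k}
      = poisson_prob (measure \<mu> (A i)) k"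
  using PPM[unfolded poisson_point_measure_def, THEN conjunct2, rule_format, of m A] assms by auto

lemma PPM_count:
  assumes A: "A \<in> sets \<mu>" "emeasure \<mu> A < \<infinity>"
  shows "(\<lambda>\<omega>. card {j\<in>J \<omega>. atom j \<omega> \<in> A}) \<in> N \<rightarrow>\<^sub>M count_space UNIV"
    and "prob {\<omega>\<in>space N. finite {j\<in>J \<omega>. atom j \<omega> \<in> A} \<and> card {j\<in>J \<omega>. atom j \<omega> \<in> A} = k} = poisson_prob (measure \<mu> A) k"
proof -
  have *: "\<And>i::nat. i < 1 \<Longrightarrow> (\<lambda>_. A) i \<in> sets \<mu> \<and> emeasure \<mu> ((\<lambda>_. A) i) < \<infinity>" "disjoint_family_on (\<lambda>_. A) {..<1::nat}"
    using A by (auto simp: disjoint_family_on_def)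
  show "(\<lambda>\<omega>. card {j\<in>J \<omega>. atom j \<omega> \<in> A}) \<in> N \<rightarrow>\<^sub>M count_space UNIV"
    using PPM_counts(1)[OF *] by (auto simp: indep_vars_def)
  show "prob {\<omega>\<in>space N. finite {j\<in>J \<omega>. atom j \<omega> \<in> A} \<and> card {j\<in>J \<omega>. atom j \<omega> \<in> A} = k} = poisson_prob (measure \<mu> A) k"
    using PPM_counts(2)[OF *, where i=0 and k=k] by simp
qed

text \<open>\<open>card\<close> of an infinite set is 0, so the count alone cannot tell. The
  definition attaches finiteness to each value of the count, and the Poisson weights sum to
  1.\<close>

lemma PPM_AE_finite:
  assumes A: "A \<in> sets \<mu>" "emeasure \<mu> A < \<infinity>"
  shows "AE \<omega> in N. finite {j\<in>J \<omega>. atom j \<omega> \<in> A}"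
proof -
  note [measurable] = PPM_count(1)[OF A] measurable_PPM_finite[OF A(1)]
  define E where "E k = {\<omega>\<in>space N. finite {j\<in>J \<omega>. atom j \<omega> \<in> A} \<and> card {j\<in>J \<omega>. atom j \<omega> \<in> A} = k}" for k
  have "(\<lambda>k. prob (E k)) sums prob (\<Union>k. E k)"
    by (rule finite_measure_UNION) (auto simp: disjoint_family_on_def E_def)
  moreover have "(\<Union>k. E k) = {\<omega>\<in>space N. finite {j\<in>J \<omega>. atom j \<omega> \<in> A}}"
    by (auto simp: E_def)
  moreover have "(\<lambda>k. prob (E k)) sums 1"
  proof -
    have "(\<lambda>k. complex_of_real (poisson_prob (measure \<mu> A) k)) sums complex_of_real 1"
      using poisson_prob_sums[of 0 "measure \<mu> A"] by simp
    then have "(\<lambda>k. poisson_prob (measure \<mu> A) k) sums 1"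
      unfolding sums_of_real_iff .
    then show ?thesis
      unfolding E_def PPM_count(2)[OF A] .
  qed
  ultimately have "prob {\<omega>\<in>space N. finite {j\<in>J \<omega>. atom j \<omega> \<in> A}} = 1"
    by (metis sums_unique2)
  then show ?thesis
    by (subst (asm) prob_Collect_eq_1) auto
qed

lemma PPM_count_char:
  assumes A: "A \<in> sets \<mu>" "emeasure \<mu> A < \<infinity>"
  shows "(\<integral>\<omega>. cis (c * real (card {j\<in>J \<omega>. atom j \<omega> \<in> A})) \<partial>N) = exp (complex_of_real (measure \<mu> A) * (cis c - 1))"
proof -
  define K where "K \<omega> = card {j\<in>J \<omega>. atom j \<omega> \<in> A}" for \<omega>
  have K [measurable]: "K \<in> N \<rightarrow>\<^sub>M count_space UNIV"
    unfolding K_def by (rule PPM_count(1)[OF A])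
  have pk: "prob {\<omega>\<in>space N. K \<omega> = k} = poisson_prob (measure \<mu> A) k" for k
  proof -
    have "prob {\<omega>\<in>space N. K \<omega> = k} = prob {\<omega>\<in>space N. finite {j\<in>J \<omega>. atom j \<omega> \<in> A} \<and> K \<omega> = k}"
      by (rule finite_measure_eq_AE) (use PPM_AE_finite[OF A] measurable_PPM_finite[OF A(1)] in auto)
    then show ?thesis
      using PPM_count(2)[OF A] by (simp add: K_def)
  qed
  \<comment> \<open>Partial sums over the values of the count; they are bounded by 1 and exact as
    soon as \<open>n\<close> exceeds the count.\<close>
  define S where "S n \<omega> = (\<Sum>k<n. cis (c * real k) * complex_of_real (indicator {\<omega>\<in>space N. K \<omega> = k} \<omega>))" for n \<omega>
  have S: "S n \<omega> = (if K \<omega> < n then cis (c * real (K \<omega>)) else 0)" if "\<omega> \<in> space N" for n \<omega>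
  proof -
    have "S n \<omega> = (\<Sum>k<n. if k = K \<omega> then cis (c * real k) else 0)"
      unfolding S_def using that by (intro sum.cong) auto
    then show ?thesis
      by simp
  qed
  have "(\<lambda>n. \<integral>\<omega>. S n \<omega> \<partial>N) \<longlonglongrightarrow> (\<integral>\<omega>. cis (c * real (K \<omega>)) \<partial>N)"
  proof (rule integral_dominated_convergence[where w="\<lambda>_. 1"])
    show "AE \<omega> in N. (\<lambda>n. S n \<omega>) \<longlonglongrightarrow> cis (c * real (K \<omega>))"
    proof (intro AE_I2 tendsto_eventually)
      fix \<omega> assume "\<omega> \<in> space N"
      then show "\<forall>\<^sub>F n in sequentially. S n \<omega> = cis (c * real (K \<omega>))"
        using eventually_gt_at_top[of "K \<omega>"] by (auto elim!: eventually_mono simp: S)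
    qed
    show "AE \<omega> in N. norm (S n \<omega>) \<le> 1" for n
      by (intro AE_I2) (simp add: S)
    show "S n \<in> borel_measurable N" for n
      unfolding S_def by measurable
  qed (auto simp: cis_conv_exp)
  moreover have "(\<integral>\<omega>. S n \<omega> \<partial>N) = (\<Sum>k<n. cis (c * real k) * complex_of_real (poisson_prob (measure \<mu> A) k))" for n
  proof -
    have "(\<integral>\<omega>. S n \<omega> \<partial>N) = (\<Sum>k<n. \<integral>\<omega>. cis (c * real k) * complex_of_real (indicator {\<omega>\<in>space N. K \<omega> = k} \<omega>) \<partial>N)"
      unfolding S_def
      by (rule Bochner_Integration.integral_sum, rule integrable_const_bound[where B=1]) (auto simp: norm_mult indicator_def)
    also have "\<dots> = (\<Sum>k<n. cis (c * real k) * complex_of_real (prob {\<omega>\<in>space N. K \<omega> = k}))"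
      by (intro sum.cong refl, subst integral_mult_right_zero, subst integral_complex_of_real) simp
    finally show ?thesis
      unfolding pk .
  qed
  ultimately have "(\<lambda>k. cis (c * real k) * complex_of_real (poisson_prob (measure \<mu> A) k)) sums (\<integral>\<omega>. cis (c * real (K \<omega>)) \<partial>N)"
    by (simp add: sums_def)
  then show ?thesis
    using poisson_prob_sums[of c "measure \<mu> A"] by (simp add: K_def sums_unique2)
qed

text \<open>On the level sets of \<open>h\<close> inside \<open>A\<close> the sum is a linear
  combination of independent Poisson counts.\<close>

lemma PPM_char_simple:
  fixes h :: "'e \<Rightarrow> real"
  assumes A: "A \<in> sets \<mu>" "emeasure \<mu> A < \<infinity>" and h: "simple_function \<mu> h"
  shows "(\<integral>\<omega>. cis (\<Sum>j\<in>{j\<in>J \<omega>. atom j \<omega> \<in> A}. h (atom j \<omega>)) \<partial>N) = exp (\<integral>x. indicator A x *\<^sub>R (cis (h x) - 1) \<partial>\<mu>)"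
proof -
  have h_meas [measurable]: "h \<in> borel_measurable \<mu>"
    using h by (rule borel_measurable_simple_function)
  have "finite (h ` space \<mu>)"
    using h by (rule simple_functionD)
  then obtain m and v :: "nat \<Rightarrow> real" where v: "bij_betw v {..<m} (h ` space \<mu>)"
    using ex_bij_betw_nat_finite[of "h ` space \<mu>"] by (auto simp: atLeast0LessThan)
  define B where "B i = {x\<in>space \<mu>. x \<in> A \<and> h x = v i}" for i
  note [measurable] = A(1)
  have B: "B i \<in> sets \<mu>" "emeasure \<mu> (B i) < \<infinity>" for i
  proof -
    show "B i \<in> sets \<mu>"
      unfolding B_def by measurable
    have "emeasure \<mu> (B i) \<le> emeasure \<mu> A"
      by (rule emeasure_mono) (auto simp: B_def)
    then show "emeasure \<mu> (B i) < \<infinity>"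
      using A by simp
  qed
  have inj: "inj_on v {..<m}" and img: "v ` {..<m} = h ` space \<mu>"
    using v by (auto simp: bij_betw_def)
  have disj: "disjoint_family_on B {..<m}"
    using inj by (auto simp: disjoint_family_on_def B_def inj_on_def)
  have AB: "A = (\<Union>i<m. B i)"
  proof
    show "A \<subseteq> (\<Union>i<m. B i)"
    proof
      fix x assume x: "x \<in> A"
      then have "x \<in> space \<mu>"
        using sets.sets_into_space[OF A(1)] by auto
      then have "h x \<in> v ` {..<m}"
        unfolding img by auto
      then show "x \<in> (\<Union>i<m. B i)"
        using x \<open>x \<in> space \<mu>\<close> by (auto simp: B_def)
    qed
  qed (auto simp: B_def)
  have counts: "\<And>i. i < m \<Longrightarrow> B i \<in> sets \<mu> \<and> emeasure \<mu> (B i) < \<infinity>"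
    using B by auto
  define K where "K i \<omega> = card {j\<in>J \<omega>. atom j \<omega> \<in> B i}" for i \<omega>
  have K_meas: "K i \<in> N \<rightarrow>\<^sub>M count_space UNIV" for i
    unfolding K_def by (rule PPM_count(1)[OF B])
  have ind: "indep_vars (\<lambda>_. count_space UNIV) K {..<m}"
    unfolding K_def[abs_def] by (rule PPM_counts(1)[OF counts disj])
  have "AE \<omega> in N. (\<Sum>j\<in>{j\<in>J \<omega>. atom j \<omega> \<in> A}. h (atom j \<omega>)) = (\<Sum>i<m. v i * real (K i \<omega>))"
    using PPM_AE_finite[OF A]
  proof eventually_elim
    case (elim \<omega>)
    have fin: "finite {j\<in>J \<omega>. atom j \<omega> \<in> B i}" if "i < m" for i
      by (rule finite_subset[OF _ elim]) (auto simp: B_def)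
    have "{j\<in>J \<omega>. atom j \<omega> \<in> A} = (\<Union>i<m. {j\<in>J \<omega>. atom j \<omega> \<in> B i})"
      by (subst AB) auto
    then have "(\<Sum>j\<in>{j\<in>J \<omega>. atom j \<omega> \<in> A}. h (atom j \<omega>)) = (\<Sum>i<m. \<Sum>j\<in>{j\<in>J \<omega>. atom j \<omega> \<in> B i}. h (atom j \<omega>))"
      using fin disj by (simp, intro sum.UNION_disjoint) (auto simp: disjoint_family_on_def)
    also have "\<dots> = (\<Sum>i<m. \<Sum>j\<in>{j\<in>J \<omega>. atom j \<omega> \<in> B i}. v i)"
      by (intro sum.cong refl) (auto simp: B_def)
    finally show ?case
      by (simp add: K_def mult.commute)
  qed
  then have eq: "AE \<omega> in N. cis (\<Sum>j\<in>{j\<in>J \<omega>. atom j \<omega> \<in> A}. h (atom j \<omega>)) = (\<Prod>i<m. cis (v i * real (K i \<omega>)))"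
  proof eventually_elim
    case (elim \<omega>)
    show ?case
      unfolding elim by (simp add: cis_conv_exp exp_sum sum_distrib_left)
  qed
  have "(\<integral>\<omega>. cis (\<Sum>j\<in>{j\<in>J \<omega>. atom j \<omega> \<in> A}. h (atom j \<omega>)) \<partial>N) = (\<integral>\<omega>. (\<Prod>i<m. cis (v i * real (K i \<omega>))) \<partial>N)"
  proof (intro integral_cong_AE)
    show "(\<lambda>\<omega>. cis (\<Sum>j\<in>{j\<in>J \<omega>. atom j \<omega> \<in> A}. h (atom j \<omega>))) \<in> borel_measurable N"
      using measurable_PPM_sum[OF A(1) h_meas] unfolding cis_conv_exp by measurable
    show "(\<lambda>\<omega>. \<Prod>i<m. cis (v i * real (K i \<omega>))) \<in> borel_measurable N"
      using K_meas unfolding cis_conv_exp by measurable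
  qed (rule eq)
  also have "\<dots> = (\<Prod>i<m. \<integral>\<omega>. cis (v i * real (K i \<omega>)) \<partial>N)"
  proof (rule indep_vars_lebesgue_integral)
    show "indep_vars (\<lambda>_. borel) (\<lambda>i \<omega>. cis (v i * real (K i \<omega>))) {..<m}"
      by (rule indep_vars_compose2[OF ind]) auto
    show "integrable N (\<lambda>\<omega>. cis (v i * real (K i \<omega>)))" for i
      using K_meas[of i] by (intro integrable_const_bound[where B=1]) (auto simp: cis_conv_exp)
  qed simp
  also have "\<dots> = (\<Prod>i<m. exp (complex_of_real (measure \<mu> (B i)) * (cis (v i) - 1)))"
    unfolding K_def PPM_count_char[OF B] ..
  also have "\<dots> = exp (\<Sum>i<m. complex_of_real (measure \<mu> (B i)) * (cis (v i) - 1))"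
    by (simp add: exp_sum)
  also have "(\<Sum>i<m. complex_of_real (measure \<mu> (B i)) * (cis (v i) - 1)) = (\<integral>x. indicator A x *\<^sub>R (cis (h x) - 1) \<partial>\<mu>)"
  proof -
    have "(\<integral>x. indicator A x *\<^sub>R (cis (h x) - 1) \<partial>\<mu>) = (\<integral>x. (\<Sum>i<m. indicator (B i) x *\<^sub>R (cis (v i) - 1)) \<partial>\<mu>)"
    proof (intro Bochner_Integration.integral_cong refl)
      fix x assume x: "x \<in> space \<mu>"
      then obtain i0 where i0: "i0 < m" "h x = v i0"
        using img by (metis image_eqI imageE lessThan_iff)
      have "(\<Sum>i<m. indicator (B i) x *\<^sub>R (cis (v i) - 1)) = (\<Sum>i<m. if i = i0 then indicator A x *\<^sub>R (cis (v i) - 1) else 0)"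
        using x i0 inj by (intro sum.cong refl) (auto simp: B_def indicator_def inj_on_def)
      then show "indicator A x *\<^sub>R (cis (h x) - 1) = (\<Sum>i<m. indicator (B i) x *\<^sub>R (cis (v i) - 1))"
        using i0 by simp
    qed
    also have "\<dots> = (\<Sum>i<m. \<integral>x. indicator (B i) x *\<^sub>R (cis (v i) - 1) \<partial>\<mu>)"
      using B by (intro Bochner_Integration.integral_sum integrable_scaleR_left integrable_real_indicator) auto
    also have "\<dots> = (\<Sum>i<m. complex_of_real (measure \<mu> (B i)) * (cis (v i) - 1))"
      using B by (intro sum.cong refl) (subst integral_scaleR_left, auto simp: scaleR_conv_of_real intro!: integrable_real_indicator)
    finally show ?thesis ..
  qed
  finally show ?thesis .
qed

text \<open>Approximation by simple functions: for each outcome the sum is finite, or 0 by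
  convention, so pointwise limits pass through it. On the other side the finite mass of
  \<open>A\<close> makes \<open>2 * indicator A\<close> an integrable bound.\<close>

theorem PPM_char:
  fixes h :: "'e \<Rightarrow> real"
  assumes A: "A \<in> sets \<mu>" "emeasure \<mu> A < \<infinity>" and h: "h \<in> borel_measurable \<mu>"
  shows "(\<integral>\<omega>. cis (\<Sum>j\<in>{j\<in>J \<omega>. atom j \<omega> \<in> A}. h (atom j \<omega>)) \<partial>N) = exp (\<integral>x. indicator A x *\<^sub>R (cis (h x) - 1) \<partial>\<mu>)"
proof -
  obtain F where F: "\<And>i. simple_function \<mu> (F i)" "\<And>x. x \<in> space \<mu> \<Longrightarrow> (\<lambda>i. F i x) \<longlonglongrightarrow> h x"
    using borel_measurable_implies_sequence_metric[OF h, of 0] by blast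
  note [measurable] = h A(1)
  have F_meas [measurable]: "F i \<in> borel_measurable \<mu>" for i
    using F(1) by (rule borel_measurable_simple_function)
  have cis_lim: "(\<lambda>i. cis (g i)) \<longlonglongrightarrow> cis l" if "g \<longlonglongrightarrow> l" for g :: "nat \<Rightarrow> real" and l
    unfolding cis_conv_exp by (intro tendsto_intros that)
  have "(\<lambda>i. \<integral>\<omega>. cis (\<Sum>j\<in>{j\<in>J \<omega>. atom j \<omega> \<in> A}. F i (atom j \<omega>)) \<partial>N)
      \<longlonglongrightarrow> (\<integral>\<omega>. cis (\<Sum>j\<in>{j\<in>J \<omega>. atom j \<omega> \<in> A}. h (atom j \<omega>)) \<partial>N)"
  proof (rule integral_dominated_convergence[where w="\<lambda>_. 1"])
    show "(\<lambda>\<omega>. cis (\<Sum>j\<in>{j\<in>J \<omega>. atom j \<omega> \<in> A}. h (atom j \<omega>))) \<in> borel_measurable N"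
      using measurable_PPM_sum[OF A(1) h] unfolding cis_conv_exp by measurable
    show "(\<lambda>\<omega>. cis (\<Sum>j\<in>{j\<in>J \<omega>. atom j \<omega> \<in> A}. F i (atom j \<omega>))) \<in> borel_measurable N" for i
      using measurable_PPM_sum[OF A(1) F_meas] unfolding cis_conv_exp by measurable
    show "AE \<omega> in N. (\<lambda>i. cis (\<Sum>j\<in>{j\<in>J \<omega>. atom j \<omega> \<in> A}. F i (atom j \<omega>)))
        \<longlonglongrightarrow> cis (\<Sum>j\<in>{j\<in>J \<omega>. atom j \<omega> \<in> A}. h (atom j \<omega>))"
      using sets.sets_into_space[OF A(1)] by (intro AE_I2 cis_lim tendsto_sum F(2)) auto
  qed auto
  moreover have "(\<lambda>i. exp (\<integral>x. indicator A x *\<^sub>R (cis (F i x) - 1) \<partial>\<mu>)) \<longlonglongrightarrow> exp (\<integral>x. indicator A x *\<^sub>R (cis (h x) - 1) \<partial>\<mu>)"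
  proof (rule tendsto_exp, rule integral_dominated_convergence[where w="\<lambda>x. 2 * indicator A x"])
    show "(\<lambda>x. indicator A x *\<^sub>R (cis (h x) - 1)) \<in> borel_measurable \<mu>"
      unfolding cis_conv_exp by measurable
    show "(\<lambda>x. indicator A x *\<^sub>R (cis (F i x) - 1)) \<in> borel_measurable \<mu>" for i
      unfolding cis_conv_exp by measurable
    show "integrable \<mu> (\<lambda>x. 2 * indicator A x :: real)"
      using A by (intro integrable_mult_right integrable_real_indicator) auto
    show "AE x in \<mu>. (\<lambda>i. indicator A x *\<^sub>R (cis (F i x) - 1)) \<longlonglongrightarrow> indicator A x *\<^sub>R (cis (h x) - 1)"
      by (intro AE_I2 tendsto_scaleR tendsto_diff tendsto_const cis_lim F(2))
    have "norm (cis a - 1) \<le> 2" for a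
      using norm_triangle_ineq4[of "cis a" 1] by simp
    then show "AE x in \<mu>. norm (indicator A x *\<^sub>R (cis (F i x) - 1)) \<le> 2 * indicator A x" for i
      by (intro AE_I2) (auto simp: indicator_def)
  qed
  ultimately show ?thesis
    unfolding PPM_char_simple[OF A F(1)] by (rule LIMSEQ_unique)
qed

end

section \<open>Growth of the characteristic exponent\<close>

lemma scale_measure_eq_density: "scale_measure r M = density M (\<lambda>_. r)"
  by (rule measure_eqI) (auto simp: emeasure_density nn_integral_cmult_indicator)

lemma integral_scale_measure:
  fixes f :: "'a \<Rightarrow> 'b::{banach, second_countable_topology}"
  assumes "0 \<le> r" "f \<in> borel_measurable M"
  shows "(\<integral>x. f x \<partial>scale_measure (ennreal r) M) = r *\<^sub>R (\<integral>x. f x \<partial>M)"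
  unfolding scale_measure_eq_density using assms by (subst integral_density) auto

lemma integrable_scale_measure:
  fixes f :: "'a \<Rightarrow> 'b::{banach, second_countable_topology}"
  assumes "0 \<le> r" "integrable M f"
  shows "integrable (scale_measure (ennreal r) M) f"
  unfolding scale_measure_eq_density
  using assms borel_measurable_integrable[OF assms(2)] by (subst integrable_density) auto

text \<open>Interpolates between the quadratic bound for small \<open>u\<close> and the linear one
  for large \<open>u\<close>; on each range \<open>\<bar>u\<bar> powr b\<close> takes over because
  \<open>1 \<le> b \<le> 2\<close>.\<close>

lemma cis_second_order_bound:
  fixes u b :: real
  assumes b: "1 \<le> b" "b \<le> 2"
  shows "norm (1 - cis u + \<i> * complex_of_real u) \<le> 2 * \<bar>u\<bar> powr b"
proof -
  have eq: "norm (1 - cis u + \<i> * complex_of_real u) = norm (iexp u - (\<Sum>k\<le>1. (\<i> * u) ^ k / fact k))"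
  proof -
    have "iexp u - (\<Sum>k\<le>1. (\<i> * u) ^ k / fact k) = - (1 - cis u + \<i> * complex_of_real u)"
      by (simp add: cis_conv_exp)
    then show ?thesis
      by (simp only: norm_minus_cancel)
  qed
  show ?thesis
  proof (cases "\<bar>u\<bar> \<le> 1")
    case True
    have "norm (1 - cis u + \<i> * complex_of_real u) \<le> \<bar>u\<bar>\<^sup>2 / 2"
      unfolding eq using iexp_approx1[of u 1] by (simp add: eval_nat_numeral)
    also have "\<dots> \<le> \<bar>u\<bar> powr 2"
      by (cases "u = 0") (auto simp: powr_numeral)
    also have "\<dots> \<le> \<bar>u\<bar> powr b"
      using True b by (intro powr_mono') auto
    finally show ?thesis
      by (smt (verit) powr_ge_zero)
  next
    case False
    have "norm (1 - cis u + \<i> * complex_of_real u) \<le> 2 * \<bar>u\<bar>"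
      unfolding eq using iexp_approx2[of u 1] by simp
    also have "\<bar>u\<bar> \<le> \<bar>u\<bar> powr b"
      using False b powr_mono[of 1 b "\<bar>u\<bar>"] by simp
    finally show ?thesis
      by simp
  qed
qed

text \<open>The right half plane is convex and the derivative has modulus at most 1 there.
  Convergence in mean of the exponents thus passes directly to the characteristic functions.\<close>

lemma norm_exp_minus_diff_le:
  assumes "0 \<le> Re z" "0 \<le> Re w"
  shows "norm (exp (- z) - exp (- w)) \<le> norm (z - w)"
proof -
  have "norm (exp (- z) - exp (- w)) \<le> 1 * norm (z - w)"
  proof (rule field_differentiable_bound[where S="{z. 0 \<le> Re z}" and f'="\<lambda>z. - exp (- z)"])
    show "convex {z. 0 \<le> Re z}"
      by (rule convex_halfspace_Re_ge)
    show "((\<lambda>z. exp (- z)) has_field_derivative - exp (- x)) (at x within {z. 0 \<le> Re z})" for x :: complex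
      by (auto intro!: derivative_eq_intros)
    show "norm (- exp (- x)) \<le> 1" if "x \<in> {z. 0 \<le> Re z}" for x
      using that by simp
  qed (use assms in auto)
  then show ?thesis
    by simp
qed

section \<open>Growth of the jump integrand\<close>

definition levy_kernel :: "real^'d \<Rightarrow> real^'d \<Rightarrow> complex" where
  "levy_kernel \<theta> x = 1 - cis (\<theta> \<bullet> x) + \<i> * complex_of_real (\<theta> \<bullet> x) * indicator (ball 0 1) x"

lemma levy_exponent_eq:
  "levy_exponent q a \<Lambda> \<theta> = complex_of_real (q \<theta> / 2) - \<i> * complex_of_real (a \<bullet> \<theta>) + (\<integral>x. levy_kernel \<theta> x \<partial>\<Lambda>)"
  by (simp add: levy_exponent_def levy_kernel_def)

lemma borel_measurable_levy_kernel [measurable]: "levy_kernel (\<theta> :: real^'d) \<in> borel_measurable borel"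
proof -
  have [measurable]: "ball 0 1 \<in> sets (borel :: (real^'d) measure)"
    by simp
  show ?thesis
    unfolding levy_kernel_def[abs_def] cis_conv_exp by measurable
qed

lemma levy_kernel_0 [simp]: "levy_kernel 0 x = 0" "levy_kernel \<theta> 0 = 0"
  by (simp_all add: levy_kernel_def)

lemma Re_levy_kernel: "0 \<le> Re (levy_kernel \<theta> x)"
  by (simp add: levy_kernel_def indicator_def)

text \<open>Separates the dependence on the jump: \<open>levy_kernel \<theta>\<close> is bounded by
  this weight times a factor of growth \<open>b\<close> in \<open>\<theta>\<close>.\<close>

definition jump_weight :: "real \<Rightarrow> real^'d \<Rightarrow> real" where
  "jump_weight b x = norm x powr b * indicator (cball 0 1) x + indicator {x. 1 \<le> norm x} x"

lemma jump_weight_nonneg: "0 \<le> jump_weight b x"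
  by (simp add: jump_weight_def)

lemma levy_kernel_bound:
  assumes b: "1 \<le> b" "b \<le> 2"
  shows "norm (levy_kernel \<theta> x) \<le> 2 * (norm \<theta> powr b + 1) * jump_weight b x"
proof (cases "norm x < 1")
  case True
  have "norm (levy_kernel \<theta> x) \<le> 2 * \<bar>\<theta> \<bullet> x\<bar> powr b"
    using True cis_second_order_bound[OF b, of "\<theta> \<bullet> x"] by (simp add: levy_kernel_def)
  also have "\<bar>\<theta> \<bullet> x\<bar> powr b \<le> (norm \<theta> * norm x) powr b"
    using b by (intro powr_mono2 Cauchy_Schwarz_ineq2) auto
  also have "\<dots> = norm \<theta> powr b * norm x powr b"
    by (simp add: powr_mult)
  also have "2 * (norm \<theta> powr b * norm x powr b) \<le> 2 * (norm \<theta> powr b + 1) * jump_weight b x"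
    using True by (simp add: jump_weight_def distrib_right)
  finally show ?thesis
    by simp
next
  case False
  have "norm (levy_kernel \<theta> x) \<le> 2"
    using False norm_triangle_ineq4[of 1 "cis (\<theta> \<bullet> x)"] by (simp add: levy_kernel_def)
  also have "\<dots> \<le> 2 * (norm \<theta> powr b + 1) * jump_weight b x"
  proof -
    have "1 \<le> jump_weight b x"
      using False by (simp add: jump_weight_def)
    then have "1 * 1 \<le> (norm \<theta> powr b + 1) * jump_weight b x"
      by (intro mult_mono) auto
    then show ?thesis
      by linarith
  qed
  finally show ?thesis .
qed

text \<open>The index is an infimum that need not be attained, so some exponent of integrability
  below \<open>1 / p\<close> is taken and clipped to the interval from 1 to 2. A nonzero quadratic
  form forces the index 2, hence \<open>2 * p < 1\<close>, and \<open>b = 2\<close> is used.\<close>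

lemma admissible_exponent:
  fixes q :: "real^'d \<Rightarrow> real"
  assumes L: "levy_measure \<Lambda>" and adm: "admissible q \<Lambda> p"
  shows "\<exists>b. 1 \<le> b \<and> b \<le> 2 \<and> p * b < 1 \<and> (\<integral>\<^sup>+ x\<in>cball 0 1. ennreal (norm x powr b) \<partial>\<Lambda>) < \<infinity>
    \<and> ((\<forall>x. q x = 0) \<or> b = 2)"
proof -
  have p: "0 < p" "p < 1" "p * bg_index q \<Lambda> < 1"
    using adm by (auto simp: admissible_def)
  define S where "S = {b::real. 0 < b \<and> (\<integral>\<^sup>+ x\<in>cball 0 1. ennreal (norm x powr b) \<partial>\<Lambda>) < \<infinity>}"
  have two: "2 \<in> S"
  proof -
    have "(\<integral>\<^sup>+ x\<in>cball 0 1. ennreal (norm x powr 2) \<partial>\<Lambda>) \<le> (\<integral>\<^sup>+ x. ennreal (min 1 ((norm x)\<^sup>2)) \<partial>\<Lambda>)"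
    proof (intro nn_integral_mono)
      fix x :: "real^'d"
      show "ennreal (norm x powr 2) * indicator (cball 0 1) x \<le> ennreal (min 1 ((norm x)\<^sup>2))"
        by (cases "norm x \<le> 1") (auto simp: powr_numeral abs_square_le_1 intro!: ennreal_leI)
    qed
    then show ?thesis
      using L unfolding S_def levy_measure_def by (auto intro: le_less_trans)
  qed
  have up: "b' \<in> S" if "b \<in> S" "b \<le> b'" for b b'
  proof -
    have "(\<integral>\<^sup>+ x\<in>cball 0 1. ennreal (norm x powr b') \<partial>\<Lambda>) \<le> (\<integral>\<^sup>+ x\<in>cball 0 1. ennreal (norm x powr b) \<partial>\<Lambda>)"
      using that by (intro nn_integral_mono) (auto simp: indicator_def intro!: ennreal_leI powr_mono')
    then show ?thesis
      using that unfolding S_def by (auto intro: le_less_trans)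
  qed
  show ?thesis
  proof (cases "\<forall>x. q x = 0")
    case True
    then have "Inf S < 1 / p"
      using p by (simp add: bg_index_def S_def field_simps)
    then obtain b0 where b0: "b0 \<in> S" "b0 < 1 / p"
      using cInf_lessD[of S "1 / p"] two by auto
    \<comment> \<open>Raising the exponent to 1 keeps it below \<open>1 / p\<close> because
      \<open>p < 1\<close>; capping it at 2 keeps integrability because 2 is always in
      \<open>S\<close>.\<close>
    define b where "b = min 2 (max 1 b0)"
    have "b \<in> S"
      using two up[OF b0(1), of b] unfolding b_def by (auto simp: min_def)
    moreover have "b < 1 / p"
    proof -
      have "1 < 1 / p"
        using p by simp
      then show ?thesis
        using b0 by (auto simp: b_def)
    qed
    ultimately show ?thesis
      using True p by (intro exI[of _ b]) (auto simp: b_def S_def field_simps)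
  next
    case False
    then have "bg_index q \<Lambda> = 2"
      unfolding bg_index_def by (rule if_not_P)
    then have "p * 2 < 1"
      using p by simp
    then show ?thesis
      using two by (intro exI[of _ 2]) (simp add: S_def)
  qed
qed

text \<open>The index is replaced by one exponent \<open>b\<close> of integrability. The alternative
  \<open>q_b\<close> lets the quadratic form grow no faster than
  \<open>norm \<theta> powr b\<close>.\<close>

locale levy_characteristics =
  fixes q :: "real^'d \<Rightarrow> real" and a :: "real^'d" and \<Lambda> :: "(real^'d) measure" and b :: real
  assumes q: "psd_quadratic_form q" and L: "levy_measure \<Lambda>" and b: "1 \<le> b" "b \<le> 2"
    and L_b: "(\<integral>\<^sup>+ x\<in>cball 0 1. ennreal (norm x powr b) \<partial>\<Lambda>) < \<infinity>" and q_b: "(\<forall>x. q x = 0) \<or> b = 2"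
begin

lemma sets_L [measurable_cong, simp]: "sets \<Lambda> = sets borel"
  using L by (simp add: levy_measure_def)

lemma space_L [simp]: "space \<Lambda> = UNIV"
  using sets_eq_imp_space_eq[OF sets_L] by simp

text \<open>Markov's inequality: on this set the integrand in the definition of a Levy measure is at
  least \<open>d\<close>.\<close>

lemma emeasure_L_ge:
  assumes "0 < e"
  shows "emeasure \<Lambda> {x. e \<le> norm x} < \<infinity>"
proof -
  define d where "d = min 1 (e\<^sup>2)"
  have d: "0 < d"
    using assms by (simp add: d_def)
  have "ennreal d * emeasure \<Lambda> {x. e \<le> norm x} = (\<integral>\<^sup>+ x. ennreal d * indicator {x. e \<le> norm x} x \<partial>\<Lambda>)"
    by (subst nn_integral_cmult_indicator) auto
  also have "\<dots> \<le> (\<integral>\<^sup>+ x. ennreal (min 1 ((norm x)\<^sup>2)) \<partial>\<Lambda>)"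
  proof (intro nn_integral_mono)
    fix x :: "real^'d"
    have "d \<le> min 1 ((norm x)\<^sup>2)" if "e \<le> norm x"
      using that assms power_mono[of e "norm x" 2] by (auto simp: d_def intro: min.coboundedI2)
    then show "ennreal d * indicator {x. e \<le> norm x} x \<le> ennreal (min 1 ((norm x)\<^sup>2))"
      by (auto simp: indicator_def intro!: ennreal_leI)
  qed
  also have "\<dots> < \<infinity>"
    using L by (simp add: levy_measure_def)
  finally have "ennreal d * emeasure \<Lambda> {x. e \<le> norm x} < \<infinity>" .
  then show ?thesis
    using d by (auto simp: ennreal_mult_less_top)
qed

lemma integrable_jump_weight: "integrable \<Lambda> (jump_weight b)"
proof (rule integrableI_bounded)
  have [measurable]: "cball 0 1 \<in> sets (borel :: (real^'d) measure)" "{x. 1 \<le> norm x} \<in> sets (borel :: (real^'d) measure)"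
    by simp_all
  show "jump_weight b \<in> borel_measurable \<Lambda>"
    unfolding jump_weight_def[abs_def] by measurable
  have "(\<integral>\<^sup>+ x. ennreal (norm (jump_weight b x)) \<partial>\<Lambda>)
      = (\<integral>\<^sup>+ x. ennreal (norm x powr b) * indicator (cball 0 1) x + indicator {x. 1 \<le> norm x} x \<partial>\<Lambda>)"
    by (intro nn_integral_cong) (auto simp: jump_weight_def indicator_def)
  also have "\<dots> = (\<integral>\<^sup>+ x\<in>cball 0 1. ennreal (norm x powr b) \<partial>\<Lambda>) + emeasure \<Lambda> {x. 1 \<le> norm x}"
    by (subst nn_integral_add) auto
  also have "\<dots> < \<infinity>"
    using L_b emeasure_L_ge[of 1] by simp
  finally show "(\<integral>\<^sup>+ x. ennreal (norm (jump_weight b x)) \<partial>\<Lambda>) < \<infinity>" .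
qed

lemma integrable_levy_kernel: "integrable \<Lambda> (levy_kernel \<theta>)"
  by (rule Bochner_Integration.integrable_bound[OF integrable_mult_right[OF integrable_jump_weight, of "2 * (norm \<theta> powr b + 1)"]])
    (use levy_kernel_bound[OF b, of \<theta>] in \<open>auto simp: abs_mult abs_of_nonneg[OF jump_weight_nonneg] intro!: AE_I2\<close>)

definition jump_mass :: real where
  "jump_mass = (\<integral>x. jump_weight b x \<partial>\<Lambda>)"

lemma jump_mass_nonneg: "0 \<le> jump_mass"
  unfolding jump_mass_def by (intro Bochner_Integration.integral_nonneg jump_weight_nonneg)

lemma norm_levy_kernel_integral:
  assumes A: "A \<in> sets borel"
  shows "norm (\<integral>x. indicator A x *\<^sub>R levy_kernel \<theta> x \<partial>\<Lambda>) \<le> 2 * (norm \<theta> powr b + 1) * jump_mass"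
proof -
  note [measurable] = A
  have "norm (\<integral>x. indicator A x *\<^sub>R levy_kernel \<theta> x \<partial>\<Lambda>) \<le> (\<integral>x. norm (indicator A x *\<^sub>R levy_kernel \<theta> x) \<partial>\<Lambda>)"
    by (rule integral_norm_bound)
  also have "\<dots> \<le> (\<integral>x. 2 * (norm \<theta> powr b + 1) * jump_weight b x \<partial>\<Lambda>)"
  proof (rule Bochner_Integration.integral_mono)
    show "integrable \<Lambda> (\<lambda>x. norm (indicator A x *\<^sub>R levy_kernel \<theta> x))"
      by (rule Bochner_Integration.integrable_bound[OF integrable_levy_kernel[of \<theta>]]) (auto simp: indicator_def)
    fix x
    show "norm (indicator A x *\<^sub>R levy_kernel \<theta> x) \<le> 2 * (norm \<theta> powr b + 1) * jump_weight b x"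
      using levy_kernel_bound[OF b, of \<theta> x] jump_weight_nonneg[of b x] by (auto simp: indicator_def)
  qed (intro integrable_mult_right integrable_jump_weight)
  finally show ?thesis
    by (simp add: jump_mass_def)
qed

lemma q_bound: "\<exists>C\<ge>0. \<forall>\<theta>. 0 \<le> q \<theta> \<and> q \<theta> \<le> C * norm \<theta> powr b"
proof (cases "\<forall>x. q x = 0")
  case True
  then show ?thesis
    by (intro exI[of _ 0]) simp
next
  case False
  then have b2: "b = 2"
    using q_b by blast
  obtain A :: "real^'d^'d" where A: "\<And>x. q x = x \<bullet> (A *v x)" and q0: "\<And>x. 0 \<le> q x"
    using q by (auto simp: psd_quadratic_form_def)
  obtain K where K: "K > 0" "\<And>x. norm (A *v x) \<le> norm x * K"
    using bounded_linear.pos_bounded[OF matrix_vector_mul_bounded_linear[of A]] by auto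
  have "q \<theta> \<le> K * norm \<theta> powr b" for \<theta>
  proof -
    have "q \<theta> \<le> norm \<theta> * norm (A *v \<theta>)"
      unfolding A by (rule norm_cauchy_schwarz)
    also have "\<dots> \<le> norm \<theta> * (norm \<theta> * K)"
      by (intro mult_left_mono K) simp
    also have "\<dots> = K * norm \<theta> powr b"
      unfolding b2 by (cases "\<theta> = 0") (auto simp: powr_numeral power2_eq_square)
    finally show ?thesis .
  qed
  then show ?thesis
    using K q0 by (intro exI[of _ K]) auto
qed

lemma q_zero: "q 0 = 0"
  using q_bound b by (metis norm_zero powr_zero_eq_one powr_0 mult_zero_right order_antisym)

lemma levy_exponent_0: "levy_exponent q a \<Lambda> 0 = 0"
  by (simp add: levy_exponent_eq q_zero)

lemma Re_levy_exponent: "0 \<le> Re (levy_exponent q a \<Lambda> \<theta>)"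
proof -
  have "0 \<le> q \<theta>"
    using q_bound by blast
  moreover have "Re (\<integral>x. levy_kernel \<theta> x \<partial>\<Lambda>) = (\<integral>x. Re (levy_kernel \<theta> x) \<partial>\<Lambda>)"
    by (rule integral_Re[symmetric, OF integrable_levy_kernel])
  moreover have "0 \<le> (\<integral>x. Re (levy_kernel \<theta> x) \<partial>\<Lambda>)"
    by (intro Bochner_Integration.integral_nonneg Re_levy_kernel)
  ultimately show ?thesis
    by (simp add: levy_exponent_eq)
qed

lemma levy_exponent_bound:
  "\<exists>C\<ge>0. \<forall>\<theta>. norm (levy_exponent q a \<Lambda> \<theta>) \<le> C * (norm \<theta> powr b + norm \<theta> + 1)"
proof -
  obtain C where C: "C \<ge> 0" "\<And>\<theta>. 0 \<le> q \<theta> \<and> q \<theta> \<le> C * norm \<theta> powr b"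
    using q_bound by blast
  define D where "D = C + norm a + 2 * jump_mass"
  have D: "0 \<le> D" "C \<le> D" "norm a \<le> D" "2 * jump_mass \<le> D" "C + 2 * jump_mass \<le> D"
    using C jump_mass_nonneg by (auto simp: D_def)
  have "norm (levy_exponent q a \<Lambda> \<theta>) \<le> D * (norm \<theta> powr b + norm \<theta> + 1)" for \<theta>
  proof -
    have "norm (levy_exponent q a \<Lambda> \<theta>) \<le> norm (complex_of_real (q \<theta> / 2)) + norm (\<i> * complex_of_real (a \<bullet> \<theta>))
        + norm (\<integral>x. levy_kernel \<theta> x \<partial>\<Lambda>)"
      unfolding levy_exponent_eq by (meson add_right_mono norm_triangle_ineq norm_triangle_ineq4 order_trans)
    also have "norm (complex_of_real (q \<theta> / 2)) \<le> C * norm \<theta> powr b"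
      using C(2)[of \<theta>] by (simp only: norm_of_real) auto
    also have "norm (\<i> * complex_of_real (a \<bullet> \<theta>)) \<le> norm a * norm \<theta>"
      by (simp add: norm_mult Cauchy_Schwarz_ineq2)
    also have "norm (\<integral>x. levy_kernel \<theta> x \<partial>\<Lambda>) \<le> 2 * (norm \<theta> powr b + 1) * jump_mass"
      using norm_levy_kernel_integral[of UNIV \<theta>] by simp
    finally have "norm (levy_exponent q a \<Lambda> \<theta>) \<le> C * norm \<theta> powr b + norm a * norm \<theta> + 2 * (norm \<theta> powr b + 1) * jump_mass"
      by simp
    also have "\<dots> = (C + 2 * jump_mass) * norm \<theta> powr b + norm a * norm \<theta> + 2 * jump_mass * 1"
      by (simp add: algebra_simps)
    also have "\<dots> \<le> D * norm \<theta> powr b + D * norm \<theta> + D * 1"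
      using D by (intro add_mono mult_right_mono) auto
    finally show ?thesis
      by (simp add: algebra_simps)
  qed
  then show ?thesis
    using D by blast
qed

end

section \<open>Limit of the characteristic functions\<close>

locale nrlp_limit = yule_simon_process p P \<tau> m Q + levy_characteristics q a \<Lambda> b
  for p :: real and P \<tau> m Q and q :: "real^'d \<Rightarrow> real" and a \<Lambda> b +
  fixes \<Theta> :: "nat \<Rightarrow> real^'d"
  assumes pb: "p * b < 1"
begin

section \<open>Growth of the exponent along size vectors\<close>

definition \<zeta> :: "(nat \<Rightarrow> nat) \<Rightarrow> real^'d" where
  "\<zeta> v = (\<Sum>j\<le>m. real (v j) *\<^sub>R \<Theta> j)"

definition T :: real where
  "T = (\<Sum>j\<le>m. norm (\<Theta> j))"

lemma b_pos: "0 < b"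
  using b by simp

lemma T_nonneg: "0 \<le> T"
  by (simp add: T_def sum_nonneg)

lemma norm_\<zeta>: "v \<in> vecs \<Longrightarrow> norm (\<zeta> v) \<le> total v * T"
proof -
  assume v: "v \<in> vecs"
  have le: "real (v j) \<le> total v" if "j \<le> m" for j
  proof (cases "j = 0")
    case True
    then show ?thesis
      using v total_nonneg[of v] by (simp add: vecs_def)
  next
    case False
    then show ?thesis
      using that by (intro le_total) auto
  qed
  have "norm (\<zeta> v) \<le> (\<Sum>j\<le>m. real (v j) * norm (\<Theta> j))"
    unfolding \<zeta>_def by (rule order_trans[OF norm_sum]) simp
  also have "\<dots> \<le> (\<Sum>j\<le>m. total v * norm (\<Theta> j))"
    using le by (intro sum_mono mult_right_mono) auto
  finally show ?thesis
    by (simp add: T_def sum_distrib_left)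
qed

definition growth :: real where
  "growth = T powr b + T + 1"

text \<open>Sizes are integers: a nonzero vector has total at least 1, so the linear and constant
  terms are absorbed into the power \<open>b \<ge> 1\<close>. The zero vector is handled by
  \<open>G 0 = 0\<close>.\<close>

lemma growth_bound:
  fixes G :: "real^'d \<Rightarrow> 'c::real_normed_vector"
  assumes v: "v \<in> vecs" and G0: "G 0 = 0" and G: "norm (G (\<zeta> v)) \<le> C * (norm (\<zeta> v) powr b + norm (\<zeta> v) + 1)" and C: "0 \<le> C"
  shows "norm (G (\<zeta> v)) \<le> C * growth * total v powr b"
proof (cases "v = (\<lambda>_. 0)")
  case True
  then show ?thesis
    using G0 C T_nonneg by (simp add: \<zeta>_def growth_def)
next
  case False
  then obtain j where j: "v j \<noteq> 0"
    by auto
  then have "j \<in> {1..m}"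
    using v by (auto simp: vecs_def)
  then have s: "1 \<le> total v"
    using le_total[of j v] j by simp
  have sb: "total v \<le> total v powr b"
    using s b powr_mono[of 1 b "total v"] by simp
  have "norm (\<zeta> v) powr b \<le> (total v * T) powr b"
    using b by (intro powr_mono2 norm_\<zeta> v) auto
  also have "\<dots> = T powr b * total v powr b"
    by (simp add: powr_mult)
  finally have 1: "norm (\<zeta> v) powr b \<le> T powr b * total v powr b" .
  have "norm (\<zeta> v) \<le> T * total v"
    using norm_\<zeta>[OF v] by (simp add: mult.commute)
  also have "\<dots> \<le> T * total v powr b"
    using sb T_nonneg by (rule mult_left_mono)
  finally have 2: "norm (\<zeta> v) \<le> T * total v powr b" .
  have "norm (\<zeta> v) powr b + norm (\<zeta> v) + 1 \<le> growth * total v powr b"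
    using 1 2 s sb by (simp add: growth_def distrib_right)
  then have "C * (norm (\<zeta> v) powr b + norm (\<zeta> v) + 1) \<le> C * (growth * total v powr b)"
    using C by (rule mult_left_mono)
  then show ?thesis
    using G by (simp add: mult.assoc)
qed

lemma integrable_total: "integrable Q (\<lambda>y. total (path_vec y) powr b)"
  by (rule total_moment_Q[OF b_pos pb])

lemma integrable_growth:
  fixes G :: "real^'d \<Rightarrow> 'c::{banach, second_countable_topology}"
  assumes "G 0 = 0" and "\<And>\<theta>. norm (G \<theta>) \<le> C * (norm \<theta> powr b + norm \<theta> + 1)" and "0 \<le> C"
  shows "integrable Q (\<lambda>y. G (\<zeta> (path_vec y)))"
proof (rule Bochner_Integration.integrable_bound[OF integrable_mult_right[OF integrable_total, of "C * growth"]])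
  show "(\<lambda>y. G (\<zeta> (path_vec y))) \<in> borel_measurable Q"
    by (rule measurable_path_vec_compose[of "\<lambda>v. G (\<zeta> v)"])
  show "AE y in Q. norm (G (\<zeta> (path_vec y))) \<le> norm (C * growth * total (path_vec y) powr b)"
  proof (intro AE_I2)
    fix y
    have "norm (G (\<zeta> (path_vec y))) \<le> C * growth * total (path_vec y) powr b"
      by (rule growth_bound[OF path_vec_in assms])
    then show "norm (G (\<zeta> (path_vec y))) \<le> norm (C * growth * total (path_vec y) powr b)"
      unfolding real_norm_def by linarith
  qed
qed

definition limit_exponent :: complex where
  "limit_exponent = (1 - p) * (\<integral>y. levy_exponent q a \<Lambda> (\<zeta> (path_vec y)) \<partial>Q)"

lemma Re_limit_exponent: "0 \<le> Re limit_exponent"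
proof -
  obtain C where C: "C \<ge> 0" "\<And>\<theta>. norm (levy_exponent q a \<Lambda> \<theta>) \<le> C * (norm \<theta> powr b + norm \<theta> + 1)"
    using levy_exponent_bound by blast
  have "integrable Q (\<lambda>y. levy_exponent q a \<Lambda> (\<zeta> (path_vec y)))"
    by (rule integrable_growth[where G="levy_exponent q a \<Lambda>", OF levy_exponent_0 C(2,1)])
  then have "Re (\<integral>y. levy_exponent q a \<Lambda> (\<zeta> (path_vec y)) \<partial>Q) = (\<integral>y. Re (levy_exponent q a \<Lambda> (\<zeta> (path_vec y))) \<partial>Q)"
    by (rule integral_Re[symmetric])
  moreover have "0 \<le> (\<integral>y. Re (levy_exponent q a \<Lambda> (\<zeta> (path_vec y))) \<partial>Q)"
    by (intro Bochner_Integration.integral_nonneg Re_levy_exponent)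
  moreover have "Re limit_exponent = (1 - p) * Re (\<integral>y. levy_exponent q a \<Lambda> (\<zeta> (path_vec y)) \<partial>Q)"
    unfolding limit_exponent_def by (simp only: Re_complex_of_real Im_complex_of_real times_complex.simps)
  ultimately show ?thesis
    using p by simp
qed

lemma \<zeta>_size_vec: "\<zeta> (size_vec n c r) = (\<Sum>j\<in>{..m}. real (tree_size c (idx n j) r) *\<^sub>R \<Theta> j)"
  unfolding \<zeta>_def by (intro sum.cong refl) (auto simp: size_vec_def not_less_eq_eq)

text \<open>The exponent in \<open>char_srrw\<close> is an empirical mean to which
  \<open>lln\<close> applies. All real parts are nonnegative, so
  \<open>norm_exp_minus_diff_le\<close> transfers the convergence.\<close>

theorem char_srrw_limit:
  fixes M :: "'w measure" and \<xi> :: "real \<Rightarrow> 'w \<Rightarrow> real^'d"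
    and \<epsilon> :: "nat \<Rightarrow> nat \<Rightarrow> 'w \<Rightarrow> bool" and U :: "nat \<Rightarrow> nat \<Rightarrow> 'w \<Rightarrow> nat"
  assumes M: "prob_space M" and levy: "levy_process M q a \<Lambda> \<xi>"
    and noise: "\<And>n. 1 \<le> n \<Longrightarrow> reinforcement_noise M p \<xi> (\<epsilon> n) (U n)"
  shows "(\<lambda>n. \<integral>\<omega>. cis (\<Sum>j\<in>{..m}. \<Theta> j \<bullet> srrw (\<lambda>i. \<xi> (real i / real n) \<omega> - \<xi> (real (i - 1) / real n) \<omega>)
      (\<lambda>i. \<epsilon> n i \<omega>) (\<lambda>i. U n i \<omega>) (idx n j)) \<partial>M) \<longlonglongrightarrow> exp (- limit_exponent)"
proof -
  define F where "F v = levy_exponent q a \<Lambda> (\<zeta> v)" for v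
  obtain C where C: "C \<ge> 0" "\<And>\<theta>. norm (levy_exponent q a \<Lambda> \<theta>) \<le> C * (norm \<theta> powr b + norm \<theta> + 1)"
    using levy_exponent_bound by blast
  have F: "norm (F v) \<le> C * growth * total v powr b" if "v \<in> vecs" for v
    unfolding F_def by (rule growth_bound[where G="levy_exponent q a \<Lambda>", OF that levy_exponent_0 C(2,1)])
  define Z where "Z n c = (\<Sum>r=1..n. F (size_vec n c r)) / real n" for n c
  have lim: "(\<lambda>n. avg p n (\<lambda>c. norm (Z n c - limit_exponent))) \<longlonglongrightarrow> 0"
    using lln(1)[OF b_pos pb F] by (simp only: Z_def F_def limit_exponent_def)
  have "(\<lambda>n. avg p n (\<lambda>c. exp (- Z n c))) \<longlonglongrightarrow> exp (- limit_exponent)"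
  proof (rule avg_norm_tendsto, rule tendsto_sandwich[OF _ _ tendsto_const lim])
    show "\<forall>\<^sub>F n in sequentially. 0 \<le> avg p n (\<lambda>c. norm (exp (- Z n c) - exp (- limit_exponent)))"
      by (intro always_eventually allI avg_nonneg p_le) simp
    show "\<forall>\<^sub>F n in sequentially. avg p n (\<lambda>c. norm (exp (- Z n c) - exp (- limit_exponent))) \<le> avg p n (\<lambda>c. norm (Z n c - limit_exponent))"
    proof (intro always_eventually allI avg_mono p_le norm_exp_minus_diff_le Re_limit_exponent)
      fix n c
      show "0 \<le> Re (Z n c)"
        unfolding Z_def Re_divide_of_real Re_sum F_def by (intro divide_nonneg_nonneg sum_nonneg Re_levy_exponent) auto
    qed
  qed
  then show ?thesis
  proof (rule Lim_transform_eventually)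
    show "\<forall>\<^sub>F n in sequentially. avg p n (\<lambda>c. exp (- Z n c)) = (\<integral>\<omega>. cis (\<Sum>j\<in>{..m}. \<Theta> j \<bullet> srrw (\<lambda>i. \<xi> (real i / real n) \<omega> - \<xi> (real (i - 1) / real n) \<omega>)
      (\<lambda>i. \<epsilon> n i \<omega>) (\<lambda>i. U n i \<omega>) (idx n j)) \<partial>M)"
      using eventually_ge_at_top[of 1]
    proof eventually_elim
      case (elim n)
      show ?case
        using char_srrw[OF M noise[OF elim] levy elim, of "{..m}" "idx n" \<Theta>] idx_le[of _ n]
        by (simp add: Z_def F_def \<zeta>_size_vec)
    qed
  qed
qed

section \<open>Characteristic function of the limit process\<close>

abbreviation \<nu> :: "(real^'d) measure" where
  "\<nu> \<equiv> scale_measure (ennreal (1 - p)) \<Lambda>"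

lemma sets_\<nu>: "sets \<nu> = sets borel" and space_\<nu>: "space \<nu> = UNIV"
  by (simp_all add: space_scale_measure)

lemma emeasure_\<nu>_ge: "0 < e \<Longrightarrow> emeasure \<nu> {x. e \<le> norm x} < \<infinity>"
  using emeasure_L_ge[of e] by (simp add: ennreal_mult_less_top)

text \<open>Exhaustion by the complements of small balls, completed by the null set
  \<open>{0}\<close>. It is required for exchanging the integrals over jumps and paths.\<close>

lemma sigma_finite_\<nu>: "sigma_finite_measure \<nu>"
proof
  define S where "S n = {x::real^'d. 1 / real (Suc n) \<le> norm x}" for n
  have "\<exists>n. 1 / real (Suc n) \<le> norm x" if "x \<noteq> 0" for x :: "real^'d"
    using that reals_Archimedean[of "norm x"] by (auto simp: inverse_eq_divide intro: less_imp_le)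
  then have "\<Union> (insert {0} (range S)) = UNIV"
    by (auto simp: S_def)
  moreover have "emeasure \<nu> {0} \<noteq> \<infinity>"
    using L by (simp add: levy_measure_def)
  moreover have "emeasure \<nu> (S n) \<noteq> \<infinity>" for n
    using emeasure_\<nu>_ge[of "1 / real (Suc n)"] by (simp add: S_def)
  moreover have "S n \<in> sets \<nu>" "{0} \<in> sets \<nu>" for n
    by (simp_all add: S_def)
  ultimately show "\<exists>A. countable A \<and> A \<subseteq> sets \<nu> \<and> \<Union> A = space \<nu> \<and> (\<forall>a\<in>A. emeasure \<nu> a \<noteq> \<infinity>)"
    by (intro exI[of _ "insert {0} (range S)"]) (auto simp: space_\<nu>)
qed

sublocale \<nu>: sigma_finite_measure \<nu>
  by (rule sigma_finite_\<nu>)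

sublocale \<nu>Q: pair_sigma_finite \<nu> Q ..

section \<open>Exponent of the jumps above a threshold\<close>

definition big_set :: "real \<Rightarrow> ((real^'d) \<times> (real \<Rightarrow> nat)) set" where
  "big_set e = {z. e \<le> norm (fst z)}"

lemma big_set_eq: "big_set e = {x. e \<le> norm x} \<times> space Q"
  by (auto simp: big_set_def space_Q)

lemma sets_big_set: "big_set e \<in> sets (\<nu> \<Otimes>\<^sub>M Q)"
  unfolding big_set_eq by (rule pair_measureI) (simp_all add: space_Q[symmetric])

lemma emeasure_big_set: "0 < e \<Longrightarrow> emeasure (\<nu> \<Otimes>\<^sub>M Q) (big_set e) < \<infinity>"
  unfolding big_set_eq
  by (subst Q.emeasure_pair_measure_Times) (use emeasure_\<nu>_ge[of e] in \<open>auto simp: Q.emeasure_space_1\<close>)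

definition jump_fun :: "(real^'d) \<times> (real \<Rightarrow> nat) \<Rightarrow> real" where
  "jump_fun z = (\<Sum>j\<le>m. real (snd z (\<tau> j)) *\<^sub>R \<Theta> j) \<bullet> fst z"

lemma measurable_jump_fun [measurable]: "jump_fun \<in> borel_measurable (\<nu> \<Otimes>\<^sub>M Q)"
proof -
  have [measurable]: "(\<lambda>z. snd z (\<tau> j)) \<in> \<nu> \<Otimes>\<^sub>M Q \<rightarrow>\<^sub>M count_space UNIV" for j
    by (rule measurable_compose[OF measurable_snd measurable_eval_Q])
  have [measurable]: "fst \<in> \<nu> \<Otimes>\<^sub>M Q \<rightarrow>\<^sub>M borel"
    using measurable_fst[of \<nu> Q] by (simp cong: measurable_cong_sets)
  show ?thesis
    unfolding jump_fun_def[abs_def] by measurable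
qed

definition K :: "real \<Rightarrow> real^'d \<Rightarrow> complex" where
  "K e \<theta> = (\<integral>x. indicator {x. e \<le> norm x} x *\<^sub>R levy_kernel \<theta> x \<partial>\<nu>)"

definition I :: "real \<Rightarrow> real^'d" where
  "I e = (\<integral>x. indicator {x. e \<le> norm x \<and> norm x < 1} x *\<^sub>R x \<partial>\<nu>)"

text \<open>The compensator subtracted in \<open>small_jump_sum\<close>, paired with the test
  vectors: \<open>t * \<rho> / (\<rho> - 1)\<close> equals \<open>t / (1 - p)\<close> for
  \<open>\<rho> = 1 / p\<close>.\<close>

definition \<beta> :: "real \<Rightarrow> real" where
  "\<beta> e = (\<Sum>j\<le>m. \<tau> j / (1 - p) * (\<Theta> j \<bullet> I e))"

lemma K_0: "K e 0 = 0"
  by (simp add: K_def)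

lemma K_eq: "K e \<theta> = (1 - p) *\<^sub>R (\<integral>x. indicator {x. e \<le> norm x} x *\<^sub>R levy_kernel \<theta> x \<partial>\<Lambda>)"
  unfolding K_def using p by (intro integral_scale_measure) auto

lemma K_bound: "norm (K e \<theta>) \<le> 2 * jump_mass * (norm \<theta> powr b + norm \<theta> + 1)"
proof -
  have "norm (K e \<theta>) \<le> 1 * norm (\<integral>x. indicator {x. e \<le> norm x} x *\<^sub>R levy_kernel \<theta> x \<partial>\<Lambda>)"
    unfolding K_eq norm_scaleR using p by (intro mult_right_mono) auto
  also have "\<dots> \<le> 2 * (norm \<theta> powr b + 1) * jump_mass"
    using norm_levy_kernel_integral[of "{x. e \<le> norm x}" \<theta>] by simp
  also have "\<dots> \<le> 2 * jump_mass * (norm \<theta> powr b + norm \<theta> + 1)"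
    using jump_mass_nonneg by (simp add: algebra_simps)
  finally show ?thesis .
qed

lemma integrable_K: "integrable Q (\<lambda>y. K e (\<zeta> (path_vec y)))"
  by (rule integrable_growth[where G="K e", OF K_0 K_bound]) (simp add: jump_mass_nonneg)

lemma integrable_path_vec: "j \<le> m \<Longrightarrow> integrable Q (\<lambda>y. real (path_vec y j))"
  using mean_Q(2)[of j] by (cases "j = 0") (auto simp: path_vec_def)

lemma mean_path_vec: "j \<le> m \<Longrightarrow> (\<integral>y. real (path_vec y j) \<partial>Q) = \<tau> j / (1 - p)"
  using mean_Q(1)[of j] p by (cases "j = 0") (auto simp: path_vec_def \<tau>0 field_simps)

lemma inner_\<zeta>: "\<zeta> v \<bullet> x = (\<Sum>j\<le>m. real (v j) * (\<Theta> j \<bullet> x))"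
  by (simp add: \<zeta>_def inner_sum_left)

lemma integral_\<zeta>_inner:
  "(\<integral>y. \<zeta> (path_vec y) \<bullet> x \<partial>Q) = (\<Sum>j\<le>m. \<tau> j / (1 - p) * (\<Theta> j \<bullet> x))"
  "integrable Q (\<lambda>y. \<zeta> (path_vec y) \<bullet> x)"
  unfolding inner_\<zeta>
  by (subst Bochner_Integration.integral_sum)
    (auto intro!: integrable_mult_left integrable_path_vec sum.cong Bochner_Integration.integrable_sum simp: mean_path_vec)

text \<open>Integrating over the jump first gives \<open>- K e\<close> plus a linear term, which
  \<open>levy_kernel\<close> subtracts for jumps below 1. Since sizes have mean
  \<open>\<tau> j / (1 - p)\<close> under \<open>Q\<close>, the linear term integrates to
  \<open>\<beta> e\<close>, the very compensator of \<open>small_jump_sum\<close>.\<close>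

lemma jump_exponent:
  assumes e: "0 < e"
  shows "(\<integral>z. indicator (big_set e) z *\<^sub>R (cis (jump_fun z) - 1) \<partial>(\<nu> \<Otimes>\<^sub>M Q))
    = - (\<integral>y. K e (\<zeta> (path_vec y)) \<partial>Q) + \<i> * complex_of_real (\<beta> e)"
proof -
  define S where "S = {x::real^'d. e \<le> norm x}"
  define g where "g \<theta> = (\<integral>x. indicator S x *\<^sub>R (cis (\<theta> \<bullet> x) - 1) \<partial>\<nu>)" for \<theta>
  define \<zeta>' where "\<zeta>' y = (\<Sum>j\<le>m. real (y (\<tau> j)) *\<^sub>R \<Theta> j)" for y :: "real \<Rightarrow> nat"
  have S [measurable]: "S \<in> sets borel"
    by (simp add: S_def)
  have S_fin: "emeasure \<nu> S < \<infinity>"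
    unfolding S_def using emeasure_\<nu>_ge[OF e] .
  have cis2: "norm (cis u - 1) \<le> 2" for u
    using norm_triangle_ineq4[of "cis u" 1] by simp
  have ind_int: "integrable \<nu> (\<lambda>x. indicator S x :: real)"
    using S_fin by (intro integrable_real_indicator) auto
  have int_cis: "integrable \<nu> (\<lambda>x. indicator S x *\<^sub>R (cis (\<theta> \<bullet> x) - 1))" for \<theta>
    by (rule Bochner_Integration.integrable_bound[OF integrable_mult_right[OF ind_int, of 2]])
      (auto simp: cis_conv_exp[symmetric] indicator_def cis2 intro!: AE_I2, auto simp: cis_conv_exp)
  have int_kernel: "integrable \<nu> (\<lambda>x. indicator S x *\<^sub>R levy_kernel \<theta> x)" for \<theta>
    using p integrable_levy_kernel[of \<theta>]
    by (intro integrable_scale_measure Bochner_Integration.integrable_bound[OF integrable_levy_kernel[of \<theta>]])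
      (auto simp: indicator_def)
  have int_x: "integrable \<nu> (\<lambda>x. indicator {x. e \<le> norm x \<and> norm x < 1} x *\<^sub>R x)"
    by (rule Bochner_Integration.integrable_bound[OF ind_int]) (auto simp: indicator_def S_def)
  have int_inner: "integrable \<nu> (\<lambda>x. \<i> * complex_of_real (\<theta> \<bullet> (indicator {x. e \<le> norm x \<and> norm x < 1} x *\<^sub>R x)))" for \<theta>
    by (intro integrable_mult_right integrable_of_real integrable_inner_right int_x)
  have g: "g \<theta> = - K e \<theta> + \<i> * complex_of_real (\<theta> \<bullet> I e)" for \<theta>
  proof -
    have "g \<theta> = (\<integral>x. - (indicator S x *\<^sub>R levy_kernel \<theta> x)
        + \<i> * complex_of_real (\<theta> \<bullet> (indicator {x. e \<le> norm x \<and> norm x < 1} x *\<^sub>R x)) \<partial>\<nu>)"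
      unfolding g_def
      by (intro Bochner_Integration.integral_cong refl) (auto simp: levy_kernel_def S_def indicator_def)
    also have "\<dots> = - K e \<theta> + (\<integral>x. \<i> * complex_of_real (\<theta> \<bullet> (indicator {x. e \<le> norm x \<and> norm x < 1} x *\<^sub>R x)) \<partial>\<nu>)"
      unfolding K_def S_def[symmetric]
      by (subst Bochner_Integration.integral_add[OF Bochner_Integration.integrable_minus[OF int_kernel] int_inner])
        (simp only: Bochner_Integration.integral_minus)
    also have "(\<integral>x. \<i> * complex_of_real (\<theta> \<bullet> (indicator {x. e \<le> norm x \<and> norm x < 1} x *\<^sub>R x)) \<partial>\<nu>)
        = \<i> * complex_of_real (\<theta> \<bullet> I e)"
      unfolding I_def integral_mult_right_zero integral_complex_of_real integral_inner_right[OF int_x] ..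
    finally show ?thesis .
  qed
  have "(\<integral>z. indicator (big_set e) z *\<^sub>R (cis (jump_fun z) - 1) \<partial>(\<nu> \<Otimes>\<^sub>M Q))
      = (\<integral>y. \<integral>x. indicator (big_set e) (x, y) *\<^sub>R (cis (jump_fun (x, y)) - 1) \<partial>\<nu> \<partial>Q)"
  proof (subst \<nu>Q.integral_snd)
    have "integrable (\<nu> \<Otimes>\<^sub>M Q) (\<lambda>z. indicator (big_set e) z *\<^sub>R (cis (jump_fun z) - 1))"
    proof (rule Bochner_Integration.integrable_bound)
      show "integrable (\<nu> \<Otimes>\<^sub>M Q) (\<lambda>z. 2 * indicator (big_set e) z :: real)"
        using sets_big_set[of e] emeasure_big_set[OF e] by (intro integrable_mult_right integrable_real_indicator) auto
      have [measurable]: "big_set e \<in> sets (\<nu> \<Otimes>\<^sub>M Q)"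
        by (rule sets_big_set)
      show "(\<lambda>z. indicator (big_set e) z *\<^sub>R (cis (jump_fun z) - 1)) \<in> borel_measurable (\<nu> \<Otimes>\<^sub>M Q)"
        unfolding cis_conv_exp by measurable
      show "AE z in \<nu> \<Otimes>\<^sub>M Q. norm (indicator (big_set e) z *\<^sub>R (cis (jump_fun z) - 1)) \<le> norm (2 * indicator (big_set e) z :: real)"
        using cis2 by (intro AE_I2) (auto simp: indicator_def)
    qed
    then show "integrable (\<nu> \<Otimes>\<^sub>M Q) (\<lambda>(x, y). indicator (big_set e) (x, y) *\<^sub>R (cis (jump_fun (x, y)) - 1))"
      by (simp add: case_prod_unfold)
  qed (simp add: case_prod_unfold)
  also have "\<dots> = (\<integral>y. g (\<zeta>' y) \<partial>Q)"
    by (simp add: g_def big_set_def S_def jump_fun_def \<zeta>'_def indicator_def)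
  \<comment> \<open>The sum in \<open>\<zeta>'\<close> contains the value of the path at time 0,
    which \<open>path_vec\<close> sets to 0; both agree almost surely by
    \<open>AE_Q_0\<close>.\<close>
  also have "\<dots> = (\<integral>y. g (\<zeta> (path_vec y)) \<partial>Q)"
  proof (rule integral_cong_AE)
    have "g \<in> borel_measurable borel"
      unfolding g_def[abs_def] cis_conv_exp by measurable
    moreover have "\<zeta>' \<in> borel_measurable Q"
      unfolding \<zeta>'_def[abs_def] by measurable
    ultimately show "(\<lambda>y. g (\<zeta>' y)) \<in> borel_measurable Q"
      by measurable
    show "(\<lambda>y. g (\<zeta> (path_vec y))) \<in> borel_measurable Q"
      by (rule measurable_path_vec_compose[of "\<lambda>v. g (\<zeta> v)"])
    show "AE y in Q. g (\<zeta>' y) = g (\<zeta> (path_vec y))"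
      using AE_Q_0
    proof eventually_elim
      case (elim y)
      have "\<zeta>' y = \<zeta> (path_vec y)"
        unfolding \<zeta>'_def \<zeta>_def using elim by (intro sum.cong refl) (auto simp: path_vec_def \<tau>0 not_le less_Suc_eq_0_disj)
      then show ?case
        by simp
    qed
  qed
  also have "\<dots> = - (\<integral>y. K e (\<zeta> (path_vec y)) \<partial>Q) + (\<integral>y. \<i> * complex_of_real (\<zeta> (path_vec y) \<bullet> I e) \<partial>Q)"
    unfolding g by (subst Bochner_Integration.integral_add)
      (use integrable_K[of e] integral_\<zeta>_inner(2)[of "I e"] in \<open>auto intro!: integrable_mult_right integrable_of_real\<close>)
  also have "(\<integral>y. \<i> * complex_of_real (\<zeta> (path_vec y) \<bullet> I e) \<partial>Q) = \<i> * complex_of_real (\<beta> e)"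
    unfolding integral_mult_right_zero integral_complex_of_real integral_\<zeta>_inner \<beta>_def ..
  finally show ?thesis .
qed

text \<open>Dominated convergence twice, in the jump for fixed \<open>\<theta>\<close> and then
  under \<open>Q\<close>. The truncation never reaches the jump 0, where the kernel
  vanishes.\<close>

lemma K_limit:
  "(\<lambda>n. \<integral>y. K (1 / real (Suc n)) (\<zeta> (path_vec y)) \<partial>Q)
    \<longlonglongrightarrow> (\<integral>y. (1 - p) *\<^sub>R (\<integral>x. levy_kernel (\<zeta> (path_vec y)) x \<partial>\<Lambda>) \<partial>Q)"
proof (rule integral_dominated_convergence[where w="\<lambda>y. 2 * jump_mass * growth * total (path_vec y) powr b"])
  show "integrable Q (\<lambda>y. 2 * jump_mass * growth * total (path_vec y) powr b)"
    by (intro integrable_mult_right integrable_total)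
  show "AE y in Q. norm (K (1 / real (Suc n)) (\<zeta> (path_vec y))) \<le> 2 * jump_mass * growth * total (path_vec y) powr b" for n
    using growth_bound[OF path_vec_in K_0 K_bound] jump_mass_nonneg by (intro AE_I2) simp
  show "(\<lambda>y. K (1 / real (Suc n)) (\<zeta> (path_vec y))) \<in> borel_measurable Q" for n
    by (rule measurable_path_vec_compose[of "\<lambda>v. K (1 / real (Suc n)) (\<zeta> v)"])
  show "(\<lambda>y. (1 - p) *\<^sub>R (\<integral>x. levy_kernel (\<zeta> (path_vec y)) x \<partial>\<Lambda>)) \<in> borel_measurable Q"
    by (rule measurable_path_vec_compose[of "\<lambda>v. (1 - p) *\<^sub>R (\<integral>x. levy_kernel (\<zeta> v) x \<partial>\<Lambda>)"])
  have "(\<lambda>n. K (1 / real (Suc n)) \<theta>) \<longlonglongrightarrow> (1 - p) *\<^sub>R (\<integral>x. levy_kernel \<theta> x \<partial>\<Lambda>)" for \<theta>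
    unfolding K_eq
  proof (intro tendsto_scaleR tendsto_const integral_dominated_convergence[where w="\<lambda>x. norm (levy_kernel \<theta> x)"])
    show "AE x in \<Lambda>. (\<lambda>n. indicator {x. 1 / real (Suc n) \<le> norm x} x *\<^sub>R levy_kernel \<theta> x) \<longlonglongrightarrow> levy_kernel \<theta> x"
    proof (intro AE_I2)
      fix x :: "real^'d"
      show "(\<lambda>n. indicator {x. 1 / real (Suc n) \<le> norm x} x *\<^sub>R levy_kernel \<theta> x) \<longlonglongrightarrow> levy_kernel \<theta> x"
      proof (cases "x = 0")
        case False
        then obtain n0 where "inverse (real (Suc n0)) < norm x"
          using reals_Archimedean[of "norm x"] by auto
        then have "1 / real (Suc n) \<le> norm x" if "n0 \<le> n" for n
        proof -
          have "1 / real (Suc n) \<le> 1 / real (Suc n0)"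
            using that by (intro frac_le) auto
          then show ?thesis
            using \<open>inverse (real (Suc n0)) < norm x\<close> unfolding inverse_eq_divide by linarith
        qed
        then show ?thesis
          by (intro tendsto_eventually eventually_sequentiallyI[of n0]) simp
      qed simp
    qed
    show "AE x in \<Lambda>. norm (indicator {x. 1 / real (Suc n) \<le> norm x} x *\<^sub>R levy_kernel \<theta> x) \<le> norm (levy_kernel \<theta> x)" for n
      by (intro AE_I2) (auto simp: indicator_def)
  qed (use integrable_levy_kernel in \<open>auto intro: integrable_norm\<close>)
  then show "AE y in Q. (\<lambda>n. K (1 / real (Suc n)) (\<zeta> (path_vec y))) \<longlonglongrightarrow> (1 - p) *\<^sub>R (\<integral>x. levy_kernel (\<zeta> (path_vec y)) x \<partial>\<Lambda>)"
    by (intro AE_I2)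
qed

section \<open>Drift, Gaussian and jump part of the limit exponent\<close>

lemma integrable_q: "integrable Q (\<lambda>y. q (\<zeta> (path_vec y)))"
proof -
  obtain C where C: "C \<ge> 0" "\<And>\<theta>. 0 \<le> q \<theta> \<and> q \<theta> \<le> C * norm \<theta> powr b"
    using q_bound by blast
  have "norm (q \<theta>) \<le> C * (norm \<theta> powr b + norm \<theta> + 1)" for \<theta>
  proof -
    have "C * norm \<theta> powr b \<le> C * (norm \<theta> powr b + norm \<theta> + 1)"
      using C by (intro mult_left_mono) auto
    then show ?thesis
      using C(2)[of \<theta>] by simp
  qed
  then show ?thesis
    by (rule integrable_growth[where G=q, OF q_zero _ C(1)])
qed

text \<open>The mean \<open>\<tau> j / (1 - p)\<close> of the sizes cancels the factor
  \<open>1 - p\<close> in the drift, leaving the term \<open>\<tau> j *\<^sub>R a\<close> of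
  \<open>nrlp_value\<close> paired with \<open>\<Theta> j\<close>.\<close>

lemma limit_exponent_eq:
  "limit_exponent = complex_of_real ((1 - p) / 2 * (\<integral>y. q (\<zeta> (path_vec y)) \<partial>Q))
    - \<i> * complex_of_real (\<Sum>j\<le>m. \<tau> j * (\<Theta> j \<bullet> a))
    + (\<integral>y. (1 - p) *\<^sub>R (\<integral>x. levy_kernel (\<zeta> (path_vec y)) x \<partial>\<Lambda>) \<partial>Q)"
proof -
  have int_k: "integrable Q (\<lambda>y. \<integral>x. levy_kernel (\<zeta> (path_vec y)) x \<partial>\<Lambda>)"
  proof (rule integrable_growth[where G="\<lambda>\<theta>. \<integral>x. levy_kernel \<theta> x \<partial>\<Lambda>" and C="2 * jump_mass"])
    fix \<theta>
    have "norm (\<integral>x. levy_kernel \<theta> x \<partial>\<Lambda>) \<le> 2 * (norm \<theta> powr b + 1) * jump_mass"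
      using norm_levy_kernel_integral[of UNIV \<theta>] by simp
    also have "\<dots> \<le> 2 * jump_mass * (norm \<theta> powr b + norm \<theta> + 1)"
      using jump_mass_nonneg by (simp add: algebra_simps)
    finally show "norm (\<integral>x. levy_kernel \<theta> x \<partial>\<Lambda>) \<le> 2 * jump_mass * (norm \<theta> powr b + norm \<theta> + 1)" .
  qed (use jump_mass_nonneg in auto)
  have int_q: "integrable Q (\<lambda>y. complex_of_real (q (\<zeta> (path_vec y)) / 2))"
    by (intro integrable_of_real integrable_divide_zero impI integrable_q)
  have int_a: "integrable Q (\<lambda>y. \<i> * complex_of_real (a \<bullet> \<zeta> (path_vec y)))"
    using integral_\<zeta>_inner(2)[of a] by (intro integrable_mult_right integrable_of_real) (simp add: inner_commute)
  have "(\<integral>y. levy_exponent q a \<Lambda> (\<zeta> (path_vec y)) \<partial>Q)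
      = (\<integral>y. complex_of_real (q (\<zeta> (path_vec y)) / 2) \<partial>Q) - (\<integral>y. \<i> * complex_of_real (a \<bullet> \<zeta> (path_vec y)) \<partial>Q)
        + (\<integral>y. \<integral>x. levy_kernel (\<zeta> (path_vec y)) x \<partial>\<Lambda> \<partial>Q)"
    unfolding levy_exponent_eq
    by (subst Bochner_Integration.integral_add[OF Bochner_Integration.integrable_diff[OF int_q int_a] int_k],
        subst Bochner_Integration.integral_diff[OF int_q int_a]) (rule refl)
  also have "(\<integral>y. complex_of_real (q (\<zeta> (path_vec y)) / 2) \<partial>Q) = complex_of_real ((\<integral>y. q (\<zeta> (path_vec y)) \<partial>Q) / 2)"
    by (subst integral_complex_of_real) simp
  also have "(\<integral>y. \<i> * complex_of_real (a \<bullet> \<zeta> (path_vec y)) \<partial>Q) = \<i> * complex_of_real (\<Sum>j\<le>m. \<tau> j / (1 - p) * (\<Theta> j \<bullet> a))"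
    unfolding integral_mult_right_zero integral_complex_of_real inner_commute[of a] integral_\<zeta>_inner ..
  finally have "limit_exponent = (1 - p) * (complex_of_real ((\<integral>y. q (\<zeta> (path_vec y)) \<partial>Q) / 2)
      - \<i> * complex_of_real (\<Sum>j\<le>m. \<tau> j / (1 - p) * (\<Theta> j \<bullet> a)) + (\<integral>y. \<integral>x. levy_kernel (\<zeta> (path_vec y)) x \<partial>\<Lambda> \<partial>Q))"
    by (simp only: limit_exponent_def)
  moreover have "(1 - p) * (\<Sum>j\<le>m. \<tau> j / (1 - p) * (\<Theta> j \<bullet> a)) = (\<Sum>j\<le>m. \<tau> j * (\<Theta> j \<bullet> a))"
    using p by (simp add: sum_distrib_left)
  ultimately show ?thesis
    by (simp only: distrib_left right_diff_distrib integral_scaleR_right scaleR_conv_of_real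
        of_real_mult[symmetric] mult.left_commute[of "complex_of_real (1 - p)" \<i>]) simp
qed

text \<open>Expanding \<open>q\<close> as a squared norm produces products of two sizes, whose means
  are the covariances by \<open>product_moment_Q\<close>; \<open>q \<noteq> 0\<close> forces
  \<open>p < 1 / 2\<close>. Terms at time 0 vanish on both sides.\<close>

lemma quadratic_form_mean:
  fixes Mat :: "real^'d^'d"
  assumes nz: "\<not> (\<forall>x. q x = 0)" and Mat: "\<And>x. (norm (Mat *v x))\<^sup>2 = q x"
  shows "(\<Sum>j\<le>m. \<Sum>l\<le>m. ((Mat *v \<Theta> j) \<bullet> (Mat *v \<Theta> l)) * nrbm_cov p (\<tau> j) (\<tau> l))
    = (1 - p) * (\<integral>y. q (\<zeta> (path_vec y)) \<partial>Q)"
proof -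
  have b2: "b = 2"
    using q_b nz by blast
  have p2: "p < 1 / 2"
    using pb b2 by simp
  have int: "integrable Q (\<lambda>y. real (path_vec y j) * real (path_vec y l))"
    and mom: "(1 - p) * (\<integral>y. real (path_vec y j) * real (path_vec y l) \<partial>Q) = nrbm_cov p (\<tau> j) (\<tau> l)"
    if jl: "j \<le> m" "l \<le> m" for j l
  proof -
    consider "j = 0" | "l = 0" | "j \<in> {1..m}" "l \<in> {1..m}"
      using jl by (cases "j = 0"; cases "l = 0") (auto simp: Suc_le_eq)
    then have "integrable Q (\<lambda>y. real (path_vec y j) * real (path_vec y l))
        \<and> (1 - p) * (\<integral>y. real (path_vec y j) * real (path_vec y l) \<partial>Q) = nrbm_cov p (\<tau> j) (\<tau> l)"
    proof cases
      case 1
      then show ?thesis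
        using \<tau>_nonneg[OF jl(2)] by (simp add: path_vec_def nrbm_cov_def \<tau>0)
    next
      case 2
      then show ?thesis
        using \<tau>_nonneg[OF jl(1)] by (simp add: path_vec_def nrbm_cov_def \<tau>0)
    next
      case 3
      then show ?thesis
        using product_moment_Q[OF p2] by blast
    qed
    then show "integrable Q (\<lambda>y. real (path_vec y j) * real (path_vec y l))"
        "(1 - p) * (\<integral>y. real (path_vec y j) * real (path_vec y l) \<partial>Q) = nrbm_cov p (\<tau> j) (\<tau> l)"
      by auto
  qed
  have q_eq: "q (\<zeta> v) = (\<Sum>j\<le>m. \<Sum>l\<le>m. ((Mat *v \<Theta> j) \<bullet> (Mat *v \<Theta> l)) * (real (v j) * real (v l)))" for v
  proof -
    have "Mat *v \<zeta> v = (\<Sum>j\<le>m. real (v j) *\<^sub>R (Mat *v \<Theta> j))"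
      unfolding \<zeta>_def by (simp add: linear_sum[OF matrix_vector_mul_linear] linear_scale[OF matrix_vector_mul_linear])
    then show ?thesis
      unfolding Mat[symmetric] power2_norm_eq_inner
      by (simp add: inner_sum_left inner_sum_right sum_distrib_left mult_ac inner_commute)
  qed
  have "(\<integral>y. q (\<zeta> (path_vec y)) \<partial>Q)
      = (\<Sum>j\<le>m. \<Sum>l\<le>m. ((Mat *v \<Theta> j) \<bullet> (Mat *v \<Theta> l)) * (\<integral>y. real (path_vec y j) * real (path_vec y l) \<partial>Q))"
    unfolding q_eq using int
    by (subst Bochner_Integration.integral_sum, force intro!: Bochner_Integration.integrable_sum integrable_mult_right)
      (intro sum.cong refl, subst Bochner_Integration.integral_sum, auto intro!: integrable_mult_right)
  then have "(1 - p) * (\<integral>y. q (\<zeta> (path_vec y)) \<partial>Q)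
      = (\<Sum>j\<le>m. \<Sum>l\<le>m. ((Mat *v \<Theta> j) \<bullet> (Mat *v \<Theta> l)) * ((1 - p) * (\<integral>y. real (path_vec y j) * real (path_vec y l) \<partial>Q)))"
    by (simp only: sum_distrib_left mult.left_commute)
  also have "\<dots> = (\<Sum>j\<le>m. \<Sum>l\<le>m. ((Mat *v \<Theta> j) \<bullet> (Mat *v \<Theta> l)) * nrbm_cov p (\<tau> j) (\<tau> l))"
    by (intro sum.cong refl) (simp only: mom atMost_iff)
  finally show ?thesis ..
qed

text \<open>Symmetry moves \<open>Mat\<close> onto the test vectors. Independence of the coordinates
  reduces the claim to real Gaussian families, and summing over coordinates restores the inner
  products.\<close>

lemma char_nrbm:
  fixes N :: "'v measure" and B :: "real \<Rightarrow> 'v \<Rightarrow> real^'d" and Mat :: "real^'d^'d"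
  assumes N: "prob_space N" and B: "nrbm N p B" and Mat: "Mat = transpose Mat"
  shows "(\<integral>\<omega>. cis (\<Sum>j\<le>m. \<Theta> j \<bullet> (Mat *v B (\<tau> j) \<omega>)) \<partial>N)
    = complex_of_real (exp (- (\<Sum>j\<le>m. \<Sum>l\<le>m. ((Mat *v \<Theta> j) \<bullet> (Mat *v \<Theta> l)) * nrbm_cov p (\<tau> j) (\<tau> l)) / 2))"
proof -
  interpret prob_space N by (rule N)
  define c where "c i j = (Mat *v \<Theta> j) $ i" for i j
  let ?P = "Pi\<^sub>M {0..1::real} (\<lambda>_. borel :: real measure)"
  have \<tau>01: "\<tau> j \<in> {0..1}" if "j \<le> m" for j
    using \<tau>_nonneg[OF that] \<tau>_le[OF that] by simp
  have B_meas [measurable]: "B t \<in> borel_measurable N" for t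
    using B by (simp add: nrbm_def)
  have ind: "indep_vars (\<lambda>_. ?P) (\<lambda>i \<omega>. \<lambda>t\<in>{0..1}. B t \<omega> $ i) (UNIV :: 'd set)"
    using B by (simp add: nrbm_def)
  have "\<Theta> j \<bullet> (Mat *v x) = (\<Sum>i\<in>UNIV. c i j * x $ i)" for j x
  proof -
    have "\<Theta> j \<bullet> (Mat *v x) = (Mat *v \<Theta> j) \<bullet> x"
      using Mat by (metis dot_lmul_matrix transpose_matrix_vector)
    then show ?thesis
      by (simp add: inner_vec_def c_def)
  qed
  then have "(\<integral>\<omega>. cis (\<Sum>j\<le>m. \<Theta> j \<bullet> (Mat *v B (\<tau> j) \<omega>)) \<partial>N) = (\<integral>\<omega>. cis (\<Sum>j\<le>m. \<Sum>i\<in>UNIV. c i j * B (\<tau> j) \<omega> $ i) \<partial>N)"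
    by simp
  also have "\<dots> = (\<integral>\<omega>. (\<Prod>i\<in>UNIV. cis (\<Sum>j\<le>m. c i j * (\<lambda>t\<in>{0..1}. B t \<omega> $ i) (\<tau> j))) \<partial>N)"
  proof (intro Bochner_Integration.integral_cong refl)
    fix \<omega>
    have "(\<Sum>j\<le>m. \<Sum>i\<in>UNIV. c i j * B (\<tau> j) \<omega> $ i) = (\<Sum>i\<in>UNIV. \<Sum>j\<le>m. c i j * (\<lambda>t\<in>{0..1}. B t \<omega> $ i) (\<tau> j))"
      by (subst sum.swap) (intro sum.cong refl, simp add: \<tau>01[simplified])
    then show "cis (\<Sum>j\<le>m. \<Sum>i\<in>UNIV. c i j * B (\<tau> j) \<omega> $ i)
        = (\<Prod>i\<in>UNIV. cis (\<Sum>j\<le>m. c i j * (\<lambda>t\<in>{0..1}. B t \<omega> $ i) (\<tau> j)))"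
      by (simp only: cis_conv_exp of_real_sum sum_distrib_left exp_sum finite)
  qed
  also have "\<dots> = (\<Prod>i\<in>UNIV. \<integral>\<omega>. cis (\<Sum>j\<le>m. c i j * (\<lambda>t\<in>{0..1}. B t \<omega> $ i) (\<tau> j)) \<partial>N)"
  proof (rule indep_vars_lebesgue_integral)
    have f: "(\<lambda>w. cis (\<Sum>j\<le>m. c i j * w (\<tau> j))) \<in> borel_measurable ?P" for i
    proof -
      have [measurable]: "(\<lambda>w. w (\<tau> j)) \<in> ?P \<rightarrow>\<^sub>M borel" if "j \<in> {..m}" for j
        using \<tau>01[of j] that by (intro measurable_component_singleton) auto
      show ?thesis
        unfolding cis_conv_exp by measurable
    qed
    show "indep_vars (\<lambda>_. borel) (\<lambda>i \<omega>. cis (\<Sum>j\<le>m. c i j * (\<lambda>t\<in>{0..1}. B t \<omega> $ i) (\<tau> j))) (UNIV :: 'd set)"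
      by (rule indep_vars_compose2[OF ind f])
    fix i
    have "(\<lambda>\<omega>. \<lambda>t\<in>{0..1}. B t \<omega> $ i) \<in> N \<rightarrow>\<^sub>M ?P"
      using ind by (simp add: indep_vars_def)
    then have "(\<lambda>\<omega>. cis (\<Sum>j\<le>m. c i j * (\<lambda>t\<in>{0..1}. B t \<omega> $ i) (\<tau> j))) \<in> borel_measurable N"
      by (rule measurable_compose[OF _ f])
    then show "integrable N (\<lambda>\<omega>. cis (\<Sum>j\<le>m. c i j * (\<lambda>t\<in>{0..1}. B t \<omega> $ i) (\<tau> j)))"
      by (rule integrable_const_bound[rotated, where B=1]) simp
  qed simp
  also have "\<dots> = (\<Prod>i\<in>UNIV. complex_of_real (exp (- (\<Sum>k\<le>m. \<Sum>l\<le>m. c i k * c i l * nrbm_cov p (\<tau> k) (\<tau> l)) / 2)))"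
  proof (intro prod.cong refl)
    fix i
    \<comment> \<open>\<open>nrbm\<close> lists times with a strict upper bound on the index, so the
      times 0 to \<open>m\<close> are \<open>Suc m\<close> many.\<close>
    have "(\<integral>\<omega>. cis (\<Sum>k<Suc m. c i k * B (\<tau> k) \<omega> $ i) \<partial>N) =
        complex_of_real (exp (- (\<Sum>k<Suc m. \<Sum>l<Suc m. c i k * c i l * nrbm_cov p (\<tau> k) (\<tau> l)) / 2))"
      by (rule B[unfolded nrbm_def, THEN conjunct2, THEN conjunct2, THEN spec[of _ i], THEN spec[of _ "Suc m"],
            THEN spec[of _ \<tau>], THEN spec[of _ "c i"], THEN mp])
        (use \<tau>01 in auto)
    moreover have "(\<Sum>j\<le>m. c i j * (\<lambda>t\<in>{0..1}. B t \<omega> $ i) (\<tau> j)) = (\<Sum>k\<le>m. c i k * B (\<tau> k) \<omega> $ i)" for \<omega>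
      by (intro sum.cong refl) (simp add: \<tau>01[simplified])
    ultimately show "(\<integral>\<omega>. cis (\<Sum>j\<le>m. c i j * (\<lambda>t\<in>{0..1}. B t \<omega> $ i) (\<tau> j)) \<partial>N)
        = complex_of_real (exp (- (\<Sum>k\<le>m. \<Sum>l\<le>m. c i k * c i l * nrbm_cov p (\<tau> k) (\<tau> l)) / 2))"
      by (simp only: lessThan_Suc_atMost)
  qed
  also have "\<dots> = complex_of_real (exp (\<Sum>i\<in>UNIV. - (\<Sum>k\<le>m. \<Sum>l\<le>m. c i k * c i l * nrbm_cov p (\<tau> k) (\<tau> l)) / 2))"
    by (simp only: of_real_prod[symmetric] exp_sum finite)
  also have "(\<Sum>i\<in>UNIV. - (\<Sum>k\<le>m. \<Sum>l\<le>m. c i k * c i l * nrbm_cov p (\<tau> k) (\<tau> l)) / 2)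
      = - (\<Sum>i\<in>UNIV. \<Sum>k\<le>m. \<Sum>l\<le>m. c i k * c i l * nrbm_cov p (\<tau> k) (\<tau> l)) / 2"
    by (simp only: sum_divide_distrib[symmetric] sum_negf)
  also have "(\<Sum>i\<in>UNIV. \<Sum>k\<le>m. \<Sum>l\<le>m. c i k * c i l * nrbm_cov p (\<tau> k) (\<tau> l))
      = (\<Sum>k\<le>m. \<Sum>l\<le>m. ((Mat *v \<Theta> k) \<bullet> (Mat *v \<Theta> l)) * nrbm_cov p (\<tau> k) (\<tau> l))"
    by (subst sum.swap, intro sum.cong refl, subst sum.swap)
      (simp add: c_def inner_vec_def sum_distrib_right)
  finally show ?thesis .
qed

section \<open>Characteristic function of the noise reinforced Levy process\<close>

context
  fixes N :: "'v measure" and J :: "'v \<Rightarrow> nat set" and xs :: "nat \<Rightarrow> 'v \<Rightarrow> real^'d"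
    and Ys :: "nat \<Rightarrow> 'v \<Rightarrow> real \<Rightarrow> nat" and Mat :: "real^'d^'d"
    and B :: "real \<Rightarrow> 'v \<Rightarrow> real^'d" and Sc :: "real \<Rightarrow> 'v \<Rightarrow> real^'d"
  assumes N: "prob_space N"
    and PPM: "poisson_point_measure N (\<nu> \<Otimes>\<^sub>M Q) J (\<lambda>j \<omega>. (xs j \<omega>, Ys j \<omega>))"
    and BM: "\<not> (\<forall>x. q x = 0) \<Longrightarrow>
               Mat = transpose Mat \<and> (\<forall>x. (norm (Mat *v x))\<^sup>2 = q x) \<and> nrbm N p B \<and>
               indep_rv N
                 (Pi\<^sub>M {0..1} (\<lambda>_. borel)) (\<lambda>\<omega>. \<lambda>s\<in>{0..1}. B s \<omega>)
                 (Pi\<^sub>M UNIV (\<lambda>_. count_space UNIV \<Otimes>\<^sub>M (borel \<Otimes>\<^sub>M path_space)))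
                 (\<lambda>\<omega> j. (j \<in> J \<omega>, (xs j \<omega>, Ys j \<omega>)))"
    and Sc_meas: "\<And>s. Sc s \<in> borel_measurable N"
    and Sc: "\<And>s. s \<in> {0..1} \<Longrightarrow> AE \<omega> in N.
               ((\<lambda>e. small_jump_sum \<nu> (1 / p) J xs Ys e s \<omega>) \<longlongrightarrow> Sc s \<omega>) (at_right 0)"
begin

interpretation N: prob_space N by (rule N)

abbreviation atom :: "nat \<Rightarrow> 'v \<Rightarrow> (real^'d) \<times> (real \<Rightarrow> nat)" where
  "atom j \<omega> \<equiv> (xs j \<omega>, Ys j \<omega>)"

definition jumps :: "real \<Rightarrow> 'v \<Rightarrow> real" where
  "jumps e \<omega> = (\<Sum>j\<in>{j\<in>J \<omega>. atom j \<omega> \<in> big_set e}. jump_fun (atom j \<omega>))"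

definition gauss_part :: "real \<Rightarrow> 'v \<Rightarrow> real^'d" where
  "gauss_part s \<omega> = (if (\<forall>x. q x = 0) then 0 else Mat *v B s \<omega>)"

lemma measurable_jumps: "jumps e \<in> borel_measurable N"
  unfolding jumps_def[abs_def]
  by (rule measurable_PPM_sum[OF N PPM sets_big_set measurable_jump_fun])

lemma measurable_gauss_part: "gauss_part s \<in> borel_measurable N"
proof (cases "\<forall>x. q x = 0")
  case True
  then show ?thesis
    by (simp add: gauss_part_def[abs_def])
next
  case False
  then have [measurable]: "B s \<in> borel_measurable N"
    using BM by (simp add: nrbm_def)
  have "(\<lambda>x. Mat *v x) \<in> borel_measurable borel"
    by (intro borel_measurable_continuous_onI linear_continuous_on matrix_vector_mul_bounded_linear)
  then have "(\<lambda>\<omega>. Mat *v B s \<omega>) \<in> borel_measurable N"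
    by measurable
  then show ?thesis
    unfolding gauss_part_def[abs_def] by (simp only: if_not_P[OF False])
qed

lemma measurable_weighted_jump: "(\<lambda>z. real (snd z s) *\<^sub>R fst z) \<in> borel_measurable (\<nu> \<Otimes>\<^sub>M Q)"
proof -
  have [measurable]: "(\<lambda>z. snd z s) \<in> \<nu> \<Otimes>\<^sub>M Q \<rightarrow>\<^sub>M count_space UNIV"
    by (rule measurable_compose[OF measurable_snd measurable_eval_Q])
  have [measurable]: "fst \<in> \<nu> \<Otimes>\<^sub>M Q \<rightarrow>\<^sub>M borel"
    using measurable_fst[of \<nu> Q] by (simp cong: measurable_cong_sets)
  show ?thesis
    by measurable
qed

lemma measurable_big_jump_sum: "big_jump_sum J xs Ys s \<in> borel_measurable N"
proof -
  have "(\<lambda>\<omega>. \<Sum>j\<in>{j\<in>J \<omega>. atom j \<omega> \<in> big_set 1}. real (snd (atom j \<omega>) s) *\<^sub>R fst (atom j \<omega>)) \<in> borel_measurable N"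
    by (rule measurable_PPM_sum[OF N PPM sets_big_set measurable_weighted_jump])
  then show ?thesis
    by (simp add: big_jump_sum_def[abs_def] big_set_def)
qed

lemma measurable_small_jump_sum: "small_jump_sum \<nu> (1 / p) J xs Ys e s \<in> borel_measurable N"
proof -
  have "big_set e - big_set 1 \<in> sets (\<nu> \<Otimes>\<^sub>M Q)"
    using sets_big_set by (intro sets.Diff) auto
  then have "(\<lambda>\<omega>. \<Sum>j\<in>{j\<in>J \<omega>. atom j \<omega> \<in> big_set e - big_set 1}. real (snd (atom j \<omega>) s) *\<^sub>R fst (atom j \<omega>)) \<in> borel_measurable N"
    by (rule measurable_PPM_sum[OF N PPM _ measurable_weighted_jump])
  then have [measurable]: "(\<lambda>\<omega>. \<Sum>j\<in>{j\<in>J \<omega>. e \<le> norm (xs j \<omega>) \<and> norm (xs j \<omega>) < 1}. real (Ys j \<omega> s) *\<^sub>R xs j \<omega>) \<in> borel_measurable N"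
    by (simp add: big_set_def not_le)
  show ?thesis
    unfolding small_jump_sum_def[abs_def] by measurable
qed

lemma measurable_nrlp: "nrlp_value q Mat a J xs Ys B Sc s \<in> borel_measurable N"
proof -
  note [measurable] = measurable_gauss_part[of s] measurable_big_jump_sum[of s] Sc_meas[of s]
  have "(\<lambda>\<omega>. gauss_part s \<omega> + s *\<^sub>R a + big_jump_sum J xs Ys s \<omega> + Sc s \<omega>) \<in> borel_measurable N"
    by measurable
  then show ?thesis
    by (simp only: nrlp_value_def[abs_def] gauss_part_def)
qed

text \<open>Almost surely only finitely many atoms have size at least \<open>e\<close>, so big and
  small jumps recombine into one finite sum; the compensators add up to
  \<open>\<beta> e\<close>.\<close>

lemma AE_jumps:
  assumes e: "0 < e" "e \<le> 1"
  shows "AE \<omega> in N. (\<Sum>j\<le>m. \<Theta> j \<bullet> (big_jump_sum J xs Ys (\<tau> j) \<omega> + small_jump_sum \<nu> (1 / p) J xs Ys e (\<tau> j) \<omega>))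
    = jumps e \<omega> - \<beta> e"
  using PPM_AE_finite[OF N PPM sets_big_set emeasure_big_set[OF e(1)]]
proof eventually_elim
  case (elim \<omega>)
  define F where "F = {j\<in>J \<omega>. e \<le> norm (xs j \<omega>)}"
  define F1 where "F1 = {j\<in>J \<omega>. 1 \<le> norm (xs j \<omega>)}"
  define F2 where "F2 = {j\<in>J \<omega>. e \<le> norm (xs j \<omega>) \<and> norm (xs j \<omega>) < 1}"
  have F: "finite F"
    using elim by (simp add: F_def big_set_def)
  have F12: "F = F1 \<union> F2" "F1 \<inter> F2 = {}"
    using e by (auto simp: F_def F1_def F2_def)
  have coeff: "t * (1 / p) / (1 / p - 1) = t / (1 - p)" for t
    using p by (simp add: field_simps)
  have "big_jump_sum J xs Ys s \<omega> + small_jump_sum \<nu> (1 / p) J xs Ys e s \<omega>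
      = (\<Sum>i\<in>F. real (Ys i \<omega> s) *\<^sub>R xs i \<omega>) - (s / (1 - p)) *\<^sub>R I e" for s
  proof -
    have "(\<Sum>i\<in>F. real (Ys i \<omega> s) *\<^sub>R xs i \<omega>) = (\<Sum>i\<in>F1. real (Ys i \<omega> s) *\<^sub>R xs i \<omega>) + (\<Sum>i\<in>F2. real (Ys i \<omega> s) *\<^sub>R xs i \<omega>)"
      unfolding F12(1) using F F12 by (intro sum.union_disjoint) (auto simp: F12(1))
    then show ?thesis
      unfolding big_jump_sum_def small_jump_sum_def coeff I_def F1_def[symmetric] F2_def[symmetric] by simp
  qed
  then have "(\<Sum>j\<le>m. \<Theta> j \<bullet> (big_jump_sum J xs Ys (\<tau> j) \<omega> + small_jump_sum \<nu> (1 / p) J xs Ys e (\<tau> j) \<omega>))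
      = (\<Sum>j\<le>m. \<Theta> j \<bullet> (\<Sum>i\<in>F. real (Ys i \<omega> (\<tau> j)) *\<^sub>R xs i \<omega>)) - \<beta> e"
    by (simp add: inner_diff_right sum_subtractf \<beta>_def)
  also have "(\<Sum>j\<le>m. \<Theta> j \<bullet> (\<Sum>i\<in>F. real (Ys i \<omega> (\<tau> j)) *\<^sub>R xs i \<omega>)) = (\<Sum>i\<in>F. jump_fun (atom i \<omega>))"
    unfolding inner_sum_right by (subst sum.swap) (simp add: jump_fun_def inner_sum_left)
  also have "F = {j\<in>J \<omega>. atom j \<omega> \<in> big_set e}"
    by (simp add: F_def big_set_def)
  finally show ?case
    by (simp only: jumps_def)
qed

text \<open>Independence of the Brownian part from the whole marked configuration factorises the
  mean; the two factors come from \<open>char_nrbm\<close> and \<open>PPM_char\<close>.\<close>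

lemma char_gauss_jumps:
  assumes e: "0 < e"
  shows "(\<integral>\<omega>. cis (\<Sum>j\<le>m. \<Theta> j \<bullet> gauss_part (\<tau> j) \<omega>) * cis (jumps e \<omega>) \<partial>N)
    = exp (- complex_of_real ((1 - p) / 2 * (\<integral>y. q (\<zeta> (path_vec y)) \<partial>Q)))
      * exp (- (\<integral>y. K e (\<zeta> (path_vec y)) \<partial>Q) + \<i> * complex_of_real (\<beta> e))"
proof -
  have jumps: "(\<integral>\<omega>. cis (jumps e \<omega>) \<partial>N) = exp (- (\<integral>y. K e (\<zeta> (path_vec y)) \<partial>Q) + \<i> * complex_of_real (\<beta> e))"
    unfolding jumps_def PPM_char[OF N PPM sets_big_set emeasure_big_set[OF e] measurable_jump_fun] jump_exponent[OF e] ..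
  show ?thesis
  proof (cases "\<forall>x. q x = 0")
    case True
    then show ?thesis
      using jumps by (simp add: gauss_part_def)
  next
    case False
    note BM' = BM[OF False]
    let ?P = "Pi\<^sub>M {0..1::real} (\<lambda>_. borel :: (real^'d) measure)"
    let ?R = "Pi\<^sub>M (UNIV :: nat set) (\<lambda>_. count_space (UNIV :: bool set) \<Otimes>\<^sub>M ((borel :: (real^'d) measure) \<Otimes>\<^sub>M path_space))"
    define f where "f w = cis (\<Sum>j\<le>m. \<Theta> j \<bullet> (Mat *v w (\<tau> j)))" for w :: "real \<Rightarrow> real^'d"
    define g where "g z = cis (\<Sum>j\<in>{j. fst (z j) \<and> snd (z j) \<in> big_set e}. jump_fun (snd (z j)))"
      for z :: "nat \<Rightarrow> bool \<times> (real^'d) \<times> (real \<Rightarrow> nat)"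
    have \<tau>01: "\<tau> j \<in> {0..1}" if "j \<le> m" for j
      using \<tau>_nonneg[OF that] \<tau>_le[OF that] by simp
    have f: "f \<in> borel_measurable ?P"
    proof -
      have Mm: "(\<lambda>x. Mat *v x) \<in> borel_measurable borel"
        by (intro borel_measurable_continuous_onI linear_continuous_on matrix_vector_mul_bounded_linear)
      have comp: "(\<lambda>w. w (\<tau> j)) \<in> ?P \<rightarrow>\<^sub>M borel" if "j \<in> {..m}" for j
        using \<tau>01[of j] that by (intro measurable_component_singleton) auto
      have [measurable]: "(\<lambda>w. Mat *v w (\<tau> j)) \<in> ?P \<rightarrow>\<^sub>M borel" if "j \<in> {..m}" for j
        by (rule measurable_compose[OF comp[OF that] Mm])
      show ?thesis
        unfolding f_def[abs_def] cis_conv_exp by measurable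
    qed
    have g: "g \<in> borel_measurable ?R"
    proof -
      \<comment> \<open>Independence is stated with \<open>borel\<close> and
        \<open>path_space\<close>, the measurability of sums over atoms with \<open>\<nu>\<close>
        and \<open>Q\<close>; their sigma algebras coincide.\<close>
      have "sets (Pi\<^sub>M (UNIV :: nat set) (\<lambda>_. count_space (UNIV :: bool set) \<Otimes>\<^sub>M (\<nu> \<Otimes>\<^sub>M Q))) = sets ?R"
        by (intro sets_PiM_cong sets_pair_measure_cong refl sets_\<nu> sets_Q)
      moreover have "g \<in> borel_measurable (Pi\<^sub>M (UNIV :: nat set) (\<lambda>_. count_space (UNIV :: bool set) \<Otimes>\<^sub>M (\<nu> \<Otimes>\<^sub>M Q)))"
        using measurable_atom_sum[OF sets_big_set[of e] measurable_jump_fun]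
        unfolding g_def[abs_def] cis_conv_exp by measurable
      ultimately show ?thesis
        using measurable_cong_sets by blast
    qed
    have "(\<integral>\<omega>. f (\<lambda>s\<in>{0..1}. B s \<omega>) * g (\<lambda>j. (j \<in> J \<omega>, atom j \<omega>)) \<partial>N)
        = (\<integral>\<omega>. f (\<lambda>s\<in>{0..1}. B s \<omega>) \<partial>N) * (\<integral>\<omega>. g (\<lambda>j. (j \<in> J \<omega>, atom j \<omega>)) \<partial>N)"
      using BM' by (intro N.indep_rv_integral_mult[OF _ f g]) (auto simp: f_def g_def)
    moreover have f_eq: "f (\<lambda>s\<in>{0..1}. B s \<omega>) = cis (\<Sum>j\<le>m. \<Theta> j \<bullet> (Mat *v B (\<tau> j) \<omega>))" for \<omega>
      unfolding f_def by (intro arg_cong[where f=cis] sum.cong refl) (simp add: \<tau>01[simplified])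
    moreover have "g (\<lambda>j. (j \<in> J \<omega>, atom j \<omega>)) = cis (jumps e \<omega>)" for \<omega>
      by (simp add: g_def jumps_def)
    moreover have "gauss_part (\<tau> j) \<omega> = Mat *v B (\<tau> j) \<omega>" for j \<omega>
      unfolding gauss_part_def by (rule if_not_P[OF False])
    moreover have "(\<integral>\<omega>. cis (\<Sum>j\<le>m. \<Theta> j \<bullet> (Mat *v B (\<tau> j) \<omega>)) \<partial>N)
        = exp (- complex_of_real ((1 - p) / 2 * (\<integral>y. q (\<zeta> (path_vec y)) \<partial>Q)))"
    proof -
      have "(\<Sum>j\<le>m. \<Sum>l\<le>m. ((Mat *v \<Theta> j) \<bullet> (Mat *v \<Theta> l)) * nrbm_cov p (\<tau> j) (\<tau> l))
          = (1 - p) * (\<integral>y. q (\<zeta> (path_vec y)) \<partial>Q)"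
        using BM' by (intro quadratic_form_mean[OF False]) auto
      moreover have "complex_of_real (exp (- ((1 - p) * (\<integral>y. q (\<zeta> (path_vec y)) \<partial>Q)) / 2))
          = exp (- complex_of_real ((1 - p) / 2 * (\<integral>y. q (\<zeta> (path_vec y)) \<partial>Q)))"
        unfolding exp_of_real[symmetric] by simp
      ultimately show ?thesis
        using BM' char_nrbm[OF N, of B Mat] by simp
    qed
    ultimately show ?thesis
      using jumps by simp
  qed
qed

text \<open>At each threshold the shift \<open>- \<beta> e\<close> of the compensated jumps cancels
  \<open>\<beta> e\<close> in the exponent, so the threshold survives only in \<open>K e\<close>,
  where \<open>K_limit\<close> applies. The values themselves converge almost surely by the defining
  property of \<open>Sc\<close>.\<close>

theorem char_nrlp:
  "(\<integral>\<omega>. cis (\<Sum>j\<le>m. \<Theta> j \<bullet> nrlp_value q Mat a J xs Ys B Sc (\<tau> j) \<omega>) \<partial>N) = exp (- limit_exponent)"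
proof -
  define \<alpha> where "\<alpha> = (\<Sum>j\<le>m. \<tau> j * (\<Theta> j \<bullet> a))"
  define e where "e n = 1 / real (Suc n)" for n
  have e: "0 < e n" "e n \<le> 1" for n
    by (auto simp: e_def field_simps)
  have e_lim: "filterlim e (at_right 0) sequentially"
    unfolding filterlim_at using e LIMSEQ_inverse_real_of_nat
    by (auto simp: e_def[abs_def] inverse_eq_divide intro!: always_eventually)
  define V where "V n \<omega> = (\<Sum>j\<le>m. \<Theta> j \<bullet> (gauss_part (\<tau> j) \<omega> + \<tau> j *\<^sub>R a + big_jump_sum J xs Ys (\<tau> j) \<omega>
      + small_jump_sum \<nu> (1 / p) J xs Ys (e n) (\<tau> j) \<omega>))" for n \<omega>
  note [measurable] = measurable_gauss_part measurable_big_jump_sum measurable_small_jump_sum measurable_nrlp measurable_jumps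
  have V_meas: "(\<lambda>\<omega>. cis (V n \<omega>)) \<in> borel_measurable N" for n
    unfolding V_def cis_conv_exp by measurable
  have cis_lim: "(\<lambda>i. cis (h i)) \<longlonglongrightarrow> cis l" if "h \<longlonglongrightarrow> l" for h :: "nat \<Rightarrow> real" and l
    unfolding cis_conv_exp by (intro tendsto_intros that)
  have "(\<lambda>n. \<integral>\<omega>. cis (V n \<omega>) \<partial>N)
      \<longlonglongrightarrow> (\<integral>\<omega>. cis (\<Sum>j\<le>m. \<Theta> j \<bullet> nrlp_value q Mat a J xs Ys B Sc (\<tau> j) \<omega>) \<partial>N)"
  proof (rule integral_dominated_convergence[where w="\<lambda>_. 1"])
    have "AE \<omega> in N. \<forall>j\<in>{..m}. ((\<lambda>e. small_jump_sum \<nu> (1 / p) J xs Ys e (\<tau> j) \<omega>) \<longlongrightarrow> Sc (\<tau> j) \<omega>) (at_right 0)"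
      using \<tau>_nonneg \<tau>_le by (intro AE_finite_allI Sc) auto
    then show "AE \<omega> in N. (\<lambda>n. cis (V n \<omega>)) \<longlonglongrightarrow> cis (\<Sum>j\<le>m. \<Theta> j \<bullet> nrlp_value q Mat a J xs Ys B Sc (\<tau> j) \<omega>)"
    proof eventually_elim
      case (elim \<omega>)
      then have lim: "(\<lambda>n. small_jump_sum \<nu> (1 / p) J xs Ys (e n) (\<tau> j) \<omega>) \<longlonglongrightarrow> Sc (\<tau> j) \<omega>" if "j \<in> {..m}" for j
        using that by (intro filterlim_compose[OF _ e_lim]) auto
      show ?case
        unfolding V_def nrlp_value_def gauss_part_def[symmetric]
        by (intro cis_lim tendsto_sum tendsto_inner tendsto_add tendsto_const lim)
    qed
    show "(\<lambda>\<omega>. cis (\<Sum>j\<le>m. \<Theta> j \<bullet> nrlp_value q Mat a J xs Ys B Sc (\<tau> j) \<omega>)) \<in> borel_measurable N"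
      unfolding cis_conv_exp by measurable
  qed (use V_meas in auto)
  moreover have "(\<integral>\<omega>. cis (V n \<omega>) \<partial>N) = exp (- complex_of_real ((1 - p) / 2 * (\<integral>y. q (\<zeta> (path_vec y)) \<partial>Q))
      + \<i> * complex_of_real \<alpha> - (\<integral>y. K (e n) (\<zeta> (path_vec y)) \<partial>Q))" for n
  proof -
    have "AE \<omega> in N. cis (V n \<omega>) = cis (\<alpha> - \<beta> (e n)) * (cis (\<Sum>j\<le>m. \<Theta> j \<bullet> gauss_part (\<tau> j) \<omega>) * cis (jumps (e n) \<omega>))"
      using AE_jumps[OF e[of n]]
    proof eventually_elim
      case (elim \<omega>)
      have "V n \<omega> = (\<Sum>j\<le>m. \<Theta> j \<bullet> gauss_part (\<tau> j) \<omega>) + \<alpha>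
          + (\<Sum>j\<le>m. \<Theta> j \<bullet> (big_jump_sum J xs Ys (\<tau> j) \<omega> + small_jump_sum \<nu> (1 / p) J xs Ys (e n) (\<tau> j) \<omega>))"
        unfolding V_def \<alpha>_def by (simp add: inner_add_right sum.distrib)
      then have V_eq: "V n \<omega> = (\<Sum>j\<le>m. \<Theta> j \<bullet> gauss_part (\<tau> j) \<omega>) + \<alpha> + (jumps (e n) \<omega> - \<beta> (e n))"
        unfolding elim .
      show ?case
        unfolding V_eq cis_mult by (rule arg_cong[where f=cis]) simp
    qed
    then have "(\<integral>\<omega>. cis (V n \<omega>) \<partial>N) = (\<integral>\<omega>. cis (\<alpha> - \<beta> (e n)) * (cis (\<Sum>j\<le>m. \<Theta> j \<bullet> gauss_part (\<tau> j) \<omega>) * cis (jumps (e n) \<omega>)) \<partial>N)"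
    proof (intro integral_cong_AE V_meas)
      show "(\<lambda>\<omega>. cis (\<alpha> - \<beta> (e n)) * (cis (\<Sum>j\<le>m. \<Theta> j \<bullet> gauss_part (\<tau> j) \<omega>) * cis (jumps (e n) \<omega>))) \<in> borel_measurable N"
        unfolding cis_conv_exp by measurable
    qed
    also have "\<dots> = cis (\<alpha> - \<beta> (e n)) * (exp (- complex_of_real ((1 - p) / 2 * (\<integral>y. q (\<zeta> (path_vec y)) \<partial>Q)))
      * exp (- (\<integral>y. K (e n) (\<zeta> (path_vec y)) \<partial>Q) + \<i> * complex_of_real (\<beta> (e n))))"
      by (simp only: integral_mult_right_zero char_gauss_jumps[OF e(1)])
    also have "\<dots> = exp (- complex_of_real ((1 - p) / 2 * (\<integral>y. q (\<zeta> (path_vec y)) \<partial>Q))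
      + \<i> * complex_of_real \<alpha> - (\<integral>y. K (e n) (\<zeta> (path_vec y)) \<partial>Q))"
      unfolding cis_conv_exp exp_add[symmetric] by (rule arg_cong[where f=exp]) (simp add: algebra_simps)
    finally show ?thesis .
  qed
  moreover have "(\<lambda>n. exp (- complex_of_real ((1 - p) / 2 * (\<integral>y. q (\<zeta> (path_vec y)) \<partial>Q))
      + \<i> * complex_of_real \<alpha> - (\<integral>y. K (e n) (\<zeta> (path_vec y)) \<partial>Q))) \<longlonglongrightarrow> exp (- limit_exponent)"
  proof -
    have "(\<lambda>n. exp (- complex_of_real ((1 - p) / 2 * (\<integral>y. q (\<zeta> (path_vec y)) \<partial>Q))
        + \<i> * complex_of_real \<alpha> - (\<integral>y. K (e n) (\<zeta> (path_vec y)) \<partial>Q)))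
      \<longlonglongrightarrow> exp (- complex_of_real ((1 - p) / 2 * (\<integral>y. q (\<zeta> (path_vec y)) \<partial>Q))
        + \<i> * complex_of_real \<alpha> - (\<integral>y. (1 - p) *\<^sub>R (\<integral>x. levy_kernel (\<zeta> (path_vec y)) x \<partial>\<Lambda>) \<partial>Q))"
      unfolding e_def by (intro tendsto_exp tendsto_diff tendsto_const K_limit)
    moreover have "- complex_of_real ((1 - p) / 2 * (\<integral>y. q (\<zeta> (path_vec y)) \<partial>Q))
        + \<i> * complex_of_real \<alpha> - (\<integral>y. (1 - p) *\<^sub>R (\<integral>x. levy_kernel (\<zeta> (path_vec y)) x \<partial>\<Lambda>) \<partial>Q) = - limit_exponent"
      unfolding limit_exponent_eq \<alpha>_def by simp
    ultimately show ?thesis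
      by simp
  qed
  ultimately show ?thesis
    by (simp add: LIMSEQ_unique)
qed

end

end

section \<open>Convergence of the finite-dimensional distributions\<close>

lemma borel_measurable_vec_lambda:
  fixes f :: "'m::finite \<Rightarrow> 'w \<Rightarrow> 'b::euclidean_space"
  assumes "\<And>k. f k \<in> borel_measurable M"
  shows "(\<lambda>\<omega>. \<chi> k. f k \<omega>) \<in> borel_measurable M"
proof (subst borel_measurable_euclidean_space, rule ballI)
  fix i :: "'b^'m" assume "i \<in> Basis"
  have "(\<lambda>\<omega>. (\<chi> k. f k \<omega>) \<bullet> i) = (\<lambda>\<omega>. \<Sum>k\<in>UNIV. f k \<omega> \<bullet> i $ k)"
    by (simp add: inner_vec_def)
  then show "(\<lambda>\<omega>. (\<chi> k. f k \<omega>) \<bullet> i) \<in> borel_measurable M"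
    using assms by simp
qed

text \<open>Sort the set of times with 0 adjoined; coinciding times share an index through
  \<open>\<sigma>\<close>.\<close>

lemma enumerate_times:
  fixes t :: "'m::finite \<Rightarrow> real"
  assumes t: "\<forall>k. 0 \<le> t k \<and> t k \<le> 1"
  shows "\<exists>\<tau> m \<sigma>. \<tau> 0 = 0 \<and> (\<forall>j<m. \<tau> j < \<tau> (Suc j)) \<and> \<tau> m \<le> 1 \<and> (\<forall>k. \<sigma> k \<le> m \<and> t k = \<tau> (\<sigma> k))"
proof -
  define A where "A = insert 0 (range t)"
  define l where "l = sorted_list_of_set A"
  have A: "finite A" "A \<noteq> {}" "\<And>x. x \<in> A \<Longrightarrow> 0 \<le> x \<and> x \<le> 1" "0 \<in> A"
    using t by (auto simp: A_def)
  have l: "set l = A" "sorted_wrt (<) l"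
    using A by (simp_all add: l_def)
  have ne: "l \<noteq> []"
    using l A by auto
  define m where "m = length l - 1"
  have len: "length l = Suc m"
    using ne unfolding m_def by simp
  have nth: "l ! j \<in> A" if "j \<le> m" for j
    using that nth_mem[of j l] unfolding len l(1) by simp
  have ex: "\<exists>j. j \<le> m \<and> l ! j = x" if x: "x \<in> A" for x
  proof -
    obtain j where "j < length l" "l ! j = x"
      using x unfolding l(1)[symmetric] in_set_conv_nth by blast
    then show ?thesis
      by (intro exI[of _ j]) (simp add: len)
  qed
  have "l ! 0 = 0"
  proof -
    obtain j where j: "j \<le> m" "l ! j = 0"
      using ex[OF A(4)] by blast
    have "0 \<le> l ! 0"
      using A(3)[OF nth[of 0]] by simp
    moreover have "l ! 0 < l ! j" if "0 < j"
      using that j by (intro sorted_wrt_nth_less[OF l(2)]) (simp_all add: len)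
    ultimately show ?thesis
      using j by (cases "j = 0") auto
  qed
  moreover have "l ! j < l ! Suc j" if "j < m" for j
    using that by (intro sorted_wrt_nth_less[OF l(2)]) (simp_all add: len)
  moreover have "l ! m \<le> 1"
    using A(3)[OF nth[of m]] by simp
  moreover have "\<exists>\<sigma>. \<forall>k. \<sigma> k \<le> m \<and> t k = l ! \<sigma> k"
  proof (intro choice allI)
    fix k
    have "t k \<in> A"
      by (simp add: A_def)
    then show "\<exists>j. j \<le> m \<and> t k = l ! j"
      using ex by metis
  qed
  ultimately show ?thesis
    by (intro exI[of _ "\<lambda>j. l ! j"] exI[of _ m]) blast
qed

text \<open>The values at all times form one vector in a Euclidean space. Its characteristic
  functions converge by \<open>char_srrw_limit\<close> and \<open>char_nrlp\<close>, and the
  continuity theorem extends this to bounded continuous functions.\<close>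

theorem theorem1:
  fixes q :: "real^'d \<Rightarrow> real" and a :: "real^'d" and \<Lambda> :: "(real^'d) measure" and p :: real
    and M :: "'w measure" and \<xi> :: "real \<Rightarrow> 'w \<Rightarrow> real^'d"
    and \<epsilon> :: "nat \<Rightarrow> nat \<Rightarrow> 'w \<Rightarrow> bool" and U :: "nat \<Rightarrow> nat \<Rightarrow> 'w \<Rightarrow> nat"
    and N :: "'v measure" and Q :: "(real \<Rightarrow> nat) measure"
    and J :: "'v \<Rightarrow> nat set" and xs :: "nat \<Rightarrow> 'v \<Rightarrow> real^'d" and Ys :: "nat \<Rightarrow> 'v \<Rightarrow> real \<Rightarrow> nat"
    and Mat :: "real^'d^'d" and B :: "real \<Rightarrow> 'v \<Rightarrow> real^'d" and Sc :: "real \<Rightarrow> 'v \<Rightarrow> real^'d"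
    and t :: "'m::finite \<Rightarrow> real" and f :: "(real^'d)^'m \<Rightarrow> real"
  assumes q: "psd_quadratic_form q" and Lambda: "levy_measure \<Lambda>" and adm: "admissible q \<Lambda> p"
    and M: "prob_space M" and xi: "levy_process M q a \<Lambda> \<xi>"
    and noise: "\<forall>n\<ge>1. reinforcement_noise M p \<xi> (\<epsilon> n) (U n)"
    and N: "prob_space N"
    and Q: "yule_simon_law (1 / p) Q"
    and PPM: "poisson_point_measure N (scale_measure (ennreal (1 - p)) \<Lambda> \<Otimes>\<^sub>M Q) J
                (\<lambda>j \<omega>. (xs j \<omega>, Ys j \<omega>))"
    and BM: "\<not> (\<forall>x. q x = 0) \<Longrightarrow>
               Mat = transpose Mat \<and> (\<forall>x. (norm (Mat *v x))\<^sup>2 = q x) \<and> nrbm N p B \<and>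
               indep_rv N
                 (Pi\<^sub>M {0..1} (\<lambda>_. borel)) (\<lambda>\<omega>. \<lambda>s\<in>{0..1}. B s \<omega>)
                 (Pi\<^sub>M UNIV (\<lambda>_. count_space UNIV \<Otimes>\<^sub>M (borel \<Otimes>\<^sub>M path_space)))
                 (\<lambda>\<omega> j. (j \<in> J \<omega>, (xs j \<omega>, Ys j \<omega>)))"
    and Sc_meas: "\<forall>s. Sc s \<in> borel_measurable N"
    and Sc: "\<forall>s\<in>{0..1}. AE \<omega> in N.
               ((\<lambda>e. small_jump_sum (scale_measure (ennreal (1 - p)) \<Lambda>) (1 / p) J xs Ys e s \<omega>)
                  \<longlongrightarrow> Sc s \<omega>) (at_right 0)"
    and t: "\<forall>k. 0 \<le> t k \<and> t k \<le> 1"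
    and f: "continuous_on UNIV f" "bounded (range f)"
  shows "(\<lambda>n. \<integral>\<omega>. f (\<chi> k. srrw (\<lambda>i. \<xi> (real i / real n) \<omega> - \<xi> (real (i - 1) / real n) \<omega>)
                                  (\<lambda>i. \<epsilon> n i \<omega>) (\<lambda>i. U n i \<omega>) (nat \<lfloor>t k * real n\<rfloor>)) \<partial>M)
         \<longlonglongrightarrow> (\<integral>\<omega>. f (\<chi> k. nrlp_value q Mat a J xs Ys B Sc (t k) \<omega>) \<partial>N)"
proof -
  interpret M: prob_space M by (rule M)
  interpret N: prob_space N by (rule N)
  obtain b where b: "1 \<le> b" "b \<le> 2" "p * b < 1"
      "(\<integral>\<^sup>+ x\<in>cball 0 1. ennreal (norm x powr b) \<partial>\<Lambda>) < \<infinity>" "(\<forall>x. q x = 0) \<or> b = 2"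
    using admissible_exponent[OF Lambda adm] by blast
  have p: "0 < p" "p < 1"
    using adm by (auto simp: admissible_def)
  from Q[unfolded yule_simon_law_def, THEN conjunct2, THEN conjunct2]
  obtain P where P: "pure_birth_transition (ys_rate (1 / p)) P"
    and law: "\<forall>l (t::nat \<Rightarrow> real) (k::nat \<Rightarrow> nat).
           t 0 = 0 \<and> k 0 = 0 \<and> (\<forall>j<l. t j \<le> t (Suc j)) \<and> t l \<le> 1 \<longrightarrow>
           measure Q {f\<in>space Q. \<forall>j\<in>{1..l}. f (t j) = k j} =
             (\<Prod>j<l. P (t j) (t (Suc j)) (k j) (k (Suc j)))"
    by - (erule exE, erule conjE, rule that)
  obtain \<tau> m \<sigma> where \<tau>: "\<tau> 0 = 0" "\<And>j. j < m \<Longrightarrow> \<tau> j < \<tau> (Suc j)" "\<tau> m \<le> 1"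
    and \<sigma>: "\<And>k. \<sigma> k \<le> m" "\<And>k. t k = \<tau> (\<sigma> k)"
    using enumerate_times[OF t] by metis
  \<comment> \<open>Test vectors of coordinates sharing a time are added up; an index that belongs
    to no coordinate, such as an adjoined time 0, gets the zero vector.\<close>
  define \<Theta> where "\<Theta> \<theta> j = (\<Sum>k | \<sigma> k = j. \<theta> $ k)" for \<theta> :: "(real^'d)^'m" and j
  interpret Q: prob_space Q
    using Q by (simp add: yule_simon_law_def)
  have L: "nrlp_limit p P \<tau> m Q q \<Lambda> b"
  proof unfold_locales
    show "sets Q = sets path_space"
      using Q by (simp add: yule_simon_law_def)
    show "measure Q {f\<in>space Q. \<forall>j\<in>{1..l}. f (t j) = k j} = (\<Prod>j<l. P (t j) (t (Suc j)) (k j) (k (Suc j)))"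
      if "t 0 = 0" "k 0 = 0" "\<forall>j<l. t j \<le> t (Suc j)" "t l \<le> 1" for l and t :: "nat \<Rightarrow> real" and k :: "nat \<Rightarrow> nat"
      using law that by simp
  qed (use p P \<tau> q Lambda b in \<open>simp_all only:\<close>)
  then have times: "yule_simon_times p P \<tau> m"
    by (simp add: nrlp_limit_def yule_simon_process_def)
  have group: "(\<Sum>j\<le>m. \<Theta> \<theta> j \<bullet> S j) = (\<Sum>k\<in>UNIV. \<theta> $ k \<bullet> S (\<sigma> k))" for \<theta> and S :: "nat \<Rightarrow> real^'d"
  proof -
    have "(\<Sum>j\<le>m. \<Theta> \<theta> j \<bullet> S j) = (\<Sum>j\<le>m. \<Sum>k\<in>{k\<in>UNIV. \<sigma> k = j}. \<theta> $ k \<bullet> S (\<sigma> k))"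
      by (intro sum.cong refl) (simp add: \<Theta>_def inner_sum_left)
    also have "\<dots> = (\<Sum>k\<in>UNIV. \<theta> $ k \<bullet> S (\<sigma> k))"
      by (rule sum.group) (use \<sigma> in auto)
    finally show ?thesis .
  qed
  define X where "X n \<omega> = (\<chi> k. srrw (\<lambda>i. \<xi> (real i / real n) \<omega> - \<xi> (real (i - 1) / real n) \<omega>)
      (\<lambda>i. \<epsilon> n i \<omega>) (\<lambda>i. U n i \<omega>) (nat \<lfloor>t k * real n\<rfloor>))" for n \<omega>
  define Y where "Y \<omega> = (\<chi> k. nrlp_value q Mat a J xs Ys B Sc (t k) \<omega>)" for \<omega>
  \<comment> \<open>The noise is specified for \<open>n \<ge> 1\<close>, hence the shift to
    \<open>Suc n\<close>, which does not affect the limit.\<close>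
  have X_meas: "X (Suc n) \<in> borel_measurable M" for n
  proof -
    have \<xi>_meas [measurable]: "\<xi> s \<in> borel_measurable M" for s
      using xi by (simp add: levy_process_def)
    have noise': "reinforcement_noise M p \<xi> (\<epsilon> (Suc n)) (U (Suc n))"
      using noise by simp
    show ?thesis
      unfolding X_def
      by (intro borel_measurable_vec_lambda measurable_srrw measurable_noise[OF M noise']) measurable
  qed
  have Y_meas: "Y \<in> borel_measurable N"
    unfolding Y_def[abs_def]
    by (intro borel_measurable_vec_lambda nrlp_limit.measurable_nrlp[OF L N PPM BM])
      (use Sc_meas Sc in auto)
  have char_X: "(\<lambda>n. \<integral>\<omega>. cis (\<theta> \<bullet> X n \<omega>) \<partial>M) \<longlonglongrightarrow> (\<integral>\<omega>. cis (\<theta> \<bullet> Y \<omega>) \<partial>N)" for \<theta>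
  proof -
    have "\<theta> \<bullet> X n \<omega> = (\<Sum>j\<le>m. \<Theta> \<theta> j \<bullet> srrw (\<lambda>i. \<xi> (real i / real n) \<omega> - \<xi> (real (i - 1) / real n) \<omega>)
      (\<lambda>i. \<epsilon> n i \<omega>) (\<lambda>i. U n i \<omega>) (yule_simon_times.idx \<tau> n j))" for n \<omega>
      unfolding group by (simp add: X_def inner_vec_def \<sigma>(2) yule_simon_times.idx_def[OF times])
    moreover have "\<theta> \<bullet> Y \<omega> = (\<Sum>j\<le>m. \<Theta> \<theta> j \<bullet> nrlp_value q Mat a J xs Ys B Sc (\<tau> j) \<omega>)" for \<omega>
      unfolding group by (simp add: Y_def inner_vec_def \<sigma>(2))
    moreover note nrlp_limit.char_srrw_limit[OF L M xi noise[rule_format], where \<Theta>="\<Theta> \<theta>"]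
      nrlp_limit.char_nrlp[OF L N PPM BM Sc_meas[rule_format] Sc[rule_format], where \<Theta>="\<Theta> \<theta>"]
    ultimately show ?thesis
      by simp
  qed
  have f_meas: "f \<in> borel_measurable borel"
    using f(1) by (rule borel_measurable_continuous_onI)
  have "(\<lambda>n. \<integral>x. f x \<partial>distr M borel (X (Suc n))) \<longlonglongrightarrow> (\<integral>x. f x \<partial>distr N borel Y)"
  proof (rule Levy_continuity_euclidean[OF _ _ _ _ _ f])
    show "prob_space (distr M borel (X (Suc n)))" for n
      by (rule M.prob_space_distr[OF X_meas])
    show "prob_space (distr N borel Y)"
      by (rule N.prob_space_distr[OF Y_meas])
    have cis_meas: "(\<lambda>x. cis (\<theta> \<bullet> x)) \<in> borel_measurable borel" for \<theta> :: "(real^'d)^'m"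
      unfolding cis_conv_exp by measurable
    show "(\<lambda>n. \<integral>x. cis (\<theta> \<bullet> x) \<partial>distr M borel (X (Suc n))) \<longlonglongrightarrow> (\<integral>x. cis (\<theta> \<bullet> x) \<partial>distr N borel Y)" for \<theta>
      unfolding integral_distr[OF X_meas cis_meas] integral_distr[OF Y_meas cis_meas]
      by (rule LIMSEQ_Suc[OF char_X])
  qed simp_all
  then have "(\<lambda>n. \<integral>\<omega>. f (X (Suc n) \<omega>) \<partial>M) \<longlonglongrightarrow> (\<integral>\<omega>. f (Y \<omega>) \<partial>N)"
    unfolding integral_distr[OF X_meas f_meas] integral_distr[OF Y_meas f_meas] .
  then show ?thesis
    unfolding X_def Y_def by (rule LIMSEQ_imp_Suc)
qed

end
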